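(* Let $\mathcal{C}$ be a Krull–Schmidt, $K$-linear, Hom-finite triangulated category over a field $K$, with suspension functor $\Sigma$, and assume that $\mathcal{C}$ has a Serre functor $S$. Let $T=\overline{T}\oplus R$ be a basic rigid object of $\mathcal{C}$ and let $T'=\overline{T}\oplus R^\ast$, where $R^\ast\to B\to R\to\Sigma R^\ast$ is a triangle with $B\to R$ a minimal right $\operatorname{add}\overline{T}$-approximation. Then the functors $$G=L\circ I:\ \overline{\mathcal{C}}(T)/(\Sigma T')\to\underline{\mathcal{C}}(T')/(\Sigma^{-1}ST),\qquad H=R\circ J:\ \underline{\mathcal{C}}(T')/(\Sigma^{-1}ST)\to\overline{\mathcal{C}}(T)/(\Sigma T')$$ (with $I,J,L,R$ the functors described in the context) are quasi-inverse equivalences of categories. In particular, the categories $\overline{\mathcal{C}}(T)/(\Sigma T')$ and $\overline{\mathcal{C}}(T)/(T)$ are equivalent.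
   Context: $\mathcal{C}(X,Y)$ denotes the morphism space; $X$ is rigid if $\mathcal{C}(X,\Sigma X)=0$. $X^\perp$ is the full subcategory of objects $Y$ with $\mathcal{C}(X,Y)=0$. $\operatorname{add}X$ is the additive subcategory generated by $X$. For an object $X$, $(X)$ is the ideal of morphisms factoring through $\operatorname{add}X$; for a full subcategory $\mathcal{A}$, $(\mathcal{A})$ is the ideal of morphisms factoring through an object of $\mathcal{A}$; quotients are by these ideals. For full subcategories $\mathcal{A},\mathcal{B}$ (or objects $A$, $B$, standing for $\operatorname{add}A$, $\operatorname{add}B$), $\mathcal{A}\ast\mathcal{B}$ is the full subcategory of objects $X$ occurring in a triangle $A\to X\to B\to\Sigma A$ with $A\in\mathcal{A}$, $B\in\mathcal{B}$. Put $\overline{\mathcal{C}}(T)=T\ast\Sigma\overline{T}$ and $\underline{\mathcal{C}}(T')=\Sigma^{-1}S\overline{T}\ast ST'$. One has $\overline{\mathcal{C}}(T)\cap\overline{T}^\perp=\operatorname{add}\Sigma T'$ and $\underline{\mathcal{C}}(T')\cap\overline{T}^\perp=\operatorname{add}\Sigma^{-1}ST$, and the inclusions into $\mathcal{C}$ induce fully faithful functors $I:\overline{\mathcal{C}}(T)/(\Sigma T')\to\mathcal{C}/(\overline{T}^\perp)$ and $J:\underline{\mathcal{C}}(T')/(\Sigma^{-1}ST)\to\mathcal{C}/(\overline{T}^\perp)$. The functor $I$ has a right adjoint, denoted $R$ (not to be confused with the summand $R$ of $T$), and $J$ has a left adjoint, denoted $L$. *)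

theory Defs
  imports "HOL.Vector_Spaces" "HOL-Library.Set_Algebras"
begin

section \<open>Categories, functors, equivalences, adjunctions\<close>

text \<open>
  Hom-sets are indexed by source and target and are not required to be disjoint, so composition
  and the action of a functor on morphisms take the objects as arguments:
  \<open>cmp C x y z g f\<close> is the composite of \<open>f : x \<rightarrow> y\<close> and \<open>g : y \<rightarrow> z\<close>, i.e. \<open>g \<circ> f\<close>.
\<close>

record ('o, 'm) cat =
  ob :: "'o set"
  hom :: "'o \<Rightarrow> 'o \<Rightarrow> 'm set"
  ident :: "'o \<Rightarrow> 'm"
  cmp :: "'o \<Rightarrow> 'o \<Rightarrow> 'o \<Rightarrow> 'm \<Rightarrow> 'm \<Rightarrow> 'm"

locale category =
  fixes C :: "('o, 'm) cat"
  assumes ident_in_hom: "x \<in> ob C \<Longrightarrow> ident C x \<in> hom C x x"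
    and cmp_in_hom:
      "\<lbrakk>x \<in> ob C; y \<in> ob C; z \<in> ob C; f \<in> hom C x y; g \<in> hom C y z\<rbrakk>
        \<Longrightarrow> cmp C x y z g f \<in> hom C x z"
    and cmp_ident_right:
      "\<lbrakk>x \<in> ob C; y \<in> ob C; f \<in> hom C x y\<rbrakk> \<Longrightarrow> cmp C x x y f (ident C x) = f"
    and cmp_ident_left:
      "\<lbrakk>x \<in> ob C; y \<in> ob C; f \<in> hom C x y\<rbrakk> \<Longrightarrow> cmp C x y y (ident C y) f = f"
    and cmp_assoc:
      "\<lbrakk>w \<in> ob C; x \<in> ob C; y \<in> ob C; z \<in> ob C;
        f \<in> hom C w x; g \<in> hom C x y; h \<in> hom C y z\<rbrakk>
        \<Longrightarrow> cmp C w y z h (cmp C w x y g f) = cmp C w x z (cmp C x y z h g) f"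

definition full_subcat :: "('o, 'm) cat \<Rightarrow> 'o set \<Rightarrow> ('o, 'm) cat" where
  "full_subcat C \<A> = C\<lparr>ob := ob C \<inter> \<A>\<rparr>"

definition is_iso :: "('o, 'm) cat \<Rightarrow> 'o \<Rightarrow> 'o \<Rightarrow> 'm \<Rightarrow> bool" where
  "is_iso C x y f \<longleftrightarrow> f \<in> hom C x y \<and>
     (\<exists>g \<in> hom C y x. cmp C x y x g f = ident C x \<and> cmp C y x y f g = ident C y)"

definition isomorphic :: "('o, 'm) cat \<Rightarrow> 'o \<Rightarrow> 'o \<Rightarrow> bool" where
  "isomorphic C x y \<longleftrightarrow> x \<in> ob C \<and> y \<in> ob C \<and> (\<exists>f. is_iso C x y f)"

record ('o, 'm, 'p, 'n) fctr =
  fobj :: "'o \<Rightarrow> 'p"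
  fmap :: "'o \<Rightarrow> 'o \<Rightarrow> 'm \<Rightarrow> 'n"

definition is_functor :: "('o, 'm) cat \<Rightarrow> ('p, 'n) cat \<Rightarrow> ('o, 'm, 'p, 'n) fctr \<Rightarrow> bool" where
  "is_functor A B F \<longleftrightarrow>
     (\<forall>x \<in> ob A. fobj F x \<in> ob B) \<and>
     (\<forall>x \<in> ob A. \<forall>y \<in> ob A. \<forall>f \<in> hom A x y. fmap F x y f \<in> hom B (fobj F x) (fobj F y)) \<and>
     (\<forall>x \<in> ob A. fmap F x x (ident A x) = ident B (fobj F x)) \<and>
     (\<forall>x \<in> ob A. \<forall>y \<in> ob A. \<forall>z \<in> ob A. \<forall>f \<in> hom A x y. \<forall>g \<in> hom A y z.
        fmap F x z (cmp A x y z g f) =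
        cmp B (fobj F x) (fobj F y) (fobj F z) (fmap F y z g) (fmap F x y f))"

definition fid :: "('o, 'm, 'o, 'm) fctr" where
  "fid = \<lparr>fobj = (\<lambda>x. x), fmap = (\<lambda>x y f. f)\<rparr>"

definition fcomp ::
  "('p, 'n, 'q, 'l) fctr \<Rightarrow> ('o, 'm, 'p, 'n) fctr \<Rightarrow> ('o, 'm, 'q, 'l) fctr" (infixl "\<circ>\<^sub>F" 55) where
  "G \<circ>\<^sub>F F = \<lparr>fobj = (\<lambda>x. fobj G (fobj F x)),
             fmap = (\<lambda>x y f. fmap G (fobj F x) (fobj F y) (fmap F x y f))\<rparr>"

definition nat_isomorphic ::
  "('o, 'm) cat \<Rightarrow> ('p, 'n) cat \<Rightarrow> ('o, 'm, 'p, 'n) fctr \<Rightarrow> ('o, 'm, 'p, 'n) fctr \<Rightarrow> bool" where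
  "nat_isomorphic A B F G \<longleftrightarrow> (\<exists>\<tau>.
     (\<forall>x \<in> ob A. is_iso B (fobj F x) (fobj G x) (\<tau> x)) \<and>
     (\<forall>x \<in> ob A. \<forall>y \<in> ob A. \<forall>f \<in> hom A x y.
        cmp B (fobj F x) (fobj F y) (fobj G y) (\<tau> y) (fmap F x y f) =
        cmp B (fobj F x) (fobj G x) (fobj G y) (fmap G x y f) (\<tau> x)))"

definition quasi_inverse ::
  "('o, 'm) cat \<Rightarrow> ('p, 'n) cat \<Rightarrow> ('o, 'm, 'p, 'n) fctr \<Rightarrow> ('p, 'n, 'o, 'm) fctr \<Rightarrow> bool" where
  "quasi_inverse A B F G \<longleftrightarrow> is_functor A B F \<and> is_functor B A G \<and>
     nat_isomorphic A A (G \<circ>\<^sub>F F) fid \<and> nat_isomorphic B B (F \<circ>\<^sub>F G) fid"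

definition equivalent :: "('o, 'm) cat \<Rightarrow> ('p, 'n) cat \<Rightarrow> bool" where
  "equivalent A B \<longleftrightarrow> (\<exists>F G. quasi_inverse A B F G)"

text \<open>\<open>adjoint A B F G\<close>: the functor \<open>F : A \<rightarrow> B\<close> is left adjoint to \<open>G : B \<rightarrow> A\<close>.\<close>

definition adjoint ::
  "('o, 'm) cat \<Rightarrow> ('p, 'n) cat \<Rightarrow> ('o, 'm, 'p, 'n) fctr \<Rightarrow> ('p, 'n, 'o, 'm) fctr \<Rightarrow> bool" where
  "adjoint A B F G \<longleftrightarrow> is_functor A B F \<and> is_functor B A G \<and> (\<exists>\<phi>.
     (\<forall>a \<in> ob A. \<forall>b \<in> ob B. bij_betw (\<phi> a b) (hom B (fobj F a) b) (hom A a (fobj G b))) \<and>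
     (\<forall>a' \<in> ob A. \<forall>a \<in> ob A. \<forall>b \<in> ob B. \<forall>b' \<in> ob B.
        \<forall>h \<in> hom A a' a. \<forall>f \<in> hom B (fobj F a) b. \<forall>k \<in> hom B b b'.
        \<phi> a' b' (cmp B (fobj F a') b b' k (cmp B (fobj F a') (fobj F a) b f (fmap F a' a h))) =
        cmp A a' (fobj G b) (fobj G b') (fmap G b b' k) (cmp A a' a (fobj G b) (\<phi> a b f) h)))"

section \<open>Linear categories\<close>

text \<open>
  The spaces \<open>hom C x y\<close> are subspaces of one ambient \<open>K\<close>-vector space, the type \<open>'v\<close> with scalar
  multiplication \<open>scale\<close>. As hom-sets may overlap, this is no restriction on a small
  \<open>K\<close>-linear category: embed every hom-space in the direct sum of all of them.
\<close>

locale linear_category =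
  category C + vector_space scale
  for scale :: "'k::field \<Rightarrow> 'v::ab_group_add \<Rightarrow> 'v" and C :: "('o, 'v) cat" +
  assumes hom_subspace: "\<lbrakk>x \<in> ob C; y \<in> ob C\<rbrakk> \<Longrightarrow> subspace (hom C x y)"
    and cmp_add_left:
      "\<lbrakk>x \<in> ob C; y \<in> ob C; z \<in> ob C; f \<in> hom C x y; g \<in> hom C y z; g' \<in> hom C y z\<rbrakk>
        \<Longrightarrow> cmp C x y z (g + g') f = cmp C x y z g f + cmp C x y z g' f"
    and cmp_add_right:
      "\<lbrakk>x \<in> ob C; y \<in> ob C; z \<in> ob C; f \<in> hom C x y; f' \<in> hom C x y; g \<in> hom C y z\<rbrakk>
        \<Longrightarrow> cmp C x y z g (f + f') = cmp C x y z g f + cmp C x y z g f'"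
    and cmp_scale_left:
      "\<lbrakk>x \<in> ob C; y \<in> ob C; z \<in> ob C; f \<in> hom C x y; g \<in> hom C y z\<rbrakk>
        \<Longrightarrow> cmp C x y z (scale c g) f = scale c (cmp C x y z g f)"
    and cmp_scale_right:
      "\<lbrakk>x \<in> ob C; y \<in> ob C; z \<in> ob C; f \<in> hom C x y; g \<in> hom C y z\<rbrakk>
        \<Longrightarrow> cmp C x y z g (scale c f) = scale c (cmp C x y z g f)"

definition hom_finite ::
  "('k::field \<Rightarrow> 'v::ab_group_add \<Rightarrow> 'v) \<Rightarrow> ('o, 'v) cat \<Rightarrow> bool" where
  "hom_finite scale C \<longleftrightarrow>
     (\<forall>x \<in> ob C. \<forall>y \<in> ob C. \<exists>B. finite B \<and> module.span scale B = hom C x y)"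

definition linear_functor ::
  "('k::field \<Rightarrow> 'v::ab_group_add \<Rightarrow> 'v) \<Rightarrow> ('o, 'v) cat \<Rightarrow> ('o, 'v, 'o, 'v) fctr \<Rightarrow> bool" where
  "linear_functor scale C F \<longleftrightarrow> is_functor C C F \<and>
     (\<forall>x \<in> ob C. \<forall>y \<in> ob C. \<forall>f \<in> hom C x y. \<forall>g \<in> hom C x y. \<forall>c.
        fmap F x y (f + g) = fmap F x y f + fmap F x y g \<and>
        fmap F x y (scale c f) = scale c (fmap F x y f))"

text \<open>\<open>is_direct_sum C xs p\<close>: \<open>p\<close> is a biproduct of the list \<open>xs\<close>; for the empty list this says that
  \<open>p\<close> is a zero object.\<close>

definition is_direct_sum :: "('o, 'v::ab_group_add) cat \<Rightarrow> 'o list \<Rightarrow> 'o \<Rightarrow> bool" where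
  "is_direct_sum C xs p \<longleftrightarrow> set xs \<subseteq> ob C \<and> p \<in> ob C \<and> (\<exists>\<iota> \<pi>.
     (\<forall>i < length xs. \<iota> i \<in> hom C (xs ! i) p \<and> \<pi> i \<in> hom C p (xs ! i)) \<and>
     (\<forall>i < length xs. \<forall>j < length xs.
        cmp C (xs ! i) p (xs ! j) (\<pi> j) (\<iota> i) = (if i = j then ident C (xs ! i) else 0)) \<and>
     (\<Sum>i < length xs. cmp C p (xs ! i) p (\<iota> i) (\<pi> i)) = ident C p)"

abbreviation is_zero_obj :: "('o, 'v::ab_group_add) cat \<Rightarrow> 'o \<Rightarrow> bool" where
  "is_zero_obj C z \<equiv> is_direct_sum C [] z"

text \<open>\<open>add_cat C x\<close> is \<open>add x\<close>: all direct summands of finite direct sums of copies of \<open>x\<close>.\<close>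

definition add_cat :: "('o, 'v::ab_group_add) cat \<Rightarrow> 'o \<Rightarrow> 'o set" where
  "add_cat C x = {y. \<exists>n p y'. is_direct_sum C (replicate n x) p \<and> is_direct_sum C [y, y'] p}"

definition local_end :: "('o, 'v::ab_group_add) cat \<Rightarrow> 'o \<Rightarrow> bool" where
  "local_end C x \<longleftrightarrow> x \<in> ob C \<and> ident C x \<noteq> 0 \<and>
     (\<forall>f \<in> hom C x x. \<forall>g \<in> hom C x x.
        \<not> is_iso C x x f \<longrightarrow> \<not> is_iso C x x g \<longrightarrow> \<not> is_iso C x x (f + g))"

definition krull_schmidt :: "('o, 'v::ab_group_add) cat \<Rightarrow> bool" where
  "krull_schmidt C \<longleftrightarrow> (\<forall>x \<in> ob C. \<exists>xs. is_direct_sum C xs x \<and> (\<forall>y \<in> set xs. local_end C y))"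

definition indecomposable :: "('o, 'v::ab_group_add) cat \<Rightarrow> 'o \<Rightarrow> bool" where
  "indecomposable C x \<longleftrightarrow> x \<in> ob C \<and> \<not> is_zero_obj C x \<and>
     (\<forall>y z. is_direct_sum C [y, z] x \<longrightarrow> is_zero_obj C y \<or> is_zero_obj C z)"

definition basic_obj :: "('o, 'v::ab_group_add) cat \<Rightarrow> 'o \<Rightarrow> bool" where
  "basic_obj C x \<longleftrightarrow> (\<exists>xs. is_direct_sum C xs x \<and> (\<forall>y \<in> set xs. indecomposable C y) \<and>
     (\<forall>i < length xs. \<forall>j < length xs. i \<noteq> j \<longrightarrow> \<not> isomorphic C (xs ! i) (xs ! j)))"

definition perp :: "('o, 'v::ab_group_add) cat \<Rightarrow> 'o \<Rightarrow> 'o set" where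
  "perp C x = {y \<in> ob C. hom C x y = {0}}"

definition right_approx :: "('o, 'm) cat \<Rightarrow> 'o set \<Rightarrow> 'o \<Rightarrow> 'o \<Rightarrow> 'm \<Rightarrow> bool" where
  "right_approx C \<A> b x f \<longleftrightarrow> b \<in> \<A> \<and> f \<in> hom C b x \<and>
     (\<forall>a \<in> \<A>. \<forall>g \<in> hom C a x. \<exists>h \<in> hom C a b. g = cmp C a b x f h)"

definition minimal_right_approx :: "('o, 'm) cat \<Rightarrow> 'o set \<Rightarrow> 'o \<Rightarrow> 'o \<Rightarrow> 'm \<Rightarrow> bool" where
  "minimal_right_approx C \<A> b x f \<longleftrightarrow> right_approx C \<A> b x f \<and>
     (\<forall>h \<in> hom C b b. cmp C b b x f h = f \<longrightarrow> is_iso C b b h)"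

section \<open>Quotients by ideals\<close>

definition factor_ideal :: "('o, 'm) cat \<Rightarrow> 'o set \<Rightarrow> 'o \<Rightarrow> 'o \<Rightarrow> 'm set" where
  "factor_ideal C \<A> x y =
     {cmp C x a y g f | a f g. a \<in> ob C \<inter> \<A> \<and> f \<in> hom C x a \<and> g \<in> hom C a y}"

text \<open>Morphisms of a quotient category are cosets \<open>f + N x y\<close>.\<close>

definition quotient_cat ::
  "('o, 'v::ab_group_add) cat \<Rightarrow> ('o \<Rightarrow> 'o \<Rightarrow> 'v set) \<Rightarrow> ('o, 'v set) cat" where
  "quotient_cat C N = \<lparr>
     ob = ob C,
     hom = (\<lambda>x y. (\<lambda>f. f +o N x y) ` hom C x y),
     ident = (\<lambda>x. ident C x +o N x x),
     cmp = (\<lambda>x y z G F. \<Union>g \<in> G. \<Union>f \<in> F. cmp C x y z g f +o N x z)\<rparr>"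

definition cat_mod :: "('o, 'v::ab_group_add) cat \<Rightarrow> 'o set \<Rightarrow> ('o, 'v set) cat" (infixl "'/'/\<^sub>c" 70) where
  "C //\<^sub>c \<A> = quotient_cat C (factor_ideal C \<A>)"

text \<open>The functor between quotients of \<open>C\<close> (or of full subcategories) that is the identity on objects
  and sends the class of \<open>f\<close> to its class modulo \<open>(\<A>)\<close>, the ideal being taken in \<open>C\<close>.\<close>

definition induced_functor ::
  "('o, 'v::ab_group_add) cat \<Rightarrow> 'o set \<Rightarrow> ('o, 'v set, 'o, 'v set) fctr" where
  "induced_functor C \<A> = \<lparr>
     fobj = (\<lambda>x. x),
     fmap = (\<lambda>x y F. \<Union>f \<in> F. f +o factor_ideal C \<A> x y)\<rparr>"

section \<open>Triangulated categories and Serre functors\<close>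

text \<open>
  The suspension is an autoequivalence \<open>\<Sigma>\<close> with chosen quasi-inverse \<open>\<Sigma>i\<close>, which includes the case of
  an automorphism. \<open>(x, y, z, u, v, w) \<in> \<Delta>\<close> means that
  \<open>x \<rightarrow> y \<rightarrow> z \<rightarrow> \<Sigma> x\<close>, with maps \<open>u\<close>, \<open>v\<close>, \<open>w\<close>, is a distinguished triangle.
\<close>

locale triangulated_category = linear_category scale C
  for scale :: "'k::field \<Rightarrow> 'v::ab_group_add \<Rightarrow> 'v" and C :: "('o, 'v) cat" +
  fixes \<Sigma> \<Sigma>i :: "('o, 'v, 'o, 'v) fctr"
    and \<Delta> :: "('o \<times> 'o \<times> 'o \<times> 'v \<times> 'v \<times> 'v) set"
  assumes direct_sums: "set xs \<subseteq> ob C \<Longrightarrow> \<exists>p. is_direct_sum C xs p"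
    and susp_linear: "linear_functor scale C \<Sigma>"
    and susp_equivalence: "quasi_inverse C C \<Sigma> \<Sigma>i"
    and tri_in:
      "(x, y, z, u, v, w) \<in> \<Delta> \<Longrightarrow> x \<in> ob C \<and> y \<in> ob C \<and> z \<in> ob C \<and>
        u \<in> hom C x y \<and> v \<in> hom C y z \<and> w \<in> hom C z (fobj \<Sigma> x)"
    and tri_iso:
      "\<lbrakk>(x, y, z, u, v, w) \<in> \<Delta>; x' \<in> ob C; y' \<in> ob C; z' \<in> ob C;
        u' \<in> hom C x' y'; v' \<in> hom C y' z'; w' \<in> hom C z' (fobj \<Sigma> x');
        is_iso C x x' a; is_iso C y y' b; is_iso C z z' c;
        cmp C x y y' b u = cmp C x x' y' u' a;
        cmp C y z z' c v = cmp C y y' z' v' b;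
        cmp C z (fobj \<Sigma> x) (fobj \<Sigma> x') (fmap \<Sigma> x x' a) w = cmp C z z' (fobj \<Sigma> x') w' c\<rbrakk>
        \<Longrightarrow> (x', y', z', u', v', w') \<in> \<Delta>"
    and tri_ident: "\<lbrakk>x \<in> ob C; is_zero_obj C z\<rbrakk> \<Longrightarrow> (x, x, z, ident C x, 0, 0) \<in> \<Delta>"
    and tri_exists:
      "\<lbrakk>x \<in> ob C; y \<in> ob C; u \<in> hom C x y\<rbrakk> \<Longrightarrow> \<exists>z v w. (x, y, z, u, v, w) \<in> \<Delta>"
    and tri_rotate:
      "\<lbrakk>x \<in> ob C; y \<in> ob C; z \<in> ob C;
        u \<in> hom C x y; v \<in> hom C y z; w \<in> hom C z (fobj \<Sigma> x)\<rbrakk>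
        \<Longrightarrow> (x, y, z, u, v, w) \<in> \<Delta> \<longleftrightarrow> (y, z, fobj \<Sigma> x, v, w, - fmap \<Sigma> x y u) \<in> \<Delta>"
    and tri_morphism:
      "\<lbrakk>(x, y, z, u, v, w) \<in> \<Delta>; (x', y', z', u', v', w') \<in> \<Delta>;
        a \<in> hom C x x'; b \<in> hom C y y'; cmp C x y y' b u = cmp C x x' y' u' a\<rbrakk>
        \<Longrightarrow> \<exists>c \<in> hom C z z'. cmp C y z z' c v = cmp C y y' z' v' b \<and>
              cmp C z (fobj \<Sigma> x) (fobj \<Sigma> x') (fmap \<Sigma> x x' a) w = cmp C z z' (fobj \<Sigma> x') w' c"
    and octahedral:
      "\<lbrakk>(x, y, z', f, f1, f2) \<in> \<Delta>; (y, z, x', g, g1, g2) \<in> \<Delta>;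
        (x, z, y', cmp C x y z g f, h1, h2) \<in> \<Delta>\<rbrakk>
        \<Longrightarrow> \<exists>a \<in> hom C z' y'. \<exists>b \<in> hom C y' x'.
              (z', y', x', a, b, cmp C x' (fobj \<Sigma> y) (fobj \<Sigma> z') (fmap \<Sigma> y z' f1) g2) \<in> \<Delta> \<and>
              cmp C y z' y' a f1 = cmp C y z y' h1 g \<and>
              cmp C z' y' (fobj \<Sigma> x) h2 a = f2 \<and>
              cmp C z y' x' b h1 = g1 \<and>
              cmp C y' (fobj \<Sigma> x) (fobj \<Sigma> y) (fmap \<Sigma> x y f) h2 = cmp C y' x' (fobj \<Sigma> y) g2 b"

text \<open>\<open>star C \<Delta> \<A> \<B>\<close> is \<open>\<A> \<ast> \<B>\<close>.\<close>

definition star ::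
  "('o, 'v) cat \<Rightarrow> ('o \<times> 'o \<times> 'o \<times> 'v \<times> 'v \<times> 'v) set \<Rightarrow> 'o set \<Rightarrow> 'o set \<Rightarrow> 'o set" where
  "star C \<Delta> \<A> \<B> = {x \<in> ob C. \<exists>a \<in> \<A>. \<exists>b \<in> \<B>. \<exists>u v w. (a, x, b, u, v, w) \<in> \<Delta>}"

definition rigid :: "('o, 'v::ab_group_add) cat \<Rightarrow> ('o, 'v, 'o, 'v) fctr \<Rightarrow> 'o \<Rightarrow> bool" where
  "rigid C \<Sigma> x \<longleftrightarrow> x \<in> ob C \<and> hom C x (fobj \<Sigma> x) = {0}"

text \<open>The dual of a subspace \<open>V\<close>: linear forms on \<open>V\<close>, extended by zero outside \<open>V\<close>.\<close>

definition dual_space ::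
  "('k::field \<Rightarrow> 'v::ab_group_add \<Rightarrow> 'v) \<Rightarrow> 'v set \<Rightarrow> ('v \<Rightarrow> 'k) set" where
  "dual_space scale V = {\<phi>. (\<forall>g. g \<notin> V \<longrightarrow> \<phi> g = 0) \<and>
     (\<forall>g \<in> V. \<forall>g' \<in> V. \<phi> (g + g') = \<phi> g + \<phi> g') \<and> (\<forall>c. \<forall>g \<in> V. \<phi> (scale c g) = c * \<phi> g)}"

text \<open>A Serre functor: a linear autoequivalence \<open>S\<close> with \<open>K\<close>-linear isomorphisms
  \<open>\<eta> x y : C(x, y) \<rightarrow> D C(y, S x)\<close>, natural in \<open>x\<close> and \<open>y\<close>.\<close>

definition serre_functor ::
  "('k::field \<Rightarrow> 'v::ab_group_add \<Rightarrow> 'v) \<Rightarrow> ('o, 'v) cat \<Rightarrow> ('o, 'v, 'o, 'v) fctr \<Rightarrow> bool" where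
  "serre_functor scale C S \<longleftrightarrow> linear_functor scale C S \<and> (\<exists>S'. quasi_inverse C C S S') \<and>
     (\<exists>\<eta>.
       (\<forall>x \<in> ob C. \<forall>y \<in> ob C.
          bij_betw (\<eta> x y) (hom C x y) (dual_space scale (hom C y (fobj S x))) \<and>
          (\<forall>f \<in> hom C x y. \<forall>f' \<in> hom C x y. \<forall>g. \<eta> x y (f + f') g = \<eta> x y f g + \<eta> x y f' g) \<and>
          (\<forall>c. \<forall>f \<in> hom C x y. \<forall>g. \<eta> x y (scale c f) g = c * \<eta> x y f g)) \<and>
       (\<forall>x' \<in> ob C. \<forall>x \<in> ob C. \<forall>y \<in> ob C.
          \<forall>a \<in> hom C x' x. \<forall>f \<in> hom C x y. \<forall>g \<in> hom C y (fobj S x').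
          \<eta> x' y (cmp C x' x y f a) g =
          \<eta> x y f (cmp C y (fobj S x') (fobj S x) (fmap S x' x a) g)) \<and>
       (\<forall>x \<in> ob C. \<forall>y \<in> ob C. \<forall>y' \<in> ob C.
          \<forall>b \<in> hom C y y'. \<forall>f \<in> hom C x y. \<forall>g \<in> hom C y' (fobj S x).
          \<eta> x y' (cmp C x y y' b f) g = \<eta> x y f (cmp C y y' (fobj S x) g b)))"

text \<open>The full subcategories of \<open>C\<close> on \<open>T \<ast> \<Sigma> Tb\<close> and on \<open>\<Sigma>\<^sup>-\<^sup>1 S Tb \<ast> S T'\<close>, where \<open>Tb\<close> stands for
  the common summand of \<open>T\<close> and \<open>T'\<close>.\<close>

definition upper_cat ::
  "('o, 'v::ab_group_add) cat \<Rightarrow> ('o, 'v, 'o, 'v) fctr \<Rightarrow>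
   ('o \<times> 'o \<times> 'o \<times> 'v \<times> 'v \<times> 'v) set \<Rightarrow> 'o \<Rightarrow> 'o \<Rightarrow> ('o, 'v) cat" where
  "upper_cat C \<Sigma> \<Delta> T Tb = full_subcat C (star C \<Delta> (add_cat C T) (add_cat C (fobj \<Sigma> Tb)))"

definition lower_cat ::
  "('o, 'v::ab_group_add) cat \<Rightarrow> ('o, 'v, 'o, 'v) fctr \<Rightarrow> ('o, 'v, 'o, 'v) fctr \<Rightarrow>
   ('o \<times> 'o \<times> 'o \<times> 'v \<times> 'v \<times> 'v) set \<Rightarrow> 'o \<Rightarrow> 'o \<Rightarrow> ('o, 'v) cat" where
  "lower_cat C \<Sigma>i S \<Delta> T' Tb =
     full_subcat C (star C \<Delta> (add_cat C (fobj \<Sigma>i (fobj S Tb))) (add_cat C (fobj S T')))"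

end

theory Submission
  imports Defs
begin

text \<open>
  A cone of a right \<open>add Tb\<close>-approximation shows that the ideal of \<open>Tb\<^sup>\<bottom>\<close> consists of the morphisms
  killed by \<open>Hom(Tb, -)\<close>; by Serre duality these are the morphisms killed by \<open>Hom(-, S Tb)\<close>. With
  this description both categories of the theorem are full subcategories of \<open>Q = C / (Tb\<^sup>\<bottom>)\<close>, and in \<open>Q\<close>
  an object of \<open>T \<ast> \<Sigma> Tb\<close> is the cokernel of a map from \<open>add Tb\<close> to \<open>add T\<close>, while an object of
  \<open>\<Sigma>\<^sup>-\<^sup>1 S Tb \<ast> S T'\<close> is the kernel of a map from \<open>add (S T')\<close> to \<open>add (S Tb)\<close>. So a morphism inverted
  by \<open>Q(Tb, -)\<close> and \<open>Q(R, -)\<close> is inverted by \<open>Q(U, -)\<close> for all \<open>U\<close> of the first kind; Serre duality turns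
  the hypothesis into the same statement for \<open>Q(-, S Tb)\<close> and \<open>Q(-, S R*)\<close>, so it is also inverted by
  \<open>Q(-, V)\<close> for all \<open>V\<close> of the second kind. Approximations provide such morphisms \<open>U \<rightarrow> X\<close> and
  \<open>X \<rightarrow> V\<close> for every \<open>X\<close>. Hence the first category is coreflective and the second reflective, the unit
  and the counit belong to this class of morphisms, and the composites of the adjoints with the
  inclusions are mutually inverse. For the last claim, \<open>T \<ast> \<Sigma> Tb = Tb \<ast> \<Sigma> T'\<close>, and \<open>S \<Sigma>\<^sup>-\<^sup>1\<close> embeds
  its quotient by \<open>(T)\<close> into \<open>Q\<close> with the same properties as the second category.
\<close>

section \<open>Fully faithful functors and adjunctions\<close>

text \<open>That \<open>S\<close> preserves triangles is not among the hypotheses. Whatever has to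
  survive \<open>S\<close> is therefore phrased by weak kernels and weak cokernels
  (\<open>wexact\<close>), retracts of finite sums (\<open>gen\<close>) and vanishing Hom spaces.
  These notions are self-dual and invariant under additive autoequivalences, so that one argument
  about strings \<open>t1 \<rightarrow> t0 \<rightarrow> U \<rightarrow> p\<close> serves
  \<open>C\<close>, its opposite and the images under \<open>S\<close> and under
  \<open>S \<Sigma>\<^sup>-\<^sup>1\<close>. Serre duality transposes the condition at
  \<open>Tb\<close> directly, surjectivity on one side being injectivity on the other. The condition
  at \<open>R\<close> has no such transpose by itself, since \<open>R\<close> would go to
  \<open>S R\<close> and not to \<open>S R*\<close>; the mutation triangle has to be used together
  with injectivity at \<open>Tb\<close>. That \<open>G\<close> and \<open>H\<close> are inverse
  needs no computation of adjoints: \<open>U\<close> and \<open>H (G U)\<close> are both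
  coreflections of the object \<open>G U\<close>, hence isomorphic over it.\<close>

definition fully_faithful :: "('o, 'm) cat \<Rightarrow> ('p, 'n) cat \<Rightarrow> ('o, 'm, 'p, 'n) fctr \<Rightarrow> bool" where
  "fully_faithful A B F \<longleftrightarrow> is_functor A B F \<and>
     (\<forall>x \<in> ob A. \<forall>y \<in> ob A. bij_betw (fmap F x y) (hom A x y) (hom B (fobj F x) (fobj F y)))"

lemma functor_ob: "is_functor A B F \<Longrightarrow> x \<in> ob A \<Longrightarrow> fobj F x \<in> ob B"
  by (simp add: is_functor_def)

lemma functor_hom:
  "is_functor A B F \<Longrightarrow> x \<in> ob A \<Longrightarrow> y \<in> ob A \<Longrightarrow> f \<in> hom A x y
    \<Longrightarrow> fmap F x y f \<in> hom B (fobj F x) (fobj F y)"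
  by (simp add: is_functor_def)

lemma functor_ident: "is_functor A B F \<Longrightarrow> x \<in> ob A \<Longrightarrow> fmap F x x (ident A x) = ident B (fobj F x)"
  by (simp add: is_functor_def)

lemma functor_cmp:
  "is_functor A B F \<Longrightarrow> x \<in> ob A \<Longrightarrow> y \<in> ob A \<Longrightarrow> z \<in> ob A \<Longrightarrow> f \<in> hom A x y \<Longrightarrow> g \<in> hom A y z
    \<Longrightarrow> fmap F x z (cmp A x y z g f)
        = cmp B (fobj F x) (fobj F y) (fobj F z) (fmap F y z g) (fmap F x y f)"
  by (simp add: is_functor_def)

lemmas functor_rules = functor_ob functor_hom functor_ident functor_cmp

lemma fobj_fcomp [simp]: "fobj (G \<circ>\<^sub>F F) x = fobj G (fobj F x)"
  and fmap_fcomp [simp]: "fmap (G \<circ>\<^sub>F F) x y f = fmap G (fobj F x) (fobj F y) (fmap F x y f)"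
  by (simp_all add: fcomp_def)

lemma fobj_fid [simp]: "fobj fid x = x" and fmap_fid [simp]: "fmap fid x y f = f"
  by (simp_all add: fid_def)

lemma is_functor_fcomp:
  assumes "is_functor A B F" "is_functor B D G"
  shows "is_functor A D (G \<circ>\<^sub>F F)"
  using assms by (auto simp: is_functor_def)

lemma ff_functor: "fully_faithful A B F \<Longrightarrow> is_functor A B F"
  by (simp add: fully_faithful_def)

lemma ff_inj:
  "\<lbrakk>fully_faithful A B F; x \<in> ob A; y \<in> ob A; f \<in> hom A x y; g \<in> hom A x y;
    fmap F x y f = fmap F x y g\<rbrakk> \<Longrightarrow> f = g"
  unfolding fully_faithful_def bij_betw_def by (meson inj_onD)

lemma ff_full:
  assumes "fully_faithful A B F" "x \<in> ob A" "y \<in> ob A" "h \<in> hom B (fobj F x) (fobj F y)"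
  obtains f where "f \<in> hom A x y" "fmap F x y f = h"
proof -
  have "h \<in> fmap F x y ` hom A x y"
    using assms unfolding fully_faithful_def bij_betw_def by blast
  then show ?thesis using that by blast
qed

lemma is_isoI:
  assumes "f \<in> hom C x y" "g \<in> hom C y x"
    "cmp C x y x g f = ident C x" "cmp C y x y f g = ident C y"
  shows "is_iso C x y f"
  using assms by (auto simp: is_iso_def)

lemmas (in category) cat_rules =
  ident_in_hom cmp_in_hom cmp_ident_left cmp_ident_right

section \<open>Quasi-inverse functors\<close>

lemma quasi_inverse_sym: "quasi_inverse A B F G \<Longrightarrow> quasi_inverse B A G F"
  by (simp add: quasi_inverse_def)

lemma nat_isoE:
  assumes "category A" "is_functor A A F" "nat_isomorphic A A F fid"
  obtains \<tau> \<sigma> where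
    "\<And>x. x \<in> ob A \<Longrightarrow> \<tau> x \<in> hom A (fobj F x) x"
    "\<And>x. x \<in> ob A \<Longrightarrow> \<sigma> x \<in> hom A x (fobj F x)"
    "\<And>x. x \<in> ob A \<Longrightarrow> cmp A (fobj F x) x (fobj F x) (\<sigma> x) (\<tau> x) = ident A (fobj F x)"
    "\<And>x. x \<in> ob A \<Longrightarrow> cmp A x (fobj F x) x (\<tau> x) (\<sigma> x) = ident A x"
    "\<And>x y f. x \<in> ob A \<Longrightarrow> y \<in> ob A \<Longrightarrow> f \<in> hom A x y \<Longrightarrow>
        cmp A (fobj F x) (fobj F y) y (\<tau> y) (fmap F x y f) = cmp A (fobj F x) x y f (\<tau> x)"
proof -
  from assms(3) obtain \<tau> where
    iso: "\<forall>x\<in>ob A. is_iso A (fobj F x) x (\<tau> x)" and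
    nat: "\<forall>x\<in>ob A. \<forall>y\<in>ob A. \<forall>f\<in>hom A x y.
        cmp A (fobj F x) (fobj F y) y (\<tau> y) (fmap F x y f) = cmp A (fobj F x) x y f (\<tau> x)"
    unfolding nat_isomorphic_def by auto
  from iso have "\<forall>x\<in>ob A. \<exists>s. s \<in> hom A x (fobj F x) \<and>
      cmp A (fobj F x) x (fobj F x) s (\<tau> x) = ident A (fobj F x) \<and>
      cmp A x (fobj F x) x (\<tau> x) s = ident A x"
    unfolding is_iso_def by blast
  then obtain \<sigma> where "\<forall>x\<in>ob A. \<sigma> x \<in> hom A x (fobj F x) \<and>
      cmp A (fobj F x) x (fobj F x) (\<sigma> x) (\<tau> x) = ident A (fobj F x) \<and>
      cmp A x (fobj F x) x (\<tau> x) (\<sigma> x) = ident A x"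
    by metis
  with iso nat show ?thesis
    by (intro that[of \<tau> \<sigma>]) (auto simp: is_iso_def)
qed

text \<open>Naturality turns \<open>f\<close> into a conjugate of \<open>G (F f)\<close> by the
  invertible components of \<tau>.\<close>

lemma quasi_inverse_faithful:
  assumes "category A" "quasi_inverse A B F G" "x \<in> ob A" "y \<in> ob A"
    "f \<in> hom A x y" "g \<in> hom A x y" "fmap F x y f = fmap F x y g"
  shows "f = g"
proof -
  interpret A: category A by fact
  have fF: "is_functor A B F" and fG: "is_functor B A G"
    using assms(2) by (auto simp: quasi_inverse_def)
  obtain \<tau> \<sigma> where t: "\<And>x. x \<in> ob A \<Longrightarrow> \<tau> x \<in> hom A (fobj (G \<circ>\<^sub>F F) x) x"
    "\<And>x. x \<in> ob A \<Longrightarrow> \<sigma> x \<in> hom A x (fobj (G \<circ>\<^sub>F F) x)"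
    "\<And>x. x \<in> ob A \<Longrightarrow> cmp A (fobj (G \<circ>\<^sub>F F) x) x (fobj (G \<circ>\<^sub>F F) x) (\<sigma> x) (\<tau> x) = ident A (fobj (G \<circ>\<^sub>F F) x)"
    "\<And>x. x \<in> ob A \<Longrightarrow> cmp A x (fobj (G \<circ>\<^sub>F F) x) x (\<tau> x) (\<sigma> x) = ident A x"
    "\<And>x y f. x \<in> ob A \<Longrightarrow> y \<in> ob A \<Longrightarrow> f \<in> hom A x y \<Longrightarrow>
        cmp A (fobj (G \<circ>\<^sub>F F) x) (fobj (G \<circ>\<^sub>F F) y) y (\<tau> y) (fmap (G \<circ>\<^sub>F F) x y f)
        = cmp A (fobj (G \<circ>\<^sub>F F) x) x y f (\<tau> x)"
    by (rule nat_isoE[OF assms(1) is_functor_fcomp[OF fF fG]])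
      (use assms(2) in \<open>auto simp: quasi_inverse_def\<close>)
  have ox: "fobj G (fobj F x) \<in> ob A" using assms fF fG by (simp add: functor_rules)
  have "cmp A (fobj G (fobj F x)) x y f (\<tau> x) = cmp A (fobj G (fobj F x)) x y g (\<tau> x)"
    using t(5)[of x y f] t(5)[of x y g] assms by simp
  moreover have "cmp A x (fobj G (fobj F x)) y (cmp A (fobj G (fobj F x)) x y h (\<tau> x)) (\<sigma> x) = h"
    if "h \<in> hom A x y" for h
    using that assms t(1,2,4)[of x] ox A.cmp_assoc[of x "fobj G (fobj F x)" x y "\<sigma> x" "\<tau> x" h]
    by (simp add: A.cat_rules)
  ultimately show ?thesis using assms by metis
qed

text \<open>Fullness: a preimage of \<open>h\<close> is the conjugate
  \<open>\<tau> y \<circ> G h \<circ> \<sigma> x\<close>. Naturality shows that \<open>G\<close>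
  sends \<open>F f\<close> and \<open>h\<close> to the same morphism, and \<open>G\<close> is
  faithful by \<open>quasi_inverse_faithful\<close> with the roles exchanged.\<close>

lemma quasi_inverse_ff:
  assumes "category A" "category B" "quasi_inverse A B F G"
  shows "fully_faithful A B F"
proof -
  interpret A: category A by fact
  have fF: "is_functor A B F" and fG: "is_functor B A G"
    using assms(3) by (auto simp: quasi_inverse_def)
  let ?H = "G \<circ>\<^sub>F F"
  obtain \<tau> \<sigma> where t: "\<And>x. x \<in> ob A \<Longrightarrow> \<tau> x \<in> hom A (fobj ?H x) x"
    "\<And>x. x \<in> ob A \<Longrightarrow> \<sigma> x \<in> hom A x (fobj ?H x)"
    "\<And>x. x \<in> ob A \<Longrightarrow> cmp A (fobj ?H x) x (fobj ?H x) (\<sigma> x) (\<tau> x) = ident A (fobj ?H x)"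
    "\<And>x. x \<in> ob A \<Longrightarrow> cmp A x (fobj ?H x) x (\<tau> x) (\<sigma> x) = ident A x"
    "\<And>x y f. x \<in> ob A \<Longrightarrow> y \<in> ob A \<Longrightarrow> f \<in> hom A x y \<Longrightarrow>
        cmp A (fobj ?H x) (fobj ?H y) y (\<tau> y) (fmap ?H x y f) = cmp A (fobj ?H x) x y f (\<tau> x)"
    by (rule nat_isoE[OF assms(1) is_functor_fcomp[OF fF fG]])
      (use assms(3) in \<open>auto simp: quasi_inverse_def\<close>)
  have surj: "\<exists>f \<in> hom A x y. fmap F x y f = h"
    if x: "x \<in> ob A" and y: "y \<in> ob A" and h: "h \<in> hom B (fobj F x) (fobj F y)" for x y h
  proof -
    let ?x = "fobj G (fobj F x)" and ?y = "fobj G (fobj F y)"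
    let ?h = "fmap G (fobj F x) (fobj F y) h"
    define f where "f = cmp A x ?x y (cmp A ?x ?y y (\<tau> y) ?h) (\<sigma> x)"
    have o: "?x \<in> ob A" "?y \<in> ob A" "?h \<in> hom A ?x ?y" "fobj F x \<in> ob B" "fobj F y \<in> ob B"
      using x y h fF fG by (simp_all add: functor_rules)
    have m: "\<tau> y \<in> hom A ?y y" "\<sigma> x \<in> hom A x ?x" "\<tau> x \<in> hom A ?x x" "\<sigma> y \<in> hom A y ?y"
      using t(1,2) x y by simp_all
    have f: "f \<in> hom A x y" unfolding f_def using x y o m by (simp add: A.cat_rules)
    have "cmp A ?x x y f (\<tau> x) = cmp A ?x ?y y (\<tau> y) ?h"
      unfolding f_def using x y o m t(3)[OF x]
        A.cmp_assoc[of ?x x ?x y "\<tau> x" "\<sigma> x" "cmp A ?x ?y y (\<tau> y) ?h"]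
      by (simp add: A.cat_rules)
    then have e: "cmp A ?x ?y y (\<tau> y) (fmap G (fobj F x) (fobj F y) (fmap F x y f))
        = cmp A ?x ?y y (\<tau> y) ?h"
      using t(5)[OF x y f] by simp
    have c: "cmp A ?x y ?y (\<sigma> y) (cmp A ?x ?y y (\<tau> y) k) = k" if "k \<in> hom A ?x ?y" for k
      using that x y o m t(3)[OF y] A.cmp_assoc[of ?x ?y y ?y k "\<tau> y" "\<sigma> y"]
      by (simp add: A.cat_rules)
    have Ff: "fmap F x y f \<in> hom B (fobj F x) (fobj F y)" using fF x y f by (simp add: functor_rules)
    have "fmap G (fobj F x) (fobj F y) (fmap F x y f) = ?h"
      using e c[OF o(3)] c[of "fmap G (fobj F x) (fobj F y) (fmap F x y f)"]
        functor_hom[OF fG o(4,5) Ff] by simp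
    then have "fmap F x y f = h"
      using quasi_inverse_faithful[OF assms(2) quasi_inverse_sym[OF assms(3)] o(4,5) Ff h] by simp
    then show ?thesis using f by blast
  qed
  show ?thesis unfolding fully_faithful_def
  proof (intro conjI ballI fF)
    fix x y assume x: "x \<in> ob A" and y: "y \<in> ob A"
    show "bij_betw (fmap F x y) (hom A x y) (hom B (fobj F x) (fobj F y))"
    proof (rule bij_betw_imageI)
      show "inj_on (fmap F x y) (hom A x y)"
        by (intro inj_onI) (rule quasi_inverse_faithful[OF assms(1,3) x y])
      show "fmap F x y ` hom A x y = hom B (fobj F x) (fobj F y)"
        using surj[OF x y] functor_hom[OF fF x y] by blast
    qed
  qed
qed

lemma quasi_inverse_iso:
  assumes "category B" "quasi_inverse A B F G" "y \<in> ob B"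
  shows "fobj G y \<in> ob A" and "\<exists>f. is_iso B (fobj F (fobj G y)) y f"
  using assms unfolding quasi_inverse_def nat_isomorphic_def is_functor_def by auto

section \<open>Opposite categories\<close>

definition opp :: "('o, 'm) cat \<Rightarrow> ('o, 'm) cat" where
  "opp C = \<lparr>ob = ob C, hom = (\<lambda>x y. hom C y x), ident = ident C,
     cmp = (\<lambda>x y z g f. cmp C z y x f g)\<rparr>"

lemma opp_simps [simp]:
  "ob (opp C) = ob C" "hom (opp C) x y = hom C y x" "ident (opp C) = ident C"
  "cmp (opp C) x y z g f = cmp C z y x f g"
  by (simp_all add: opp_def)

definition opf :: "('o, 'm, 'p, 'n) fctr \<Rightarrow> ('o, 'm, 'p, 'n) fctr" where
  "opf F = \<lparr>fobj = fobj F, fmap = (\<lambda>x y. fmap F y x)\<rparr>"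

lemma opf_simps [simp]: "fobj (opf F) = fobj F" "fmap (opf F) x y = fmap F y x"
  by (simp_all add: opf_def)

lemma opp_opp [simp]: "opp (opp C) = C" and opf_opf [simp]: "opf (opf F) = F"
  by (simp_all add: opp_def opf_def)

lemma is_iso_opp [simp]: "is_iso (opp C) x y f \<longleftrightarrow> is_iso C y x f"
  unfolding is_iso_def by auto

lemma category_opp: "category C \<Longrightarrow> category (opp C)"
  unfolding category_def by simp

lemma is_functor_opf: "is_functor A B F \<Longrightarrow> is_functor (opp A) (opp B) (opf F)"
  unfolding is_functor_def by simp

lemma fully_faithful_opf: "fully_faithful A B F \<Longrightarrow> fully_faithful (opp A) (opp B) (opf F)"
  unfolding fully_faithful_def using is_functor_opf by auto

lemma nat_isomorphic_opp: "nat_isomorphic (opp A) (opp B) (opf F) (opf G) \<longleftrightarrow> nat_isomorphic A B G F"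
  unfolding nat_isomorphic_def by (intro iff_exI) auto

section \<open>Adjunctions: passage to opposites, counits\<close>

lemma adjoint_functors: "adjoint A B F G \<Longrightarrow> is_functor A B F" "adjoint A B F G \<Longrightarrow> is_functor B A G"
  by (simp_all add: adjoint_def)

text \<open>Opposites exchange left and right adjoints, and the bijection \<phi> is replaced by its
  inverse \<psi>. Statements about reflections are obtained in this way from those about
  coreflections.\<close>

lemma adjoint_opf:
  assumes "category A" "category B" "adjoint A B F G"
  shows "adjoint (opp B) (opp A) (opf G) (opf F)"
proof -
  interpret A: category A by fact
  interpret B: category B by fact
  have fF: "is_functor A B F" and fG: "is_functor B A G"
    using assms by (auto simp: adjoint_def)
  obtain \<phi> where
    bij: "\<forall>a\<in>ob A. \<forall>b\<in>ob B. bij_betw (\<phi> a b) (hom B (fobj F a) b) (hom A a (fobj G b))"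
    and nat: "\<forall>a'\<in>ob A. \<forall>a\<in>ob A. \<forall>b\<in>ob B. \<forall>b'\<in>ob B.
      \<forall>h\<in>hom A a' a. \<forall>f\<in>hom B (fobj F a) b. \<forall>k\<in>hom B b b'.
        \<phi> a' b' (cmp B (fobj F a') b b' k (cmp B (fobj F a') (fobj F a) b f (fmap F a' a h))) =
        cmp A a' (fobj G b) (fobj G b') (fmap G b b' k) (cmp A a' a (fobj G b) (\<phi> a b f) h)"
    using assms(3) unfolding adjoint_def by (elim conjE exE) (rule that)
  note Fr = functor_rules[OF fF] and Gr = functor_rules[OF fG]
  define \<psi> where "\<psi> b a = inv_into (hom B (fobj F a) b) (\<phi> a b)" for a b
  have \<psi>: "bij_betw (\<psi> b a) (hom A a (fobj G b)) (hom B (fobj F a) b)" if "a \<in> ob A" "b \<in> ob B" for a b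
    unfolding \<psi>_def using bij that by (intro bij_betw_inv_into) blast
  have \<psi>h: "\<psi> b a f \<in> hom B (fobj F a) b" and \<phi>\<psi>: "\<phi> a b (\<psi> b a f) = f"
    if "a \<in> ob A" "b \<in> ob B" "f \<in> hom A a (fobj G b)" for a b f
    using \<psi>[OF that(1,2)] bij that bij_betwE bij_betw_inv_into_right unfolding \<psi>_def by (blast, metis)
  have \<psi>\<phi>: "\<psi> b a (\<phi> a b f) = f" if "a \<in> ob A" "b \<in> ob B" "f \<in> hom B (fobj F a) b" for a b f
    unfolding \<psi>_def using bij that bij_betw_inv_into_left by metis
  have "\<psi> b' a' (cmp A a' a (fobj G b') (cmp A a (fobj G b) (fobj G b') (fmap G b b' h) f) k)
      = cmp B (fobj F a') (fobj F a) b' (cmp B (fobj F a) b b' h (\<psi> b a f)) (fmap F a' a k)"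
    if a: "b' \<in> ob B" "b \<in> ob B" "a \<in> ob A" "a' \<in> ob A" "h \<in> hom B b b'" "f \<in> hom A a (fobj G b)" "k \<in> hom A a' a"
    for b' b a a' h f k
  proof -
    note m = a \<psi>h[OF a(3,2,6)] Fr(1)[OF a(3)] Fr(1)[OF a(4)] Gr(1)[OF a(1)] Gr(1)[OF a(2)]
      Fr(2)[OF a(4,3,7)] Gr(2)[OF a(2,1,5)]
    have "\<phi> a' b' (cmp B (fobj F a') (fobj F a) b' (cmp B (fobj F a) b b' h (\<psi> b a f)) (fmap F a' a k))
        = cmp A a' a (fobj G b') (cmp A a (fobj G b) (fobj G b') (fmap G b b' h) f) k"
      using nat[rule_format, OF a(4,3,2,1,7) \<psi>h[OF a(3,2,6)] a(5)] \<phi>\<psi>[OF a(3,2,6)] m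
      by (simp add: A.cmp_assoc B.cmp_assoc)
    moreover have "cmp B (fobj F a') (fobj F a) b' (cmp B (fobj F a) b b' h (\<psi> b a f)) (fmap F a' a k) \<in> hom B (fobj F a') b'"
      using m by (simp add: B.cmp_in_hom)
    ultimately show ?thesis using \<psi>\<phi>[OF a(4,1)] by metis
  qed
  then show ?thesis
    unfolding adjoint_def using is_functor_opf[OF fF] is_functor_opf[OF fG] \<psi>
    by (intro conjI exI[of _ \<psi>]) simp_all
qed

text \<open>The counit \<open>\<epsilon> b\<close> is the preimage of the identity of
  \<open>G b\<close>. Its second property is the form of the adjunction that \<open>linv\<close>
  asks for: composition with one morphism is bijective.\<close>

lemma adjoint_counit:
  assumes "category A" "category B" "adjoint A B F G"
  obtains \<epsilon> where
    "\<And>b. b \<in> ob B \<Longrightarrow> \<epsilon> b \<in> hom B (fobj F (fobj G b)) b"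
    "\<And>a b. a \<in> ob A \<Longrightarrow> b \<in> ob B \<Longrightarrow>
       bij_betw (\<lambda>f. cmp B (fobj F a) (fobj F (fobj G b)) b (\<epsilon> b) (fmap F a (fobj G b) f))
         (hom A a (fobj G b)) (hom B (fobj F a) b)"
    "\<And>a b f. a \<in> ob B \<Longrightarrow> b \<in> ob B \<Longrightarrow> f \<in> hom B a b \<Longrightarrow>
       cmp B (fobj F (fobj G a)) (fobj F (fobj G b)) b (\<epsilon> b)
         (fmap F (fobj G a) (fobj G b) (fmap G a b f))
       = cmp B (fobj F (fobj G a)) a b f (\<epsilon> a)"
proof -
  interpret A: category A by fact
  interpret B: category B by fact
  have fF: "is_functor A B F" and fG: "is_functor B A G"
    using assms(3) by (auto simp: adjoint_def)
  obtain \<phi> where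
    bij0: "\<forall>a\<in>ob A. \<forall>b\<in>ob B. bij_betw (\<phi> a b) (hom B (fobj F a) b) (hom A a (fobj G b))"
    and nat0: "\<forall>a'\<in>ob A. \<forall>a\<in>ob A. \<forall>b\<in>ob B. \<forall>b'\<in>ob B.
      \<forall>h\<in>hom A a' a. \<forall>f\<in>hom B (fobj F a) b. \<forall>k\<in>hom B b b'.
        \<phi> a' b' (cmp B (fobj F a') b b' k (cmp B (fobj F a') (fobj F a) b f (fmap F a' a h))) =
        cmp A a' (fobj G b) (fobj G b') (fmap G b b' k) (cmp A a' a (fobj G b) (\<phi> a b f) h)"
    using assms(3) unfolding adjoint_def by (elim conjE exE) (rule that)
  have bij: "\<And>a b. a \<in> ob A \<Longrightarrow> b \<in> ob B \<Longrightarrow> bij_betw (\<phi> a b) (hom B (fobj F a) b) (hom A a (fobj G b))"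
    by (rule bij0[rule_format])
  have nat: "\<And>a' a b b' h f k. \<lbrakk>a' \<in> ob A; a \<in> ob A; b \<in> ob B; b' \<in> ob B;
      h \<in> hom A a' a; f \<in> hom B (fobj F a) b; k \<in> hom B b b'\<rbrakk> \<Longrightarrow>
        \<phi> a' b' (cmp B (fobj F a') b b' k (cmp B (fobj F a') (fobj F a) b f (fmap F a' a h))) =
        cmp A a' (fobj G b) (fobj G b') (fmap G b b' k) (cmp A a' a (fobj G b) (\<phi> a b f) h)"
    by (rule nat0[rule_format])
  define \<epsilon> where "\<epsilon> b = inv_into (hom B (fobj F (fobj G b)) b) (\<phi> (fobj G b) b) (ident A (fobj G b))" for b
  have \<epsilon>: "\<epsilon> b \<in> hom B (fobj F (fobj G b)) b" "\<phi> (fobj G b) b (\<epsilon> b) = ident A (fobj G b)"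
    if "b \<in> ob B" for b
  proof -
    have o: "fobj G b \<in> ob A" using fG that by (simp add: functor_rules)
    note bb = bij[OF o that]
    have "ident A (fobj G b) \<in> \<phi> (fobj G b) b ` hom B (fobj F (fobj G b)) b"
      using bb o by (simp add: bij_betw_def A.cat_rules)
    then show "\<epsilon> b \<in> hom B (fobj F (fobj G b)) b" "\<phi> (fobj G b) b (\<epsilon> b) = ident A (fobj G b)"
      unfolding \<epsilon>_def by (simp_all add: inv_into_into f_inv_into_f)
  qed
  have c: "cmp B (fobj F a) (fobj F (fobj G b)) b (\<epsilon> b) (fmap F a (fobj G b) f) \<in> hom B (fobj F a) b"
    and \<phi>\<epsilon>: "\<phi> a b (cmp B (fobj F a) (fobj F (fobj G b)) b (\<epsilon> b) (fmap F a (fobj G b) f)) = f"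
    if "a \<in> ob A" "b \<in> ob B" "f \<in> hom A a (fobj G b)" for a b f
    using nat[of a "fobj G b" b b f "\<epsilon> b" "ident B b"] that \<epsilon>[OF that(2)] 
      functor_rules[OF fF] functor_rules[OF fG]
    by (simp_all add: A.cat_rules B.cat_rules)
  have inj: "f = g" if "a \<in> ob A" "b \<in> ob B" "f \<in> hom B (fobj F a) b" "g \<in> hom B (fobj F a) b"
    "\<phi> a b f = \<phi> a b g" for a b f g
    using bij[OF that(1,2)] that(3-) unfolding bij_betw_def by (meson inj_onD)
  show ?thesis
  proof (rule that[of \<epsilon>])
    show "\<epsilon> b \<in> hom B (fobj F (fobj G b)) b" if "b \<in> ob B" for b using \<epsilon>[OF that] by simp
    show "bij_betw (\<lambda>f. cmp B (fobj F a) (fobj F (fobj G b)) b (\<epsilon> b) (fmap F a (fobj G b) f))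
         (hom A a (fobj G b)) (hom B (fobj F a) b)" if ab: "a \<in> ob A" "b \<in> ob B" for a b
    proof (rule bij_betw_byWitness[where f' = "\<phi> a b"])
      have *: "\<phi> a b f \<in> hom A a (fobj G b)" if "f \<in> hom B (fobj F a) b" for f
        using bij[OF ab] that by (meson bij_betwE)
      then show "\<phi> a b ` hom B (fobj F a) b \<subseteq> hom A a (fobj G b)" by blast
      show "\<forall>f\<in>hom A a (fobj G b).
         \<phi> a b (cmp B (fobj F a) (fobj F (fobj G b)) b (\<epsilon> b) (fmap F a (fobj G b) f)) = f"
        using \<phi>\<epsilon>[OF ab] by blast
      show "(\<lambda>f. cmp B (fobj F a) (fobj F (fobj G b)) b (\<epsilon> b) (fmap F a (fobj G b) f)) ` hom A a (fobj G b)
          \<subseteq> hom B (fobj F a) b" using c[OF ab] by blast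
      show "\<forall>f\<in>hom B (fobj F a) b.
         cmp B (fobj F a) (fobj F (fobj G b)) b (\<epsilon> b) (fmap F a (fobj G b) (\<phi> a b f)) = f"
        using inj[OF ab] c[OF ab] \<phi>\<epsilon>[OF ab] * by metis
    qed
    show "cmp B (fobj F (fobj G a)) (fobj F (fobj G b)) b (\<epsilon> b)
         (fmap F (fobj G a) (fobj G b) (fmap G a b f))
       = cmp B (fobj F (fobj G a)) a b f (\<epsilon> a)" if ab: "a \<in> ob B" "b \<in> ob B" "f \<in> hom B a b" for a b f
    proof -
      have o: "fobj G a \<in> ob A" "fobj G b \<in> ob A" using fG ab by (simp_all add: functor_rules)
      have m: "fmap G a b f \<in> hom A (fobj G a) (fobj G b)" using fG ab by (simp add: functor_rules)
      have "\<phi> (fobj G a) b (cmp B (fobj F (fobj G a)) a b f (\<epsilon> a)) = fmap G a b f"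
        using nat[of "fobj G a" "fobj G a" a b "ident A (fobj G a)" "\<epsilon> a" f] ab o \<epsilon>[OF ab(1)] m
          functor_rules[OF fF] functor_rules[OF fG]
        by (simp add: A.cat_rules B.cat_rules)
      moreover have "cmp B (fobj F (fobj G a)) a b f (\<epsilon> a) \<in> hom B (fobj F (fobj G a)) b"
        using ab o \<epsilon>[OF ab(1)] fF by (simp add: B.cat_rules functor_rules)
      ultimately show ?thesis
        using inj[OF o(1) ab(2)] c[OF o(1) ab(2) m] \<phi>\<epsilon>[OF o(1) ab(2) m] by metis
    qed
  qed
qed

lemma nat_isomorphic_sym:
  assumes "category B" "is_functor A B F" "is_functor A B G" "nat_isomorphic A B F G"
  shows "nat_isomorphic A B G F"
proof -
  interpret B: category B by fact
  note Fr = functor_rules[OF assms(2)] and Gr = functor_rules[OF assms(3)]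
  obtain \<tau> where iso: "\<forall>x\<in>ob A. is_iso B (fobj F x) (fobj G x) (\<tau> x)" and
    nat: "\<forall>x\<in>ob A. \<forall>y\<in>ob A. \<forall>f\<in>hom A x y.
        cmp B (fobj F x) (fobj F y) (fobj G y) (\<tau> y) (fmap F x y f) =
        cmp B (fobj F x) (fobj G x) (fobj G y) (fmap G x y f) (\<tau> x)"
    using assms(4) unfolding nat_isomorphic_def by (elim exE conjE) (rule that)
  have "\<forall>x\<in>ob A. \<exists>s. s \<in> hom B (fobj G x) (fobj F x) \<and>
      cmp B (fobj F x) (fobj G x) (fobj F x) s (\<tau> x) = ident B (fobj F x) \<and>
      cmp B (fobj G x) (fobj F x) (fobj G x) (\<tau> x) s = ident B (fobj G x)"
    using iso unfolding is_iso_def by blast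
  then obtain \<sigma> where \<sigma>: "\<And>x. x \<in> ob A \<Longrightarrow> \<sigma> x \<in> hom B (fobj G x) (fobj F x) \<and>
      cmp B (fobj F x) (fobj G x) (fobj F x) (\<sigma> x) (\<tau> x) = ident B (fobj F x) \<and>
      cmp B (fobj G x) (fobj F x) (fobj G x) (\<tau> x) (\<sigma> x) = ident B (fobj G x)"
    by metis
  have \<tau>: "\<tau> x \<in> hom B (fobj F x) (fobj G x)" if "x \<in> ob A" for x using iso that by (simp add: is_iso_def)
  have "cmp B (fobj G x) (fobj G y) (fobj F y) (\<sigma> y) (fmap G x y f)
      = cmp B (fobj G x) (fobj F x) (fobj F y) (fmap F x y f) (\<sigma> x)"
    if a: "x \<in> ob A" "y \<in> ob A" "f \<in> hom A x y" for x y f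
  proof -
    note m = Fr(1)[OF a(1)] Fr(1)[OF a(2)] Gr(1)[OF a(1)] Gr(1)[OF a(2)] Fr(2)[OF a] Gr(2)[OF a]
      \<tau>[OF a(1)] \<tau>[OF a(2)] \<sigma>[OF a(1)] \<sigma>[OF a(2)]
    have "cmp B (fobj G x) (fobj G y) (fobj F y) (\<sigma> y) (fmap G x y f)
        = cmp B (fobj G x) (fobj F x) (fobj F y) (cmp B (fobj F x) (fobj G y) (fobj F y) (\<sigma> y)
            (cmp B (fobj F x) (fobj G x) (fobj G y) (fmap G x y f) (\<tau> x))) (\<sigma> x)"
      using m by (simp add: B.cat_rules flip: B.cmp_assoc)
    also have "\<dots> = cmp B (fobj G x) (fobj F x) (fobj F y) (fmap F x y f) (\<sigma> x)"
      unfolding nat[rule_format, OF a, symmetric] using m by (simp add: B.cat_rules B.cmp_assoc)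
    finally show ?thesis .
  qed
  moreover have "is_iso B (fobj G x) (fobj F x) (\<sigma> x)" if "x \<in> ob A" for x
    using \<sigma>[OF that] \<tau>[OF that] by (intro is_isoI) auto
  ultimately show ?thesis unfolding nat_isomorphic_def by blast
qed

section \<open>Comparing two full subcategories inside a third category\<close>

lemma ff_lift_iso:
  assumes "category A" "fully_faithful A B F" "x \<in> ob A" "y \<in> ob A"
    "t \<in> hom B (fobj F x) (fobj F y)" "s \<in> hom B (fobj F y) (fobj F x)"
    "cmp B (fobj F x) (fobj F y) (fobj F x) s t = ident B (fobj F x)"
    "cmp B (fobj F y) (fobj F x) (fobj F y) t s = ident B (fobj F y)"
  obtains \<tau> where "is_iso A x y \<tau>" "\<tau> \<in> hom A x y" "fmap F x y \<tau> = t"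
proof -
  interpret A: category A by fact
  note fF = ff_functor[OF assms(2)]
  obtain \<tau> where \<tau>: "\<tau> \<in> hom A x y" "fmap F x y \<tau> = t"
    using ff_full[OF assms(2-5)] by blast
  obtain \<sigma> where \<sigma>: "\<sigma> \<in> hom A y x" "fmap F y x \<sigma> = s"
    using ff_full[OF assms(2) assms(4,3,6)] by blast
  have "cmp A x y x \<sigma> \<tau> = ident A x"
    using ff_inj[OF assms(2) assms(3,3), of "cmp A x y x \<sigma> \<tau>" "ident A x"]
      assms \<sigma> \<tau> functor_cmp[OF fF assms(3,4,3) \<tau>(1) \<sigma>(1)] functor_ident[OF fF assms(3)]
    by (simp add: A.cat_rules)
  moreover have "cmp A y x y \<tau> \<sigma> = ident A y"
    using ff_inj[OF assms(2) assms(4,4), of "cmp A y x y \<tau> \<sigma>" "ident A y"]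
      assms \<sigma> \<tau> functor_cmp[OF fF assms(4,3,4) \<sigma>(1) \<tau>(1)] functor_ident[OF fF assms(4)]
    by (simp add: A.cat_rules)
  ultimately have "is_iso A x y \<tau>" using \<tau> \<sigma> by (intro is_isoI)
  with \<tau> that show ?thesis by blast
qed

text \<open>The object types of \<open>A\<close>, \<open>B\<close> and \<open>Q\<close> are
  independent and \<open>I\<close>, \<open>K\<close> are arbitrary full embeddings: the second
  equivalence of the theorem uses for \<open>K\<close> an embedding that is not an
  inclusion.\<close>

locale bridge = A: category A + B: category B + Q: category Q
  for A :: "('o, 'm) cat" and B :: "('p, 'n) cat" and Q :: "('q, 'l) cat" +
  fixes I :: "('o, 'm, 'q, 'l) fctr" and K :: "('p, 'n, 'q, 'l) fctr"
  assumes ffI: "fully_faithful A Q I" and ffK: "fully_faithful B Q K"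
begin

lemmas I_rules = functor_rules[OF ff_functor[OF ffI]]
lemmas K_rules = functor_rules[OF ff_functor[OF ffK]]

text \<open>For \<open>x\<close> in the image of \<open>I\<close> this says that \<open>w\<close> is
  the coreflection of \<open>y\<close> into \<open>A\<close>; \<open>rinv\<close> is the
  corresponding condition for reflections into \<open>B\<close>.\<close>

definition linv :: "'q \<Rightarrow> 'q \<Rightarrow> 'l \<Rightarrow> bool" where
  "linv x y w \<longleftrightarrow> w \<in> hom Q x y \<and> (\<forall>u \<in> ob A.
     bij_betw (cmp Q (fobj I u) x y w) (hom Q (fobj I u) x) (hom Q (fobj I u) y))"

definition rinv :: "'q \<Rightarrow> 'q \<Rightarrow> 'l \<Rightarrow> bool" where
  "rinv x y w \<longleftrightarrow> w \<in> hom Q x y \<and> (\<forall>v \<in> ob B.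
     bij_betw (\<lambda>f. cmp Q x y (fobj K v) f w) (hom Q y (fobj K v)) (hom Q x (fobj K v)))"

definition good :: "'q \<Rightarrow> 'q \<Rightarrow> 'l \<Rightarrow> bool" where
  "good x y w \<longleftrightarrow> linv x y w \<and> rinv x y w"

lemma linv_lift:
  assumes "linv x y w" "u \<in> ob A" "f \<in> hom Q (fobj I u) y"
  obtains g where "g \<in> hom Q (fobj I u) x" "cmp Q (fobj I u) x y w g = f"
proof -
  have "f \<in> cmp Q (fobj I u) x y w ` hom Q (fobj I u) x"
    using assms unfolding linv_def bij_betw_def by simp
  then show thesis using that by blast
qed

lemma linv_cancel:
  "\<lbrakk>linv x y w; u \<in> ob A; f \<in> hom Q (fobj I u) x; g \<in> hom Q (fobj I u) x;
    cmp Q (fobj I u) x y w f = cmp Q (fobj I u) x y w g\<rbrakk> \<Longrightarrow> f = g"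
  unfolding linv_def bij_betw_def by (meson inj_onD)

lemma rinv_lift:
  assumes "rinv x y w" "v \<in> ob B" "f \<in> hom Q x (fobj K v)"
  obtains g where "g \<in> hom Q y (fobj K v)" "cmp Q x y (fobj K v) g w = f"
proof -
  have "f \<in> (\<lambda>f. cmp Q x y (fobj K v) f w) ` hom Q y (fobj K v)"
    using assms unfolding rinv_def bij_betw_def by simp
  then show thesis using that by blast
qed

lemma rinv_cancel:
  assumes "rinv x y w" "v \<in> ob B" "f \<in> hom Q y (fobj K v)" "g \<in> hom Q y (fobj K v)"
    "cmp Q x y (fobj K v) f w = cmp Q x y (fobj K v) g w"
  shows "f = g"
  using assms inj_onD[of "\<lambda>f. cmp Q x y (fobj K v) f w" "hom Q y (fobj K v)" f g]
  unfolding rinv_def bij_betw_def by blast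

lemma linv_hom: "linv x y w \<Longrightarrow> w \<in> hom Q x y"
  and rinv_hom: "rinv x y w \<Longrightarrow> w \<in> hom Q x y"
  by (simp_all add: linv_def rinv_def)

text \<open>Halves the work: the reflective side of each statement is the coreflective side for the
  opposites, where \<open>A\<close> and \<open>B\<close> change places.\<close>

lemma bridge_opp: "bridge (opp B) (opp A) (opp Q) (opf K) (opf I)"
  using A.category_axioms B.category_axioms Q.category_axioms ffI ffK
  by (simp add: bridge_def bridge_axioms_def category_opp fully_faithful_opf)

lemma good_opp:
  "bridge.linv (opp B) (opp Q) (opf K) x y w \<longleftrightarrow> rinv y x w"
  "bridge.good (opp B) (opp A) (opp Q) (opf K) (opf I) x y w \<longleftrightarrow> good y x w"
proof -
  interpret O: bridge "opp B" "opp A" "opp Q" "opf K" "opf I" by (rule bridge_opp)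
  have c: "cmp (opp Q) a b c g = (\<lambda>f. cmp Q c b a f g)" for a b c g by (simp add: fun_eq_iff)
  show "O.linv x y w \<longleftrightarrow> rinv y x w" by (simp add: O.linv_def rinv_def c)
  moreover have "O.rinv x y w \<longleftrightarrow> linv y x w" by (simp add: O.rinv_def linv_def)
  ultimately show "O.good x y w \<longleftrightarrow> good y x w" by (auto simp: O.good_def good_def)
qed

text \<open>The morphisms \<open>w u : I u \<rightarrow> K (F u)\<close> and
  \<open>v (F u) : I (H (F u)) \<rightarrow> K (F u)\<close> are both coreflections of
  \<open>K (F u)\<close>, so a unique isomorphism over \<open>K (F u)\<close> connects their
  sources; uniqueness makes it natural.\<close>

lemma HF_iso:
  assumes F: "is_functor A B F" and H: "is_functor B A H"
    and w: "\<And>u. u \<in> ob A \<Longrightarrow> good (fobj I u) (fobj K (fobj F u)) (w u)"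
    and w_nat: "\<And>u u' f. u \<in> ob A \<Longrightarrow> u' \<in> ob A \<Longrightarrow> f \<in> hom A u u' \<Longrightarrow>
      cmp Q (fobj I u) (fobj I u') (fobj K (fobj F u')) (w u') (fmap I u u' f)
      = cmp Q (fobj I u) (fobj K (fobj F u)) (fobj K (fobj F u'))
          (fmap K (fobj F u) (fobj F u') (fmap F u u' f)) (w u)"
    and v: "\<And>b. b \<in> ob B \<Longrightarrow> good (fobj I (fobj H b)) (fobj K b) (v b)"
    and v_nat: "\<And>b b' g. b \<in> ob B \<Longrightarrow> b' \<in> ob B \<Longrightarrow> g \<in> hom B b b' \<Longrightarrow>
      cmp Q (fobj I (fobj H b)) (fobj I (fobj H b')) (fobj K b') (v b')
        (fmap I (fobj H b) (fobj H b') (fmap H b b' g))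
      = cmp Q (fobj I (fobj H b)) (fobj K b) (fobj K b') (fmap K b b' g) (v b)"
  shows "nat_isomorphic A A (H \<circ>\<^sub>F F) fid"
proof -
  note Fr = functor_rules[OF F] and Hr = functor_rules[OF H]
  let ?o = "\<lambda>u. fobj H (fobj F u)"
  have "\<exists>\<tau>. is_iso A (?o u) u \<tau> \<and> \<tau> \<in> hom A (?o u) u \<and>
      cmp Q (fobj I (?o u)) (fobj I u) (fobj K (fobj F u)) (w u) (fmap I (?o u) u \<tau>) = v (fobj F u)"
    if u: "u \<in> ob A" for u
  proof -
    have o: "fobj F u \<in> ob B" "?o u \<in> ob A" using u by (simp_all add: Fr Hr)
    have gw: "linv (fobj I u) (fobj K (fobj F u)) (w u)" using w[OF u] by (simp add: good_def)
    have gv: "linv (fobj I (?o u)) (fobj K (fobj F u)) (v (fobj F u))"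
      using v[OF o(1)] by (simp add: good_def)
    obtain t where t: "t \<in> hom Q (fobj I (?o u)) (fobj I u)"
      "cmp Q (fobj I (?o u)) (fobj I u) (fobj K (fobj F u)) (w u) t = v (fobj F u)"
      by (rule linv_lift[OF gw o(2) linv_hom[OF gv]])
    obtain s where s: "s \<in> hom Q (fobj I u) (fobj I (?o u))"
      "cmp Q (fobj I u) (fobj I (?o u)) (fobj K (fobj F u)) (v (fobj F u)) s = w u"
      by (rule linv_lift[OF gv u linv_hom[OF gw]])
    note ob = u o I_rules(1)[OF u] I_rules(1)[OF o(2)] K_rules(1)[OF o(1)]
    note hm = linv_hom[OF gw] linv_hom[OF gv] t(1) s(1)
    have "cmp Q (fobj I (?o u)) (fobj I u) (fobj I (?o u)) s t = ident Q (fobj I (?o u))"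
      by (rule linv_cancel[OF gv o(2)]) (use ob hm t s in \<open>simp_all add: Q.cat_rules Q.cmp_assoc\<close>)
    moreover have "cmp Q (fobj I u) (fobj I (?o u)) (fobj I u) t s = ident Q (fobj I u)"
      by (rule linv_cancel[OF gw u]) (use ob hm t s in \<open>simp_all add: Q.cat_rules Q.cmp_assoc\<close>)
    ultimately show ?thesis
      using ff_lift_iso[OF A.category_axioms ffI o(2) u t(1) s(1)] t(2) by metis
  qed
  then obtain \<tau> where \<tau>: "\<And>u. u \<in> ob A \<Longrightarrow> is_iso A (?o u) u (\<tau> u)"
    "\<And>u. u \<in> ob A \<Longrightarrow> \<tau> u \<in> hom A (?o u) u"
    "\<And>u. u \<in> ob A \<Longrightarrow>
      cmp Q (fobj I (?o u)) (fobj I u) (fobj K (fobj F u)) (w u) (fmap I (?o u) u (\<tau> u)) = v (fobj F u)"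
    by metis
  have "cmp A (?o x) (?o y) y (\<tau> y) (fmap H (fobj F x) (fobj F y) (fmap F x y f))
      = cmp A (?o x) x y f (\<tau> x)"
    if x: "x \<in> ob A" and y: "y \<in> ob A" and f: "f \<in> hom A x y" for x y f
  proof -
    let ?fx = "fobj F x" and ?fy = "fobj F y" and ?ix = "fobj I x" and ?iy = "fobj I y"
    let ?kx = "fobj K ?fx" and ?ky = "fobj K ?fy" and ?iox = "fobj I (?o x)" and ?ioy = "fobj I (?o y)"
    have ob: "?fx \<in> ob B" "?o x \<in> ob A" "?fy \<in> ob B" "?o y \<in> ob A"
      "?ix \<in> ob Q" "?iy \<in> ob Q" "?kx \<in> ob Q" "?ky \<in> ob Q"
      "?iox \<in> ob Q" "?ioy \<in> ob Q"
      using x y by (simp_all add: Fr Hr I_rules K_rules)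
    have Ff: "fmap F x y f \<in> hom B ?fx ?fy" using x y f by (simp add: Fr)
    then have HFf: "fmap H ?fx ?fy (fmap F x y f) \<in> hom A (?o x) (?o y)"
      using ob by (simp add: Hr)
    have gw: "linv ?iy ?ky (w y)" "w x \<in> hom Q ?ix ?kx"
      using w[OF y] w[OF x] by (simp_all add: good_def linv_hom)
    note hm = Ff HFf f \<tau>(2)[OF x] \<tau>(2)[OF y] gw(2) linv_hom[OF gw(1)]
    let ?l = "cmp A (?o x) (?o y) y (\<tau> y) (fmap H ?fx ?fy (fmap F x y f))"
    let ?r = "cmp A (?o x) x y f (\<tau> x)"
    have lr: "?l \<in> hom A (?o x) y" "?r \<in> hom A (?o x) y" using hm ob x y by (simp_all add: A.cat_rules)
    have l: "fmap I (?o x) y ?l = cmp Q ?iox ?ioy ?iy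
        (fmap I (?o y) y (\<tau> y)) (fmap I (?o x) (?o y) (fmap H ?fx ?fy (fmap F x y f)))"
      using hm ob x y by (simp add: I_rules)
    have r: "fmap I (?o x) y ?r = cmp Q ?iox ?ix ?iy
        (fmap I x y f) (fmap I (?o x) x (\<tau> x))"
      using hm ob x y by (simp add: I_rules)
    have hm': "fmap I (?o y) y (\<tau> y) \<in> hom Q ?ioy ?iy"
      "fmap I (?o x) x (\<tau> x) \<in> hom Q ?iox ?ix"
      "fmap I x y f \<in> hom Q ?ix ?iy"
      "fmap K ?fx ?fy (fmap F x y f) \<in> hom Q ?kx ?ky"
      "fmap I (?o x) (?o y) (fmap H ?fx ?fy (fmap F x y f))
        \<in> hom Q ?iox ?ioy"
      using hm ob x y by (simp_all add: I_rules K_rules)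
    \<comment> \<open>Both sides of the naturality square become \<open>K (F f) \<circ> v\<close>
      after composition with \<open>w y\<close>, and \<open>w y\<close> may be cancelled.\<close>
    have "cmp Q ?iox ?iy ?ky (w y) (fmap I (?o x) y ?l)
      = cmp Q ?iox ?kx ?ky
          (fmap K ?fx ?fy (fmap F x y f)) (v ?fx)"
      unfolding l using hm hm' ob x y \<tau>(3)[OF y] v_nat[OF ob(1,3) Ff] by (simp add: Q.cmp_assoc)
    moreover have "cmp Q ?iox ?iy ?ky (w y) (fmap I (?o x) y ?r)
      = cmp Q ?iox ?kx ?ky
          (fmap K ?fx ?fy (fmap F x y f)) (v ?fx)"
      unfolding r \<tau>(3)[OF x, symmetric]
      using hm hm' ob x y w_nat[OF x y f] by (simp add: Q.cmp_assoc)
    ultimately have "fmap I (?o x) y ?l = fmap I (?o x) y ?r"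
      using linv_cancel[OF gw(1) ob(2)] lr ob(2) y by (simp add: I_rules)
    then show ?thesis using ff_inj[OF ffI ob(2) y lr] by blast
  qed
  with \<tau>(1) show ?thesis
    unfolding nat_isomorphic_def by (intro exI[of _ \<tau>]) simp
qed

text \<open>The second isomorphism is \<open>HF_iso\<close> for the opposite categories; there it
  comes out as an isomorphism from the identity to \<open>F \<circ> H\<close> and has to be
  reversed.\<close>

lemma bridge_quasi_inverse:
  assumes F: "is_functor A B F" and H: "is_functor B A H"
    and w: "\<And>u. u \<in> ob A \<Longrightarrow> good (fobj I u) (fobj K (fobj F u)) (w u)"
    and w_nat: "\<And>u u' f. u \<in> ob A \<Longrightarrow> u' \<in> ob A \<Longrightarrow> f \<in> hom A u u' \<Longrightarrow>
      cmp Q (fobj I u) (fobj I u') (fobj K (fobj F u')) (w u') (fmap I u u' f)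
      = cmp Q (fobj I u) (fobj K (fobj F u)) (fobj K (fobj F u'))
          (fmap K (fobj F u) (fobj F u') (fmap F u u' f)) (w u)"
    and v: "\<And>b. b \<in> ob B \<Longrightarrow> good (fobj I (fobj H b)) (fobj K b) (v b)"
    and v_nat: "\<And>b b' g. b \<in> ob B \<Longrightarrow> b' \<in> ob B \<Longrightarrow> g \<in> hom B b b' \<Longrightarrow>
      cmp Q (fobj I (fobj H b)) (fobj I (fobj H b')) (fobj K b') (v b')
        (fmap I (fobj H b) (fobj H b') (fmap H b b' g))
      = cmp Q (fobj I (fobj H b)) (fobj K b) (fobj K b') (fmap K b b' g) (v b)"
  shows "quasi_inverse A B F H"
proof -
  interpret O: bridge "opp B" "opp A" "opp Q" "opf K" "opf I" by (rule bridge_opp)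
  have "nat_isomorphic (opp B) (opp B) (opf F \<circ>\<^sub>F opf H) fid"
    by (rule O.HF_iso[where w = v and v = w])
      (use w v w_nat v_nat is_functor_opf[OF F] is_functor_opf[OF H] in \<open>simp_all add: good_opp\<close>)
  moreover have "opf F \<circ>\<^sub>F opf H = opf (F \<circ>\<^sub>F H)" "fid = opf fid" by (simp_all add: fcomp_def opf_def fid_def)
  ultimately have "nat_isomorphic B B fid (F \<circ>\<^sub>F H)" using nat_isomorphic_opp by metis
  then have "nat_isomorphic B B (F \<circ>\<^sub>F H) fid"
    by (rule nat_isomorphic_sym[OF B.category_axioms, rotated 2])
      (use is_functor_fcomp[OF H F] in \<open>auto simp: is_functor_def\<close>)
  then show ?thesis unfolding quasi_inverse_def using F H HF_iso[of F H w v] w v w_nat v_nat by blast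
qed

text \<open>Coreflections \<open>e x\<close> are chosen object by object. The adjoint sends
  \<open>f\<close> to the unique \<open>g\<close> with
  \<open>e y \<circ> I g = f \<circ> e x\<close>, and uniqueness gives functoriality and
  naturality.\<close>

lemma right_adjoint_exists:
  assumes "\<And>x. x \<in> ob Q \<Longrightarrow> \<exists>u \<in> ob A. \<exists>e. linv (fobj I u) x e"
  shows "\<exists>Rf. adjoint A Q I Rf"
proof -
  from assms obtain Ro e where Ro: "\<And>x. x \<in> ob Q \<Longrightarrow> Ro x \<in> ob A"
    and e: "\<And>x. x \<in> ob Q \<Longrightarrow> linv (fobj I (Ro x)) x (e x)" by metis
  let ?i = "\<lambda>x. fobj I (Ro x)"
  note eh = linv_hom[OF e]
  have "\<exists>g. g \<in> hom A u (Ro x) \<and> cmp Q (fobj I u) (?i x) x (e x) (fmap I u (Ro x) g) = f"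
    if a: "u \<in> ob A" "x \<in> ob Q" "f \<in> hom Q (fobj I u) x" for u x f
    using linv_lift[OF e[OF a(2)] a(1) a(3)] ff_full[OF ffI a(1) Ro[OF a(2)]] by metis
  then obtain \<phi> where \<phi>: "\<And>u x f. u \<in> ob A \<Longrightarrow> x \<in> ob Q \<Longrightarrow> f \<in> hom Q (fobj I u) x \<Longrightarrow>
      \<phi> u x f \<in> hom A u (Ro x)"
    and e\<phi>: "\<And>u x f. u \<in> ob A \<Longrightarrow> x \<in> ob Q \<Longrightarrow> f \<in> hom Q (fobj I u) x \<Longrightarrow>
      cmp Q (fobj I u) (?i x) x (e x) (fmap I u (Ro x) (\<phi> u x f)) = f" by metis
  have eq: "g = g'" if a: "u \<in> ob A" "x \<in> ob Q" "g \<in> hom A u (Ro x)" "g' \<in> hom A u (Ro x)"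
    "cmp Q (fobj I u) (?i x) x (e x) (fmap I u (Ro x) g)
     = cmp Q (fobj I u) (?i x) x (e x) (fmap I u (Ro x) g')" for u x g g'
    using linv_cancel[OF e[OF a(2)] a(1) _ _ a(5)] ff_inj[OF ffI a(1) Ro[OF a(2)] a(3,4)] a Ro
    by (simp add: I_rules)
  define Rm where "Rm x y f = \<phi> (Ro x) y (cmp Q (?i x) x y f (e x))" for x y f
  have Rm: "Rm x y f \<in> hom A (Ro x) (Ro y)"
    and eRm: "cmp Q (?i x) (?i y) y (e y) (fmap I (Ro x) (Ro y) (Rm x y f))
      = cmp Q (?i x) x y f (e x)" if "x \<in> ob Q" "y \<in> ob Q" "f \<in> hom Q x y" for x y f
    unfolding Rm_def using that Ro eh[OF that(1)]
    by (simp_all add: \<phi> e\<phi> Q.cat_rules I_rules)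
  define Rf where "Rf = \<lparr>fobj = Ro, fmap = Rm\<rparr>"
  have "is_functor Q A Rf"
    unfolding is_functor_def Rf_def fctr.simps
  proof (intro conjI ballI)
    fix x assume x: "x \<in> ob Q"
    show "Ro x \<in> ob A" by (rule Ro[OF x])
    show "Rm x x (ident Q x) = ident A (Ro x)"
      by (rule eq[OF Ro[OF x] x])
        (use x Ro[OF x] eh[OF x] eRm[OF x x Q.ident_in_hom[OF x]] Rm[OF x x] in
          \<open>simp_all add: A.cat_rules Q.cat_rules I_rules\<close>)
  next
    fix x y f assume a: "x \<in> ob Q" "y \<in> ob Q" "f \<in> hom Q x y"
    then show "Rm x y f \<in> hom A (Ro x) (Ro y)" by (rule Rm)
  next
    fix x y z f g assume a: "x \<in> ob Q" "y \<in> ob Q" "z \<in> ob Q" "f \<in> hom Q x y" "g \<in> hom Q y z"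
    have gf: "cmp Q x y z g f \<in> hom Q x z" using a by (simp add: Q.cat_rules)
    note n = eRm[OF a(1,2,4)] eRm[OF a(2,3,5)] eRm[OF a(1,3) gf]
    note m = a Ro Rm[OF a(1,2,4)] Rm[OF a(2,3,5)] Rm[OF a(1,3) gf] gf eh[OF a(1)] eh[OF a(2)] eh[OF a(3)]
    show "Rm x z (cmp Q x y z g f) = cmp A (Ro x) (Ro y) (Ro z) (Rm y z g) (Rm x y f)"
    proof (rule eq[OF Ro[OF a(1)] a(3)])
      have "cmp Q (?i x) (?i z) z (e z)
          (fmap I (Ro x) (Ro z) (Rm x z (cmp Q x y z g f)))
        = cmp Q (?i x) y z g (cmp Q (?i x) x y f (e x))"
        unfolding n(3) using m by (simp add: I_rules Q.cmp_assoc)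
      also have "\<dots> = cmp Q (?i x) (?i y) z
          (cmp Q (?i y) y z g (e y)) (fmap I (Ro x) (Ro y) (Rm x y f))"
        unfolding n(1)[symmetric] using m by (simp add: I_rules Q.cmp_assoc)
      also have "\<dots> = cmp Q (?i x) (?i z) z (e z)
          (fmap I (Ro x) (Ro z) (cmp A (Ro x) (Ro y) (Ro z) (Rm y z g) (Rm x y f)))"
        unfolding n(2)[symmetric] using m by (simp add: I_rules Q.cmp_assoc)
      finally show "cmp Q (?i x) (?i z) z (e z)
          (fmap I (Ro x) (Ro z) (Rm x z (cmp Q x y z g f))) = \<dots>" .
    qed (use m in \<open>simp_all add: A.cat_rules\<close>)
  qed
  moreover have "bij_betw (\<phi> u x) (hom Q (fobj I u) x) (hom A u (Ro x))"
    if a: "u \<in> ob A" "x \<in> ob Q" for u x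
  proof (rule bij_betw_byWitness[where f' = "\<lambda>g. cmp Q (fobj I u) (?i x) x (e x) (fmap I u (Ro x) g)"])
    have c: "cmp Q (fobj I u) (?i x) x (e x) (fmap I u (Ro x) g) \<in> hom Q (fobj I u) x"
      if "g \<in> hom A u (Ro x)" for g
      using a that Ro eh[OF a(2)] by (simp add: Q.cat_rules I_rules)
    show "\<forall>f\<in>hom Q (fobj I u) x. cmp Q (fobj I u) (?i x) x (e x) (fmap I u (Ro x) (\<phi> u x f)) = f"
      using a e\<phi> by blast
    show "\<forall>g\<in>hom A u (Ro x). \<phi> u x (cmp Q (fobj I u) (?i x) x (e x) (fmap I u (Ro x) g)) = g"
      using eq[OF a \<phi>[OF a c] _ e\<phi>[OF a c]] by blast
    show "\<phi> u x ` hom Q (fobj I u) x \<subseteq> hom A u (Ro x)" using \<phi> a by blast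
    show "(\<lambda>g. cmp Q (fobj I u) (?i x) x (e x) (fmap I u (Ro x) g)) ` hom A u (Ro x)
        \<subseteq> hom Q (fobj I u) x" using c by blast
  qed
  moreover have "\<phi> a' b' (cmp Q (fobj I a') b b' k (cmp Q (fobj I a') (fobj I a) b f (fmap I a' a h))) =
        cmp A a' (Ro b) (Ro b') (Rm b b' k) (cmp A a' a (Ro b) (\<phi> a b f) h)"
    if a: "a' \<in> ob A" "a \<in> ob A" "b \<in> ob Q" "b' \<in> ob Q"
      "h \<in> hom A a' a" "f \<in> hom Q (fobj I a) b" "k \<in> hom Q b b'" for a' a b b' h f k
  proof (rule eq[OF a(1,4)])
    note m = a Ro \<phi>[OF a(2,3,6)] Rm[OF a(3,4,7)] eh[OF a(3)] eh[OF a(4)]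
    let ?f = "cmp Q (fobj I a') b b' k (cmp Q (fobj I a') (fobj I a) b f (fmap I a' a h))"
    have f: "?f \<in> hom Q (fobj I a') b'" using m by (simp add: Q.cat_rules I_rules)
    show "\<phi> a' b' ?f \<in> hom A a' (Ro b')" using \<phi>[OF a(1,4) f] .
    show "cmp A a' (Ro b) (Ro b') (Rm b b' k) (cmp A a' a (Ro b) (\<phi> a b f) h) \<in> hom A a' (Ro b')"
      using m by (simp add: A.cat_rules)
    have "cmp Q (fobj I a') (?i b') b' (e b') (fmap I a' (Ro b') (\<phi> a' b' ?f))
      = cmp Q (fobj I a') b b' k (cmp Q (fobj I a') (fobj I a) b
          (cmp Q (fobj I a) (?i b) b (e b) (fmap I a (Ro b) (\<phi> a b f))) (fmap I a' a h))"
      unfolding e\<phi>[OF a(1,4) f] e\<phi>[OF a(2,3,6)] ..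
    also have "\<dots> = cmp Q (fobj I a') (?i b) b' (cmp Q (?i b) b b' k (e b))
         (cmp Q (fobj I a') (fobj I a) (?i b) (fmap I a (Ro b) (\<phi> a b f)) (fmap I a' a h))"
      using m by (simp add: Q.cat_rules I_rules Q.cmp_assoc)
    also have "\<dots> = cmp Q (fobj I a') (?i b') b' (e b') (fmap I a' (Ro b')
          (cmp A a' (Ro b) (Ro b') (Rm b b' k) (cmp A a' a (Ro b) (\<phi> a b f) h)))"
      unfolding eRm[OF a(3,4,7), symmetric] using m by (simp add: Q.cat_rules A.cat_rules I_rules Q.cmp_assoc)
    finally show "cmp Q (fobj I a') (?i b') b' (e b') (fmap I a' (Ro b') (\<phi> a' b' ?f)) = \<dots>" .
  qed
  ultimately have "adjoint A Q I Rf"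
    unfolding adjoint_def using ff_functor[OF ffI] by (intro conjI exI[of _ \<phi>]) (simp_all add: Rf_def)
  then show ?thesis by blast
qed

lemma left_adjoint_exists:
  assumes "\<And>x. x \<in> ob Q \<Longrightarrow> \<exists>v \<in> ob B. \<exists>e. rinv x (fobj K v) e"
  shows "\<exists>Lf. adjoint Q B Lf K"
proof -
  interpret O: bridge "opp B" "opp A" "opp Q" "opf K" "opf I" by (rule bridge_opp)
  obtain Lf where "adjoint (opp B) (opp Q) (opf K) Lf"
    using O.right_adjoint_exists assms by (auto simp: good_opp)
  then have "adjoint Q B (opf Lf) K"
    using adjoint_opf[OF O.A.category_axioms O.Q.category_axioms] by fastforce
  then show ?thesis ..
qed

text \<open>The counit satisfies \<open>linv\<close> for every adjunction. It differs by an
  isomorphism from the good morphism \<open>e\<close> provided by \<open>U\<close>, and therefore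
  inherits \<open>rinv\<close>.\<close>

lemma counit_good:
  assumes U: "\<And>x. x \<in> ob Q \<Longrightarrow> \<exists>u \<in> ob A. \<exists>e. good (fobj I u) x e"
    and Rf: "adjoint A Q I Rf"
  obtains \<epsilon> where "\<And>x. x \<in> ob Q \<Longrightarrow> good (fobj I (fobj Rf x)) x (\<epsilon> x)"
    "\<And>a b f. a \<in> ob Q \<Longrightarrow> b \<in> ob Q \<Longrightarrow> f \<in> hom Q a b \<Longrightarrow>
       cmp Q (fobj I (fobj Rf a)) (fobj I (fobj Rf b)) b (\<epsilon> b)
         (fmap I (fobj Rf a) (fobj Rf b) (fmap Rf a b f))
       = cmp Q (fobj I (fobj Rf a)) a b f (\<epsilon> a)"
proof -
  note Rr = functor_rules[OF adjoint_functors(2)[OF Rf]]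
  obtain \<epsilon> where \<epsilon>: "\<And>b. b \<in> ob Q \<Longrightarrow> \<epsilon> b \<in> hom Q (fobj I (fobj Rf b)) b"
    and \<epsilon>_bij: "\<And>a b. a \<in> ob A \<Longrightarrow> b \<in> ob Q \<Longrightarrow>
       bij_betw (\<lambda>f. cmp Q (fobj I a) (fobj I (fobj Rf b)) b (\<epsilon> b) (fmap I a (fobj Rf b) f))
         (hom A a (fobj Rf b)) (hom Q (fobj I a) b)"
    and \<epsilon>_nat: "\<And>a b f. a \<in> ob Q \<Longrightarrow> b \<in> ob Q \<Longrightarrow> f \<in> hom Q a b \<Longrightarrow>
       cmp Q (fobj I (fobj Rf a)) (fobj I (fobj Rf b)) b (\<epsilon> b)
         (fmap I (fobj Rf a) (fobj Rf b) (fmap Rf a b f))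
       = cmp Q (fobj I (fobj Rf a)) a b f (\<epsilon> a)"
    by (rule adjoint_counit[OF A.category_axioms Q.category_axioms Rf], rule that) assumption+
  have \<epsilon>_linv: "linv (fobj I (fobj Rf x)) x (\<epsilon> x)" if x: "x \<in> ob Q" for x
    unfolding linv_def
  proof (intro conjI ballI \<epsilon>[OF x])
    fix u assume u: "u \<in> ob A"
    have "bij_betw (cmp Q (fobj I u) (fobj I (fobj Rf x)) x (\<epsilon> x) \<circ> fmap I u (fobj Rf x))
        (hom A u (fobj Rf x)) (hom Q (fobj I u) x)"
      using \<epsilon>_bij[OF u x] by (simp add: o_def)
    then show "bij_betw (cmp Q (fobj I u) (fobj I (fobj Rf x)) x (\<epsilon> x))
        (hom Q (fobj I u) (fobj I (fobj Rf x))) (hom Q (fobj I u) x)"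
      using ffI u Rr(1)[OF x] unfolding fully_faithful_def
      by (subst bij_betw_comp_iff[where f = "fmap I u (fobj Rf x)" and A = "hom A u (fobj Rf x)"]) auto
  qed
  have \<epsilon>_good: "good (fobj I (fobj Rf x)) x (\<epsilon> x)" if x: "x \<in> ob Q" for x
  proof -
    obtain u e where u: "u \<in> ob A" and e: "good (fobj I u) x e" using U[OF x] by blast
    let ?r = "fobj I (fobj Rf x)"
    have o: "fobj Rf x \<in> ob A" using Rr x by blast
    note ob = x u o I_rules(1)[OF u] I_rules(1)[OF o]
    have le: "linv (fobj I u) x e" and re: "rinv (fobj I u) x e" using e by (simp_all add: good_def)
    obtain k where k: "k \<in> hom Q (fobj I u) ?r" "cmp Q (fobj I u) ?r x (\<epsilon> x) k = e"
      by (rule linv_lift[OF \<epsilon>_linv[OF x] u linv_hom[OF le]])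
    obtain k' where k': "k' \<in> hom Q ?r (fobj I u)" "cmp Q ?r (fobj I u) x e k' = \<epsilon> x"
      by (rule linv_lift[OF le o \<epsilon>[OF x]])
    note hm = k k' linv_hom[OF le] \<epsilon>[OF x]
    \<comment> \<open>Only this composite is needed: injectivity below uses
      \<open>\<epsilon> x \<circ> k = e\<close>, surjectivity uses
      \<open>e \<circ> k' = \<epsilon> x\<close> and \<open>k \<circ> k' = id\<close>.\<close>
    have kk: "cmp Q ?r (fobj I u) ?r k k' = ident Q ?r"
      by (rule linv_cancel[OF \<epsilon>_linv[OF x] o]) (use ob hm in \<open>simp_all add: Q.cat_rules Q.cmp_assoc\<close>)
    have "rinv ?r x (\<epsilon> x)" unfolding rinv_def
    proof (intro conjI ballI \<epsilon>[OF x] bij_betw_imageI inj_onI subset_antisym subsetI)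
      fix v f g assume v: "v \<in> ob B" and fg: "f \<in> hom Q x (fobj K v)" "g \<in> hom Q x (fobj K v)"
        and eq: "cmp Q ?r x (fobj K v) f (\<epsilon> x) = cmp Q ?r x (fobj K v) g (\<epsilon> x)"
      have c: "cmp Q (fobj I u) ?r (fobj K v) (cmp Q ?r x (fobj K v) h (\<epsilon> x)) k
          = cmp Q (fobj I u) x (fobj K v) h e" if "h \<in> hom Q x (fobj K v)" for h
        using that ob hm K_rules(1)[OF v] by (simp flip: Q.cmp_assoc)
      show "f = g" by (rule rinv_cancel[OF re v fg]) (use c[OF fg(1)] c[OF fg(2)] eq in simp)
    next
      fix v g assume v: "v \<in> ob B" and g: "g \<in> hom Q ?r (fobj K v)"
      note kv = K_rules(1)[OF v]
      have gk: "cmp Q (fobj I u) ?r (fobj K v) g k \<in> hom Q (fobj I u) (fobj K v)"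
        using g ob hm kv by (simp add: Q.cat_rules)
      obtain h where h: "h \<in> hom Q x (fobj K v)"
        "cmp Q (fobj I u) x (fobj K v) h e = cmp Q (fobj I u) ?r (fobj K v) g k"
        by (rule rinv_lift[OF re v gk])
      have "cmp Q ?r x (fobj K v) h (\<epsilon> x)
          = cmp Q ?r (fobj I u) (fobj K v) (cmp Q (fobj I u) x (fobj K v) h e) k'"
        using h(1) ob hm kv by (simp flip: Q.cmp_assoc)
      also have "\<dots> = g" unfolding h(2) using g kk ob hm kv by (simp add: Q.cat_rules flip: Q.cmp_assoc)
      finally show "g \<in> (\<lambda>f. cmp Q ?r x (fobj K v) f (\<epsilon> x)) ` hom Q x (fobj K v)" using h(1) by blast
    next
      fix v g assume "v \<in> ob B" "g \<in> (\<lambda>f. cmp Q ?r x (fobj K v) f (\<epsilon> x)) ` hom Q x (fobj K v)"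
      then show "g \<in> hom Q ?r (fobj K v)" using ob hm K_rules(1) by (auto simp: Q.cat_rules)
    qed
    with \<epsilon>_linv[OF x] show ?thesis by (simp add: good_def)
  qed
  with \<epsilon>_nat show thesis by (intro that)
qed

lemma unit_good:
  assumes V: "\<And>x. x \<in> ob Q \<Longrightarrow> \<exists>v \<in> ob B. \<exists>e. good x (fobj K v) e"
    and Lf: "adjoint Q B Lf K"
  obtains \<eta> where "\<And>x. x \<in> ob Q \<Longrightarrow> good x (fobj K (fobj Lf x)) (\<eta> x)"
    "\<And>a b f. a \<in> ob Q \<Longrightarrow> b \<in> ob Q \<Longrightarrow> f \<in> hom Q a b \<Longrightarrow>
       cmp Q a (fobj K (fobj Lf a)) (fobj K (fobj Lf b)) (fmap K (fobj Lf a) (fobj Lf b) (fmap Lf a b f)) (\<eta> a)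
       = cmp Q a b (fobj K (fobj Lf b)) (\<eta> b) f"
proof -
  interpret O: bridge "opp B" "opp A" "opp Q" "opf K" "opf I" by (rule bridge_opp)
  note adj = adjoint_opf[OF Q.category_axioms B.category_axioms Lf]
  show thesis
    by (rule O.counit_good[OF _ adj], use V in \<open>simp add: good_opp\<close>, rule that)
      (simp_all add: good_opp)
qed

text \<open>The unit at \<open>I u\<close> and the counit at \<open>K v\<close> are the good natural
  morphisms required by \<open>bridge_quasi_inverse\<close>, whichever adjoints are chosen.\<close>

lemma adjoint_quasi_inverse:
  assumes U: "\<And>x. x \<in> ob Q \<Longrightarrow> \<exists>u \<in> ob A. \<exists>e. good (fobj I u) x e"
    and V: "\<And>x. x \<in> ob Q \<Longrightarrow> \<exists>v \<in> ob B. \<exists>e. good x (fobj K v) e"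
    and Rf: "adjoint A Q I Rf" and Lf: "adjoint Q B Lf K"
  shows "quasi_inverse A B (Lf \<circ>\<^sub>F I) (Rf \<circ>\<^sub>F K)"
proof -
  note fR = adjoint_functors(2)[OF Rf] and fL = adjoint_functors(1)[OF Lf]
  obtain \<epsilon> where \<epsilon>: "\<And>x. x \<in> ob Q \<Longrightarrow> good (fobj I (fobj Rf x)) x (\<epsilon> x)"
    "\<And>a b f. a \<in> ob Q \<Longrightarrow> b \<in> ob Q \<Longrightarrow> f \<in> hom Q a b \<Longrightarrow>
       cmp Q (fobj I (fobj Rf a)) (fobj I (fobj Rf b)) b (\<epsilon> b)
         (fmap I (fobj Rf a) (fobj Rf b) (fmap Rf a b f))
       = cmp Q (fobj I (fobj Rf a)) a b f (\<epsilon> a)"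
    by (rule counit_good[OF U Rf], assumption, rule that) assumption+
  obtain \<eta> where \<eta>: "\<And>x. x \<in> ob Q \<Longrightarrow> good x (fobj K (fobj Lf x)) (\<eta> x)"
    "\<And>a b f. a \<in> ob Q \<Longrightarrow> b \<in> ob Q \<Longrightarrow> f \<in> hom Q a b \<Longrightarrow>
       cmp Q a (fobj K (fobj Lf a)) (fobj K (fobj Lf b)) (fmap K (fobj Lf a) (fobj Lf b) (fmap Lf a b f)) (\<eta> a)
       = cmp Q a b (fobj K (fobj Lf b)) (\<eta> b) f"
    by (rule unit_good[OF V Lf], assumption, rule that) assumption+
  show ?thesis
    by (rule bridge_quasi_inverse[where w = "\<lambda>u. \<eta> (fobj I u)" and v = "\<lambda>v. \<epsilon> (fobj K v)"])
      (simp_all add: is_functor_fcomp[OF ff_functor[OF ffI] fL] is_functor_fcomp[OF ff_functor[OF ffK] fR]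
        \<eta> \<epsilon> I_rules K_rules)
qed

lemma bridge_equivalent:
  assumes U: "\<And>x. x \<in> ob Q \<Longrightarrow> \<exists>u \<in> ob A. \<exists>e. good (fobj I u) x e"
    and V: "\<And>x. x \<in> ob Q \<Longrightarrow> \<exists>v \<in> ob B. \<exists>e. good x (fobj K v) e"
  shows "equivalent A B"
proof -
  obtain Rf Lf where "adjoint A Q I Rf" "adjoint Q B Lf K"
    using right_adjoint_exists left_adjoint_exists U V unfolding good_def by meson
  then show ?thesis using adjoint_quasi_inverse[OF U V] unfolding equivalent_def by blast
qed

end

section \<open>Linear categories\<close>

context linear_category
begin

lemma hom_zero: "\<lbrakk>x \<in> ob C; y \<in> ob C\<rbrakk> \<Longrightarrow> 0 \<in> hom C x y"
  using hom_subspace[of x y] subspace_0 by blast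

lemma hom_add: "\<lbrakk>x \<in> ob C; y \<in> ob C; f \<in> hom C x y; g \<in> hom C x y\<rbrakk> \<Longrightarrow> f + g \<in> hom C x y"
  using hom_subspace[of x y] subspace_add by blast

lemma hom_scale: "\<lbrakk>x \<in> ob C; y \<in> ob C; f \<in> hom C x y\<rbrakk> \<Longrightarrow> scale c f \<in> hom C x y"
  using hom_subspace[of x y] subspace_scale by blast

lemma hom_uminus: "\<lbrakk>x \<in> ob C; y \<in> ob C; f \<in> hom C x y\<rbrakk> \<Longrightarrow> - f \<in> hom C x y"
  using hom_subspace[of x y] subspace_neg by blast

lemma hom_diff: "\<lbrakk>x \<in> ob C; y \<in> ob C; f \<in> hom C x y; g \<in> hom C x y\<rbrakk> \<Longrightarrow> f - g \<in> hom C x y"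
  using hom_subspace[of x y] subspace_diff by blast

lemma cmp_zero_left: "\<lbrakk>x \<in> ob C; y \<in> ob C; z \<in> ob C; f \<in> hom C x y\<rbrakk> \<Longrightarrow> cmp C x y z 0 f = 0"
  using cmp_add_left[of x y z f 0 0] hom_zero[of y z] by simp

lemma cmp_zero_right: "\<lbrakk>x \<in> ob C; y \<in> ob C; z \<in> ob C; g \<in> hom C y z\<rbrakk> \<Longrightarrow> cmp C x y z g 0 = 0"
  using cmp_add_right[of x y z 0 0 g] hom_zero[of x y] by simp

lemma cmp_uminus_left:
  assumes "x \<in> ob C" "y \<in> ob C" "z \<in> ob C" "f \<in> hom C x y" "g \<in> hom C y z"
  shows "cmp C x y z (- g) f = - cmp C x y z g f"
  using cmp_add_left[of x y z f g "- g"] hom_uminus[of y z g] cmp_zero_left[of x y z f] assms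
  by (metis add.right_inverse add_eq_0_iff)

lemma cmp_uminus_right:
  assumes "x \<in> ob C" "y \<in> ob C" "z \<in> ob C" "f \<in> hom C x y" "g \<in> hom C y z"
  shows "cmp C x y z g (- f) = - cmp C x y z g f"
  using cmp_add_right[of x y z f "- f" g] hom_uminus[of x y f] cmp_zero_right[of x y z g] assms
  by (metis add.right_inverse add_eq_0_iff)

lemma cmp_diff_left:
  assumes "x \<in> ob C" "y \<in> ob C" "z \<in> ob C" "f \<in> hom C x y" "g \<in> hom C y z" "g' \<in> hom C y z"
  shows "cmp C x y z (g - g') f = cmp C x y z g f - cmp C x y z g' f"
  using cmp_add_left[of x y z f g "- g'"] hom_uminus[of y z g'] cmp_uminus_left[of x y z f g'] assms
  by simp

lemma cmp_diff_right:
  assumes "x \<in> ob C" "y \<in> ob C" "z \<in> ob C" "f \<in> hom C x y" "f' \<in> hom C x y" "g \<in> hom C y z"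
  shows "cmp C x y z g (f - f') = cmp C x y z g f - cmp C x y z g f'"
  using cmp_add_right[of x y z f "- f'" g] hom_uminus[of x y f'] cmp_uminus_right[of x y z f' g] assms
  by simp

lemmas lin_rules = ident_in_hom cmp_in_hom cmp_ident_left cmp_ident_right
  hom_zero hom_add hom_uminus hom_diff cmp_zero_left cmp_zero_right
  cmp_add_left cmp_add_right cmp_diff_left cmp_diff_right cmp_uminus_left cmp_uminus_right

lemma linear_opp: "linear_category scale (opp C)"
  by unfold_locales
    (simp_all add: lin_rules cmp_assoc hom_subspace cmp_scale_left cmp_scale_right)

end

section \<open>Morphisms factoring through finite sums\<close>

text \<open>\<open>gen C Z\<close> is the class of retracts of finite direct sums of objects from \<open>Z\<close>: that the
  identity lies in \<open>thru C Z\<close> is a form of \<open>y \<in> add Z\<close> that needs neither biproducts nor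
  complements.\<close>

inductive_set thru :: "('o, 'v::ab_group_add) cat \<Rightarrow> 'o set \<Rightarrow> 'o \<Rightarrow> 'o \<Rightarrow> 'v set"
  for C Z x y where
    zero: "0 \<in> thru C Z x y"
  | add: "\<lbrakk>s \<in> thru C Z x y; z \<in> Z; f \<in> hom C x z; g \<in> hom C z y\<rbrakk>
            \<Longrightarrow> s + cmp C x z y g f \<in> thru C Z x y"

definition gen :: "('o, 'v::ab_group_add) cat \<Rightarrow> 'o set \<Rightarrow> 'o set" where
  "gen C Z = {y \<in> ob C. ident C y \<in> thru C Z y y}"

lemma thru_opp [simp]: "thru (opp C) Z x y = thru C Z y x"
proof
  show "thru (opp C) Z x y \<subseteq> thru C Z y x"
  proof
    fix s assume "s \<in> thru (opp C) Z x y"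
    then show "s \<in> thru C Z y x" by induct (auto intro: thru.intros)
  qed
  show "thru C Z y x \<subseteq> thru (opp C) Z x y"
  proof
    fix s assume "s \<in> thru C Z y x"
    then show "s \<in> thru (opp C) Z x y"
    proof induct
      case (add s z f g)
      then show ?case using thru.add[of s "opp C" Z x y z g f] by simp
    qed (auto intro: thru.intros)
  qed
qed

lemma gen_opp [simp]: "gen (opp C) Z = gen C Z"
  by (simp add: gen_def)

lemma gen_ob: "y \<in> gen C Z \<Longrightarrow> y \<in> ob C"
  by (simp add: gen_def)

lemma thru_single: "\<lbrakk>z \<in> Z; f \<in> hom C x z; g \<in> hom C z y\<rbrakk> \<Longrightarrow> cmp C x z y g f \<in> thru C Z x y"
  using thru.add[OF thru.zero] by fastforce

lemma thru_plus:
  assumes "s \<in> thru C Z x y" "s' \<in> thru C Z x y"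
  shows "s + s' \<in> thru C Z x y"
  using assms(2)
proof induct
  case (add s' z f g)
  then show ?case using thru.add[of "s + s'" C Z x y z f g] by (simp add: add.assoc)
qed (simp add: assms)

lemma thru_mono: "\<lbrakk>s \<in> thru C Z x y; Z \<subseteq> Z'\<rbrakk> \<Longrightarrow> s \<in> thru C Z' x y"
  by (induct rule: thru.induct) (auto intro: thru.intros)

lemma gen_mono: "\<lbrakk>y \<in> gen C Z; Z \<subseteq> Z'\<rbrakk> \<Longrightarrow> y \<in> gen C Z'"
  unfolding gen_def using thru_mono by fastforce

context linear_category
begin

lemma thru_hom: "\<lbrakk>s \<in> thru C Z x y; Z \<subseteq> ob C; x \<in> ob C; y \<in> ob C\<rbrakk> \<Longrightarrow> s \<in> hom C x y"
  by (induct rule: thru.induct) (auto simp: lin_rules subset_iff)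

lemma thru_post:
  "\<lbrakk>s \<in> thru C Z x y; h \<in> hom C y w; Z \<subseteq> ob C; x \<in> ob C; y \<in> ob C; w \<in> ob C\<rbrakk>
    \<Longrightarrow> cmp C x y w h s \<in> thru C Z x w"
proof (induct rule: thru.induct)
  case (add s z f g)
  then have "z \<in> ob C" "s \<in> hom C x y" by (auto simp: thru_hom)
  with add have "cmp C x y w h (s + cmp C x z y g f)
      = cmp C x y w h s + cmp C x z w (cmp C z y w h g) f"
    by (simp add: lin_rules cmp_assoc)
  moreover have "cmp C z y w h g \<in> hom C z w" using add \<open>z \<in> ob C\<close> by (simp add: lin_rules)
  ultimately show ?case using add by (simp add: thru.add)
qed (simp add: lin_rules thru.zero)

lemma thru_pre:
  "\<lbrakk>s \<in> thru C Z x y; h \<in> hom C w x; Z \<subseteq> ob C; x \<in> ob C; y \<in> ob C; w \<in> ob C\<rbrakk>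
    \<Longrightarrow> cmp C w x y s h \<in> thru C Z w y"
proof (induct rule: thru.induct)
  case (add s z f g)
  then have "z \<in> ob C" "s \<in> hom C x y" by (auto simp: thru_hom)
  with add have "cmp C w x y (s + cmp C x z y g f) h
      = cmp C w x y s h + cmp C w z y g (cmp C w x z f h)"
    by (simp add: lin_rules cmp_assoc)
  moreover have "cmp C w x z f h \<in> hom C w z" using add \<open>z \<in> ob C\<close> by (simp add: lin_rules)
  ultimately show ?case using add by (simp add: thru.add)
qed (simp add: lin_rules thru.zero)

lemma thru_via_gen:
  assumes "y \<in> gen C Z" "Z \<subseteq> ob C" "x \<in> ob C" "w \<in> ob C" "f \<in> hom C x y" "g \<in> hom C y w"
  shows "cmp C x y w g f \<in> thru C Z x w"
proof -
  have y: "y \<in> ob C" "ident C y \<in> thru C Z y y" using assms by (auto simp: gen_def)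
  have "cmp C x y w (cmp C y y w g (ident C y)) f \<in> thru C Z x w"
    using thru_pre[OF thru_post[OF y(2) assms(6)] assms(5)] assms y by simp
  then show ?thesis using assms y by (simp add: lin_rules)
qed

lemma thru_from_gen:
  "\<lbrakk>y \<in> gen C Z; Z \<subseteq> ob C; w \<in> ob C; g \<in> hom C y w\<rbrakk> \<Longrightarrow> g \<in> thru C Z y w"
  using thru_via_gen[of y Z y w "ident C y" g] gen_ob[of y C Z] by (simp add: lin_rules)

lemma thru_to_gen:
  "\<lbrakk>y \<in> gen C Z; Z \<subseteq> ob C; x \<in> ob C; f \<in> hom C x y\<rbrakk> \<Longrightarrow> f \<in> thru C Z x y"
  using thru_via_gen[of y Z x y f "ident C y"] gen_ob[of y C Z] by (simp add: lin_rules)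

lemma thru_trans:
  "\<lbrakk>s \<in> thru C Z x y; Z \<subseteq> gen C Z'; Z' \<subseteq> ob C; x \<in> ob C; y \<in> ob C\<rbrakk> \<Longrightarrow> s \<in> thru C Z' x y"
proof (induct rule: thru.induct)
  case (add s z f g)
  then have "cmp C x z y g f \<in> thru C Z' x y" by (intro thru_via_gen) auto
  with add show ?case by (simp add: thru_plus)
qed (simp add: thru.zero)

lemma gen_trans: "\<lbrakk>y \<in> gen C Z; Z \<subseteq> gen C Z'; Z' \<subseteq> ob C\<rbrakk> \<Longrightarrow> y \<in> gen C Z'"
  using thru_trans[of "ident C y" Z y y Z'] by (simp add: gen_def)

lemma gen_self: "z \<in> Z \<Longrightarrow> z \<in> ob C \<Longrightarrow> z \<in> gen C Z"
  using thru_single[of z Z "ident C z" C z "ident C z" z] by (simp add: gen_def lin_rules)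

lemma gen_retract:
  assumes "x \<in> gen C Z" "Z \<subseteq> ob C" "y \<in> ob C" "s \<in> hom C y x" "r \<in> hom C x y"
    "cmp C y x y r s = ident C y"
  shows "y \<in> gen C Z"
  using thru_via_gen[OF assms(1,2,3,3,4,5)] assms by (simp add: gen_def)

lemma thru_eq_0:
  assumes "s \<in> thru C Z x y" "Z \<subseteq> ob C" "x \<in> ob C" "y \<in> ob C"
    and "\<And>z f g. \<lbrakk>z \<in> Z; f \<in> hom C x z; g \<in> hom C z y\<rbrakk> \<Longrightarrow> cmp C x z y g f = 0"
  shows "s = 0"
  using assms(1) by induct (use assms in auto)

lemma gen_hom_0:
  assumes "y \<in> gen C Z" "Z \<subseteq> ob C" "w \<in> ob C" "\<And>z. z \<in> Z \<Longrightarrow> hom C z w = {0}" "f \<in> hom C y w"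
  shows "f = 0"
proof (rule thru_eq_0[OF thru_from_gen[OF assms(1,2,3,5)] assms(2) gen_ob[OF assms(1)] assms(3)])
  fix z h g assume "z \<in> Z" "h \<in> hom C y z" "g \<in> hom C z w"
  then show "cmp C y z w g h = 0"
    using assms(2-4) gen_ob[OF assms(1)] cmp_zero_left[of y z w h] by auto
qed

lemma hom_gen_0:
  assumes "y \<in> gen C Z" "Z \<subseteq> ob C" "w \<in> ob C" "\<And>z. z \<in> Z \<Longrightarrow> hom C w z = {0}" "f \<in> hom C w y"
  shows "f = 0"
proof (rule thru_eq_0[OF thru_to_gen[OF assms(1,2,3,5)] assms(2,3) gen_ob[OF assms(1)]])
  fix z h g assume "z \<in> Z" "h \<in> hom C w z" "g \<in> hom C z y"
  then show "cmp C w z y g h = 0"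
    using assms(2-4) gen_ob[OF assms(1)] cmp_zero_right[of w z y g] by auto
qed

text \<open>The identity of \<open>y\<close> is a sum of maps through \<open>Z\<close>, so
  \<open>f\<close> is a sum of terms each containing some \<open>f \<circ> h\<close>.\<close>

lemma gen_test:
  assumes "y \<in> gen C Z" "Z \<subseteq> ob C" "w \<in> ob C" "f \<in> hom C y w"
    "\<And>z h. \<lbrakk>z \<in> Z; h \<in> hom C z y\<rbrakk> \<Longrightarrow> cmp C z y w f h = 0"
  shows "f = 0"
proof -
  have y: "y \<in> ob C" using assms(1) by (rule gen_ob)
  have "cmp C y y w f s = 0" if "s \<in> thru C Z y y" for s
    using that
  proof induct
    case (add s z h g)
    then have "z \<in> ob C" "s \<in> hom C y y" using assms y by (auto simp: thru_hom)
    then show ?case using add assms y by (simp add: lin_rules cmp_assoc)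
  qed (use assms y in \<open>simp add: lin_rules\<close>)
  from this[of "ident C y"] show ?thesis using assms y by (simp add: gen_def lin_rules)
qed

end

section \<open>Exact pairs\<close>

text \<open>\<open>u\<close> is a weak kernel of \<open>v\<close> and \<open>v\<close> a weak
  cokernel of \<open>u\<close>: factorizations exist but need not be unique. Consecutive maps of a
  triangle have this property, and it can be carried along \<open>S\<close>.\<close>

definition wexact :: "('o, 'v::ab_group_add) cat \<Rightarrow> 'o \<Rightarrow> 'o \<Rightarrow> 'o \<Rightarrow> 'v \<Rightarrow> 'v \<Rightarrow> bool" where
  "wexact C x y z u v \<longleftrightarrow> x \<in> ob C \<and> y \<in> ob C \<and> z \<in> ob C \<and> u \<in> hom C x y \<and> v \<in> hom C y z \<and>
     cmp C x y z v u = 0 \<and>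
     (\<forall>w \<in> ob C. \<forall>f \<in> hom C w y. cmp C w y z v f = 0 \<longrightarrow> (\<exists>g \<in> hom C w x. f = cmp C w x y u g)) \<and>
     (\<forall>w \<in> ob C. \<forall>f \<in> hom C y w. cmp C x y w f u = 0 \<longrightarrow> (\<exists>g \<in> hom C z w. f = cmp C y z w g v))"

lemma wexact_opp [simp]: "wexact (opp C) z y x v u \<longleftrightarrow> wexact C x y z u v"
  unfolding wexact_def by auto

lemma wexactD:
  assumes "wexact C x y z u v"
  shows "x \<in> ob C" "y \<in> ob C" "z \<in> ob C" "u \<in> hom C x y" "v \<in> hom C y z" "cmp C x y z v u = 0"
  using assms by (auto simp: wexact_def)

lemma wexact_lift:
  assumes "wexact C x y z u v" "w \<in> ob C" "f \<in> hom C w y" "cmp C w y z v f = 0"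
  obtains g where "g \<in> hom C w x" "f = cmp C w x y u g"
  using assms unfolding wexact_def by blast

lemma wexact_ext:
  assumes "wexact C x y z u v" "w \<in> ob C" "f \<in> hom C y w" "cmp C x y w f u = 0"
  obtains g where "g \<in> hom C z w" "f = cmp C y z w g v"
  using assms unfolding wexact_def by blast

section \<open>Approximations in Hom-finite additive categories\<close>

definition biprod :: "('o, 'v::ab_group_add) cat \<Rightarrow> 'o \<Rightarrow> 'o \<Rightarrow> 'o \<Rightarrow> 'v \<Rightarrow> 'v \<Rightarrow> 'v \<Rightarrow> 'v \<Rightarrow> bool" where
  "biprod C x y p i j r s \<longleftrightarrow> x \<in> ob C \<and> y \<in> ob C \<and> p \<in> ob C \<and>
     i \<in> hom C x p \<and> j \<in> hom C y p \<and> r \<in> hom C p x \<and> s \<in> hom C p y \<and>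
     cmp C x p x r i = ident C x \<and> cmp C y p y s j = ident C y \<and>
     cmp C x p y s i = 0 \<and> cmp C y p x r j = 0 \<and>
     cmp C p x p i r + cmp C p y p j s = ident C p"

lemma biprod_opp [simp]: "biprod (opp C) x y p r s i j \<longleftrightarrow> biprod C x y p i j r s"
  unfolding biprod_def by auto

text \<open>What the opposite category shares with \<open>C\<close>: approximations and strings rest
  on biproducts and finite Hom spaces and involve no suspension.\<close>

locale add_category = linear_category scale C
  for scale :: "'k::field \<Rightarrow> 'v::ab_group_add \<Rightarrow> 'v" and C :: "('o, 'v) cat" +
  assumes zero_object: "\<exists>z \<in> ob C. ident C z = 0"
    and biproducts: "\<lbrakk>x \<in> ob C; y \<in> ob C\<rbrakk> \<Longrightarrow> \<exists>p i j r s. biprod C x y p i j r s"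
    and hom_finite: "hom_finite scale C"
begin

lemma add_category_opp: "add_category scale (opp C)"
proof (intro add_category.intro add_category_axioms.intro linear_opp)
  show "\<exists>z\<in>ob (opp C). ident (opp C) z = 0" using zero_object by simp
  show "\<exists>p i j r s. biprod (opp C) x y p i j r s" if "x \<in> ob (opp C)" "y \<in> ob (opp C)" for x y
    using biproducts[of x y] that biprod_opp by (metis opp_simps(1))
  show "hom_finite scale (opp C)" using hom_finite by (auto simp: hom_finite_def)
qed

text \<open>The last clause makes the approximation economical: \<alpha> is built from members of
  \<open>F\<close> only, so a map that kills all of \<open>F\<close> kills \<alpha>.\<close>

lemma finite_approx:
  assumes "finite F" "F \<subseteq> hom C z x" "x \<in> ob C" "z \<in> ob C"
  shows "\<exists>p \<in> gen C {z}. \<exists>\<alpha> \<in> hom C p x.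
    (\<forall>f \<in> F. \<exists>g \<in> hom C z p. f = cmp C z p x \<alpha> g) \<and>
    (\<forall>y \<in> ob C. \<forall>h \<in> hom C x y. (\<forall>f \<in> F. cmp C z x y h f = 0) \<longrightarrow> cmp C p x y h \<alpha> = 0)"
  using assms(1,2)
proof (induct rule: finite_induct)
  case empty
  obtain n where n: "n \<in> ob C" "ident C n = 0" using zero_object by blast
  then have "n \<in> gen C {z}" by (simp add: gen_def thru.zero)
  moreover have "0 \<in> hom C n x" using n assms by (simp add: lin_rules)
  ultimately show ?case using n assms by (intro bexI[of _ n] bexI[of _ 0]) (auto simp: lin_rules)
next
  case (insert f F)
  then obtain p \<alpha> where p: "p \<in> gen C {z}" and \<alpha>: "\<alpha> \<in> hom C p x"
    and lift: "\<And>f. f \<in> F \<Longrightarrow> \<exists>g \<in> hom C z p. f = cmp C z p x \<alpha> g"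
    and kill: "\<And>y h. y \<in> ob C \<Longrightarrow> h \<in> hom C x y \<Longrightarrow> (\<forall>f \<in> F. cmp C z x y h f = 0) \<Longrightarrow>
      cmp C p x y h \<alpha> = 0"
    by auto
  have po: "p \<in> ob C" using p by (rule gen_ob)
  obtain q i j r s where b: "biprod C p z q i j r s" using biproducts[OF po assms(4)] by blast
  note b' = b[unfolded biprod_def]
  \<comment> \<open>The row \<open>(\<alpha>, f)\<close> on the biproduct of \<open>p\<close> with
    one more copy of \<open>z\<close>.\<close>
  define \<beta> where "\<beta> = cmp C q p x \<alpha> r + cmp C q z x f s"
  have fh: "f \<in> hom C z x" using insert by simp
  have ob: "q \<in> ob C" "z \<in> ob C" "x \<in> ob C" "p \<in> ob C" using b' assms by auto
  have \<beta>: "\<beta> \<in> hom C q x" unfolding \<beta>_def using b' fh \<alpha> ob by (simp add: lin_rules)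
  have "cmp C q p q i r \<in> thru C {z} q q" by (rule thru_via_gen) (use p b' ob in auto)
  moreover have "cmp C q z q j s \<in> thru C {z} q q" by (rule thru_single) (use b' in auto)
  ultimately have "cmp C q p q i r + cmp C q z q j s \<in> thru C {z} q q" by (rule thru_plus)
  then have q: "q \<in> gen C {z}" using b' by (simp add: gen_def)
  have "\<exists>g \<in> hom C z q. f' = cmp C z q x \<beta> g" if f': "f' \<in> insert f F" for f'
  proof (cases "f' = f")
    case True
    have "cmp C z q x \<beta> j = cmp C z q x (cmp C q p x \<alpha> r) j + cmp C z q x (cmp C q z x f s) j"
      unfolding \<beta>_def using b' fh \<alpha> ob by (simp add: lin_rules)
    also have "\<dots> = f" using b' fh \<alpha> ob by (simp add: lin_rules flip: cmp_assoc)
    finally show ?thesis using True b' by blast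
  next
    case False
    then obtain g where g: "g \<in> hom C z p" "f' = cmp C z p x \<alpha> g" using f' lift by blast
    have "cmp C p q x \<beta> i = cmp C p q x (cmp C q p x \<alpha> r) i + cmp C p q x (cmp C q z x f s) i"
      unfolding \<beta>_def using b' fh \<alpha> ob by (simp add: lin_rules)
    also have "\<dots> = \<alpha>" using b' fh \<alpha> ob by (simp add: lin_rules flip: cmp_assoc)
    finally have "f' = cmp C z q x \<beta> (cmp C z p q i g)"
      using g b' \<beta> ob by (simp add: cmp_assoc)
    moreover have "cmp C z p q i g \<in> hom C z q" using g b' ob by (simp add: lin_rules)
    ultimately show ?thesis by blast
  qed
  moreover have "cmp C q x y h \<beta> = 0"
    if y: "y \<in> ob C" "h \<in> hom C x y" "\<forall>f \<in> insert f F. cmp C z x y h f = 0" for y h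
  proof -
    have "cmp C q x y h \<beta> = cmp C q p y (cmp C p x y h \<alpha>) r + cmp C q z y (cmp C z x y h f) s"
      unfolding \<beta>_def using y b' fh \<alpha> ob by (simp add: lin_rules cmp_assoc)
    then show ?thesis using y b' fh \<alpha> ob kill[of y h] by (simp add: lin_rules)
  qed
  ultimately show ?case using q \<beta> by (intro bexI[of _ q] bexI[of _ \<beta>]) auto
qed

text \<open>A basis of \<open>V\<close> is finite by Hom-finiteness, and the maps that lift through
  \<alpha> form a subspace, so lifting the basis lifts all of \<open>V\<close>.\<close>

lemma subspace_approx:
  assumes "subspace V" "V \<subseteq> hom C z x" "x \<in> ob C" "z \<in> ob C"
  obtains p \<alpha> where "p \<in> gen C {z}" "\<alpha> \<in> hom C p x"
    "\<And>f. f \<in> V \<Longrightarrow> \<exists>g \<in> hom C z p. f = cmp C z p x \<alpha> g"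
    "\<And>y h. \<lbrakk>y \<in> ob C; h \<in> hom C x y; \<And>f. f \<in> V \<Longrightarrow> cmp C z x y h f = 0\<rbrakk> \<Longrightarrow> cmp C p x y h \<alpha> = 0"
proof -
  obtain F0 where F0: "finite F0" "span F0 = hom C z x"
    using hom_finite assms unfolding hom_finite_def by blast
  obtain F where F: "F \<subseteq> V" "independent F" "V \<subseteq> span F"
    using maximal_independent_subset by blast
  have "finite F" using independent_span_bound[OF F0(1) F(2)] F(1) assms(2) F0(2) by auto
  then obtain p \<alpha> where p: "p \<in> gen C {z}" and \<alpha>: "\<alpha> \<in> hom C p x"
    and lift: "\<forall>f \<in> F. \<exists>g \<in> hom C z p. f = cmp C z p x \<alpha> g"
    and kill: "\<forall>y \<in> ob C. \<forall>h \<in> hom C x y. (\<forall>f \<in> F. cmp C z x y h f = 0) \<longrightarrow> cmp C p x y h \<alpha> = 0"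
    using finite_approx[of F z x] F(1) assms by blast
  have po: "p \<in> ob C" using p by (rule gen_ob)
  have "subspace {f. \<exists>g \<in> hom C z p. f = cmp C z p x \<alpha> g}" (is "subspace ?S")
  proof (rule subspaceI)
    show "0 \<in> ?S" using po \<alpha> assms by (auto intro!: bexI[of _ 0] simp: lin_rules)
    show "f + g \<in> ?S" if "f \<in> ?S" "g \<in> ?S" for f g
    proof -
      from that obtain f' g' where "f' \<in> hom C z p" "f = cmp C z p x \<alpha> f'"
        "g' \<in> hom C z p" "g = cmp C z p x \<alpha> g'" by blast
      then show ?thesis using po \<alpha> assms by (auto intro!: bexI[of _ "f' + g'"] simp: lin_rules)
    qed
    show "scale c f \<in> ?S" if "f \<in> ?S" for c f
    proof -
      from that obtain f' where "f' \<in> hom C z p" "f = cmp C z p x \<alpha> f'" by blast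
      then show ?thesis using po \<alpha> assms
        by (auto intro!: bexI[of _ "scale c f'"] simp: hom_scale cmp_scale_right)
    qed
  qed
  then have "span F \<subseteq> ?S" using lift by (intro span_minimal) auto
  then have "V \<subseteq> ?S" using F(3) by blast
  with p \<alpha> kill F(1) that show thesis by blast
qed

lemma approx:
  assumes "x \<in> ob C" "z \<in> ob C"
  obtains p \<alpha> where "p \<in> gen C {z}" "\<alpha> \<in> hom C p x"
    "\<And>f. f \<in> hom C z x \<Longrightarrow> \<exists>g \<in> hom C z p. f = cmp C z p x \<alpha> g"
  using subspace_approx[OF hom_subspace[OF assms(2,1)] subset_refl assms] by metis

end

section \<open>Morphisms killed by \<open>Hom(t, -)\<close>\<close>

definition null_on :: "('o, 'v::zero) cat \<Rightarrow> 'o \<Rightarrow> 'o \<Rightarrow> 'o \<Rightarrow> 'v set" where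
  "null_on C t x y = {f \<in> hom C x y. \<forall>h \<in> hom C t x. cmp C t x y f h = 0}"

lemma null_on_hom: "f \<in> null_on C t x y \<Longrightarrow> f \<in> hom C x y"
  by (simp add: null_on_def)

lemma null_on_eq_0: "\<lbrakk>f \<in> null_on C t x y; h \<in> hom C t x\<rbrakk> \<Longrightarrow> cmp C t x y f h = 0"
  by (simp add: null_on_def)

context linear_category
begin

lemma null_on_zero: "\<lbrakk>t \<in> ob C; x \<in> ob C; y \<in> ob C\<rbrakk> \<Longrightarrow> 0 \<in> null_on C t x y"
  by (simp add: null_on_def lin_rules)

lemma null_on_add:
  "\<lbrakk>t \<in> ob C; x \<in> ob C; y \<in> ob C; f \<in> null_on C t x y; g \<in> null_on C t x y\<rbrakk>
    \<Longrightarrow> f + g \<in> null_on C t x y"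
  by (simp add: null_on_def lin_rules)

lemma null_on_diff:
  "\<lbrakk>t \<in> ob C; x \<in> ob C; y \<in> ob C; f \<in> null_on C t x y; g \<in> null_on C t x y\<rbrakk>
    \<Longrightarrow> f - g \<in> null_on C t x y"
  by (simp add: null_on_def lin_rules)

lemma null_on_post:
  "\<lbrakk>t \<in> ob C; x \<in> ob C; y \<in> ob C; z \<in> ob C; f \<in> null_on C t x y; g \<in> hom C y z\<rbrakk>
    \<Longrightarrow> cmp C x y z g f \<in> null_on C t x z"
  unfolding null_on_def by (auto simp: lin_rules simp flip: cmp_assoc)

lemma null_on_pre:
  "\<lbrakk>t \<in> ob C; x \<in> ob C; y \<in> ob C; w \<in> ob C; f \<in> null_on C t x y; g \<in> hom C w x\<rbrakk>
    \<Longrightarrow> cmp C w x y f g \<in> null_on C t w y"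
  unfolding null_on_def by (auto simp: lin_rules simp flip: cmp_assoc)

lemma null_on_gen:
  assumes "f \<in> null_on C t x y" "c \<in> gen C {t}" "g \<in> hom C c x" "t \<in> ob C" "x \<in> ob C" "y \<in> ob C"
  shows "cmp C c x y f g = 0"
proof (rule gen_test[OF assms(2)])
  have f: "f \<in> hom C x y" using assms(1) by (rule null_on_hom)
  show "cmp C c x y f g \<in> hom C c y" using f assms gen_ob[OF assms(2)] by (simp add: lin_rules)
  fix z h assume zh: "z \<in> {t}" "h \<in> hom C z c"
  then have "cmp C z c y (cmp C c x y f g) h = cmp C t x y f (cmp C t c x g h)"
    using f assms gen_ob[OF assms(2)] by (simp add: cmp_assoc)
  also have "\<dots> = 0" using zh assms gen_ob[OF assms(2)] by (intro null_on_eq_0[OF assms(1)]) (auto simp: lin_rules)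
  finally show "cmp C z c y (cmp C c x y f g) h = 0" .
qed (use assms in auto)

end

text \<open>The morphisms that become invertible under \<open>Hom(t, -)\<close> and under \<open>Hom(r, -)\<close> modulo
  \<open>null_on C t\<close>; injectivity in the second case follows from the first.\<close>

definition wequiv :: "('o, 'v::ab_group_add) cat \<Rightarrow> 'o \<Rightarrow> 'o \<Rightarrow> 'o \<Rightarrow> 'o \<Rightarrow> 'v set" where
  "wequiv C t r x y = {w \<in> hom C x y.
     (\<forall>h \<in> hom C t x. cmp C t x y w h = 0 \<longrightarrow> h = 0) \<and>
     (\<forall>h \<in> hom C t y. \<exists>g \<in> hom C t x. h = cmp C t x y w g) \<and>
     (\<forall>h \<in> hom C r y. \<exists>g \<in> hom C r x. h - cmp C r x y w g \<in> null_on C t r y)}"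

section \<open>One side of a mutation\<close>

text \<open>The self-dual part of the setting: it holds in \<open>C\<close> for \<open>Tb\<close>, \<open>R\<close>, \<open>\<Sigma> Tb\<close>, \<open>\<Sigma> R*\<close>, but
  also in \<open>C\<^sup>o\<^sup>p\<close> for \<open>\<Sigma> Tb\<close>, \<open>\<Sigma> R*\<close>, \<open>Tb\<close>, \<open>R\<close> and for the images under the Serre functor.\<close>

locale mutation_pair = add_category scale C
  for scale :: "'k::field \<Rightarrow> 'v::ab_group_add \<Rightarrow> 'v" and C :: "('o, 'v) cat" +
  fixes Tb R P N M :: 'o and \<kappa> \<nu> :: 'v
  assumes obs: "Tb \<in> ob C" "R \<in> ob C" "P \<in> ob C" "N \<in> ob C"
    and exact: "wexact C M R N \<kappa> \<nu>"
    and M: "M \<in> gen C {Tb}"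
    and hom_P: "hom C Tb P = {0}"
    and hom_N: "hom C Tb N = {0}"
begin

abbreviation "NN \<equiv> null_on C Tb"

lemmas ex = wexactD[OF exact]

text \<open>Of a triangle \<open>t1 \<rightarrow> t0 \<rightarrow> U \<rightarrow> \<Sigma>
  t1\<close> only the two exact pairs are kept, and \<open>p\<close> replaces
  \<open>\<Sigma> t1\<close>. Hence images of such a triangle under \<open>S\<close> or in the
  opposite category are covered too.\<close>

definition strung :: "'o \<Rightarrow> bool" where
  "strung U \<longleftrightarrow> (\<exists>t1 t0 p d a b. t1 \<in> gen C {Tb} \<and> t0 \<in> gen C {Tb, R} \<and> p \<in> gen C {P} \<and>
     wexact C t1 t0 U d a \<and> wexact C t0 U p a b)"

lemma strung_ob: "strung U \<Longrightarrow> U \<in> ob C"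
  unfolding strung_def by (auto dest: wexactD)

lemma strungE:
  assumes "strung U"
  obtains t1 t0 p d a b where "t1 \<in> gen C {Tb}" "t0 \<in> gen C {Tb, R}" "p \<in> gen C {P}"
    "wexact C t1 t0 U d a" "wexact C t0 U p a b"
    "\<And>h. h \<in> hom C Tb U \<Longrightarrow> \<exists>g \<in> hom C Tb t0. h = cmp C Tb t0 U a g"
proof -
  obtain t1 t0 p d a b where s: "t1 \<in> gen C {Tb}" "t0 \<in> gen C {Tb, R}" "p \<in> gen C {P}"
    and e: "wexact C t1 t0 U d a" "wexact C t0 U p a b"
    using assms unfolding strung_def by blast
  note e' = wexactD[OF e(1)] wexactD[OF e(2)]
  have "\<exists>g \<in> hom C Tb t0. h = cmp C Tb t0 U a g" if h: "h \<in> hom C Tb U" for h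
  proof -
    have bh: "cmp C Tb U p b h \<in> hom C Tb p" using h e' obs by (simp add: lin_rules)
    have "cmp C Tb U p b h = 0"
      by (rule hom_gen_0[OF s(3) _ _ _ bh]) (use obs hom_P in auto)
    then show ?thesis using wexact_lift[OF e(2) obs(1) h] by metis
  qed
  with s e that show thesis by blast
qed

lemma hom_gen_N: "\<lbrakk>t \<in> gen C {Tb}; f \<in> hom C t N\<rbrakk> \<Longrightarrow> f = 0"
  by (rule gen_hom_0[of t "{Tb}" N f]) (use obs hom_N in auto)

lemma hom_gen_P: "\<lbrakk>t \<in> gen C {Tb}; f \<in> hom C t P\<rbrakk> \<Longrightarrow> f = 0"
  by (rule gen_hom_0[of t "{Tb}" P f]) (use obs hom_P in auto)

text \<open>Restrict \<open>f\<close> along \<open>a : t0 \<rightarrow> U\<close> and split the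
  identity of \<open>t0\<close> into maps through \<open>Tb\<close> and \<open>R\<close>. The parts
  through \<open>Tb\<close> vanish, those through \<open>R\<close> come from maps
  \<open>U \<rightarrow> N \<rightarrow> V\<close>, and what is left of \<open>f\<close> kills
  \<open>a\<close> and so factors through \<open>p\<close>.\<close>

lemma thru_of_null_on:
  assumes U: "strung U" and V: "V \<in> ob C" and f: "f \<in> NN U V"
  shows "f \<in> thru C {P, N} U V"
proof -
  obtain t1 t0 p d a b where t1: "t1 \<in> gen C {Tb}" and t0: "t0 \<in> gen C {Tb, R}" and p: "p \<in> gen C {P}"
    and e1: "wexact C t1 t0 U d a" and e2: "wexact C t0 U p a b"
    using strungE[OF U] by metis
  note e = wexactD[OF e1] wexactD[OF e2]
  have fh: "f \<in> hom C U V" using f by (rule null_on_hom)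
  have PN: "{P, N} \<subseteq> ob C" "{Tb, R} \<subseteq> ob C" using obs by auto
  let ?J = "thru C {P, N} U V"
  have "\<exists>j \<in> ?J. cmp C t0 t0 V (cmp C t0 U V f a) s = cmp C t0 U V j a" if "s \<in> thru C {Tb, R} t0 t0" for s
    using that
  proof induct
    case zero
    then show ?case using fh e V by (intro bexI[of _ 0]) (auto simp: lin_rules thru.zero)
  next
    case (add s z h g)
    then obtain j where j: "j \<in> ?J" "cmp C t0 t0 V (cmp C t0 U V f a) s = cmp C t0 U V j a" by blast
    have jh: "j \<in> hom C U V" using thru_hom[OF j(1)] PN e V by simp
    have sh: "s \<in> hom C t0 t0" using thru_hom[OF add(1)] PN e by simp
    have z: "z \<in> ob C" using add PN by blast
    have split: "cmp C t0 t0 V (cmp C t0 U V f a) (s + cmp C t0 z t0 g h)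
        = cmp C t0 U V j a + cmp C t0 z V (cmp C z U V f (cmp C z t0 U a g)) h"
      using add z sh fh e V j by (simp add: lin_rules cmp_assoc)
    show ?case
    proof (cases "z = Tb")
      case True
      then have "cmp C z U V f (cmp C z t0 U a g) = 0"
        using add e obs by (intro null_on_gen[OF f gen_self]) (auto simp: lin_rules V)
      then show ?thesis using split j add z V e by (auto simp: lin_rules)
    next
      case False
      then have zR: "z = R" using add by blast
      let ?k = "cmp C R U V f (cmp C R t0 U a g)"
      have g: "g \<in> hom C R t0" and h: "h \<in> hom C t0 R" using add zR by auto
      have kh: "?k \<in> hom C R V" using g fh e V obs by (simp add: lin_rules)
      have "cmp C M R V ?k \<kappa> = cmp C M U V f (cmp C M t0 U a (cmp C M R t0 g \<kappa>))"
        using g fh e V obs ex by (simp add: lin_rules cmp_assoc)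
      \<comment> \<open>\<open>M\<close> lies in \<open>add Tb\<close>, where null maps vanish; so
        the restriction of \<open>f\<close> to \<open>R\<close> factors over the weak cokernel
        \<nu>.\<close>
      also have "\<dots> = 0" using g fh e V obs ex by (intro null_on_gen[OF f M]) (auto simp: lin_rules)
      finally obtain m where m: "m \<in> hom C N V" "?k = cmp C R N V m \<nu>"
        using wexact_ext[OF exact V kh] by blast
      have nh: "cmp C t0 R N \<nu> h \<in> hom C t0 N" using h ex e by (simp add: lin_rules)
      have nhd: "cmp C t1 t0 N (cmp C t0 R N \<nu> h) d \<in> hom C t1 N" using nh ex e by (simp add: lin_rules)
      \<comment> \<open>The composite \<open>t1 \<rightarrow> t0 \<rightarrow> N\<close> is a map
        from \<open>add Tb\<close> to \<open>N\<close>, hence zero; this extends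
        \<open>\<nu> \<circ> h\<close> to \<open>U\<close>.\<close>
      obtain l where l: "l \<in> hom C U N" "cmp C t0 R N \<nu> h = cmp C t0 U N l a"
        using wexact_ext[OF e1 obs(4) nh hom_gen_N[OF t1 nhd]] by blast
      have "cmp C t0 R V ?k h = cmp C t0 N V m (cmp C t0 R N \<nu> h)"
        using m h ex e V by (simp add: cmp_assoc)
      also have "\<dots> = cmp C t0 U V (cmp C U N V m l) a" unfolding l(2) using m l ex e V by (simp add: cmp_assoc)
      finally have "cmp C t0 t0 V (cmp C t0 U V f a) (s + cmp C t0 z t0 g h)
          = cmp C t0 U V (j + cmp C U N V m l) a"
        using split zR j jh m l ex e V by (simp add: lin_rules)
      moreover have "j + cmp C U N V m l \<in> ?J" by (rule thru.add) (use j m l in auto)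
      ultimately show ?thesis by blast
    qed
  qed
  from this[of "ident C t0"] t0 obtain j where j: "j \<in> ?J" "cmp C t0 U V f a = cmp C t0 U V j a"
    using fh e V by (auto simp: gen_def lin_rules)
  have jh: "j \<in> hom C U V" using thru_hom[OF j(1)] PN e V by simp
  have "cmp C t0 U V (f - j) a = 0" using j jh fh e V by (simp add: lin_rules)
  then obtain k where k: "k \<in> hom C p V" "f - j = cmp C U p V k b"
    using wexact_ext[OF e2 V, of "f - j"] jh fh e V by (auto simp: lin_rules)
  have "cmp C U p V k b \<in> thru C {P} U V" by (rule thru_via_gen[OF p]) (use k e V obs in auto)
  then have "cmp C U p V k b \<in> ?J" by (rule thru_mono) simp
  then have "j + cmp C U p V k b \<in> ?J" using j by (intro thru_plus)
  then show ?thesis using k(2)[symmetric] by simp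
qed

text \<open>The projection \<pi> kills every map from \<open>Tb\<close>, so it factors through
  \<open>P\<close> and \<open>N\<close>; each map \<open>U \<rightarrow> z\<close> involved vanishes
  on \<open>c\<close> and extends over \<open>E\<close>. This yields \<open>s\<close> with
  \<open>\<pi> = s \<circ> \<pi>\<close>, and \<open>id - s\<close> factors through
  \<open>q\<close>.\<close>

lemma cone_of_approx:
  assumes U: "strung U" and c: "c \<in> gen C {Tb}"
    and m: "\<And>h. h \<in> hom C Tb U \<Longrightarrow> \<exists>g \<in> hom C Tb c. h = cmp C Tb c U m g"
    and e1: "wexact C c U E m \<pi>" and e2: "wexact C U E q \<pi> \<omega>" and q: "q \<in> gen C {P}"
  shows "E \<in> gen C {P, N}"
proof -
  note e = wexactD[OF e1] wexactD[OF e2]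
  have PN: "{P, N} \<subseteq> ob C" using obs by auto
  have "\<pi> \<in> NN U E" unfolding null_on_def
  proof (intro CollectI conjI ballI)
    fix h assume "h \<in> hom C Tb U"
    then obtain g where "g \<in> hom C Tb c" "h = cmp C Tb c U m g" using m by blast
    then show "cmp C Tb U E \<pi> h = 0" using e obs by (simp add: cmp_assoc lin_rules)
  qed (use e in simp)
  then have \<pi>: "\<pi> \<in> thru C {P, N} U E" using thru_of_null_on[OF U] e by simp
  have "\<exists>s' \<in> thru C {P, N} E E. s = cmp C U E E s' \<pi>" if "s \<in> thru C {P, N} U E" for s
    using that
  proof induct
    case zero
    then show ?case using e by (intro bexI[of _ 0]) (auto simp: lin_rules thru.zero)
  next
    case (add s z h g)
    then obtain s' where s': "s' \<in> thru C {P, N} E E" "s = cmp C U E E s' \<pi>" by blast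
    have z: "z \<in> ob C" using add PN by blast
    have "cmp C c U z h m \<in> hom C c z" using add z e by (simp add: lin_rules)
    then have "cmp C c U z h m = 0" using add(3) hom_gen_P[OF c] hom_gen_N[OF c] by auto
    then obtain h' where h': "h' \<in> hom C E z" "h = cmp C U E z h' \<pi>"
      using wexact_ext[OF e1 z add(4)] by blast
    have "s + cmp C U z E g h = cmp C U E E (s' + cmp C E z E g h') \<pi>"
      using s' h' add z e thru_hom[OF s'(1) PN] by (simp add: lin_rules cmp_assoc)
    moreover have "s' + cmp C E z E g h' \<in> thru C {P, N} E E"
      by (rule thru.add) (use s' h' add in auto)
    ultimately show ?case by blast
  qed
  from this[OF \<pi>] obtain s where s: "s \<in> thru C {P, N} E E" "\<pi> = cmp C U E E s \<pi>" by blast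
  have sh: "s \<in> hom C E E" using thru_hom[OF s(1) PN] e by simp
  have "cmp C U E E (ident C E - s) \<pi> = 0" using sh s(2) e by (simp add: lin_rules)
  then obtain k where k: "k \<in> hom C q E" "ident C E - s = cmp C E q E k \<omega>"
    using wexact_ext[OF e2, of E "ident C E - s"] sh e by (auto simp: lin_rules)
  have "cmp C E q E k \<omega> \<in> thru C {P} E E" by (rule thru_via_gen[OF q]) (use k e obs in auto)
  then have "s + cmp C E q E k \<omega> \<in> thru C {P, N} E E"
    using s by (intro thru_plus) (auto intro: thru_mono)
  then show ?thesis using k(2)[symmetric] e by (simp add: gen_def)
qed

section \<open>Morphisms inverted by maps from \<open>Tb\<close> and \<open>R\<close>\<close>

abbreviation "WW \<equiv> wequiv C Tb R"

lemma WW_hom: "w \<in> WW x y \<Longrightarrow> w \<in> hom C x y"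
  by (simp add: wequiv_def)

text \<open>Injectivity at \<open>Tb\<close> alone is used, so the source \<open>u\<close> is
  arbitrary.\<close>

lemma WW_cancel:
  assumes w: "w \<in> WW x y" and xy: "x \<in> ob C" "y \<in> ob C" "u \<in> ob C" and f: "f \<in> hom C u x"
    and wf: "cmp C u x y w f \<in> NN u y"
  shows "f \<in> NN u x"
  unfolding null_on_def
proof (intro CollectI conjI ballI f)
  fix h assume h: "h \<in> hom C Tb u"
  have "cmp C Tb x y w (cmp C Tb u x f h) = 0"
    using null_on_eq_0[OF wf h] h f WW_hom[OF w] xy obs by (simp add: cmp_assoc)
  moreover have "cmp C Tb u x f h \<in> hom C Tb x" using h f xy obs by (simp add: lin_rules)
  ultimately show "cmp C Tb u x f h = 0" using w by (simp add: wequiv_def)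
qed

text \<open>Lift on the summands \<open>Tb\<close> and \<open>R\<close> of \<open>t0\<close> first.
  The resulting \<open>w \<circ> r\<close> agrees with \<open>f \<circ> a\<close> only modulo null
  maps, but null maps vanish on \<open>t1\<close>, so \<open>w \<circ> r \<circ> d\<close> is
  exactly zero. Injectivity at \<open>Tb\<close> gives \<open>r \<circ> d = 0\<close>, and
  \<open>r\<close> descends to \<open>U\<close>.\<close>

lemma WW_lift:
  assumes w: "w \<in> WW x y" and xy: "x \<in> ob C" "y \<in> ob C" and U: "strung U" and f: "f \<in> hom C U y"
  obtains g where "g \<in> hom C U x" "f - cmp C U x y w g \<in> NN U y"
proof -
  obtain t1 t0 p d a b where t1: "t1 \<in> gen C {Tb}" and t0: "t0 \<in> gen C {Tb, R}" and p: "p \<in> gen C {P}"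
    and e1: "wexact C t1 t0 U d a" and e2: "wexact C t0 U p a b"
    and lift: "\<And>h. h \<in> hom C Tb U \<Longrightarrow> \<exists>g \<in> hom C Tb t0. h = cmp C Tb t0 U a g"
    using strungE[OF U] by metis
  note e = wexactD[OF e1] wexactD[OF e2]
  have TR: "{Tb, R} \<subseteq> ob C" using obs by auto
  have wh: "w \<in> hom C x y" using w by (rule WW_hom)
  have lift_z: "\<exists>k \<in> hom C z x. h - cmp C z x y w k \<in> NN z y" if "z \<in> {Tb, R}" "h \<in> hom C z y" for z h
  proof (cases "z = R")
    case True
    then show ?thesis using w that by (auto simp: wequiv_def)
  next
    case False
    then have "z = Tb" using that by blast
    then obtain k where "k \<in> hom C z x" "h = cmp C z x y w k" using w \<open>h \<in> hom C z y\<close> by (auto simp: wequiv_def)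
    then show ?thesis using \<open>z = Tb\<close> xy obs by (intro bexI[of _ k]) (auto simp: null_on_zero)
  qed
  have "\<exists>r \<in> hom C t0 x. cmp C t0 t0 y (cmp C t0 U y f a) s - cmp C t0 x y w r \<in> NN t0 y"
    if "s \<in> thru C {Tb, R} t0 t0" for s
    using that
  proof induct
    case zero
    then show ?case using f wh xy e obs by (intro bexI[of _ 0]) (auto simp: lin_rules null_on_zero)
  next
    case (add s z h g)
    then obtain r where r: "r \<in> hom C t0 x" "cmp C t0 t0 y (cmp C t0 U y f a) s - cmp C t0 x y w r \<in> NN t0 y"
      by blast
    have z: "z \<in> ob C" using add TR by blast
    have sh: "s \<in> hom C t0 t0" using thru_hom[OF add(1)] TR e by simp
    have "cmp C z t0 y (cmp C t0 U y f a) g \<in> hom C z y" using add z f e xy by (simp add: lin_rules)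
    then obtain k where k: "k \<in> hom C z x"
      "cmp C z t0 y (cmp C t0 U y f a) g - cmp C z x y w k \<in> NN z y" using lift_z add(3) by blast
    have "cmp C t0 t0 y (cmp C t0 U y f a) (s + cmp C t0 z t0 g h) - cmp C t0 x y w (r + cmp C t0 z x k h)
      = (cmp C t0 t0 y (cmp C t0 U y f a) s - cmp C t0 x y w r)
        + cmp C t0 z y (cmp C z t0 y (cmp C t0 U y f a) g - cmp C z x y w k) h"
      using add sh r k z f wh xy e by (simp add: lin_rules cmp_assoc)
    moreover have "\<dots> \<in> NN t0 y"
      using add r k z xy e obs by (intro null_on_add null_on_pre) auto
    moreover have "r + cmp C t0 z x k h \<in> hom C t0 x" using add r k z xy e by (simp add: lin_rules)
    ultimately show ?case by metis
  qed
  from this[of "ident C t0"] t0 obtain r where r: "r \<in> hom C t0 x" "cmp C t0 U y f a - cmp C t0 x y w r \<in> NN t0 y"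
    using f e xy by (auto simp: gen_def lin_rules)
  have rd: "cmp C t1 t0 x r d \<in> hom C t1 x" using r e xy by (simp add: lin_rules)
  have "cmp C t1 t0 y (cmp C t0 U y f a - cmp C t0 x y w r) d = 0"
    by (rule null_on_gen[OF r(2) t1]) (use e xy obs in auto)
  moreover have "cmp C t1 t0 y (cmp C t0 U y f a) d = 0"
    using f e xy cmp_assoc[of t1 t0 U y d a f] by (simp add: lin_rules)
  ultimately have wrd: "cmp C t1 x y w (cmp C t1 t0 x r d) = 0"
    using r f wh e xy by (simp add: lin_rules cmp_assoc)
  have "cmp C t1 t0 x r d = 0"
  proof (rule gen_test[OF t1 _ xy(1) rd])
    fix z h assume zh: "z \<in> {Tb}" "h \<in> hom C z t1"
    have "cmp C Tb x y w (cmp C Tb t1 x (cmp C t1 t0 x r d) h)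
        = cmp C Tb t1 y (cmp C t1 x y w (cmp C t1 t0 x r d)) h"
      using zh rd wh e xy obs by (simp add: cmp_assoc)
    then have "cmp C Tb x y w (cmp C Tb t1 x (cmp C t1 t0 x r d) h) = 0"
      using wrd zh e xy obs by (simp add: lin_rules)
    moreover have "cmp C Tb t1 x (cmp C t1 t0 x r d) h \<in> hom C Tb x" using zh rd e xy obs by (simp add: lin_rules)
    ultimately show "cmp C z t1 x (cmp C t1 t0 x r d) h = 0" using w zh by (simp add: wequiv_def)
  qed (use obs in simp)
  then obtain g where g: "g \<in> hom C U x" "r = cmp C t0 U x g a" using wexact_ext[OF e1 xy(1) r(1)] by blast
  have fg: "f - cmp C U x y w g \<in> hom C U y" using f g wh xy e by (simp add: lin_rules)
  have fga: "cmp C t0 U y (f - cmp C U x y w g) a \<in> NN t0 y"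
    using r g f wh xy e by (simp add: lin_rules cmp_assoc)
  \<comment> \<open>Every map \<open>Tb \<rightarrow> U\<close> factors through \<open>a\<close>, so
    it is enough that the composite with \<open>a\<close> is null.\<close>
  have "f - cmp C U x y w g \<in> NN U y" unfolding null_on_def
  proof (intro CollectI conjI ballI fg)
    fix h assume "h \<in> hom C Tb U"
    then obtain k where k: "k \<in> hom C Tb t0" "h = cmp C Tb t0 U a k" using lift by blast
    then have "cmp C Tb U y (f - cmp C U x y w g) h = cmp C Tb t0 y (cmp C t0 U y (f - cmp C U x y w g) a) k"
      using fg e xy obs by (simp add: cmp_assoc)
    also have "\<dots> = 0" by (rule null_on_eq_0[OF fga k(1)])
    finally show "cmp C Tb U y (f - cmp C U x y w g) h = 0" .
  qed
  with g that show thesis by blast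
qed

end

text \<open>The class is a parameter because it has several forms:
  \<open>T \<ast> \<Sigma> Tb\<close> in \<open>C\<close>, and in the opposite category
  \<open>Tb \<ast> \<Sigma> T'\<close> and the class of the lower category.\<close>

locale mutation_class = mutation_pair scale C Tb R P N M \<kappa> \<nu>
  for scale :: "'k::field \<Rightarrow> 'v::ab_group_add \<Rightarrow> 'v" and C :: "('o, 'v) cat" and Tb R P N M \<kappa> \<nu> +
  fixes UU :: "'o set"
  assumes UU_strung: "U \<in> UU \<Longrightarrow> strung U"
    and cones: "\<lbrakk>t1 \<in> gen C {Tb}; t0 \<in> gen C {Tb, R}; d \<in> hom C t1 t0\<rbrakk> \<Longrightarrow>
      \<exists>U \<in> UU. \<exists>p \<in> gen C {P}. \<exists>a b. wexact C t1 t0 U d a \<and> wexact C t0 U p a b"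
begin

text \<open>\<open>U\<close> is presented by an approximation \<open>t0 \<rightarrow> X\<close> from
  \<open>add (Tb \<oplus> R)\<close> and by an approximation of its kernel on
  \<open>Hom(Tb, -)\<close>: the first gives surjectivity of \<open>w\<close>, the second
  injectivity at \<open>Tb\<close>.\<close>

lemma WW_exists:
  assumes X: "X \<in> ob C"
  obtains U w where "U \<in> UU" "w \<in> WW U X"
proof -
  obtain q \<alpha>1 where q: "q \<in> gen C {Tb}" "\<alpha>1 \<in> hom C q X"
    "\<And>f. f \<in> hom C Tb X \<Longrightarrow> \<exists>g \<in> hom C Tb q. f = cmp C Tb q X \<alpha>1 g"
    using approx[OF X obs(1)] by metis
  obtain r \<alpha>2 where r: "r \<in> gen C {R}" "\<alpha>2 \<in> hom C r X"
    "\<And>f. f \<in> hom C R X \<Longrightarrow> \<exists>g \<in> hom C R r. f = cmp C R r X \<alpha>2 g"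
    using approx[OF X obs(2)] by metis
  have qr: "q \<in> ob C" "r \<in> ob C" using q r by (auto dest: gen_ob)
  obtain t0 i j \<rho> \<sigma> where b: "biprod C q r t0 i j \<rho> \<sigma>" using biproducts[OF qr] by blast
  note b' = b[unfolded biprod_def]
  define \<alpha> where "\<alpha> = cmp C t0 q X \<alpha>1 \<rho> + cmp C t0 r X \<alpha>2 \<sigma>"
  have \<alpha>: "\<alpha> \<in> hom C t0 X" unfolding \<alpha>_def using b' q r X by (simp add: lin_rules)
  have \<alpha>i: "cmp C q t0 X \<alpha> i = \<alpha>1" and \<alpha>j: "cmp C r t0 X \<alpha> j = \<alpha>2"
    unfolding \<alpha>_def using b' q r X by (simp_all add: lin_rules flip: cmp_assoc)
  have q': "q \<in> gen C {Tb, R}" and r': "r \<in> gen C {Tb, R}"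
    using gen_mono[OF q(1)] gen_mono[OF r(1)] by auto
  have "cmp C t0 q t0 i \<rho> + cmp C t0 r t0 j \<sigma> \<in> thru C {Tb, R} t0 t0"
    by (intro thru_plus thru_via_gen q' r') (use b' obs in auto)
  then have t0: "t0 \<in> gen C {Tb, R}" using b' by (simp add: gen_def)
  have t0o: "t0 \<in> ob C" using t0 by (rule gen_ob)
  let ?V = "{h \<in> hom C Tb t0. cmp C Tb t0 X \<alpha> h = 0}"
  have "subspace ?V"
    by (rule subspaceI)
      (use \<alpha> t0o X obs in \<open>auto simp: lin_rules hom_scale cmp_scale_right\<close>)
  then obtain t1 d where t1: "t1 \<in> gen C {Tb}" and d: "d \<in> hom C t1 t0"
    and d_lift: "\<And>f. f \<in> ?V \<Longrightarrow> \<exists>g \<in> hom C Tb t1. f = cmp C Tb t1 t0 d g"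
    and d_kill: "\<And>y h. \<lbrakk>y \<in> ob C; h \<in> hom C t0 y; \<And>f. f \<in> ?V \<Longrightarrow> cmp C Tb t0 y h f = 0\<rbrakk>
      \<Longrightarrow> cmp C t1 t0 y h d = 0"
    using subspace_approx[of ?V Tb t0] t0o obs by auto
  obtain U p a b where U: "U \<in> UU" and p: "p \<in> gen C {P}"
    and e1: "wexact C t1 t0 U d a" and e2: "wexact C t0 U p a b"
    using cones[OF t1 t0 d] by blast
  note e = wexactD[OF e1] wexactD[OF e2]
  \<comment> \<open>\<alpha> kills \<open>?V\<close> by definition, hence kills \<open>d\<close> by
    the last clause of \<open>subspace_approx\<close>; thus it extends to the cone.\<close>
  have "cmp C t1 t0 X \<alpha> d = 0" by (rule d_kill[OF X \<alpha>]) simp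
  then obtain w where w: "w \<in> hom C U X" "\<alpha> = cmp C t0 U X w a" using wexact_ext[OF e1 X \<alpha>] by blast
  have surj: "\<exists>g \<in> hom C z U. cmp C z U X w g = h"
    if zh: "z \<in> {Tb, R}" "h \<in> hom C z X" for z h
  proof -
    have z: "z \<in> ob C" using zh obs by auto
    have "\<exists>g \<in> hom C z t0. h = cmp C z t0 X \<alpha> g"
    proof (cases "z = R")
      case True
      then obtain g where g: "g \<in> hom C R r" "h = cmp C R r X \<alpha>2 g"
        using r(3)[of h] zh(2) by blast
      have "h = cmp C R t0 X \<alpha> (cmp C R r t0 j g)"
        unfolding g(2) \<alpha>j[symmetric] using g b' \<alpha> X obs by (simp add: cmp_assoc)
      moreover have "cmp C R r t0 j g \<in> hom C R t0" using g b' obs by (simp add: lin_rules)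
      ultimately show ?thesis using True by blast
    next
      case False
      then have zT: "z = Tb" using zh by blast
      then obtain g where g: "g \<in> hom C Tb q" "h = cmp C Tb q X \<alpha>1 g"
        using q(3)[of h] zh(2) by blast
      have "h = cmp C Tb t0 X \<alpha> (cmp C Tb q t0 i g)"
        unfolding g(2) \<alpha>i[symmetric] using g b' \<alpha> X obs by (simp add: cmp_assoc)
      moreover have "cmp C Tb q t0 i g \<in> hom C Tb t0" using g b' obs by (simp add: lin_rules)
      ultimately show ?thesis using zT by blast
    qed
    then obtain g where g: "g \<in> hom C z t0" "h = cmp C z t0 X \<alpha> g" by blast
    then have "cmp C z U X w (cmp C z t0 U a g) = h" using w e z X by (simp add: cmp_assoc)
    moreover have "cmp C z t0 U a g \<in> hom C z U" using g e z by (simp add: lin_rules)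
    ultimately show ?thesis by blast
  qed
  have lift': "\<exists>g \<in> hom C Tb t0. h = cmp C Tb t0 U a g" if h: "h \<in> hom C Tb U" for h
  proof -
    have bh: "cmp C Tb U p b h \<in> hom C Tb p" using h e obs by (simp add: lin_rules)
    have "cmp C Tb U p b h = 0" by (rule hom_gen_0[OF p _ _ _ bh]) (use obs hom_P in auto)
    then show ?thesis using wexact_lift[OF e2 obs(1) h] by metis
  qed
  have "w \<in> WW U X" unfolding wequiv_def
  proof (intro CollectI conjI ballI impI w(1))
    fix h assume h: "h \<in> hom C Tb U" "cmp C Tb U X w h = 0"
    then obtain g where g: "g \<in> hom C Tb t0" "h = cmp C Tb t0 U a g" using lift' by blast
    have "cmp C Tb t0 X \<alpha> g = 0" using h g w e X obs by (simp add: cmp_assoc)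
    then obtain k where k: "k \<in> hom C Tb t1" "g = cmp C Tb t1 t0 d k" using d_lift[of g] g by auto
    show "h = 0" using g k e obs by (simp add: cmp_assoc lin_rules)
  next
    fix h assume "h \<in> hom C Tb X"
    then show "\<exists>g\<in>hom C Tb U. h = cmp C Tb U X w g" using surj[of Tb h] by fastforce
  next
    fix h assume "h \<in> hom C R X"
    then obtain g where "g \<in> hom C R U" "cmp C R U X w g = h" using surj[of R h] by blast
    then show "\<exists>g\<in>hom C R U. h - cmp C R U X w g \<in> NN R X"
      using X obs by (intro bexI[of _ g]) (auto simp: null_on_zero)
  qed
  with U that show thesis by blast
qed

end

section \<open>Additive autoequivalences\<close>

text \<open>Stated by full faithfulness and essential surjectivity, without a chosen quasi-inverse,
  so that it applies alike to \<open>\<Sigma>\<close>, to its quasi-inverse, to \<open>S\<close> and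
  to composites of these.\<close>

definition autoequiv :: "('o, 'v::ab_group_add) cat \<Rightarrow> ('o, 'v, 'o, 'v) fctr \<Rightarrow> bool" where
  "autoequiv C F \<longleftrightarrow> fully_faithful C C F \<and>
     (\<forall>x \<in> ob C. \<forall>y \<in> ob C. \<forall>f \<in> hom C x y. \<forall>g \<in> hom C x y.
        fmap F x y (f + g) = fmap F x y f + fmap F x y g) \<and>
     (\<forall>y \<in> ob C. \<exists>x \<in> ob C. \<exists>f. is_iso C (fobj F x) y f)"

lemma autoequiv_ff: "autoequiv C F \<Longrightarrow> fully_faithful C C F"
  by (simp add: autoequiv_def)

lemma autoequiv_functor: "autoequiv C F \<Longrightarrow> is_functor C C F"
  by (simp add: autoequiv_def ff_functor)

lemma autoequiv_add:
  "\<lbrakk>autoequiv C F; x \<in> ob C; y \<in> ob C; f \<in> hom C x y; g \<in> hom C x y\<rbrakk>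
    \<Longrightarrow> fmap F x y (f + g) = fmap F x y f + fmap F x y g"
  by (simp add: autoequiv_def)

context linear_category
begin

lemma autoequiv_essential:
  assumes "autoequiv C F" "y \<in> ob C"
  obtains x k k' where "x \<in> ob C" "k \<in> hom C (fobj F x) y" "k' \<in> hom C y (fobj F x)"
    "cmp C (fobj F x) y (fobj F x) k' k = ident C (fobj F x)"
    "cmp C y (fobj F x) y k k' = ident C y"
  using assms unfolding autoequiv_def is_iso_def by metis

lemma autoequiv_zero:
  assumes "autoequiv C F" "x \<in> ob C" "y \<in> ob C"
  shows "fmap F x y 0 = 0"
  using autoequiv_add[OF assms, of 0 0] assms hom_zero[of x y] by simp

lemma autoequiv_uminus:
  assumes "autoequiv C F" "x \<in> ob C" "y \<in> ob C" "f \<in> hom C x y"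
  shows "fmap F x y (- f) = - fmap F x y f"
  using autoequiv_add[OF assms, of "- f"] autoequiv_zero[OF assms(1-3)] assms hom_uminus[of x y f]
  by (simp add: eq_neg_iff_add_eq_0 add.commute)

lemma autoequiv_diff:
  assumes "autoequiv C F" "x \<in> ob C" "y \<in> ob C" "f \<in> hom C x y" "g \<in> hom C x y"
  shows "fmap F x y (f - g) = fmap F x y f - fmap F x y g"
  using autoequiv_add[OF assms(1-4), of "- g"] autoequiv_uminus[OF assms(1-3,5)] assms hom_uminus[of x y g]
  by simp

lemma autoequiv_eq_0:
  assumes "autoequiv C F" "x \<in> ob C" "y \<in> ob C" "f \<in> hom C x y" "fmap F x y f = 0"
  shows "f = 0"
  using ff_inj[OF autoequiv_ff[OF assms(1)] assms(2-4), of 0] assms autoequiv_zero[OF assms(1-3)]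
  by (simp add: hom_zero)

lemma autoequiv_hom_0:
  assumes "autoequiv C F" "x \<in> ob C" "y \<in> ob C"
  shows "hom C (fobj F x) (fobj F y) = {0} \<longleftrightarrow> hom C x y = {0}"
proof -
  have "bij_betw (fmap F x y) (hom C x y) (hom C (fobj F x) (fobj F y))"
    using assms by (auto simp: autoequiv_def fully_faithful_def)
  then have i: "fmap F x y ` hom C x y = hom C (fobj F x) (fobj F y)" by (simp add: bij_betw_def)
  show ?thesis
  proof
    assume "hom C x y = {0}"
    then show "hom C (fobj F x) (fobj F y) = {0}" using i autoequiv_zero[OF assms] by auto
  next
    assume "hom C (fobj F x) (fobj F y) = {0}"
    then have "f = 0" if "f \<in> hom C x y" for f using that i autoequiv_eq_0[OF assms that] by blast
    then show "hom C x y = {0}" using hom_zero[of x y] assms by auto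
  qed
qed

lemma autoequiv_gen:
  assumes F: "autoequiv C F" and y: "y \<in> gen C Z" and Z: "Z \<subseteq> ob C"
  shows "fobj F y \<in> gen C (fobj F ` Z)"
proof -
  note Fr = functor_rules[OF autoequiv_functor[OF F]]
  have yo: "y \<in> ob C" using y by (rule gen_ob)
  have "fmap F y y s \<in> thru C (fobj F ` Z) (fobj F y) (fobj F y)" if "s \<in> thru C Z y y" for s
    using that
  proof induct
    case zero
    then show ?case using autoequiv_zero[OF F yo yo] by (simp add: thru.zero)
  next
    case (add s z f g)
    then have z: "z \<in> ob C" using Z by blast
    have sh: "s \<in> hom C y y" using thru_hom[OF add(1)] Z yo by simp
    have "fmap F y y (s + cmp C y z y g f)
        = fmap F y y s + cmp C (fobj F y) (fobj F z) (fobj F y) (fmap F z y g) (fmap F y z f)"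
      using autoequiv_add[OF F yo yo sh, of "cmp C y z y g f"] add z yo by (simp add: Fr lin_rules)
    then show ?case using add z yo by (simp add: thru.add Fr)
  qed
  from this[of "ident C y"] show ?thesis using y yo by (simp add: gen_def Fr)
qed

text \<open>A test object is isomorphic to some \<open>F w0\<close>; after this replacement fullness
  and faithfulness move the factorization problem back to the pair \<open>u\<close>,
  \<open>v\<close>.\<close>

lemma autoequiv_wexact:
  assumes F: "autoequiv C F" and e: "wexact C x y z u v"
  shows "wexact C (fobj F x) (fobj F y) (fobj F z) (fmap F x y u) (fmap F y z v)"
proof -
  let ?Fx = "fobj F x" and ?Fy = "fobj F y" and ?Fz = "fobj F z"
  note Fr = functor_rules[OF autoequiv_functor[OF F]] and ex = wexactD[OF e]
  show ?thesis unfolding wexact_def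
  proof (intro conjI ballI impI)
    show "cmp C ?Fx ?Fy ?Fz (fmap F y z v) (fmap F x y u) = 0"
      using ex autoequiv_zero[OF F ex(1,3)] by (simp flip: Fr(4))
  next
    fix w f assume w: "w \<in> ob C" and f: "f \<in> hom C w ?Fy"
      and vf: "cmp C w ?Fy ?Fz (fmap F y z v) f = 0"
    obtain w0 k k' where k: "w0 \<in> ob C" "k \<in> hom C (fobj F w0) w" "k' \<in> hom C w (fobj F w0)"
      "cmp C (fobj F w0) w (fobj F w0) k' k = ident C (fobj F w0)"
      "cmp C w (fobj F w0) w k k' = ident C w"
      using autoequiv_essential[OF F w] by metis
    let ?Fw = "fobj F w0"
    note ob = ex w k(1) Fr(1)[OF ex(1)] Fr(1)[OF ex(2)] Fr(1)[OF ex(3)] Fr(1)[OF k(1)]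
    have fk: "cmp C ?Fw w ?Fy f k \<in> hom C ?Fw ?Fy"
      using f k ob by (simp add: lin_rules)
    obtain f0 where f0: "f0 \<in> hom C w0 y" "fmap F w0 y f0 = cmp C ?Fw w ?Fy f k"
      by (rule ff_full[OF autoequiv_ff[OF F] k(1) ex(2) fk])
    have "fmap F w0 z (cmp C w0 y z v f0) = 0"
      using Fr(4)[OF k(1) ex(2,3) f0(1) ex(5)] f0 vf f k ob Fr(2)[OF ex(2,3,5)]
      by (simp add: cmp_assoc lin_rules)
    then have "cmp C w0 y z v f0 = 0"
      using autoequiv_eq_0[OF F k(1) ex(3)] f0 ob by (simp add: lin_rules)
    then obtain g0 where g0: "g0 \<in> hom C w0 x" "f0 = cmp C w0 x y u g0"
      using wexact_lift[OF e k(1) f0(1)] by blast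
    have "f = cmp C w ?Fw ?Fy (cmp C ?Fw w ?Fy f k) k'"
      using f k ob by (simp add: lin_rules flip: cmp_assoc)
    also have "\<dots> = cmp C w ?Fx ?Fy (fmap F x y u)
        (cmp C w ?Fw ?Fx (fmap F w0 x g0) k')"
      unfolding f0(2)[symmetric] g0(2) using g0 k ob Fr(2)[OF k(1) ex(1) g0(1)] Fr(2)[OF ex(1,2,4)]
      by (simp add: Fr(4) cmp_assoc)
    finally show "\<exists>g\<in>hom C w ?Fx. f = cmp C w ?Fx ?Fy (fmap F x y u) g"
      using g0 k ob Fr(2)[OF k(1) ex(1) g0(1)]
      by (intro bexI[of _ "cmp C w ?Fw ?Fx (fmap F w0 x g0) k'"]) (simp_all add: lin_rules)
  next
    fix w f assume w: "w \<in> ob C" and f: "f \<in> hom C ?Fy w"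
      and fu: "cmp C ?Fx ?Fy w f (fmap F x y u) = 0"
    obtain w0 k k' where k: "w0 \<in> ob C" "k \<in> hom C (fobj F w0) w" "k' \<in> hom C w (fobj F w0)"
      "cmp C (fobj F w0) w (fobj F w0) k' k = ident C (fobj F w0)"
      "cmp C w (fobj F w0) w k k' = ident C w"
      using autoequiv_essential[OF F w] by metis
    let ?Fw = "fobj F w0"
    note ob = ex w k(1) Fr(1)[OF ex(1)] Fr(1)[OF ex(2)] Fr(1)[OF ex(3)] Fr(1)[OF k(1)]
    have kf: "cmp C ?Fy w ?Fw k' f \<in> hom C ?Fy ?Fw"
      using f k ob by (simp add: lin_rules)
    obtain f0 where f0: "f0 \<in> hom C y w0" "fmap F y w0 f0 = cmp C ?Fy w ?Fw k' f"
      by (rule ff_full[OF autoequiv_ff[OF F] ex(2) k(1) kf])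
    have "fmap F x w0 (cmp C x y w0 f0 u) = 0"
      using Fr(4)[OF ex(1,2) k(1) ex(4) f0(1)] f0 fu f k ob Fr(2)[OF ex(1,2,4)]
      by (simp add: lin_rules flip: cmp_assoc)
    then have "cmp C x y w0 f0 u = 0"
      using autoequiv_eq_0[OF F ex(1) k(1)] f0 ob by (simp add: lin_rules)
    then obtain g0 where g0: "g0 \<in> hom C z w0" "f0 = cmp C y z w0 g0 v"
      using wexact_ext[OF e k(1) f0(1)] by blast
    have "f = cmp C ?Fy ?Fw w k (cmp C ?Fy w ?Fw k' f)"
      using f k ob by (simp add: lin_rules cmp_assoc)
    also have "\<dots> = cmp C ?Fy ?Fz w (cmp C ?Fz ?Fw w k (fmap F z w0 g0))
        (fmap F y z v)"
      unfolding f0(2)[symmetric] g0(2) using g0 k ob Fr(2)[OF ex(3) k(1) g0(1)] Fr(2)[OF ex(2,3,5)]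
      by (simp add: Fr(4) cmp_assoc)
    finally show "\<exists>g\<in>hom C ?Fz w. f = cmp C ?Fy ?Fz w g (fmap F y z v)"
      using g0 k ob Fr(2)[OF ex(3) k(1) g0(1)]
      by (intro bexI[of _ "cmp C ?Fz ?Fw w k (fmap F z w0 g0)"]) (simp_all add: lin_rules)
  qed (use ex in \<open>simp_all add: Fr\<close>)
qed

lemma autoequiv_fcomp:
  assumes F: "autoequiv C F" and G: "autoequiv C G"
  shows "autoequiv C (G \<circ>\<^sub>F F)"
  unfolding autoequiv_def
proof (intro conjI ballI)
  note Fr = functor_rules[OF autoequiv_functor[OF F]] and Gr = functor_rules[OF autoequiv_functor[OF G]]
  show "fully_faithful C C (G \<circ>\<^sub>F F)" unfolding fully_faithful_def
  proof (intro conjI ballI is_functor_fcomp[OF autoequiv_functor[OF F] autoequiv_functor[OF G]])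
    fix x y assume xy: "x \<in> ob C" "y \<in> ob C"
    have "bij_betw (fmap F x y) (hom C x y) (hom C (fobj F x) (fobj F y))"
      "bij_betw (fmap G (fobj F x) (fobj F y)) (hom C (fobj F x) (fobj F y))
        (hom C (fobj G (fobj F x)) (fobj G (fobj F y)))"
      using autoequiv_ff[OF F] autoequiv_ff[OF G] xy Fr(1) by (simp_all add: fully_faithful_def)
    from bij_betw_trans[OF this]
    show "bij_betw (fmap (G \<circ>\<^sub>F F) x y) (hom C x y) (hom C (fobj (G \<circ>\<^sub>F F) x) (fobj (G \<circ>\<^sub>F F) y))"
      by (simp add: o_def fcomp_def)
  qed
  fix x y f g assume "x \<in> ob C" "y \<in> ob C" "f \<in> hom C x y" "g \<in> hom C x y"
  then show "fmap (G \<circ>\<^sub>F F) x y (f + g) = fmap (G \<circ>\<^sub>F F) x y f + fmap (G \<circ>\<^sub>F F) x y g"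
    using F G by (simp add: autoequiv_add Fr)
next
  note Fr = functor_rules[OF autoequiv_functor[OF F]] and Gr = functor_rules[OF autoequiv_functor[OF G]]
  fix y assume y: "y \<in> ob C"
  obtain x k k' where k: "x \<in> ob C" "k \<in> hom C (fobj G x) y" "k' \<in> hom C y (fobj G x)"
    "cmp C (fobj G x) y (fobj G x) k' k = ident C (fobj G x)" "cmp C y (fobj G x) y k k' = ident C y"
    using autoequiv_essential[OF G y] by metis
  obtain w l l' where l: "w \<in> ob C" "l \<in> hom C (fobj F w) x" "l' \<in> hom C x (fobj F w)"
    "cmp C (fobj F w) x (fobj F w) l' l = ident C (fobj F w)" "cmp C x (fobj F w) x l l' = ident C x"
    using autoequiv_essential[OF F k(1)] by metis
  let ?w = "fobj G (fobj F w)" and ?x = "fobj G x"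
  have ob: "fobj F w \<in> ob C" "?w \<in> ob C" "?x \<in> ob C" using k l Fr(1) Gr(1) by simp_all
  have Gl: "fmap G (fobj F w) x l \<in> hom C ?w ?x" "fmap G x (fobj F w) l' \<in> hom C ?x ?w"
    using l k ob by (simp_all add: Gr)
  have inv: "cmp C ?w ?x ?w (fmap G x (fobj F w) l') (fmap G (fobj F w) x l) = ident C ?w"
    "cmp C ?x ?w ?x (fmap G (fobj F w) x l) (fmap G x (fobj F w) l') = ident C ?x"
    using l k ob by (simp_all add: Gr flip: Gr(4))
  have "is_iso C ?w y (cmp C ?w ?x y k (fmap G (fobj F w) x l))"
  proof (rule is_isoI)
    let ?kl = "cmp C ?w ?x y k (fmap G (fobj F w) x l)"
    let ?lk = "cmp C y ?x ?w (fmap G x (fobj F w) l') k'"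
    show "?kl \<in> hom C ?w y" "?lk \<in> hom C y ?w" using k y ob Gl by (simp_all add: lin_rules)
    have "cmp C ?w y ?w ?lk ?kl
        = cmp C ?w ?x ?w (fmap G x (fobj F w) l') (cmp C ?w ?x ?x (cmp C ?x y ?x k' k) (fmap G (fobj F w) x l))"
      using k(2,3) y ob Gl by (simp add: lin_rules cmp_assoc)
    then show "cmp C ?w y ?w ?lk ?kl = ident C ?w" using k y ob Gl inv by (simp add: lin_rules)
    have "cmp C y ?w y ?kl ?lk
        = cmp C y ?x y k (cmp C y ?x ?x (cmp C ?x ?w ?x (fmap G (fobj F w) x l) (fmap G x (fobj F w) l')) k')"
      using k(2,3) y ob Gl by (simp add: lin_rules cmp_assoc)
    then show "cmp C y ?w y ?kl ?lk = ident C y" using k y ob Gl inv by (simp add: lin_rules)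
  qed
  then show "\<exists>x\<in>ob C. \<exists>f. is_iso C (fobj (G \<circ>\<^sub>F F) x) y f" using l(1) by auto
qed

text \<open>Linearity is given for \<open>F\<close>. By naturality of \<tau> the composite
  \<open>F \<circ> G\<close> is additive on morphisms, and \<open>F\<close> is additive and
  faithful, so \<open>G\<close> is additive.\<close>

lemma quasi_inverse_autoequiv:
  assumes "linear_functor scale C F" "quasi_inverse C C F G"
  shows "autoequiv C F" "autoequiv C G"
proof -
  show F: "autoequiv C F"
    using assms(1) quasi_inverse_ff[OF category_axioms category_axioms assms(2)]
      quasi_inverse_iso[OF category_axioms assms(2)]
    unfolding autoequiv_def linear_functor_def by blast
  have ffG: "fully_faithful C C G"
    by (rule quasi_inverse_ff[OF category_axioms category_axioms quasi_inverse_sym[OF assms(2)]])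
  note Fr = functor_rules[OF autoequiv_functor[OF F]] and Gr = functor_rules[OF ff_functor[OF ffG]]
  obtain \<tau> \<sigma> where t: "\<And>x. x \<in> ob C \<Longrightarrow> \<tau> x \<in> hom C (fobj (F \<circ>\<^sub>F G) x) x"
    "\<And>x. x \<in> ob C \<Longrightarrow> \<sigma> x \<in> hom C x (fobj (F \<circ>\<^sub>F G) x)"
    "\<And>x. x \<in> ob C \<Longrightarrow> cmp C (fobj (F \<circ>\<^sub>F G) x) x (fobj (F \<circ>\<^sub>F G) x) (\<sigma> x) (\<tau> x) = ident C (fobj (F \<circ>\<^sub>F G) x)"
    "\<And>x. x \<in> ob C \<Longrightarrow> cmp C x (fobj (F \<circ>\<^sub>F G) x) x (\<tau> x) (\<sigma> x) = ident C x"
    "\<And>x y f. x \<in> ob C \<Longrightarrow> y \<in> ob C \<Longrightarrow> f \<in> hom C x y \<Longrightarrow>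
        cmp C (fobj (F \<circ>\<^sub>F G) x) (fobj (F \<circ>\<^sub>F G) y) y (\<tau> y) (fmap (F \<circ>\<^sub>F G) x y f)
        = cmp C (fobj (F \<circ>\<^sub>F G) x) x y f (\<tau> x)"
    by (rule nat_isoE[OF category_axioms is_functor_fcomp[OF ff_functor[OF ffG] autoequiv_functor[OF F]]])
      (use assms(2) in \<open>auto simp: quasi_inverse_def\<close>)
  have "fmap G x y (f + g) = fmap G x y f + fmap G x y g"
    if a: "x \<in> ob C" "y \<in> ob C" "f \<in> hom C x y" "g \<in> hom C x y" for x y f g
  proof -
    let ?x = "fobj F (fobj G x)" and ?y = "fobj F (fobj G y)"
    have ob: "fobj G x \<in> ob C" "fobj G y \<in> ob C" "?x \<in> ob C" "?y \<in> ob C" using a Fr(1) Gr(1) by simp_all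
    have tm: "\<tau> y \<in> hom C ?y y" "\<tau> x \<in> hom C ?x x" "\<sigma> y \<in> hom C y ?y" using t(1,2) a by simp_all
    have Gh: "fmap G x y h \<in> hom C (fobj G x) (fobj G y)" if "h \<in> hom C x y" for h
      using that a by (simp add: Gr)
    have Fh: "fmap F (fobj G x) (fobj G y) h \<in> hom C ?x ?y" if "h \<in> hom C (fobj G x) (fobj G y)" for h
      using that ob by (simp add: Fr)
    have fg: "f + g \<in> hom C x y" using a by (simp add: lin_rules)
    have c: "h = h'" if "h \<in> hom C ?x ?y" "h' \<in> hom C ?x ?y" "cmp C ?x ?y y (\<tau> y) h = cmp C ?x ?y y (\<tau> y) h'" for h h'
    proof -
      have "cmp C ?x y ?y (\<sigma> y) (cmp C ?x ?y y (\<tau> y) k) = k" if "k \<in> hom C ?x ?y" for k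
        using that ob a tm t(3)[OF a(2)] cmp_assoc[of ?x ?y y ?y k "\<tau> y" "\<sigma> y"] by (simp add: lin_rules)
      then show ?thesis using that by metis
    qed
    have "fmap F (fobj G x) (fobj G y) (fmap G x y (f + g))
        = fmap F (fobj G x) (fobj G y) (fmap G x y f) + fmap F (fobj G x) (fobj G y) (fmap G x y g)"
      by (rule c) (use t(5)[OF a(1,2,3)] t(5)[OF a(1,2,4)] t(5)[OF a(1,2) fg] Fh[OF Gh[OF fg]] Fh[OF Gh[OF a(3)]]
        Fh[OF Gh[OF a(4)]] ob a tm in
        \<open>simp_all add: lin_rules\<close>)
    also have "\<dots> = fmap F (fobj G x) (fobj G y) (fmap G x y f + fmap G x y g)"
      using autoequiv_add[OF F ob(1,2) Gh[OF a(3)] Gh[OF a(4)]] by simp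
    finally show ?thesis
      using ff_inj[OF autoequiv_ff[OF F] ob(1,2) Gh[OF fg]] Gh[OF a(3)] Gh[OF a(4)] ob by (simp add: lin_rules)
  qed
  moreover have "\<forall>y \<in> ob C. \<exists>x \<in> ob C. \<exists>f. is_iso C (fobj G x) y f"
    using quasi_inverse_iso[OF category_axioms quasi_inverse_sym[OF assms(2)]] by blast
  ultimately show "autoequiv C G" using ffG by (simp add: autoequiv_def)
qed

section \<open>Retracts and biproducts under autoequivalences\<close>

lemma gen_iso:
  assumes "x \<in> ob C" "y \<in> ob C" "f \<in> hom C x y" "g \<in> hom C y x" "cmp C x y x g f = ident C x"
  shows "x \<in> gen C {y}"
  using gen_retract[of y "{y}" x f g] gen_self[of y "{y}"] assms by simp

lemma biprod_gen:
  assumes "biprod C x y p i j r s"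
  shows "gen C {p} = gen C {x, y}"
proof -
  note b = assms[unfolded biprod_def]
  have "cmp C p x p i r + cmp C p y p j s \<in> thru C {x, y} p p"
    by (intro thru_plus thru_single) (use b in auto)
  then have p: "p \<in> gen C {x, y}" using b by (simp add: gen_def)
  have "x \<in> gen C {p}" "y \<in> gen C {p}" using b by (auto intro: gen_iso)
  then show ?thesis
    using p gen_trans[of _ "{p}" "{x, y}"] gen_trans[of _ "{x, y}" "{p}"] b by auto
qed

lemma biprod_autoequiv:
  assumes F: "autoequiv C F" and b: "biprod C x y p i j r s"
  shows "biprod C (fobj F x) (fobj F y) (fobj F p) (fmap F x p i) (fmap F y p j) (fmap F p x r) (fmap F p y s)"
proof -
  note Fr = functor_rules[OF autoequiv_functor[OF F]] and b' = b[unfolded biprod_def]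
  have "fmap F p p (cmp C p x p i r + cmp C p y p j s)
      = fmap F p p (cmp C p x p i r) + fmap F p p (cmp C p y p j s)"
    using b' by (intro autoequiv_add[OF F]) (auto simp: lin_rules)
  then have "cmp C (fobj F p) (fobj F x) (fobj F p) (fmap F x p i) (fmap F p x r) +
    cmp C (fobj F p) (fobj F y) (fobj F p) (fmap F y p j) (fmap F p y s) = ident C (fobj F p)"
    using b' by (simp add: Fr)
  moreover have "cmp C (fobj F x) (fobj F p) (fobj F y) (fmap F p y s) (fmap F x p i) = 0"
    "cmp C (fobj F y) (fobj F p) (fobj F x) (fmap F p x r) (fmap F y p j) = 0"
    using b' autoequiv_zero[OF F] by (simp_all flip: Fr(4))
  moreover have "cmp C (fobj F x) (fobj F p) (fobj F x) (fmap F p x r) (fmap F x p i) = ident C (fobj F x)"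
    "cmp C (fobj F y) (fobj F p) (fobj F y) (fmap F p y s) (fmap F y p j) = ident C (fobj F y)"
    using b' by (simp_all add: Fr(1-3) flip: Fr(4))
  ultimately show ?thesis using b' by (simp add: biprod_def Fr)
qed

end

section \<open>Triangulated categories\<close>

context linear_category
begin

lemma cmp_sum_left:
  assumes "x \<in> ob C" "y \<in> ob C" "z \<in> ob C" "f \<in> hom C x y" "\<And>k. k \<in> A \<Longrightarrow> g k \<in> hom C y z"
  shows "(\<Sum>k\<in>A. g k) \<in> hom C y z \<and> cmp C x y z (\<Sum>k\<in>A. g k) f = (\<Sum>k\<in>A. cmp C x y z (g k) f)"
  using assms(5)
proof (induct A rule: infinite_finite_induct)
  case (insert k A)
  then show ?case using assms(1-4) by (simp add: lin_rules)
qed (use assms(1-4) in \<open>simp_all add: lin_rules\<close>)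

lemma cmp_sum_right:
  assumes "x \<in> ob C" "y \<in> ob C" "z \<in> ob C" "g \<in> hom C y z" "\<And>k. k \<in> A \<Longrightarrow> f k \<in> hom C x y"
  shows "(\<Sum>k\<in>A. f k) \<in> hom C x y \<and> cmp C x y z g (\<Sum>k\<in>A. f k) = (\<Sum>k\<in>A. cmp C x y z g (f k))"
  using assms(5)
proof (induct A rule: infinite_finite_induct)
  case (insert k A)
  then show ?case using assms(1-4) by (simp add: lin_rules)
qed (use assms(1-4) in \<open>simp_all add: lin_rules\<close>)

lemma direct_sum_pair: "is_direct_sum C [x, y] p \<longleftrightarrow> (\<exists>i j r s. biprod C x y p i j r s)"
proof
  assume "is_direct_sum C [x, y] p"
  then obtain \<iota> \<pi> where o: "x \<in> ob C" "y \<in> ob C" "p \<in> ob C" and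
    h: "\<forall>i < length [x, y]. \<iota> i \<in> hom C ([x, y] ! i) p \<and> \<pi> i \<in> hom C p ([x, y] ! i)" and
    c: "\<forall>i < length [x, y]. \<forall>j < length [x, y].
        cmp C ([x, y] ! i) p ([x, y] ! j) (\<pi> j) (\<iota> i) = (if i = j then ident C ([x, y] ! i) else 0)" and
    s: "(\<Sum>i < length [x, y]. cmp C p ([x, y] ! i) p (\<iota> i) (\<pi> i)) = ident C p"
    unfolding is_direct_sum_def by auto
  have "biprod C x y p (\<iota> 0) (\<iota> 1) (\<pi> 0) (\<pi> 1)"
    unfolding biprod_def
    using o h[rule_format, of 0] h[rule_format, of 1] s
      c[rule_format, of 0 0] c[rule_format, of 0 1] c[rule_format, of 1 0] c[rule_format, of 1 1]
    by (simp add: numeral_2_eq_2 lessThan_Suc add.commute)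
  then show "\<exists>i j r s. biprod C x y p i j r s" by blast
next
  assume "\<exists>i j r s. biprod C x y p i j r s"
  then obtain i j r s where b: "biprod C x y p i j r s" by blast
  note b' = b[unfolded biprod_def]
  show "is_direct_sum C [x, y] p"
    unfolding is_direct_sum_def
    by (intro conjI exI[of _ "\<lambda>k. if k = 0 then i else j"] exI[of _ "\<lambda>k. if k = 0 then r else s"])
      (use b' in \<open>auto simp: less_2_cases_iff numeral_2_eq_2 lessThan_Suc add.commute less_Suc_eq\<close>)
qed

lemma is_zero_obj_iff: "is_zero_obj C z \<longleftrightarrow> z \<in> ob C \<and> ident C z = 0"
  by (auto simp: is_direct_sum_def)

lemma direct_sum_gen:
  assumes p: "is_direct_sum C (replicate n x) p" and x: "x \<in> ob C"
  shows "p \<in> gen C {x}"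
proof -
  obtain \<iota> \<pi> where po: "p \<in> ob C" and h: "\<forall>i < n. \<iota> i \<in> hom C x p \<and> \<pi> i \<in> hom C p x"
    and s: "(\<Sum>i < n. cmp C p x p (\<iota> i) (\<pi> i)) = ident C p"
    using p unfolding is_direct_sum_def by auto
  have "(\<Sum>i < m. cmp C p x p (\<iota> i) (\<pi> i)) \<in> thru C {x} p p" if "m \<le> n" for m
    using that
  proof (induct m)
    case (Suc m)
    then show ?case using thru.add[of "\<Sum>i<m. cmp C p x p (\<iota> i) (\<pi> i)" C "{x}" p p x "\<pi> m" "\<iota> m"] h
      by simp
  qed (simp add: thru.zero)
  from this[of n] show ?thesis using s po by (simp add: gen_def)
qed

lemma thru_as_sum:
  assumes "s \<in> thru C {x} y w" "x \<in> ob C" "y \<in> ob C" "w \<in> ob C"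
  shows "\<exists>(n::nat) f g. (\<forall>k<n. f k \<in> hom C y x \<and> g k \<in> hom C x w) \<and> s = (\<Sum>k<n. cmp C y x w (g k) (f k))"
  using assms(1)
proof induct
  case zero
  show ?case by (intro exI[of _ 0]) simp
next
  case (add s z f g)
  then obtain n :: nat and f' g' where *: "\<forall>k<n. f' k \<in> hom C y x \<and> g' k \<in> hom C x w"
    "s = (\<Sum>k<n. cmp C y x w (g' k) (f' k))" by blast
  show ?case
    by (intro exI[of _ "Suc n"] exI[of _ "f'(n := f)"] exI[of _ "g'(n := g)"])
      (use * add in \<open>auto simp: less_Suc_eq intro!: sum.cong\<close>)
qed

end

section \<open>Exact pairs from triangles; direct summands from retracts\<close>

context triangulated_category
begin

lemma susp: "autoequiv C \<Sigma>" and susp_inv: "autoequiv C \<Sigma>i"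
  using quasi_inverse_autoequiv[OF susp_linear susp_equivalence] by simp_all

lemmas S_rules = functor_rules[OF autoequiv_functor[OF susp]]
lemmas Si_rules = functor_rules[OF autoequiv_functor[OF susp_inv]]

lemma zero_ob: obtains z where "z \<in> ob C" "ident C z = 0" "is_zero_obj C z"
  using direct_sums[of "[]"] is_zero_obj_iff by auto

lemma susp_iso:
  assumes "x \<in> ob C"
  obtains f g where "f \<in> hom C (fobj \<Sigma> (fobj \<Sigma>i x)) x" "g \<in> hom C x (fobj \<Sigma> (fobj \<Sigma>i x))"
    "cmp C (fobj \<Sigma> (fobj \<Sigma>i x)) x (fobj \<Sigma> (fobj \<Sigma>i x)) g f = ident C (fobj \<Sigma> (fobj \<Sigma>i x))"
    "cmp C x (fobj \<Sigma> (fobj \<Sigma>i x)) x f g = ident C x"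
  using quasi_inverse_iso(2)[OF category_axioms susp_equivalence assms] unfolding is_iso_def by metis

lemma susp_inv_iso:
  assumes "x \<in> ob C"
  obtains f g where "f \<in> hom C (fobj \<Sigma>i (fobj \<Sigma> x)) x" "g \<in> hom C x (fobj \<Sigma>i (fobj \<Sigma> x))"
    "cmp C (fobj \<Sigma>i (fobj \<Sigma> x)) x (fobj \<Sigma>i (fobj \<Sigma> x)) g f = ident C (fobj \<Sigma>i (fobj \<Sigma> x))"
    "cmp C x (fobj \<Sigma>i (fobj \<Sigma> x)) x f g = ident C x"
  using quasi_inverse_iso(2)[OF category_axioms quasi_inverse_sym[OF susp_equivalence] assms]
  unfolding is_iso_def by metis

lemma triD:
  assumes "(x, y, z, u, v, w) \<in> \<Delta>"
  shows "x \<in> ob C" "y \<in> ob C" "z \<in> ob C" "u \<in> hom C x y" "v \<in> hom C y z" "w \<in> hom C z (fobj \<Sigma> x)"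
    "fobj \<Sigma> x \<in> ob C" "fobj \<Sigma> y \<in> ob C"
  using tri_in[OF assms] S_rules(1) by auto

lemma tri_rot: "(x, y, z, u, v, w) \<in> \<Delta> \<Longrightarrow> (y, z, fobj \<Sigma> x, v, w, - fmap \<Sigma> x y u) \<in> \<Delta>"
  using tri_rotate[of x y z u v w] tri_in[of x y z u v w] by blast

text \<open>Each clause completes a partial morphism between the given triangle and a trivial
  triangle, possibly after rotation.\<close>

lemma tri_wexact:
  assumes t: "(x, y, z, u, v, w) \<in> \<Delta>"
  shows "wexact C x y z u v"
proof -
  note d = triD[OF t]
  obtain zo where zo: "zo \<in> ob C" "ident C zo = 0" "is_zero_obj C zo" using zero_ob by metis
  have so: "fobj \<Sigma> zo \<in> ob C" "is_zero_obj C (fobj \<Sigma> zo)"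
    using zo S_rules(1,3)[OF zo(1)] autoequiv_zero[OF susp zo(1,1)] by (simp_all add: is_zero_obj_iff)
  show ?thesis unfolding wexact_def
  proof (intro conjI ballI impI d(1-5))
    have "\<exists>c\<in>hom C zo z. cmp C x zo z c 0 = cmp C x y z v u \<and>
        cmp C zo (fobj \<Sigma> x) (fobj \<Sigma> x) (fmap \<Sigma> x x (ident C x)) 0 = cmp C zo z (fobj \<Sigma> x) w c"
      by (rule tri_morphism[OF tri_ident[OF d(1) zo(3)] t]) (use d zo in \<open>simp_all add: lin_rules\<close>)
    then show "cmp C x y z v u = 0" using d zo by (auto simp: lin_rules)
  next
    fix q f assume q: "q \<in> ob C" and f: "f \<in> hom C q y" and vf: "cmp C q y z v f = 0"
    have "\<exists>c\<in>hom C (fobj \<Sigma> q) (fobj \<Sigma> x). cmp C zo (fobj \<Sigma> q) (fobj \<Sigma> x) c 0 = cmp C zo z (fobj \<Sigma> x) w 0 \<and>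
        cmp C (fobj \<Sigma> q) (fobj \<Sigma> q) (fobj \<Sigma> y) (fmap \<Sigma> q y f) (- fmap \<Sigma> q q (ident C q))
          = cmp C (fobj \<Sigma> q) (fobj \<Sigma> x) (fobj \<Sigma> y) (- fmap \<Sigma> x y u) c"
      by (rule tri_morphism[OF tri_rot[OF tri_ident[OF q zo(3)]] tri_rot[OF t] f])
        (use d zo q f vf in \<open>simp_all add: lin_rules\<close>)
    then obtain c where c: "c \<in> hom C (fobj \<Sigma> q) (fobj \<Sigma> x)"
      "cmp C (fobj \<Sigma> q) (fobj \<Sigma> q) (fobj \<Sigma> y) (fmap \<Sigma> q y f) (- ident C (fobj \<Sigma> q))
          = cmp C (fobj \<Sigma> q) (fobj \<Sigma> x) (fobj \<Sigma> y) (- fmap \<Sigma> x y u) c"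
      using q S_rules(3) by auto
    obtain g where g: "g \<in> hom C q x" "fmap \<Sigma> q x g = c"
      by (rule ff_full[OF autoequiv_ff[OF susp] q d(1) c(1)])
    have "fmap \<Sigma> q y f = cmp C (fobj \<Sigma> q) (fobj \<Sigma> x) (fobj \<Sigma> y) (fmap \<Sigma> x y u) c"
      using c d q f by (simp add: lin_rules S_rules(1,2))
    then have "fmap \<Sigma> q y f = fmap \<Sigma> q y (cmp C q x y u g)" using g d q by (simp add: S_rules)
    then have "f = cmp C q x y u g"
      using ff_inj[OF autoequiv_ff[OF susp] q d(2) f] g d q by (simp add: lin_rules)
    then show "\<exists>g\<in>hom C q x. f = cmp C q x y u g" using g by blast
  next
    fix q f assume q: "q \<in> ob C" and f: "f \<in> hom C y q" and fu: "cmp C x y q f u = 0"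
    \<comment> \<open>The trivial triangle \<open>q = q \<rightarrow> 0\<close> is rotated back to
      \<open>0 \<rightarrow> q = q\<close>; for this the zero object in third place has to be a
      suspension.\<close>
    have "(q, q, fobj \<Sigma> zo, ident C q, 0, 0) \<in> \<Delta>" by (rule tri_ident[OF q so(2)])
    then have "(q, q, fobj \<Sigma> zo, ident C q, 0, - fmap \<Sigma> zo q 0) \<in> \<Delta>"
      using autoequiv_zero[OF susp zo(1) q] by simp
    then have t2: "(zo, q, q, 0, ident C q, 0) \<in> \<Delta>"
      using tri_rotate[of zo q q 0 "ident C q" 0] zo q so by (simp add: lin_rules)
    have "\<exists>c\<in>hom C z q. cmp C y z q c v = cmp C y q q (ident C q) f \<and>
        cmp C z (fobj \<Sigma> x) (fobj \<Sigma> zo) (fmap \<Sigma> x zo 0) w = cmp C z q (fobj \<Sigma> zo) 0 c"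
      by (rule tri_morphism[OF t t2 _ f]) (use d zo q fu in \<open>simp_all add: lin_rules\<close>)
    then show "\<exists>g\<in>hom C z q. f = cmp C y z q g v" using q f d by (auto simp: lin_rules)
  qed
qed

lemma tri_wexact': "(x, y, z, u, v, w) \<in> \<Delta> \<Longrightarrow> wexact C y z (fobj \<Sigma> x) v w"
  by (rule tri_wexact[OF tri_rot])

text \<open>Removes the sign that rotation introduces.\<close>

lemma wexact_minus_right:
  assumes "wexact C x y z u v"
  shows "wexact C x y z u (- v)"
proof -
  note e = wexactD[OF assms]
  show ?thesis unfolding wexact_def
  proof (intro conjI ballI impI)
    fix w f assume a: "w \<in> ob C" "f \<in> hom C w y" "cmp C w y z (- v) f = 0"
    then have "cmp C w y z v f = 0" using e by (simp add: lin_rules)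
    then show "\<exists>g\<in>hom C w x. f = cmp C w x y u g" using wexact_lift[OF assms a(1,2)] by metis
  next
    fix w f assume a: "w \<in> ob C" "f \<in> hom C y w" "cmp C x y w f u = 0"
    obtain g where g: "g \<in> hom C z w" "f = cmp C y z w g v" by (rule wexact_ext[OF assms a])
    then show "\<exists>g\<in>hom C z w. f = cmp C y z w g (- v)"
      using e a by (intro bexI[of _ "- g"]) (simp_all add: lin_rules)
  qed (use e in \<open>simp_all add: lin_rules\<close>)
qed

lemma tri_wexact'':
  assumes t: "(x, y, z, u, v, w) \<in> \<Delta>"
  shows "wexact C z (fobj \<Sigma> x) (fobj \<Sigma> y) w (fmap \<Sigma> x y u)"
  using wexact_minus_right[OF tri_wexact[OF tri_rot[OF tri_rot[OF t]]]] by simp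

lemma tri_replace_third:
  assumes t: "(x, y, z, u, v, w) \<in> \<Delta>" and z': "z' \<in> ob C" and c: "c \<in> hom C z z'" "c' \<in> hom C z' z"
    "cmp C z z' z c' c = ident C z" "cmp C z' z z' c c' = ident C z'"
  shows "(x, y, z', u, cmp C y z z' c v, cmp C z' z (fobj \<Sigma> x) w c') \<in> \<Delta>"
proof (rule tri_iso[OF t])
  note d = triD[OF t]
  show "is_iso C x x (ident C x)" "is_iso C y y (ident C y)"
    using d is_isoI[of "ident C x" C x x "ident C x"] is_isoI[of "ident C y" C y y "ident C y"]
    by (simp_all add: lin_rules)
  show "is_iso C z z' c" using c by (intro is_isoI)
  have "cmp C z z' (fobj \<Sigma> x) (cmp C z' z (fobj \<Sigma> x) w c') c = w"
    using c d z' by (simp add: lin_rules flip: cmp_assoc)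
  then show "cmp C z (fobj \<Sigma> x) (fobj \<Sigma> x) (fmap \<Sigma> x x (ident C x)) w =
    cmp C z z' (fobj \<Sigma> x) (cmp C z' z (fobj \<Sigma> x) w c') c"
    using d by (simp add: lin_rules S_rules(3))
qed (use triD[OF t] c z' in \<open>simp_all add: lin_rules\<close>)

text \<open>A triangle can be rotated back only when its third object is a suspension, so
  \<open>z\<close> is replaced by the isomorphic \<open>\<Sigma> (\<Sigma>i z)\<close>; the sign of
  the rotation is absorbed into \<open>d\<close>.\<close>

lemma tri_unrotate:
  assumes t: "(x, y, z, u, v, w) \<in> \<Delta>"
  obtains d w' where "(fobj \<Sigma>i z, x, y, d, u, w') \<in> \<Delta>"
proof -
  note e = triD[OF t]
  let ?s = "fobj \<Sigma>i z" and ?z = "fobj \<Sigma> (fobj \<Sigma>i z)"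
  have o: "?s \<in> ob C" "?z \<in> ob C" using e S_rules(1) Si_rules(1) by auto
  obtain c c' where c: "c' \<in> hom C ?z z" "c \<in> hom C z ?z"
    "cmp C ?z z ?z c c' = ident C ?z" "cmp C z ?z z c' c = ident C z" using susp_iso[OF e(3)] by metis
  have t': "(x, y, ?z, u, cmp C y z ?z c v, cmp C ?z z (fobj \<Sigma> x) w c') \<in> \<Delta>"
    by (rule tri_replace_third[OF t o(2) c(2,1,4,3)])
  have wc: "- cmp C ?z z (fobj \<Sigma> x) w c' \<in> hom C ?z (fobj \<Sigma> x)" using e o c by (simp add: lin_rules)
  obtain d where d: "d \<in> hom C ?s x" "fmap \<Sigma> ?s x d = - cmp C ?z z (fobj \<Sigma> x) w c'"
    by (rule ff_full[OF autoequiv_ff[OF susp] o(1) e(1) wc])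
  have "(?s, x, y, d, u, cmp C y z ?z c v) \<in> \<Delta>"
    using tri_rotate[of ?s x y d u "cmp C y z ?z c v"] t' d e o c by (simp add: lin_rules)
  then show thesis using that by blast
qed

text \<open>Complete \<open>w\<close> to a triangle
  \<open>z \<rightarrow> \<Sigma> x \<rightarrow> q\<close> and rotate back twice; the two signs are
  absorbed into \<open>u\<close> and \<open>v\<close>.\<close>

lemma tri_from_third:
  assumes "z \<in> ob C" "x \<in> ob C" "w \<in> hom C z (fobj \<Sigma> x)"
  obtains y u v where "(x, y, z, u, v, w) \<in> \<Delta>"
proof -
  have sx: "fobj \<Sigma> x \<in> ob C" using assms S_rules(1) by simp
  obtain q g h where t: "(z, fobj \<Sigma> x, q, w, g, h) \<in> \<Delta>" using tri_exists[OF assms(1) sx assms(3)] by metis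
  note e = triD[OF t]
  let ?y = "fobj \<Sigma>i q" and ?q = "fobj \<Sigma> (fobj \<Sigma>i q)"
  have o: "?y \<in> ob C" "?q \<in> ob C" using e S_rules(1) Si_rules(1) by auto
  obtain c c' where c: "c' \<in> hom C ?q q" "c \<in> hom C q ?q"
    "cmp C ?q q ?q c c' = ident C ?q" "cmp C q ?q q c' c = ident C q" using susp_iso[OF e(3)] by metis
  let ?g = "cmp C (fobj \<Sigma> x) q ?q c g" and ?h = "cmp C ?q q (fobj \<Sigma> z) h c'"
  have t': "(z, fobj \<Sigma> x, ?q, w, ?g, ?h) \<in> \<Delta>"
    by (rule tri_replace_third[OF t o(2) c(2,1,4,3)])
  have gh: "- ?g \<in> hom C (fobj \<Sigma> x) ?q" "- ?h \<in> hom C ?q (fobj \<Sigma> z)" using e o c by (simp_all add: lin_rules)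
  obtain u where u: "u \<in> hom C x ?y" "fmap \<Sigma> x ?y u = - ?g"
    by (rule ff_full[OF autoequiv_ff[OF susp] assms(2) o(1) gh(1)])
  obtain v where v: "v \<in> hom C ?y z" "fmap \<Sigma> ?y z v = - ?h"
    by (rule ff_full[OF autoequiv_ff[OF susp] o(1) assms(1) gh(2)])
  have "(?y, z, fobj \<Sigma> x, v, w, - fmap \<Sigma> x ?y u) \<in> \<Delta>"
    using tri_rotate[of ?y z "fobj \<Sigma> x" v w "?g"] t' u v e o c assms sx by (simp add: lin_rules)
  then have "(x, ?y, z, u, v, w) \<in> \<Delta>" using tri_rotate[of x ?y z u v w] u v o assms by simp
  then show thesis using that by blast
qed

text \<open>In the triangle on the split monomorphism \<open>s\<close> the third map is zero because
  \<open>\<Sigma> s\<close> is split again. So \<open>v\<close> has a section, and the cone is the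
  complement.\<close>

lemma retract_summand:
  assumes "y \<in> ob C" "p \<in> ob C" "s \<in> hom C y p" "r \<in> hom C p y" "cmp C y p y r s = ident C y"
  obtains y' where "is_direct_sum C [y, y'] p"
proof -
  obtain z v w where t: "(y, p, z, s, v, w) \<in> \<Delta>" using tri_exists[OF assms(1-3)] by metis
  note d = triD[OF t]
  note e1 = tri_wexact[OF t] and e2 = tri_wexact'[OF t] and e3 = tri_wexact''[OF t]
  have Sr: "cmp C (fobj \<Sigma> y) (fobj \<Sigma> p) (fobj \<Sigma> y) (fmap \<Sigma> p y r) (fmap \<Sigma> y p s) = ident C (fobj \<Sigma> y)"
    using assms S_rules(3,4) by (metis (no_types, lifting))
  have "w = cmp C z (fobj \<Sigma> y) (fobj \<Sigma> y)
      (cmp C (fobj \<Sigma> y) (fobj \<Sigma> p) (fobj \<Sigma> y) (fmap \<Sigma> p y r) (fmap \<Sigma> y p s)) w"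
    unfolding Sr using d by (simp add: lin_rules)
  also have "\<dots> = 0"
    using d assms wexactD(6)[OF e3] by (simp add: lin_rules S_rules(1,2) flip: cmp_assoc)
  finally have w: "w = 0" .
  obtain t where t: "t \<in> hom C z p" "ident C z = cmp C z p z v t"
    by (rule wexact_lift[OF e2 d(3) ident_in_hom[OF d(3)]]) (use w d in \<open>simp_all add: lin_rules\<close>)
  have vs: "cmp C y p z v s = 0" using wexactD(6)[OF e1] .
  let ?f = "ident C p - cmp C p y p s r"
  have f: "?f \<in> hom C p p" using assms by (simp add: lin_rules)
  \<comment> \<open>The injection of the complement is not the section \<open>t\<close> but the map
    \<open>k\<close> with \<open>k \<circ> v = id - s \<circ> r\<close>, which is compatible with
    the given retraction; \<open>t\<close> serves to cancel \<open>v\<close>.\<close>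
  obtain k where k: "k \<in> hom C z p" "?f = cmp C p z p k v"
    by (rule wexact_ext[OF e1 assms(2) f])
      (use assms in \<open>simp_all add: lin_rules flip: cmp_assoc\<close>)
  have cancel: "h = h'" if "q \<in> ob C" "h \<in> hom C z q" "h' \<in> hom C z q"
    "cmp C p z q h v = cmp C p z q h' v" for h h' q
  proof -
    have "h = cmp C z p q (cmp C p z q h v) t" "h' = cmp C z p q (cmp C p z q h' v) t"
      using that(1-3) t(1) d by (simp_all add: lin_rules flip: cmp_assoc t(2))
    then show ?thesis using that(4) by simp
  qed
  have "cmp C z p z v k = ident C z"
  proof (rule cancel[OF d(3)])
    have "cmp C p z z (cmp C z p z v k) v = cmp C p p z v ?f"
      unfolding k(2) using k d by (simp add: cmp_assoc)
    also have "\<dots> = v" using assms d vs by (simp add: lin_rules cmp_assoc)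
    finally show "cmp C p z z (cmp C z p z v k) v = cmp C p z z (ident C z) v" using d by (simp add: lin_rules)
  qed (use k d in \<open>simp_all add: lin_rules\<close>)
  moreover have "cmp C z p y r k = 0"
  proof (rule cancel[OF assms(1)])
    have "cmp C p z y (cmp C z p y r k) v = cmp C p p y r ?f"
      unfolding k(2) using k d assms by (simp add: cmp_assoc)
    also have "\<dots> = 0" using assms d by (simp add: lin_rules cmp_assoc)
    finally show "cmp C p z y (cmp C z p y r k) v = cmp C p z y 0 v" using d assms by (simp add: lin_rules)
  qed (use k d assms in \<open>simp_all add: lin_rules\<close>)
  moreover have "cmp C p y p s r + cmp C p z p k v = ident C p" unfolding k(2)[symmetric] by simp
  ultimately have "biprod C y z p s k r v" unfolding biprod_def using assms d k vs by simp
  then show thesis using that direct_sum_pair by blast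
qed

text \<open>The identity of \<open>y\<close> is a sum of \<open>n\<close> maps through
  \<open>x\<close>; their components exhibit \<open>y\<close> as a retract of \<open>n\<close>
  copies of \<open>x\<close>, and \<open>retract_summand\<close> supplies the complement that
  \<open>add_cat\<close> demands.\<close>

lemma add_cat_gen:
  assumes x: "x \<in> ob C"
  shows "add_cat C x = gen C {x}"
proof (intro subset_antisym subsetI)
  fix y assume "y \<in> add_cat C x"
  then obtain n p y' where p: "is_direct_sum C (replicate n x) p" and "is_direct_sum C [y, y'] p"
    unfolding add_cat_def by blast
  then obtain i j r s where b: "biprod C y y' p i j r s" using direct_sum_pair by blast
  then have "y \<in> gen C {p}" using biprod_gen[OF b] gen_self[of y "{y, y'}"] by (simp add: biprod_def)
  then show "y \<in> gen C {x}" using gen_trans[of y "{p}" "{x}"] direct_sum_gen[OF p x] x by simp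
next
  fix y assume y: "y \<in> gen C {x}"
  then have yo: "y \<in> ob C" by (rule gen_ob)
  obtain n :: nat and f g where fg: "\<And>k. k < n \<Longrightarrow> f k \<in> hom C y x \<and> g k \<in> hom C x y"
    and id: "ident C y = (\<Sum>k<n. cmp C y x y (g k) (f k))"
    using thru_as_sum[of "ident C y" x y y] y yo x by (auto simp: gen_def)
  have "set (replicate n x) \<subseteq> ob C" using x by auto
  then obtain p where p: "is_direct_sum C (replicate n x) p" using direct_sums by blast
  then obtain \<iota> \<pi> where po: "p \<in> ob C" and h0: "\<forall>i<n. \<iota> i \<in> hom C x p \<and> \<pi> i \<in> hom C p x"
    and c0: "\<forall>i<n. \<forall>j<n. cmp C x p x (\<pi> j) (\<iota> i) = (if i = j then ident C (replicate n x ! i) else 0)"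
    unfolding is_direct_sum_def by auto
  have h: "\<iota> i \<in> hom C x p \<and> \<pi> i \<in> hom C p x" if "i < n" for i using h0 that by blast
  have c: "cmp C x p x (\<pi> j) (\<iota> i) = (if i = j then ident C x else 0)" if "i < n" "j < n" for i j
    using c0 that by simp
  define \<alpha> where "\<alpha> = (\<Sum>k<n. cmp C y x p (\<iota> k) (f k))"
  define \<beta> where "\<beta> = (\<Sum>k<n. cmp C p x y (g k) (\<pi> k))"
  have a: "cmp C y x p (\<iota> k) (f k) \<in> hom C y p" if "k \<in> {..<n}" for k
    using that h fg x yo po by (simp add: lin_rules)
  have b: "cmp C p x y (g k) (\<pi> k) \<in> hom C p y" if "k \<in> {..<n}" for k
    using that h fg x yo po by (simp add: lin_rules)
  have \<alpha>: "\<alpha> \<in> hom C y p"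
    unfolding \<alpha>_def using cmp_sum_right[of y p p "ident C p" "{..<n}" "\<lambda>k. cmp C y x p (\<iota> k) (f k)"] a yo po
    by (simp add: lin_rules)
  have \<beta>: "\<beta> \<in> hom C p y"
    unfolding \<beta>_def using cmp_sum_left[of p p y "ident C p" "{..<n}" "\<lambda>k. cmp C p x y (g k) (\<pi> k)"] b yo po
    by (simp add: lin_rules)
  have "cmp C y p y \<beta> \<alpha> = (\<Sum>k<n. cmp C y p y (cmp C p x y (g k) (\<pi> k)) \<alpha>)"
    unfolding \<beta>_def using cmp_sum_left[of y p y \<alpha> "{..<n}" "\<lambda>k. cmp C p x y (g k) (\<pi> k)"] b \<alpha> yo po by simp
  also have "\<dots> = (\<Sum>k<n. cmp C y x y (g k) (f k))"
  proof (rule sum.cong[OF refl])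
    fix k assume k: "k \<in> {..<n}"
    have "cmp C y p y (cmp C p x y (g k) (\<pi> k)) \<alpha>
        = (\<Sum>l<n. cmp C y p y (cmp C p x y (g k) (\<pi> k)) (cmp C y x p (\<iota> l) (f l)))"
      unfolding \<alpha>_def using cmp_sum_right[of y p y _ "{..<n}" "\<lambda>l. cmp C y x p (\<iota> l) (f l)"] a b[OF k] yo po by simp
    also have "\<dots> = (\<Sum>l<n. if l = k then cmp C y x y (g k) (f k) else 0)"
    proof (rule sum.cong[OF refl])
      fix l assume l: "l \<in> {..<n}"
      have "cmp C y p y (cmp C p x y (g k) (\<pi> k)) (cmp C y x p (\<iota> l) (f l))
          = cmp C y x y (g k) (cmp C y x x (cmp C x p x (\<pi> k) (\<iota> l)) (f l))"
        using k l h fg x yo po by (simp add: lin_rules cmp_assoc)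
      then show "cmp C y p y (cmp C p x y (g k) (\<pi> k)) (cmp C y x p (\<iota> l) (f l))
          = (if l = k then cmp C y x y (g k) (f k) else 0)"
        using k l c[of l k] fg x yo po by (simp add: lin_rules)
    qed
    also have "\<dots> = cmp C y x y (g k) (f k)" using k by simp
    finally show "cmp C y p y (cmp C p x y (g k) (\<pi> k)) \<alpha> = cmp C y x y (g k) (f k)" .
  qed
  finally have "cmp C y p y \<beta> \<alpha> = ident C y" using id by simp
  then obtain y' where "is_direct_sum C [y, y'] p" using retract_summand[OF yo po \<alpha> \<beta>] by metis
  then show "y \<in> add_cat C x" unfolding add_cat_def using p by blast
qed

lemma add_category: "hom_finite scale C \<Longrightarrow> add_category scale C"
proof (intro add_category.intro add_category_axioms.intro linear_category_axioms)
  show "\<exists>z\<in>ob C. ident C z = 0" using zero_ob by metis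
  show "\<exists>p i j r s. biprod C x y p i j r s" if "x \<in> ob C" "y \<in> ob C" for x y
    using direct_sums[of "[x, y]"] direct_sum_pair that by auto
qed

end

section \<open>Serre duality\<close>

lemma (in vector_space) separating_functional:
  assumes "subspace I" "s \<notin> I"
  obtains \<phi> :: "'b \<Rightarrow> 'a" where "\<And>x y. \<phi> (x + y) = \<phi> x + \<phi> y" "\<And>c x. \<phi> (scale c x) = c * \<phi> x"
    "\<And>i. i \<in> I \<Longrightarrow> \<phi> i = 0" "\<phi> s = 1"
proof -
  interpret P: vector_space_pair scale "(*) :: 'a \<Rightarrow> 'a \<Rightarrow> 'a"
    by unfold_locales (simp_all add: algebra_simps)
  obtain B where B: "B \<subseteq> I" "independent B" "I \<subseteq> span B"
    using maximal_independent_subset by blast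
  have sB: "s \<notin> span B" using assms span_minimal[OF B(1) assms(1)] by blast
  then have "independent (insert s B)" using B(2) by (simp add: independent_insert)
  from P.linear_independent_extend[OF this, of "\<lambda>x. if x = s then 1 else 0"]
  obtain \<phi> where \<phi>: "Vector_Spaces.linear scale (*) \<phi>"
    "\<forall>x\<in>insert s B. \<phi> x = (if x = s then 1 else 0)" by blast
  interpret L: Vector_Spaces.linear scale "(*)" \<phi> by (rule \<phi>(1))
  have "\<phi> x = 0" if "x \<in> B" for x using \<phi>(2) that sB span_base by auto
  then have "\<phi> i = 0" if "i \<in> I" for i
    using L.eq_0_on_span[of B i] B(3) that by blast
  then show thesis using \<phi>(2) L.add L.scale by (intro that[of \<phi>]) simp_all
qed

text \<open>Composition is linear only on Hom spaces, hence linearity is assumed on \<open>V\<close>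
  alone.\<close>

lemma (in vector_space) subspace_image_on:
  assumes "subspace V" "\<And>a b. \<lbrakk>a \<in> V; b \<in> V\<rbrakk> \<Longrightarrow> f (a + b) = f a + f b"
    "\<And>c a. a \<in> V \<Longrightarrow> f (scale c a) = scale c (f a)"
  shows "subspace (f ` V)"
proof (rule subspaceI)
  have z: "0 \<in> V" using assms(1) by (rule subspace_0)
  have "f 0 = 0" using assms(2)[OF z z] by simp
  then show "0 \<in> f ` V" using z by (metis imageI)
  show "x + y \<in> f ` V" if "x \<in> f ` V" "y \<in> f ` V" for x y
    using that assms(2) subspace_add[OF assms(1)] by (metis (no_types, lifting) image_iff)
  show "scale c x \<in> f ` V" if "x \<in> f ` V" for c x
    using that assms(3) subspace_scale[OF assms(1)] by (metis (no_types, lifting) image_iff)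
qed

lemma (in vector_space) subspace_vimage_on:
  assumes "subspace V" "subspace W" "\<And>a b. \<lbrakk>a \<in> V; b \<in> V\<rbrakk> \<Longrightarrow> f (a + b) = f a + f b"
    "\<And>c a. a \<in> V \<Longrightarrow> f (scale c a) = scale c (f a)"
  shows "subspace {a \<in> V. f a \<in> W}"
proof (rule subspaceI)
  have z: "0 \<in> V" using assms(1) by (rule subspace_0)
  have "f 0 = 0" using assms(3)[OF z z] by simp
  then show "0 \<in> {a \<in> V. f a \<in> W}" using z subspace_0[OF assms(2)] by simp
qed (use assms in \<open>auto simp: subspace_add subspace_scale\<close>)

section \<open>The Serre pairing\<close>

locale serre_category = linear_category scale C
  for scale :: "'k::field \<Rightarrow> 'v::ab_group_add \<Rightarrow> 'v" and C :: "('o, 'v) cat" +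
  fixes S :: "('o, 'v, 'o, 'v) fctr"
  assumes serre: "serre_functor scale C S"
begin

lemma S_linear: "linear_functor scale C S"
  using serre unfolding serre_functor_def by (elim conjE)

lemma S: "autoequiv C S"
proof -
  have "\<exists>S'. quasi_inverse C C S S'" using serre unfolding serre_functor_def by (elim conjE)
  then show ?thesis using quasi_inverse_autoequiv(1)[OF S_linear] by blast
qed

lemmas Sr = functor_rules[OF autoequiv_functor[OF S]]

lemma S_scale: "\<lbrakk>x \<in> ob C; y \<in> ob C; f \<in> hom C x y\<rbrakk> \<Longrightarrow> fmap S x y (scale c f) = scale c (fmap S x y f)"
  using S_linear unfolding linear_functor_def by blast

text \<open>The natural isomorphism of the Serre functor, fixed once and read as a bilinear form on
  \<open>Hom(x, y)\<close> and \<open>Hom(y, S x)\<close>.\<close>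

definition pair :: "'o \<Rightarrow> 'o \<Rightarrow> 'v \<Rightarrow> 'v \<Rightarrow> 'k" where
  "pair = (SOME \<eta>.
       (\<forall>x \<in> ob C. \<forall>y \<in> ob C.
          bij_betw (\<eta> x y) (hom C x y) (dual_space scale (hom C y (fobj S x))) \<and>
          (\<forall>f \<in> hom C x y. \<forall>f' \<in> hom C x y. \<forall>g. \<eta> x y (f + f') g = \<eta> x y f g + \<eta> x y f' g) \<and>
          (\<forall>c. \<forall>f \<in> hom C x y. \<forall>g. \<eta> x y (scale c f) g = c * \<eta> x y f g)) \<and>
       (\<forall>x' \<in> ob C. \<forall>x \<in> ob C. \<forall>y \<in> ob C.
          \<forall>a \<in> hom C x' x. \<forall>f \<in> hom C x y. \<forall>g \<in> hom C y (fobj S x').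
          \<eta> x' y (cmp C x' x y f a) g =
          \<eta> x y f (cmp C y (fobj S x') (fobj S x) (fmap S x' x a) g)) \<and>
       (\<forall>x \<in> ob C. \<forall>y \<in> ob C. \<forall>y' \<in> ob C.
          \<forall>b \<in> hom C y y'. \<forall>f \<in> hom C x y. \<forall>g \<in> hom C y' (fobj S x).
          \<eta> x y' (cmp C x y y' b f) g = \<eta> x y f (cmp C y y' (fobj S x) g b)))"

lemma pair_props:
  shows pair_bij: "\<lbrakk>x \<in> ob C; y \<in> ob C\<rbrakk> \<Longrightarrow>
      bij_betw (pair x y) (hom C x y) (dual_space scale (hom C y (fobj S x)))"
    and pair_add: "\<lbrakk>x \<in> ob C; y \<in> ob C; f \<in> hom C x y; f' \<in> hom C x y\<rbrakk> \<Longrightarrow>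
      pair x y (f + f') g = pair x y f g + pair x y f' g"
    and pair_scale: "\<lbrakk>x \<in> ob C; y \<in> ob C; f \<in> hom C x y\<rbrakk> \<Longrightarrow>
      pair x y (scale c f) g = c * pair x y f g"
    and pair_pre: "\<lbrakk>x' \<in> ob C; x \<in> ob C; y \<in> ob C; a \<in> hom C x' x; f \<in> hom C x y; g \<in> hom C y (fobj S x')\<rbrakk> \<Longrightarrow>
      pair x' y (cmp C x' x y f a) g = pair x y f (cmp C y (fobj S x') (fobj S x) (fmap S x' x a) g)"
    and pair_post: "\<lbrakk>x \<in> ob C; y \<in> ob C; y' \<in> ob C; b \<in> hom C y y'; f \<in> hom C x y; g \<in> hom C y' (fobj S x)\<rbrakk> \<Longrightarrow>
      pair x y' (cmp C x y y' b f) g = pair x y f (cmp C y y' (fobj S x) g b)"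
proof -
  from serre have ex: "\<exists>\<eta> :: 'o \<Rightarrow> 'o \<Rightarrow> 'v \<Rightarrow> 'v \<Rightarrow> 'k.
       (\<forall>x \<in> ob C. \<forall>y \<in> ob C.
          bij_betw (\<eta> x y) (hom C x y) (dual_space scale (hom C y (fobj S x))) \<and>
          (\<forall>f \<in> hom C x y. \<forall>f' \<in> hom C x y. \<forall>g. \<eta> x y (f + f') g = \<eta> x y f g + \<eta> x y f' g) \<and>
          (\<forall>c. \<forall>f \<in> hom C x y. \<forall>g. \<eta> x y (scale c f) g = c * \<eta> x y f g)) \<and>
       (\<forall>x' \<in> ob C. \<forall>x \<in> ob C. \<forall>y \<in> ob C.
          \<forall>a \<in> hom C x' x. \<forall>f \<in> hom C x y. \<forall>g \<in> hom C y (fobj S x').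
          \<eta> x' y (cmp C x' x y f a) g =
          \<eta> x y f (cmp C y (fobj S x') (fobj S x) (fmap S x' x a) g)) \<and>
       (\<forall>x \<in> ob C. \<forall>y \<in> ob C. \<forall>y' \<in> ob C.
          \<forall>b \<in> hom C y y'. \<forall>f \<in> hom C x y. \<forall>g \<in> hom C y' (fobj S x).
          \<eta> x y' (cmp C x y y' b f) g = \<eta> x y f (cmp C y y' (fobj S x) g b))"
    unfolding serre_functor_def by (elim conjE)
  note p = someI_ex[OF ex, folded pair_def]
  note p1 = conjunct1[OF p] and p2 = conjunct1[OF conjunct2[OF p]] and p3 = conjunct2[OF conjunct2[OF p]]
  show "\<lbrakk>x \<in> ob C; y \<in> ob C\<rbrakk> \<Longrightarrow> bij_betw (pair x y) (hom C x y) (dual_space scale (hom C y (fobj S x)))"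
    using p1 by blast
  show "\<lbrakk>x \<in> ob C; y \<in> ob C; f \<in> hom C x y; f' \<in> hom C x y\<rbrakk> \<Longrightarrow>
      pair x y (f + f') g = pair x y f g + pair x y f' g" using p1 by blast
  show "\<lbrakk>x \<in> ob C; y \<in> ob C; f \<in> hom C x y\<rbrakk> \<Longrightarrow> pair x y (scale c f) g = c * pair x y f g"
    using p1 by blast
  show "\<lbrakk>x' \<in> ob C; x \<in> ob C; y \<in> ob C; a \<in> hom C x' x; f \<in> hom C x y; g \<in> hom C y (fobj S x')\<rbrakk> \<Longrightarrow>
      pair x' y (cmp C x' x y f a) g = pair x y f (cmp C y (fobj S x') (fobj S x) (fmap S x' x a) g)"
    by (rule p2[rule_format])
  show "\<lbrakk>x \<in> ob C; y \<in> ob C; y' \<in> ob C; b \<in> hom C y y'; f \<in> hom C x y; g \<in> hom C y' (fobj S x)\<rbrakk> \<Longrightarrow>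
      pair x y' (cmp C x y y' b f) g = pair x y f (cmp C y y' (fobj S x) g b)"
    by (rule p3[rule_format])
qed

lemma pair_dual: "\<lbrakk>x \<in> ob C; y \<in> ob C; f \<in> hom C x y\<rbrakk> \<Longrightarrow> pair x y f \<in> dual_space scale (hom C y (fobj S x))"
  using pair_bij[of x y] by (rule bij_betwE[THEN bspec])

lemma pair_add_right:
  "\<lbrakk>x \<in> ob C; y \<in> ob C; f \<in> hom C x y; g \<in> hom C y (fobj S x); g' \<in> hom C y (fobj S x)\<rbrakk> \<Longrightarrow>
    pair x y f (g + g') = pair x y f g + pair x y f g'"
  using pair_dual[of x y f] unfolding dual_space_def by blast

lemma pair_zero_left: "\<lbrakk>x \<in> ob C; y \<in> ob C\<rbrakk> \<Longrightarrow> pair x y 0 g = 0"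
  using pair_add[of x y 0 0 g] by (metis add.right_neutral add_left_cancel hom_zero)

lemma pair_zero_right: "\<lbrakk>x \<in> ob C; y \<in> ob C; f \<in> hom C x y\<rbrakk> \<Longrightarrow> pair x y f 0 = 0"
  using pair_add_right[of x y f 0 0] by (metis add.right_neutral add_left_cancel hom_zero Sr(1))

lemma pair_diff_right:
  "\<lbrakk>x \<in> ob C; y \<in> ob C; f \<in> hom C x y; g \<in> hom C y (fobj S x); g' \<in> hom C y (fobj S x)\<rbrakk> \<Longrightarrow>
    pair x y f (g - g') = pair x y f g - pair x y f g'"
  using pair_add_right[of x y f "g - g'" g'] by (simp add: hom_diff Sr)

lemma represent_left:
  assumes "x \<in> ob C" "y \<in> ob C"
    and "\<And>g g'. \<lbrakk>g \<in> hom C y (fobj S x); g' \<in> hom C y (fobj S x)\<rbrakk> \<Longrightarrow> \<phi> (g + g') = \<phi> g + \<phi> g'"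
    and "\<And>c g. g \<in> hom C y (fobj S x) \<Longrightarrow> \<phi> (scale c g) = c * \<phi> g"
  shows "\<exists>f \<in> hom C x y. \<forall>g \<in> hom C y (fobj S x). pair x y f g = \<phi> g"
proof -
  have sx: "fobj S x \<in> ob C" using assms by (simp add: Sr)
  have "(\<lambda>g. if g \<in> hom C y (fobj S x) then \<phi> g else 0) \<in> dual_space scale (hom C y (fobj S x))"
    unfolding dual_space_def using assms sx by (auto simp: hom_add hom_scale)
  then have "(\<lambda>g. if g \<in> hom C y (fobj S x) then \<phi> g else 0) \<in> pair x y ` hom C x y"
    using pair_bij[OF assms(1,2)] by (simp add: bij_betw_def)
  then obtain f where f: "f \<in> hom C x y" "pair x y f = (\<lambda>g. if g \<in> hom C y (fobj S x) then \<phi> g else 0)"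
    by force
  show ?thesis by (rule bexI[OF _ f(1)]) (simp add: f(2))
qed

text \<open>Linear forms on \<open>Hom(x, y)\<close> are represented as well: transport them along \<open>S\<close> and use that
  \<open>pair x y f g = pair y (S x) g (S f)\<close>.\<close>

lemma pair_swap:
  assumes "x \<in> ob C" "y \<in> ob C" "f \<in> hom C x y" "g \<in> hom C y (fobj S x)"
  shows "pair y (fobj S x) g (fmap S x y f) = pair x y f g"
proof -
  have sx: "fobj S x \<in> ob C" "fobj S y \<in> ob C" "fmap S x y f \<in> hom C (fobj S x) (fobj S y)"
    using assms by (simp_all add: Sr)
  have "pair y (fobj S x) (cmp C y y (fobj S x) g (ident C y)) (fmap S x y f)
      = pair y y (ident C y) (cmp C y (fobj S x) (fobj S y) (fmap S x y f) g)"
    by (rule pair_post) (use assms sx in \<open>simp_all add: lin_rules\<close>)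
  also have "\<dots> = pair x y (cmp C x y y (ident C y) f) g"
    by (rule pair_pre[symmetric]) (use assms sx in \<open>simp_all add: lin_rules\<close>)
  finally show ?thesis using assms sx by (simp add: lin_rules)
qed

lemma represent_right:
  assumes "x \<in> ob C" "y \<in> ob C"
    and add: "\<And>f f'. \<lbrakk>f \<in> hom C x y; f' \<in> hom C x y\<rbrakk> \<Longrightarrow> \<phi> (f + f') = \<phi> f + \<phi> f'"
    and scale: "\<And>c f. f \<in> hom C x y \<Longrightarrow> \<phi> (scale c f) = c * \<phi> f"
  shows "\<exists>g \<in> hom C y (fobj S x). \<forall>f \<in> hom C x y. pair x y f g = \<phi> f"
proof -
  have sx: "fobj S x \<in> ob C" "fobj S y \<in> ob C" using assms by (simp_all add: Sr)
  define \<psi> where "\<psi> h = \<phi> (inv_into (hom C x y) (fmap S x y) h)" for h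
  have inj: "inj_on (fmap S x y) (hom C x y)"
    using autoequiv_ff[OF S] assms(1,2) by (auto simp: fully_faithful_def bij_betw_def)
  have \<psi>: "\<psi> (fmap S x y f) = \<phi> f" if "f \<in> hom C x y" for f
    unfolding \<psi>_def using inv_into_f_f[OF inj that] by simp
  have full: "\<exists>f \<in> hom C x y. fmap S x y f = h" if "h \<in> hom C (fobj S x) (fobj S y)" for h
    using ff_full[OF autoequiv_ff[OF S] assms(1,2) that] by metis
  have "\<exists>g \<in> hom C y (fobj S x). \<forall>h \<in> hom C (fobj S x) (fobj S y). pair y (fobj S x) g h = \<psi> h"
  proof (rule represent_left)
    fix h h' assume "h \<in> hom C (fobj S x) (fobj S y)" "h' \<in> hom C (fobj S x) (fobj S y)"
    then obtain f f' where f: "f \<in> hom C x y" "fmap S x y f = h" "f' \<in> hom C x y" "fmap S x y f' = h'"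
      using full by metis
    then have "h + h' = fmap S x y (f + f')" using autoequiv_add[OF S assms(1,2)] by simp
    then show "\<psi> (h + h') = \<psi> h + \<psi> h'" using f \<psi> add assms(1,2) by (metis hom_add)
  next
    fix c h assume "h \<in> hom C (fobj S x) (fobj S y)"
    then obtain f where f: "f \<in> hom C x y" "fmap S x y f = h" using full by metis
    then have "scale c h = fmap S x y (scale c f)" using S_scale[OF assms(1,2)] by simp
    then show "\<psi> (scale c h) = c * \<psi> h" using f \<psi> scale assms(1,2) by (metis hom_scale)
  qed (use assms sx in auto)
  then obtain g where g: "g \<in> hom C y (fobj S x)"
    "\<forall>h \<in> hom C (fobj S x) (fobj S y). pair y (fobj S x) g h = \<psi> h" by blast
  have "pair x y f g = \<phi> f" if f: "f \<in> hom C x y" for f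
    using g(2) pair_swap[OF assms(1,2) f g(1)] \<psi>[OF f] Sr(2)[OF assms(1,2) f] by simp
  with g(1) show ?thesis by blast
qed

text \<open>Duality is applied in this form: a morphism outside a subspace is detected by an
  orthogonal morphism on the other side of the pairing. The witness is a morphism of
  \<open>C\<close>, so that it can be composed further.\<close>

lemma separate_left:
  assumes "x \<in> ob C" "y \<in> ob C" "subspace I" "s \<in> hom C y (fobj S x)" "s \<notin> I"
  shows "\<exists>f \<in> hom C x y. (\<forall>i. i \<in> I \<longrightarrow> i \<in> hom C y (fobj S x) \<longrightarrow> pair x y f i = 0) \<and> pair x y f s = 1"
proof -
  obtain \<phi> :: "'v \<Rightarrow> 'k" where \<phi>: "\<And>x y. \<phi> (x + y) = \<phi> x + \<phi> y" "\<And>c x. \<phi> (scale c x) = c * \<phi> x"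
    "\<And>i. i \<in> I \<Longrightarrow> \<phi> i = 0" "\<phi> s = 1" using separating_functional[OF assms(3,5)] by metis
  have "\<exists>f \<in> hom C x y. \<forall>g \<in> hom C y (fobj S x). pair x y f g = \<phi> g"
    by (rule represent_left[OF assms(1,2)]) (simp_all add: \<phi>)
  then show ?thesis using \<phi> assms(4) by metis
qed

lemma separate_right:
  assumes "x \<in> ob C" "y \<in> ob C" "subspace I" "s \<in> hom C x y" "s \<notin> I"
  shows "\<exists>g \<in> hom C y (fobj S x). (\<forall>i. i \<in> I \<longrightarrow> i \<in> hom C x y \<longrightarrow> pair x y i g = 0) \<and> pair x y s g = 1"
proof -
  obtain \<phi> :: "'v \<Rightarrow> 'k" where \<phi>: "\<And>x y. \<phi> (x + y) = \<phi> x + \<phi> y" "\<And>c x. \<phi> (scale c x) = c * \<phi> x"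
    "\<And>i. i \<in> I \<Longrightarrow> \<phi> i = 0" "\<phi> s = 1" using separating_functional[OF assms(3,5)] by metis
  have "\<exists>g \<in> hom C y (fobj S x). \<forall>f \<in> hom C x y. pair x y f g = \<phi> f"
    by (rule represent_right[OF assms(1,2)]) (simp_all add: \<phi>)
  then show ?thesis using \<phi> assms(4) by metis
qed

lemma nondegenerate_right:
  assumes "x \<in> ob C" "y \<in> ob C" "s \<in> hom C y (fobj S x)" "\<And>f. f \<in> hom C x y \<Longrightarrow> pair x y f s = 0"
  shows "s = 0"
proof (rule ccontr)
  assume "s \<noteq> 0"
  then obtain f where "f \<in> hom C x y" "pair x y f s = 1"
    using separate_left[OF assms(1,2) subspace_single_0 assms(3)] by auto
  then show False using assms(4) by force
qed

lemma nondegenerate_left: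
  assumes "x \<in> ob C" "y \<in> ob C" "s \<in> hom C x y" "\<And>g. g \<in> hom C y (fobj S x) \<Longrightarrow> pair x y s g = 0"
  shows "s = 0"
proof (rule ccontr)
  assume "s \<noteq> 0"
  then obtain g where "g \<in> hom C y (fobj S x)" "pair x y s g = 1"
    using separate_right[OF assms(1,2) subspace_single_0 assms(3)] by auto
  then show False using assms(4) by force
qed

section \<open>Consequences of Serre duality for Hom spaces and classes of morphisms\<close>

lemma serre_hom_0:
  assumes "x \<in> ob C" "y \<in> ob C"
  shows "hom C y (fobj S x) = {0} \<longleftrightarrow> hom C x y = {0}"
proof -
  have z: "0 \<in> hom C x y" "0 \<in> hom C y (fobj S x)" using assms by (simp_all add: hom_zero Sr)
  have "s = 0" if "hom C x y = {0}" "s \<in> hom C y (fobj S x)" for s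
    by (rule nondegenerate_right[OF assms that(2)]) (use that(1) pair_zero_left[OF assms] in auto)
  moreover have "s = 0" if "hom C y (fobj S x) = {0}" "s \<in> hom C x y" for s
    by (rule nondegenerate_left[OF assms that(2)])
      (use that(1) pair_zero_right[OF assms that(2)] in auto)
  ultimately show ?thesis using z by blast
qed

text \<open>By naturality the pairing of \<open>h\<close> with \<open>s \<circ> f\<close> is that of
  \<open>f \<circ> h\<close> with \<open>s\<close>, so all \<open>f \<circ> h\<close> vanish if and
  only if all \<open>s \<circ> f\<close> do.\<close>

lemma null_on_serre:
  assumes "t \<in> ob C" "x \<in> ob C" "y \<in> ob C"
  shows "null_on (opp C) (fobj S t) y x = null_on C t x y"
proof -
  have st: "fobj S t \<in> ob C" using assms by (simp add: Sr)
  have *: "pair t x h (cmp C x y (fobj S t) s f) = pair t y (cmp C t x y f h) s"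
    if "f \<in> hom C x y" "h \<in> hom C t x" "s \<in> hom C y (fobj S t)" for f h s
    using pair_post[OF assms that(1,2,3)] by simp
  have "cmp C t x y f h = 0" if "f \<in> hom C x y" "h \<in> hom C t x"
    "\<forall>s \<in> hom C y (fobj S t). cmp C x y (fobj S t) s f = 0" for f h
    by (rule nondegenerate_left[OF assms(1,3)])
      (use that assms st *[OF that(1,2)] pair_zero_right[OF assms(1,2) that(2)] in \<open>simp_all add: lin_rules\<close>)
  moreover have "cmp C x y (fobj S t) s f = 0" if "f \<in> hom C x y" "s \<in> hom C y (fobj S t)"
    "\<forall>h \<in> hom C t x. cmp C t x y f h = 0" for f s
    by (rule nondegenerate_right[OF assms(1,2)])
      (use that assms st *[OF that(1) _ that(2)] pair_zero_left[OF assms(1,3)] in \<open>simp_all add: lin_rules\<close>)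
  ultimately show ?thesis by (auto simp: null_on_def)
qed

text \<open>Injectivity and surjectivity at \<open>Tb\<close> are dual to surjectivity and
  injectivity at \<open>S Tb\<close>. For the third condition the exact pair
  \<open>Rs \<rightarrow> M \<rightarrow> R\<close> enters: since \<open>M\<close> lies in
  \<open>add Tb\<close>, nullity at \<open>R\<close> and at \<open>S Rs\<close> is measured by
  composing with \<kappa> and \<open>S i\<close>, and an obstruction at one end is pushed through
  \<open>M\<close> to the other end, where it is seen to vanish.\<close>

lemma wequiv_serre:
  assumes ex: "wexact C Rs M R i \<kappa>" and Tb: "Tb \<in> ob C" and M: "M \<in> gen C {Tb}"
    and \<kappa>: "\<And>h. h \<in> hom C Tb R \<Longrightarrow> \<exists>g \<in> hom C Tb M. h = cmp C Tb M R \<kappa> g"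
    and i: "\<And>h. h \<in> hom C Rs Tb \<Longrightarrow> \<exists>g \<in> hom C M Tb. h = cmp C Rs M Tb g i"
    and x: "x \<in> ob C" and y: "y \<in> ob C"
  shows "wequiv (opp C) (fobj S Tb) (fobj S Rs) y x = wequiv C Tb R x y"
proof -
  note e = wexactD[OF ex]
  interpret O: linear_category scale "opp C" by (rule linear_opp)
  let ?T = "fobj S Tb" and ?Rs = "fobj S Rs" and ?M = "fobj S M" and ?R = "fobj S R"
  let ?i = "fmap S Rs M i" and ?k = "fmap S M R \<kappa>"
  have ob: "?T \<in> ob C" "?Rs \<in> ob C" "?M \<in> ob C" "?R \<in> ob C" using Tb e Sr(1) by simp_all
  have SM: "?M \<in> gen C {?T}" using autoequiv_gen[OF S M] Tb by simp
  note Sex = autoequiv_wexact[OF S ex]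
  note Se = wexactD[OF Sex]
  have null_R: "h \<in> null_on C Tb R z \<longleftrightarrow> cmp C M R z h \<kappa> = 0" if z: "z \<in> ob C" and h: "h \<in> hom C R z" for z h
  proof
    assume "h \<in> null_on C Tb R z"
    then show "cmp C M R z h \<kappa> = 0" by (rule null_on_gen[OF _ M]) (use e Tb z in auto)
  next
    assume h0: "cmp C M R z h \<kappa> = 0"
    show "h \<in> null_on C Tb R z" unfolding null_on_def
    proof (intro CollectI conjI ballI h)
      fix t assume "t \<in> hom C Tb R"
      then obtain g where "g \<in> hom C Tb M" "t = cmp C Tb M R \<kappa> g" using \<kappa> by blast
      then show "cmp C Tb R z h t = 0" using h0 h e Tb z by (simp add: cmp_assoc lin_rules)
    qed
  qed
  have null_Rs: "h \<in> null_on (opp C) ?T ?Rs z \<longleftrightarrow> cmp C z ?Rs ?M ?i h = 0"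
    if z: "z \<in> ob C" and h: "h \<in> hom C z ?Rs" for z h
  proof
    assume "h \<in> null_on (opp C) ?T ?Rs z"
    then show "cmp C z ?Rs ?M ?i h = 0"
      using O.null_on_gen[of h ?T ?Rs z ?M ?i] SM Se ob z by simp
  next
    assume h0: "cmp C z ?Rs ?M ?i h = 0"
    show "h \<in> null_on (opp C) ?T ?Rs z" unfolding null_on_def
    proof (intro CollectI conjI ballI)
      show "h \<in> hom (opp C) ?Rs z" using h by simp
      fix t assume "t \<in> hom (opp C) ?T ?Rs"
      then have "t \<in> hom C ?Rs ?T" by simp
      then obtain u where u: "u \<in> hom C Rs Tb" "fmap S Rs Tb u = t"
        by (rule ff_full[OF autoequiv_ff[OF S] e(1) Tb])
      then obtain g where g: "g \<in> hom C M Tb" "u = cmp C Rs M Tb g i" using i by blast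
      have "t = cmp C ?Rs ?M ?T (fmap S M Tb g) ?i" using u g e Tb by (simp add: Sr)
      then have "cmp C z ?Rs ?T t h = 0"
        using h0 h g(1) e Se Tb z ob Sr(2)[OF e(2) Tb g(1)] by (simp add: lin_rules flip: cmp_assoc)
      then show "cmp (opp C) ?T ?Rs z h t = 0" by simp
    qed
  qed
  have M_cancel: "b = 0" if "w \<in> hom C x y" "\<forall>h \<in> hom C Tb x. cmp C Tb x y w h = 0 \<longrightarrow> h = 0"
    "b \<in> hom C M x" "cmp C M x y w b = 0" for w b
  proof (rule gen_test[OF M _ x that(3)])
    fix z h assume z: "z \<in> {Tb}" "h \<in> hom C z M"
    have "cmp C Tb x y w (cmp C Tb M x b h) = 0"
      using z that(1,3,4) e Tb x y by (simp add: cmp_assoc lin_rules)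
    then show "cmp C z M x b h = 0" using z that(2,3) e Tb x by (simp add: lin_rules)
  qed (use Tb in simp)
  have SM_cancel: "b = 0" if "w \<in> hom C x y" "\<forall>h \<in> hom C y ?T. cmp C x y ?T h w = 0 \<longrightarrow> h = 0"
    "b \<in> hom C y ?M" "cmp C x y ?M b w = 0" for w b
  proof (rule O.gen_test[of ?M "{?T}" y b])
    fix z h assume z: "z \<in> {?T}" "h \<in> hom (opp C) z ?M"
    have "cmp C x y ?T (cmp C y ?M ?T h b) w = 0"
      using z that(1,3,4) ob x y by (simp add: lin_rules flip: cmp_assoc)
    then show "cmp (opp C) z ?M y b h = 0" using z that(2,3) ob y by (simp add: lin_rules)
  qed (use SM ob y that in simp_all)
  note shift = pair_post[OF _ x y]
  have iff: "w \<in> wequiv (opp C) ?T ?Rs y x \<longleftrightarrow> w \<in> wequiv C Tb R x y" if w: "w \<in> hom C x y" for w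
  proof -
    \<comment> \<open>The letter \<open>A\<close> refers to maps out of \<open>Tb\<close> and
      \<open>R\<close>, the letter \<open>B\<close> to maps into \<open>S Tb\<close> and
      \<open>S Rs\<close>; 1 is injectivity, 2 surjectivity, 3 surjectivity modulo null
      maps.\<close>
    define A1 where "A1 \<longleftrightarrow> (\<forall>h \<in> hom C Tb x. cmp C Tb x y w h = 0 \<longrightarrow> h = 0)"
    define A2 where "A2 \<longleftrightarrow> (\<forall>h \<in> hom C Tb y. \<exists>g \<in> hom C Tb x. h = cmp C Tb x y w g)"
    define A3 where "A3 \<longleftrightarrow> (\<forall>h \<in> hom C R y. \<exists>g \<in> hom C R x. h - cmp C R x y w g \<in> null_on C Tb R y)"
    define B1 where "B1 \<longleftrightarrow> (\<forall>h \<in> hom C y ?T. cmp C x y ?T h w = 0 \<longrightarrow> h = 0)"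
    define B2 where "B2 \<longleftrightarrow> (\<forall>h \<in> hom C x ?T. \<exists>g \<in> hom C y ?T. h = cmp C x y ?T g w)"
    define B3 where "B3 \<longleftrightarrow> (\<forall>h \<in> hom C x ?Rs. \<exists>g \<in> hom C y ?Rs. h - cmp C x y ?Rs g w \<in> null_on (opp C) ?T ?Rs x)"
    have "B2" if A1
      unfolding B2_def
    proof (intro ballI, rule ccontr)
      fix h assume h: "h \<in> hom C x ?T" and nex: "\<not> (\<exists>g\<in>hom C y ?T. h = cmp C x y ?T g w)"
      let ?I = "(\<lambda>g. cmp C x y ?T g w) ` hom C y ?T"
      have "subspace ?I"
        by (rule subspace_image_on[OF hom_subspace])
          (use ob Se e Tb x y w in \<open>simp_all add: lin_rules cmp_scale_left cmp_scale_right\<close>)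
      moreover have "h \<notin> ?I" using nex by blast
      ultimately obtain t where t: "t \<in> hom C Tb x" "\<And>a. \<lbrakk>a \<in> ?I; a \<in> hom C x ?T\<rbrakk> \<Longrightarrow> pair Tb x t a = 0"
        "pair Tb x t h = 1" using separate_left[OF Tb x _ h] by blast
      have "cmp C Tb x y w t = 0"
      proof (rule nondegenerate_left[OF Tb y])
        fix g assume g: "g \<in> hom C y ?T"
        have "cmp C x y ?T g w \<in> hom C x ?T" using g w x y ob by (simp add: lin_rules)
        then show "pair Tb y (cmp C Tb x y w t) g = 0" using shift[OF Tb w t(1) g] t(2) g by auto
      qed (use t w x y Tb in \<open>simp add: lin_rules\<close>)
      then show False using \<open>A1\<close> t pair_zero_left[OF Tb x] unfolding A1_def by auto
    qed
    moreover have "A1" if b2: B2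
      unfolding A1_def
    proof (intro ballI impI)
      fix h assume h: "h \<in> hom C Tb x" "cmp C Tb x y w h = 0"
      show "h = 0"
      proof (rule nondegenerate_left[OF Tb x h(1)])
        fix g assume "g \<in> hom C x ?T"
        then obtain g' where g': "g' \<in> hom C y ?T" "g = cmp C x y ?T g' w" using b2 unfolding B2_def by blast
        then show "pair Tb x h g = 0" using shift[OF Tb w h(1) g'(1)] h pair_zero_left[OF Tb y] by simp
      qed
    qed
    moreover have "B1" if a2: A2
      unfolding B1_def
    proof (intro ballI impI)
      fix h assume h: "h \<in> hom C y ?T" "cmp C x y ?T h w = 0"
      show "h = 0"
      proof (rule nondegenerate_right[OF Tb y h(1)])
        fix g assume "g \<in> hom C Tb y"
        then obtain g' where g': "g' \<in> hom C Tb x" "g = cmp C Tb x y w g'" using a2 unfolding A2_def by blast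
        then show "pair Tb y g h = 0" using shift[OF Tb w g'(1) h(1)] h pair_zero_right[OF Tb x g'(1)] by simp
      qed
    qed
    moreover have "A2" if B1
      unfolding A2_def
    proof (intro ballI, rule ccontr)
      fix h assume h: "h \<in> hom C Tb y" and nex: "\<not> (\<exists>g\<in>hom C Tb x. h = cmp C Tb x y w g)"
      let ?I = "cmp C Tb x y w ` hom C Tb x"
      have "subspace ?I"
        by (rule subspace_image_on[OF hom_subspace])
          (use ob Se e Tb x y w in \<open>simp_all add: lin_rules cmp_scale_left cmp_scale_right\<close>)
      moreover have "h \<notin> ?I" using nex by blast
      ultimately obtain s where s: "s \<in> hom C y ?T" "\<And>a. \<lbrakk>a \<in> ?I; a \<in> hom C Tb y\<rbrakk> \<Longrightarrow> pair Tb y a s = 0"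
        "pair Tb y h s = 1" using separate_right[OF Tb y _ h] by blast
      have "cmp C x y ?T s w = 0"
      proof (rule nondegenerate_right[OF Tb x])
        fix g assume g: "g \<in> hom C Tb x"
        have "cmp C Tb x y w g \<in> hom C Tb y" using g w x y Tb by (simp add: lin_rules)
        then show "pair Tb x g (cmp C x y ?T s w) = 0" using shift[OF Tb w g s(1)] s(2) g by auto
      qed (use s w x y ob in \<open>simp add: lin_rules\<close>)
      then show False using \<open>B1\<close> s pair_zero_right[OF Tb y h] unfolding B1_def by auto
    qed
    moreover have "B3" if A1 A3
      unfolding B3_def
    proof (intro ballI, rule ccontr)
      fix r assume r: "r \<in> hom C x ?Rs"
        and nex: "\<not> (\<exists>g\<in>hom C y ?Rs. r - cmp C x y ?Rs g w \<in> null_on (opp C) ?T ?Rs x)"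
      \<comment> \<open>The maps that agree with some \<open>g \<circ> w\<close> modulo null maps,
        tested after \<open>S i\<close> as \<open>null_Rs\<close> permits. With \<open>g = 0\<close>
        this subspace contains all null maps, which is used below.\<close>
      let ?I = "{a \<in> hom C x ?Rs. cmp C x ?Rs ?M ?i a \<in> (\<lambda>g. cmp C x ?Rs ?M ?i (cmp C x y ?Rs g w)) ` hom C y ?Rs}"
      have "subspace ?I"
        by (rule subspace_vimage_on[OF hom_subspace subspace_image_on[OF hom_subspace]])
          (use ob Se e x y w in \<open>simp_all add: lin_rules hom_scale cmp_scale_left cmp_scale_right\<close>)
      moreover have "r \<notin> ?I"
        using nex null_Rs[OF x] r ob Se x y w by (auto simp: lin_rules)
      ultimately obtain f where f: "f \<in> hom C Rs x" "\<And>a. \<lbrakk>a \<in> ?I; a \<in> hom C x ?Rs\<rbrakk> \<Longrightarrow> pair Rs x f a = 0"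
        "pair Rs x f r = 1" using separate_left[OF e(1) x _ r] by blast
      have wf: "cmp C Rs x y w f = 0"
      proof (rule nondegenerate_left[OF e(1) y])
        fix g assume g: "g \<in> hom C y ?Rs"
        have "cmp C x y ?Rs g w \<in> ?I" using g w x y ob Se by (auto simp: lin_rules)
        then show "pair Rs y (cmp C Rs x y w f) g = 0" using shift[OF e(1) w f(1) g] f(2) by auto
      qed (use f w x y e in \<open>simp add: lin_rules\<close>)
      \<comment> \<open>\<open>f\<close> is orthogonal to all maps killed by \<open>S i\<close>, and
        the orthogonal of these consists of the maps that extend along \<open>i\<close>.\<close>
      have "f \<in> (\<lambda>b. cmp C Rs M x b i) ` hom C M x" (is "_ \<in> ?J")
      proof (rule ccontr)
        assume nf: "f \<notin> ?J"
        have "subspace ?J"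
          by (rule subspace_image_on[OF hom_subspace])
            (use ob Se e Tb x y w in \<open>simp_all add: lin_rules cmp_scale_left cmp_scale_right\<close>)
        then obtain g where g: "g \<in> hom C x ?Rs" "\<And>a. \<lbrakk>a \<in> ?J; a \<in> hom C Rs x\<rbrakk> \<Longrightarrow> pair Rs x a g = 0"
          "pair Rs x f g = 1" using nf separate_right[OF e(1) x _ f(1)] by blast
        have "cmp C x ?Rs ?M ?i g = 0"
        proof (rule nondegenerate_right[OF e(2) x])
          fix b assume b: "b \<in> hom C M x"
          then have "cmp C Rs M x b i \<in> hom C Rs x" using e x by (simp add: lin_rules)
          then show "pair M x b (cmp C x ?Rs ?M ?i g) = 0"
            using pair_pre[OF e(1,2) x e(4) b g(1)] g(2) b by auto
        qed (use g Se x in \<open>simp add: lin_rules\<close>)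
        then have "g \<in> ?I" using g ob x y w Se by (auto simp: lin_rules intro!: image_eqI[of _ _ 0])
        then show False using f(2) g by auto
      qed
      then obtain b where b: "b \<in> hom C M x" "f = cmp C Rs M x b i" by blast
      have wb: "cmp C M x y w b \<in> hom C M y" using b w e x y by (simp add: lin_rules)
      \<comment> \<open>Since \<open>w \<circ> b\<close> kills \<open>i\<close>, it extends over
        \<open>R\<close>, where \<open>A3\<close> lifts it to \<open>x\<close> up to a null map, and
        \<kappa> kills that map. Injectivity then forces \<open>b = r1 \<circ> \<kappa>\<close>,
        whence \<open>f = r1 \<circ> \<kappa> \<circ> i = 0\<close>.\<close>
      have "cmp C Rs M y (cmp C M x y w b) i = 0" using wf b w e x y by (simp add: cmp_assoc)
      then obtain r0 where r0: "r0 \<in> hom C R y" "cmp C M x y w b = cmp C M R y r0 \<kappa>"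
        using wexact_ext[OF ex y wb] by metis
      obtain r1 where r1: "r1 \<in> hom C R x" "r0 - cmp C R x y w r1 \<in> null_on C Tb R y"
        using \<open>A3\<close> r0 unfolding A3_def by blast
      have "cmp C M R y (r0 - cmp C R x y w r1) \<kappa> = 0"
        using null_R[OF y, of "r0 - cmp C R x y w r1"] r1 r0 w e x y by (simp add: lin_rules)
      then have "cmp C M x y w (b - cmp C M R x r1 \<kappa>) = 0"
        using r0 r1 b w e x y by (simp add: lin_rules cmp_assoc)
      then have "b - cmp C M R x r1 \<kappa> = 0"
        using M_cancel[OF w, of "b - cmp C M R x r1 \<kappa>"] \<open>A1\<close> b r1 e x by (simp add: A1_def lin_rules)
      then have "f = 0" using b r1 e x by (simp add: lin_rules flip: cmp_assoc)
      then show False using f(3) pair_zero_left[OF e(1) x] by simp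
    qed
    \<comment> \<open>The mirror image: \<open>g\<close> lifts through \<open>S \<kappa>\<close> to
      \<open>S M\<close>, the composite of the lift with \<open>w\<close> comes from
      \<open>S Rs\<close> by exactness of the image under \<open>S\<close>, and \<open>B3\<close>
      with \<open>B1\<close> force \<open>g = S \<kappa> \<circ> S i \<circ> h1 = 0\<close>.\<close>
    moreover have "A3" if B1 B3
      unfolding A3_def
    proof (intro ballI, rule ccontr)
      fix r assume r: "r \<in> hom C R y"
        and nex: "\<not> (\<exists>g\<in>hom C R x. r - cmp C R x y w g \<in> null_on C Tb R y)"
      let ?I = "{a \<in> hom C R y. cmp C M R y a \<kappa> \<in> (\<lambda>g. cmp C M R y (cmp C R x y w g) \<kappa>) ` hom C R x}"
      have "subspace ?I"
        by (rule subspace_vimage_on[OF hom_subspace subspace_image_on[OF hom_subspace]])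
          (use ob Se e x y w in \<open>simp_all add: lin_rules hom_scale cmp_scale_left cmp_scale_right\<close>)
      moreover have "r \<notin> ?I"
        using nex null_R[OF y] r e x y w by (auto simp: lin_rules)
      ultimately obtain g where g: "g \<in> hom C y ?R" "\<And>a. \<lbrakk>a \<in> ?I; a \<in> hom C R y\<rbrakk> \<Longrightarrow> pair R y a g = 0"
        "pair R y r g = 1" using separate_right[OF e(3) y _ r] by blast
      have gw: "cmp C x y ?R g w = 0"
      proof (rule nondegenerate_right[OF e(3) x])
        fix f assume f: "f \<in> hom C R x"
        have "cmp C R x y w f \<in> ?I" using f w x y e by (auto simp: lin_rules)
        then show "pair R x f (cmp C x y ?R g w) = 0" using shift[OF e(3) w f g(1)] g(2) by auto
      qed (use g w x y ob in \<open>simp add: lin_rules\<close>)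
      have "g \<in> cmp C y ?M ?R ?k ` hom C y ?M" (is "_ \<in> ?J")
      proof (rule ccontr)
        assume nf: "g \<notin> ?J"
        have "subspace ?J"
          by (rule subspace_image_on[OF hom_subspace])
            (use ob Se e Tb x y w in \<open>simp_all add: lin_rules cmp_scale_left cmp_scale_right\<close>)
        then obtain k where k: "k \<in> hom C R y" "\<And>a. \<lbrakk>a \<in> ?J; a \<in> hom C y ?R\<rbrakk> \<Longrightarrow> pair R y k a = 0"
          "pair R y k g = 1" using nf separate_left[OF e(3) y _ g(1)] by blast
        have "cmp C M R y k \<kappa> = 0"
        proof (rule nondegenerate_left[OF e(2) y])
          fix b assume b: "b \<in> hom C y ?M"
          then have "cmp C y ?M ?R ?k b \<in> hom C y ?R" using Se y by (simp add: lin_rules)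
          then show "pair M y (cmp C M R y k \<kappa>) b = 0"
            using pair_pre[OF e(2,3) y e(5) k(1) b] k(2) b by auto
        qed (use k e y in \<open>simp add: lin_rules\<close>)
        then have "k \<in> ?I" using k x y w e by (auto simp: lin_rules intro!: image_eqI[of _ _ 0])
        then show False using g(2) k by auto
      qed
      then obtain b where b: "b \<in> hom C y ?M" "g = cmp C y ?M ?R ?k b" by blast
      have bw: "cmp C x y ?M b w \<in> hom C x ?M" using b w ob x y by (simp add: lin_rules)
      have "cmp C x ?M ?R ?k (cmp C x y ?M b w) = 0" using gw b w Se x y by (simp add: cmp_assoc)
      then obtain h where h: "h \<in> hom C x ?Rs" "cmp C x y ?M b w = cmp C x ?Rs ?M ?i h"
        using wexact_lift[OF Sex x bw] by metis
      obtain h1 where h1: "h1 \<in> hom C y ?Rs" "h - cmp C x y ?Rs h1 w \<in> null_on (opp C) ?T ?Rs x"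
        using \<open>B3\<close> h unfolding B3_def by blast
      have "cmp C x ?Rs ?M ?i (h - cmp C x y ?Rs h1 w) = 0"
        using null_Rs[OF x, of "h - cmp C x y ?Rs h1 w"] h1 h w ob x y by (simp add: lin_rules)
      then have "cmp C x y ?M (b - cmp C y ?Rs ?M ?i h1) w = 0"
        using h h1 b w Se x y by (simp add: lin_rules cmp_assoc)
      then have "b - cmp C y ?Rs ?M ?i h1 = 0"
        using SM_cancel[OF w, of "b - cmp C y ?Rs ?M ?i h1"] \<open>B1\<close> b h1 Se y by (simp add: B1_def lin_rules)
      then have "g = 0" using b h1 Se y by (simp add: lin_rules cmp_assoc)
      then show False using g(3) pair_zero_right[OF e(3) y r] by simp
    qed
    ultimately have "A1 \<and> A2 \<and> A3 \<longleftrightarrow> B1 \<and> B2 \<and> B3" by blast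
    then show ?thesis
      unfolding wequiv_def A1_def A2_def A3_def B1_def B2_def B3_def using w by simp
  qed
  have "wequiv (opp C) ?T ?Rs y x \<subseteq> hom C x y" "wequiv C Tb R x y \<subseteq> hom C x y"
    by (auto simp: wequiv_def)
  then show ?thesis using iff by blast
qed

end

text \<open>\<open>S \<Sigma>\<^sup>-\<^sup>1 x\<close> and \<open>\<Sigma>\<^sup>-\<^sup>1 S x\<close> represent the same functor; one half of this isomorphism is enough.\<close>

lemma (in triangulated_category) serre_susp_gen:
  assumes "serre_functor scale C S" and x: "x \<in> ob C"
  shows "fobj S (fobj \<Sigma>i x) \<in> gen C {fobj \<Sigma>i (fobj S x)}"
proof -
  interpret serre_category scale C S by unfold_locales (rule assms(1))
  let ?a = "fobj \<Sigma>i x" and ?s = "fobj S x"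
  let ?Sa = "fobj S ?a" and ?is = "fobj \<Sigma>i ?s"
  have ob: "?a \<in> ob C" "?s \<in> ob C" "?Sa \<in> ob C" "?is \<in> ob C" "fobj \<Sigma> ?a \<in> ob C" "fobj \<Sigma> ?is \<in> ob C"
    "fobj \<Sigma> ?Sa \<in> ob C"
    using x by (simp_all add: Sr(1) S_rules(1) Si_rules(1))
  obtain \<theta>' \<theta> where \<theta>: "\<theta>' \<in> hom C (fobj \<Sigma> ?a) x" "\<theta> \<in> hom C x (fobj \<Sigma> ?a)"
    "cmp C (fobj \<Sigma> ?a) x (fobj \<Sigma> ?a) \<theta> \<theta>' = ident C (fobj \<Sigma> ?a)" using susp_iso[OF x] by metis
  obtain \<psi> \<psi>' where \<psi>: "\<psi> \<in> hom C (fobj \<Sigma> ?is) ?s" "\<psi>' \<in> hom C ?s (fobj \<Sigma> ?is)"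
    "cmp C ?s (fobj \<Sigma> ?is) ?s \<psi> \<psi>' = ident C ?s" using susp_iso[OF ob(2)] by metis
  have susp_scale: "fmap \<Sigma> y z (scale c f) = scale c (fmap \<Sigma> y z f)"
    if "y \<in> ob C" "z \<in> ob C" "f \<in> hom C y z" for y z c f
    using susp_linear that unfolding linear_functor_def by blast
  \<comment> \<open>\<open>pair x x (ident C x)\<close> is the trace form on
    \<open>Hom(x, S x)\<close>; \<theta> and \<psi> turn \<open>\<Sigma> f\<close> into a map
    \<open>x \<rightarrow> S x\<close>. The morphism representing this form is the comparison map in
    one direction.\<close>
  let ?\<phi> = "\<lambda>f. pair x x (ident C x) (cmp C x (fobj \<Sigma> ?is) ?s \<psi> (cmp C x (fobj \<Sigma> ?a) (fobj \<Sigma> ?is) (fmap \<Sigma> ?a ?is f) \<theta>))"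
  have pair_id_scale: "pair x x (ident C x) (scale c g) = c * pair x x (ident C x) g" if "g \<in> hom C x ?s" for c g
    using pair_dual[OF x x ident_in_hom[OF x]] that unfolding dual_space_def by blast
  have "\<exists>\<alpha> \<in> hom C ?is ?Sa. \<forall>f \<in> hom C ?a ?is. pair ?a ?is f \<alpha> = ?\<phi> f"
  proof (rule represent_right[OF ob(1,4)])
    fix f f' assume f: "f \<in> hom C ?a ?is" "f' \<in> hom C ?a ?is"
    then have Sf: "fmap \<Sigma> ?a ?is f \<in> hom C (fobj \<Sigma> ?a) (fobj \<Sigma> ?is)" "fmap \<Sigma> ?a ?is f' \<in> hom C (fobj \<Sigma> ?a) (fobj \<Sigma> ?is)"
      using ob by (simp_all add: S_rules(2))
    show "?\<phi> (f + f') = ?\<phi> f + ?\<phi> f'"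
      using f Sf ob x \<theta> \<psi> autoequiv_add[OF susp ob(1,4)] by (simp add: lin_rules pair_add_right)
  next
    fix c f assume f: "f \<in> hom C ?a ?is"
    then have Sf: "fmap \<Sigma> ?a ?is f \<in> hom C (fobj \<Sigma> ?a) (fobj \<Sigma> ?is)" using ob by (simp add: S_rules(2))
    show "?\<phi> (scale c f) = c * ?\<phi> f"
      using f Sf ob x \<theta> \<psi> susp_scale[OF ob(1,4)]
      by (simp add: lin_rules cmp_scale_left cmp_scale_right pair_id_scale)
  qed
  then obtain \<alpha> where \<alpha>: "\<alpha> \<in> hom C ?is ?Sa" "\<And>f. f \<in> hom C ?a ?is \<Longrightarrow> pair ?a ?is f \<alpha> = ?\<phi> f"
    by blast
  define inv\<Sigma> where "inv\<Sigma> = inv_into (hom C ?a ?Sa) (fmap \<Sigma> ?a ?Sa)"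
  have bij: "bij_betw (fmap \<Sigma> ?a ?Sa) (hom C ?a ?Sa) (hom C (fobj \<Sigma> ?a) (fobj \<Sigma> ?Sa))"
    using autoequiv_ff[OF susp] ob by (simp add: fully_faithful_def)
  have inv\<Sigma>: "inv\<Sigma> (fmap \<Sigma> ?a ?Sa f) = f" if "f \<in> hom C ?a ?Sa" for f
    unfolding inv\<Sigma>_def using bij_betw_inv_into_left[OF bij that] .
  have inv\<Sigma>': "inv\<Sigma> g \<in> hom C ?a ?Sa" "fmap \<Sigma> ?a ?Sa (inv\<Sigma> g) = g" if "g \<in> hom C (fobj \<Sigma> ?a) (fobj \<Sigma> ?Sa)" for g
    unfolding inv\<Sigma>_def using bij_betw_inv_into_right[OF bij that] bij that
    by (auto simp: bij_betw_def inv_into_into)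
  \<comment> \<open>The form behind the other direction: undo \<open>\<Sigma>\<close> and apply the
    trace form of \<open>\<Sigma>i x\<close>.\<close>
  let ?\<phi>' = "\<lambda>g. pair ?a ?Sa (inv\<Sigma> (cmp C (fobj \<Sigma> ?a) x (fobj \<Sigma> ?Sa) g \<theta>')) (ident C ?Sa)"
  have "\<exists>\<beta>' \<in> hom C (fobj \<Sigma> ?Sa) ?s. \<forall>g \<in> hom C x (fobj \<Sigma> ?Sa). pair x (fobj \<Sigma> ?Sa) g \<beta>' = ?\<phi>' g"
  proof (rule represent_right[OF x ob(7)])
    fix g g' assume g: "g \<in> hom C x (fobj \<Sigma> ?Sa)" "g' \<in> hom C x (fobj \<Sigma> ?Sa)"
    let ?g = "cmp C (fobj \<Sigma> ?a) x (fobj \<Sigma> ?Sa) g \<theta>'" and ?g' = "cmp C (fobj \<Sigma> ?a) x (fobj \<Sigma> ?Sa) g' \<theta>'"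
    have h: "?g \<in> hom C (fobj \<Sigma> ?a) (fobj \<Sigma> ?Sa)" "?g' \<in> hom C (fobj \<Sigma> ?a) (fobj \<Sigma> ?Sa)"
      using g ob x \<theta> by (simp_all add: lin_rules)
    have "inv\<Sigma> (?g + ?g') = inv\<Sigma> (fmap \<Sigma> ?a ?Sa (inv\<Sigma> ?g + inv\<Sigma> ?g'))"
      using autoequiv_add[OF susp ob(1,3)] inv\<Sigma>'[OF h(1)] inv\<Sigma>'[OF h(2)] by simp
    also have "\<dots> = inv\<Sigma> ?g + inv\<Sigma> ?g'"
      using inv\<Sigma>'[OF h(1)] inv\<Sigma>'[OF h(2)] ob by (intro inv\<Sigma>) (simp add: lin_rules)
    finally show "?\<phi>' (g + g') = ?\<phi>' g + ?\<phi>' g'"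
      using g ob x \<theta> inv\<Sigma>'[OF h(1)] inv\<Sigma>'[OF h(2)] by (simp add: lin_rules pair_add)
  next
    fix c g assume g: "g \<in> hom C x (fobj \<Sigma> ?Sa)"
    let ?g = "cmp C (fobj \<Sigma> ?a) x (fobj \<Sigma> ?Sa) g \<theta>'"
    have h: "?g \<in> hom C (fobj \<Sigma> ?a) (fobj \<Sigma> ?Sa)" using g ob x \<theta> by (simp add: lin_rules)
    have "inv\<Sigma> (scale c ?g) = inv\<Sigma> (fmap \<Sigma> ?a ?Sa (scale c (inv\<Sigma> ?g)))"
      using susp_scale[OF ob(1,3)] inv\<Sigma>'[OF h] by simp
    also have "\<dots> = scale c (inv\<Sigma> ?g)" using inv\<Sigma>'[OF h] ob by (intro inv\<Sigma>) (simp add: hom_scale)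
    finally show "?\<phi>' (scale c g) = c * ?\<phi>' g"
      using g ob x \<theta> inv\<Sigma>'[OF h] by (simp add: cmp_scale_left pair_scale)
  qed
  then obtain \<beta>' where \<beta>': "\<beta>' \<in> hom C (fobj \<Sigma> ?Sa) ?s"
    "\<And>g. g \<in> hom C x (fobj \<Sigma> ?Sa) \<Longrightarrow> pair x (fobj \<Sigma> ?Sa) g \<beta>' = ?\<phi>' g" by blast
  have "cmp C (fobj \<Sigma> ?Sa) ?s (fobj \<Sigma> ?is) \<psi>' \<beta>' \<in> hom C (fobj \<Sigma> ?Sa) (fobj \<Sigma> ?is)"
    using \<beta>' \<psi> ob by (simp add: lin_rules)
  then obtain \<beta> where \<beta>: "\<beta> \<in> hom C ?Sa ?is" "fmap \<Sigma> ?Sa ?is \<beta> = cmp C (fobj \<Sigma> ?Sa) ?s (fobj \<Sigma> ?is) \<psi>' \<beta>'"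
    by (rule ff_full[OF autoequiv_ff[OF susp] ob(3,4)])
  have "cmp C ?Sa ?is ?Sa \<alpha> \<beta> - ident C ?Sa = 0"
  proof (rule nondegenerate_right[OF ob(1,3)])
    show "cmp C ?Sa ?is ?Sa \<alpha> \<beta> - ident C ?Sa \<in> hom C ?Sa ?Sa" using \<alpha> \<beta> ob by (simp add: lin_rules)
    fix f assume f: "f \<in> hom C ?a ?Sa"
    let ?\<Sigma>f = "fmap \<Sigma> ?a ?Sa f"
    have \<Sigma>f: "?\<Sigma>f \<in> hom C (fobj \<Sigma> ?a) (fobj \<Sigma> ?Sa)" using f ob by (simp add: S_rules(2))
    let ?h = "cmp C x (fobj \<Sigma> ?a) (fobj \<Sigma> ?Sa) ?\<Sigma>f \<theta>"
    have h: "?h \<in> hom C x (fobj \<Sigma> ?Sa)" using \<Sigma>f \<theta> ob x by (simp add: lin_rules)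
    have "pair ?a ?Sa f (cmp C ?Sa ?is ?Sa \<alpha> \<beta>) = pair ?a ?is (cmp C ?a ?Sa ?is \<beta> f) \<alpha>"
      using pair_post[OF ob(1,3,4) \<beta>(1) f \<alpha>(1)] by simp
    also have "\<dots> = ?\<phi> (cmp C ?a ?Sa ?is \<beta> f)" using \<beta> f ob by (intro \<alpha>(2)) (simp add: lin_rules)
    also have "\<dots> = pair x x (ident C x) (cmp C x (fobj \<Sigma> ?Sa) ?s \<beta>' ?h)"
    proof -
      have "cmp C x (fobj \<Sigma> ?is) ?s \<psi> (cmp C x (fobj \<Sigma> ?a) (fobj \<Sigma> ?is) (fmap \<Sigma> ?a ?is (cmp C ?a ?Sa ?is \<beta> f)) \<theta>)
        = cmp C x (fobj \<Sigma> ?Sa) ?s (cmp C (fobj \<Sigma> ?Sa) ?s ?s (cmp C ?s (fobj \<Sigma> ?is) ?s \<psi> \<psi>') \<beta>') ?h"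
        unfolding S_rules(4)[OF ob(1,3,4) f \<beta>(1)] \<beta>(2) using \<beta>'(1) \<psi>(1,2) \<theta> \<Sigma>f ob x
        by (simp add: lin_rules cmp_assoc)
      then show ?thesis unfolding \<psi>(3) using \<beta>'(1) ob by (simp add: lin_rules)
    qed
    also have "\<dots> = pair x (fobj \<Sigma> ?Sa) (cmp C x x (fobj \<Sigma> ?Sa) ?h (ident C x)) \<beta>'"
      using pair_post[OF x x ob(7) h ident_in_hom[OF x] \<beta>'(1)] by simp
    also have "\<dots> = ?\<phi>' ?h" using h x ob \<beta>'(2)[OF h] by (simp add: lin_rules)
    also have "\<dots> = pair ?a ?Sa f (ident C ?Sa)"
    proof -
      have "cmp C (fobj \<Sigma> ?a) x (fobj \<Sigma> ?Sa) ?h \<theta>' = ?\<Sigma>f"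
        using \<Sigma>f \<theta> ob x by (simp add: lin_rules flip: cmp_assoc)
      then show ?thesis using inv\<Sigma>[OF f] by simp
    qed
    finally show "pair ?a ?Sa f (cmp C ?Sa ?is ?Sa \<alpha> \<beta> - ident C ?Sa) = 0"
      using f \<alpha> \<beta> ob by (simp add: pair_diff_right lin_rules)
  qed
  then have "cmp C ?Sa ?is ?Sa \<alpha> \<beta> = ident C ?Sa" by simp
  then show ?thesis by (rule gen_iso[OF ob(3,4) \<beta>(1) \<alpha>(1)])
qed

section \<open>Quotients by ideals\<close>

locale ideal = linear_category scale C
  for scale :: "'k::field \<Rightarrow> 'v::ab_group_add \<Rightarrow> 'v" and C :: "('o, 'v) cat" +
  fixes N :: "'o \<Rightarrow> 'o \<Rightarrow> 'v set"
  assumes N_hom: "\<lbrakk>x \<in> ob C; y \<in> ob C; f \<in> N x y\<rbrakk> \<Longrightarrow> f \<in> hom C x y"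
    and N_zero: "\<lbrakk>x \<in> ob C; y \<in> ob C\<rbrakk> \<Longrightarrow> 0 \<in> N x y"
    and N_diff: "\<lbrakk>x \<in> ob C; y \<in> ob C; f \<in> N x y; g \<in> N x y\<rbrakk> \<Longrightarrow> f - g \<in> N x y"
    and N_post: "\<lbrakk>x \<in> ob C; y \<in> ob C; z \<in> ob C; f \<in> N x y; g \<in> hom C y z\<rbrakk> \<Longrightarrow> cmp C x y z g f \<in> N x z"
    and N_pre: "\<lbrakk>x \<in> ob C; y \<in> ob C; z \<in> ob C; f \<in> hom C x y; g \<in> N y z\<rbrakk> \<Longrightarrow> cmp C x y z g f \<in> N x z"
begin

lemma N_add: "\<lbrakk>x \<in> ob C; y \<in> ob C; f \<in> N x y; g \<in> N x y\<rbrakk> \<Longrightarrow> f + g \<in> N x y"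
  using N_diff[of x y f "0 - g"] N_diff[of x y 0 g] N_zero[of x y] by simp

lemma cls_eq:
  assumes "x \<in> ob C" "y \<in> ob C"
  shows "f +o N x y = g +o N x y \<longleftrightarrow> f - g \<in> N x y"
proof
  assume eq: "f +o N x y = g +o N x y"
  have "f + 0 \<in> f +o N x y" using N_zero[OF assms] by (auto simp: elt_set_plus_def)
  then obtain n where "n \<in> N x y" "f = g + n" unfolding eq by (auto simp: elt_set_plus_def)
  then show "f - g \<in> N x y" by simp
next
  assume n: "f - g \<in> N x y"
  have "f + m \<in> g +o N x y" if "m \<in> N x y" for m
    using N_add[OF assms n that] unfolding elt_set_plus_def
    by (intro CollectI bexI[of _ "f - g + m"]) simp_all
  moreover have "g + m \<in> f +o N x y" if "m \<in> N x y" for m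
    using N_diff[OF assms that n] unfolding elt_set_plus_def
    by (intro CollectI bexI[of _ "m - (f - g)"]) simp_all
  ultimately show "f +o N x y = g +o N x y" by (auto simp: elt_set_plus_def)
qed

lemma cls_mem: "\<lbrakk>x \<in> ob C; y \<in> ob C\<rbrakk> \<Longrightarrow> f' \<in> f +o N x y \<longleftrightarrow> f' - f \<in> N x y"
  unfolding elt_set_plus_def by force

lemma cls_self: "\<lbrakk>x \<in> ob C; y \<in> ob C\<rbrakk> \<Longrightarrow> f \<in> f +o N x y"
  by (simp add: cls_mem N_zero)

lemma mem_cls_hom:
  assumes "x \<in> ob C" "y \<in> ob C" "f \<in> hom C x y" "f' \<in> f +o N x y"
  shows "f' \<in> hom C x y"
proof -
  have "f' - f \<in> hom C x y" using assms by (intro N_hom) (simp_all add: cls_mem)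
  then have "(f' - f) + f \<in> hom C x y" using assms by (intro hom_add)
  then show ?thesis by simp
qed

text \<open>On its objects \<open>A\<close> is the full subcategory of \<open>C/N\<close> on
  \<open>U\<close>. The quotients of the theorem are formed by ideals computed in different
  categories; this predicate forgets how an ideal was obtained and keeps its values on Hom
  spaces.\<close>

definition presents :: "'o set \<Rightarrow> ('o, 'v set) cat \<Rightarrow> bool" where
  "presents U A \<longleftrightarrow> ob A = ob C \<inter> U \<and>
     (\<forall>x \<in> ob A. \<forall>y \<in> ob A. hom A x y = (\<lambda>f. f +o N x y) ` hom C x y) \<and>
     (\<forall>x \<in> ob A. ident A x = ident C x +o N x x) \<and>
     (\<forall>x \<in> ob A. \<forall>y \<in> ob A. \<forall>z \<in> ob A. \<forall>f \<in> hom C x y. \<forall>g \<in> hom C y z.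
        cmp A x y z (g +o N y z) (f +o N x y) = cmp C x y z g f +o N x z)"

lemma presents_ob: "presents U A \<Longrightarrow> x \<in> ob A \<Longrightarrow> x \<in> ob C"
  by (simp add: presents_def)

lemma presents_hom: "\<lbrakk>presents U A; x \<in> ob A; y \<in> ob A\<rbrakk> \<Longrightarrow> hom A x y = (\<lambda>f. f +o N x y) ` hom C x y"
  by (simp add: presents_def)

lemma presents_ident: "\<lbrakk>presents U A; x \<in> ob A\<rbrakk> \<Longrightarrow> ident A x = ident C x +o N x x"
  by (simp add: presents_def)

lemma presents_cmp:
  "\<lbrakk>presents U A; x \<in> ob A; y \<in> ob A; z \<in> ob A; f \<in> hom C x y; g \<in> hom C y z\<rbrakk> \<Longrightarrow>
    cmp A x y z (g +o N y z) (f +o N x y) = cmp C x y z g f +o N x z"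
  unfolding presents_def by blast

lemma presents_homE:
  assumes "presents U A" "x \<in> ob A" "y \<in> ob A" "F \<in> hom A x y"
  obtains f where "f \<in> hom C x y" "F = f +o N x y"
  using assms presents_hom by blast

lemma presents_quotient:
  assumes N': "\<And>x y. \<lbrakk>x \<in> ob C \<inter> U; y \<in> ob C \<inter> U\<rbrakk> \<Longrightarrow> N' x y = N x y"
  shows "presents U (quotient_cat (full_subcat C U) N')"
  unfolding presents_def
proof (intro conjI ballI)
  let ?A = "quotient_cat (full_subcat C U) N'"
  have obA: "ob ?A = ob C \<inter> U" by (simp add: quotient_cat_def full_subcat_def)
  show "ob ?A = ob C \<inter> U" by (rule obA)
  fix x assume x: "x \<in> ob ?A"
  show "ident ?A x = ident C x +o N x x"
    using x N'[of x x] obA by (simp add: quotient_cat_def full_subcat_def)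
  fix y assume y: "y \<in> ob ?A"
  show "hom ?A x y = (\<lambda>f. f +o N x y) ` hom C x y"
    using x y N'[of x y] obA by (simp add: quotient_cat_def full_subcat_def)
  fix z f g assume z: "z \<in> ob ?A" and f: "f \<in> hom C x y" and g: "g \<in> hom C y z"
  have o: "x \<in> ob C" "y \<in> ob C" "z \<in> ob C" using x y z obA by auto
  have "cmp C x y z g' f' +o N x z = cmp C x y z g f +o N x z"
    if "f' \<in> f +o N x y" "g' \<in> g +o N y z" for f' g'
  proof -
    have h: "f' \<in> hom C x y" "g' \<in> hom C y z" using mem_cls_hom o f g that by blast+
    have "cmp C x y z g' f' - cmp C x y z g f = cmp C x y z g' (f' - f) + cmp C x y z (g' - g) f"
      using h o f g by (simp add: lin_rules)
    also have "\<dots> \<in> N x z"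
      using h o f g that by (intro N_add N_post N_pre) (simp_all add: cls_mem)
    finally show ?thesis using cls_eq[OF o(1,3)] by simp
  qed
  moreover have "cmp ?A x y z (g +o N y z) (f +o N x y)
      = (\<Union>g' \<in> g +o N y z. \<Union>f' \<in> f +o N x y. cmp C x y z g' f' +o N x z)"
    using x z N'[of x z] obA by (simp add: quotient_cat_def full_subcat_def)
  moreover have "f \<in> f +o N x y" "g \<in> g +o N y z" using cls_self o by auto
  ultimately show "cmp ?A x y z (g +o N y z) (f +o N x y) = cmp C x y z g f +o N x z" by blast
qed

lemma presents_category:
  assumes A: "presents U A"
  shows "category A"
proof
  note [simp] = presents_ident[OF A] presents_cmp[OF A]
  note ho = presents_hom[OF A] and o = presents_ob[OF A]
  show "ident A x \<in> hom A x x" if "x \<in> ob A" for x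
    using that o[OF that] ho by (simp add: lin_rules)
  show "cmp A x y z f g \<in> hom A x z"
    if "x \<in> ob A" "y \<in> ob A" "z \<in> ob A" "g \<in> hom A x y" "f \<in> hom A y z" for x y z f g
    using that o ho by (auto simp: lin_rules)
  show "cmp A x x y f (ident A x) = f" if "x \<in> ob A" "y \<in> ob A" "f \<in> hom A x y" for x y f
    using that o ho by (auto simp: lin_rules)
  show "cmp A x y y (ident A y) f = f" if "x \<in> ob A" "y \<in> ob A" "f \<in> hom A x y" for x y f
    using that o ho by (auto simp: lin_rules)
  show "cmp A w y z h (cmp A w x y g f) = cmp A w x z (cmp A x y z h g) f"
    if a: "w \<in> ob A" "x \<in> ob A" "y \<in> ob A" "z \<in> ob A" "f \<in> hom A w x" "g \<in> hom A x y" "h \<in> hom A y z"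
    for w x y z f g h
  proof -
    obtain f' where "f' \<in> hom C w x" "f = f' +o N w x" using presents_homE[OF A a(1,2,5)] by metis
    moreover obtain g' where "g' \<in> hom C x y" "g = g' +o N x y" using presents_homE[OF A a(2,3,6)] by metis
    moreover obtain h' where "h' \<in> hom C y z" "h = h' +o N y z" using presents_homE[OF A a(3,4,7)] by metis
    ultimately show ?thesis using a o by (simp add: lin_rules cmp_assoc)
  qed
qed

lemma quotient_bij_left:
  assumes Q: "presents U Q" and o: "u \<in> ob Q" "x \<in> ob Q" "y \<in> ob Q" and w: "w \<in> hom C x y"
    and lift: "\<And>f. f \<in> hom C u y \<Longrightarrow> \<exists>g \<in> hom C u x. f - cmp C u x y w g \<in> N u y"
    and cancel: "\<And>g. \<lbrakk>g \<in> hom C u x; cmp C u x y w g \<in> N u y\<rbrakk> \<Longrightarrow> g \<in> N u x"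
  shows "bij_betw (cmp Q u x y (w +o N x y)) (hom Q u x) (hom Q u y)"
proof (rule bij_betw_imageI)
  note oC = o[THEN presents_ob[OF Q]] and c = presents_cmp[OF Q o _ w] and h = presents_hom[OF Q]
  show "inj_on (cmp Q u x y (w +o N x y)) (hom Q u x)"
  proof (rule inj_onI)
    fix F G assume "F \<in> hom Q u x" "G \<in> hom Q u x"
      and eq: "cmp Q u x y (w +o N x y) F = cmp Q u x y (w +o N x y) G"
    then obtain f g where fg: "f \<in> hom C u x" "F = f +o N u x" "g \<in> hom C u x" "G = g +o N u x"
      using presents_homE[OF Q o(1,2)] by metis
    then have "cmp C u x y w f - cmp C u x y w g \<in> N u y" using eq cls_eq[OF oC(1,3)] c by simp
    then have "f - g \<in> N u x" using fg oC w by (intro cancel) (simp_all add: lin_rules)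
    then show "F = G" using fg cls_eq[OF oC(1,2)] by simp
  qed
  show "cmp Q u x y (w +o N x y) ` hom Q u x = hom Q u y"
  proof (intro subset_antisym subsetI)
    fix F assume "F \<in> hom Q u y"
    then obtain f where f: "f \<in> hom C u y" "F = f +o N u y" using presents_homE[OF Q o(1,3)] by metis
    then obtain g where g: "g \<in> hom C u x" "f - cmp C u x y w g \<in> N u y" using lift by blast
    then have "F = cmp Q u x y (w +o N x y) (g +o N u x)" using f c cls_eq[OF oC(1,3)] by simp
    then show "F \<in> cmp Q u x y (w +o N x y) ` hom Q u x" using g(1) h[OF o(1,2)] by blast
  next
    fix F assume "F \<in> cmp Q u x y (w +o N x y) ` hom Q u x"
    then obtain g where "g \<in> hom C u x" "F = cmp C u x y w g +o N u y" using h[OF o(1,2)] c by auto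
    then show "F \<in> hom Q u y" using h[OF o(1,3)] w oC by (auto simp: lin_rules)
  qed
qed

lemma quotient_bij_right:
  assumes Q: "presents U Q" and o: "x \<in> ob Q" "y \<in> ob Q" "v \<in> ob Q" and w: "w \<in> hom C x y"
    and lift: "\<And>f. f \<in> hom C x v \<Longrightarrow> \<exists>g \<in> hom C y v. f - cmp C x y v g w \<in> N x v"
    and cancel: "\<And>g. \<lbrakk>g \<in> hom C y v; cmp C x y v g w \<in> N x v\<rbrakk> \<Longrightarrow> g \<in> N y v"
  shows "bij_betw (\<lambda>f. cmp Q x y v f (w +o N x y)) (hom Q y v) (hom Q x v)"
proof (rule bij_betw_imageI)
  note oC = o[THEN presents_ob[OF Q]] and c = presents_cmp[OF Q o w] and h = presents_hom[OF Q]
  show "inj_on (\<lambda>f. cmp Q x y v f (w +o N x y)) (hom Q y v)"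
  proof (rule inj_onI)
    fix F G assume "F \<in> hom Q y v" "G \<in> hom Q y v"
      and eq: "cmp Q x y v F (w +o N x y) = cmp Q x y v G (w +o N x y)"
    then obtain f g where fg: "f \<in> hom C y v" "F = f +o N y v" "g \<in> hom C y v" "G = g +o N y v"
      using presents_homE[OF Q o(2,3)] by metis
    then have "cmp C x y v f w - cmp C x y v g w \<in> N x v" using eq cls_eq[OF oC(1,3)] c by simp
    then have "f - g \<in> N y v" using fg oC w by (intro cancel) (simp_all add: lin_rules)
    then show "F = G" using fg cls_eq[OF oC(2,3)] by simp
  qed
  show "(\<lambda>f. cmp Q x y v f (w +o N x y)) ` hom Q y v = hom Q x v"
  proof (intro subset_antisym subsetI)
    fix F assume "F \<in> hom Q x v"
    then obtain f where f: "f \<in> hom C x v" "F = f +o N x v" using presents_homE[OF Q o(1,3)] by metis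
    then obtain g where g: "g \<in> hom C y v" "f - cmp C x y v g w \<in> N x v" using lift by blast
    then have "F = cmp Q x y v (g +o N y v) (w +o N x y)" using f c cls_eq[OF oC(1,3)] by simp
    then show "F \<in> (\<lambda>f. cmp Q x y v f (w +o N x y)) ` hom Q y v" using g(1) h[OF o(2,3)] by blast
  next
    fix F assume "F \<in> (\<lambda>f. cmp Q x y v f (w +o N x y)) ` hom Q y v"
    then obtain g where "g \<in> hom C y v" "F = cmp C x y v g w +o N x v" using h[OF o(2,3)] c by auto
    then show "F \<in> hom Q x v" using h[OF o(1,3)] w oC by (auto simp: lin_rules)
  qed
qed

text \<open>Serves twice: with the identity for \<open>I\<close> and \<open>J\<close>, and with
  \<open>S \<Sigma>\<^sup>-\<^sup>1\<close> for the embedding of the quotient by \<open>(T)\<close>.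
  That \<open>F\<close> pulls \<open>N\<close> back to \<open>N'\<close> is faithfulness on the
  quotients; fullness comes from \<open>F\<close>.\<close>

lemma presents_ff:
  assumes A: "ideal.presents C N' U' A" and ideal': "ideal scale C N'" and Q: "presents U Q"
    and F: "autoequiv C F" and obK: "\<And>x. x \<in> ob A \<Longrightarrow> fobj F x \<in> U"
    and N': "\<And>x y f. \<lbrakk>x \<in> ob A; y \<in> ob A; f \<in> hom C x y\<rbrakk> \<Longrightarrow> f \<in> N' x y \<longleftrightarrow> fmap F x y f \<in> N (fobj F x) (fobj F y)"
    and K: "\<And>x. x \<in> ob A \<Longrightarrow> fobj K x = fobj F x"
      "\<And>x y f. \<lbrakk>x \<in> ob A; y \<in> ob A; f \<in> hom C x y\<rbrakk> \<Longrightarrow>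
         fmap K x y (f +o N' x y) = fmap F x y f +o N (fobj F x) (fobj F y)"
  shows "fully_faithful A Q K"
proof -
  interpret N': ideal scale C N' by (rule ideal')
  note Fr = functor_rules[OF autoequiv_functor[OF F]]
  note oA = N'.presents_ob[OF A]
  have oQ: "fobj F x \<in> ob Q" if "x \<in> ob A" for x
    using Q obK[OF that] Fr(1)[OF oA[OF that]] by (simp add: presents_def)
  have bij: "bij_betw (fmap K x y) (hom A x y) (hom Q (fobj K x) (fobj K y))"
    if xy: "x \<in> ob A" "y \<in> ob A" for x y
  proof (rule bij_betw_imageI)
    note o = oA[OF xy(1)] oA[OF xy(2)] and FQ = oQ[OF xy(1)] oQ[OF xy(2)]
    show "inj_on (fmap K x y) (hom A x y)"
    proof (rule inj_onI)
      fix G H assume "G \<in> hom A x y" "H \<in> hom A x y" and eq: "fmap K x y G = fmap K x y H"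
      then obtain g h where gh: "g \<in> hom C x y" "G = g +o N' x y" "h \<in> hom C x y" "H = h +o N' x y"
        using N'.presents_homE[OF A xy] by metis
      then have "fmap F x y g - fmap F x y h \<in> N (fobj F x) (fobj F y)"
        using eq K(2)[OF xy] cls_eq[OF Fr(1)[OF o(1)] Fr(1)[OF o(2)]] by simp
      then have "g - h \<in> N' x y" using N'[OF xy] autoequiv_diff[OF F o gh(1,3)] gh o by (simp add: lin_rules)
      then show "G = H" using gh N'.cls_eq[OF o] by simp
    qed
    show "fmap K x y ` hom A x y = hom Q (fobj K x) (fobj K y)"
    proof (intro subset_antisym subsetI)
      fix G assume "G \<in> hom Q (fobj K x) (fobj K y)"
      then obtain g where g: "g \<in> hom C (fobj F x) (fobj F y)" "G = g +o N (fobj F x) (fobj F y)"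
        using presents_homE[OF Q FQ] K(1) xy by metis
      obtain f where f: "f \<in> hom C x y" "fmap F x y f = g" by (rule ff_full[OF autoequiv_ff[OF F] o g(1)])
      then have "G = fmap K x y (f +o N' x y)" using g K(2)[OF xy] by simp
      then show "G \<in> fmap K x y ` hom A x y" using f(1) N'.presents_hom[OF A xy] by blast
    next
      fix G assume "G \<in> fmap K x y ` hom A x y"
      then obtain f where f: "f \<in> hom C x y" "G = fmap F x y f +o N (fobj F x) (fobj F y)"
        using N'.presents_hom[OF A xy] K(2)[OF xy] by auto
      then show "G \<in> hom Q (fobj K x) (fobj K y)"
        using presents_hom[OF Q FQ] K(1) xy Fr(2)[OF o f(1)] by simp
    qed
  qed
  have "is_functor A Q K"
    unfolding is_functor_def
  proof (intro conjI ballI)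
    fix x assume x: "x \<in> ob A"
    show "fobj K x \<in> ob Q" using K(1)[OF x] oQ[OF x] by simp
    show "fmap K x x (ident A x) = ident Q (fobj K x)"
      using K(1)[OF x] K(2)[OF x x ident_in_hom[OF oA[OF x]]] N'.presents_ident[OF A x]
        presents_ident[OF Q oQ[OF x]] Fr(3)[OF oA[OF x]] by simp
  next
    fix x y f assume "x \<in> ob A" "y \<in> ob A" "f \<in> hom A x y"
    then show "fmap K x y f \<in> hom Q (fobj K x) (fobj K y)" using bij by (blast dest: bij_betwE)
  next
    fix x y z G H assume o: "x \<in> ob A" "y \<in> ob A" "z \<in> ob A" and "G \<in> hom A x y" "H \<in> hom A y z"
    then obtain g h where gh: "g \<in> hom C x y" "G = g +o N' x y" "h \<in> hom C y z" "H = h +o N' y z"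
      using N'.presents_homE[OF A] by metis
    have hg: "cmp C x y z h g \<in> hom C x z" using gh oA o by (simp add: lin_rules)
    show "fmap K x z (cmp A x y z H G) = cmp Q (fobj K x) (fobj K y) (fobj K z) (fmap K y z H) (fmap K x y G)"
      using N'.presents_cmp[OF A o gh(1,3)] K(1)[OF o(1)] K(1)[OF o(2)] K(1)[OF o(3)]
        K(2)[OF o(1,3) hg] K(2)[OF o(1,2) gh(1)] K(2)[OF o(2,3) gh(3)] gh
        presents_cmp[OF Q oQ[OF o(1)] oQ[OF o(2)] oQ[OF o(3)], of "fmap F x y g" "fmap F y z h"]
        Fr(2)[OF oA[OF o(1)] oA[OF o(2)] gh(1)] Fr(2)[OF oA[OF o(2)] oA[OF o(3)] gh(3)]
        Fr(4)[OF oA[OF o(1)] oA[OF o(2)] oA[OF o(3)] gh(1,3)] by simp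
  qed
  with bij show ?thesis by (simp add: fully_faithful_def)
qed

end

lemma (in linear_category) ideal_null_on:
  assumes "t \<in> ob C"
  shows "ideal scale C (null_on C t)"
  by unfold_locales
    (use assms in \<open>simp_all add: null_on_hom null_on_zero null_on_diff null_on_post null_on_pre\<close>)

lemma (in linear_category) ideal_null_on_opp:
  assumes "t \<in> ob C"
  shows "ideal scale C (\<lambda>x y. null_on (opp C) t y x)"
proof -
  interpret O: linear_category scale "opp C" by (rule linear_opp)
  show ?thesis
    by unfold_locales
      (use assms O.null_on_zero O.null_on_diff O.null_on_post O.null_on_pre null_on_hom[of _ "opp C"] in \<open>simp_all\<close>)
qed

lemma (in linear_category) autoequiv_fid: "autoequiv C fid"
proof -
  have "is_iso C x x (ident C x)" if "x \<in> ob C" for x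
    using that by (intro is_isoI[of _ C _ _ "ident C x"]) (simp_all add: lin_rules)
  then show ?thesis
    unfolding autoequiv_def fully_faithful_def is_functor_def by (auto simp: bij_betw_def inj_on_def)
qed

section \<open>Ideals of morphisms factoring through a subcategory\<close>

lemma factor_ideal_opp [simp]: "factor_ideal (opp C) A y x = factor_ideal C A x y"
  unfolding factor_ideal_def by auto

lemma opp_full_subcat: "full_subcat (opp C) U = opp (full_subcat C U)"
  by (simp add: full_subcat_def opp_def)

text \<open>\<open>thru\<close> allows sums of composites over several objects,
  \<open>factor_ideal\<close> a single middle object; biproducts collect the summands.\<close>

lemma (in add_category) thru_factor:
  assumes "f \<in> thru C Z x y" "Z \<subseteq> ob C" "x \<in> ob C" "y \<in> ob C"
  obtains p g h where "p \<in> gen C Z" "g \<in> hom C x p" "h \<in> hom C p y" "f = cmp C x p y h g"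
proof -
  from assms(1) have "\<exists>p g h. p \<in> gen C Z \<and> g \<in> hom C x p \<and> h \<in> hom C p y \<and> f = cmp C x p y h g"
  proof induct
    case zero
    obtain n where n: "n \<in> ob C" "ident C n = 0" using zero_object by blast
    then show ?case
      using assms by (intro exI[of _ n] exI[of _ 0]) (simp add: gen_def thru.zero lin_rules)
  next
    case (add s z f g)
    then obtain p a b where p: "p \<in> gen C Z" "a \<in> hom C x p" "b \<in> hom C p y" "s = cmp C x p y b a" by blast
    have o: "p \<in> ob C" "z \<in> ob C" using p(1) gen_ob add assms by auto
    obtain q i j r t where b: "biprod C p z q i j r t" using biproducts[OF o] by blast
    note b' = b[unfolded biprod_def]
    have bt: "q \<in> ob C" "i \<in> hom C p q" "j \<in> hom C z q" "r \<in> hom C q p" "t \<in> hom C q z"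
      using b' by simp_all
    have "z \<in> gen C Z" using add o by (intro gen_self)
    then have "cmp C q p q i r + cmp C q z q j t \<in> thru C Z q q"
      using p(1) b' assms by (intro thru_plus thru_via_gen) auto
    then have "q \<in> gen C Z" using b' by (simp add: gen_def)
    moreover have "cmp C x p q i a + cmp C x z q j f \<in> hom C x q" "cmp C q p y b r + cmp C q z y g t \<in> hom C q y"
      using p add b' assms o by (simp_all add: lin_rules)
    moreover have "s + cmp C x z y g f
        = cmp C x q y (cmp C q p y b r + cmp C q z y g t) (cmp C x p q i a + cmp C x z q j f)"
    proof -
      have "cmp C x q y (cmp C q p y b r) (cmp C x p q i a) = cmp C x p y b (cmp C x p p (cmp C p q p r i) a)"
        "cmp C x q y (cmp C q p y b r) (cmp C x z q j f) = cmp C x p y b (cmp C x z p (cmp C z q p r j) f)"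
        "cmp C x q y (cmp C q z y g t) (cmp C x p q i a) = cmp C x z y g (cmp C x p z (cmp C p q z t i) a)"
        "cmp C x q y (cmp C q z y g t) (cmp C x z q j f) = cmp C x z y g (cmp C x z z (cmp C z q z t j) f)"
        using p(2,3) add(4,5) bt assms(3,4) o by (simp_all add: lin_rules cmp_assoc)
      then show ?thesis using p add b' assms o by (simp add: lin_rules)
    qed
    ultimately show ?case by blast
  qed
  with that show thesis by blast
qed

text \<open>The middle object must lie in the subcategory \<open>W\<close> as well as in
  \<open>A\<close>. All classes between \<open>add (P \<oplus> N)\<close> and the objects without
  maps from \<open>Tb\<close> give the same ideal on maps out of objects with strings.\<close>

lemma (in mutation_pair) factor_ideal_eq_null_on:
  assumes x: "strung x" "y \<in> ob C" and W: "gen C {P, N} \<subseteq> W" "gen C {P, N} \<subseteq> A"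
    and A: "\<And>a. a \<in> A \<Longrightarrow> a \<in> ob C \<Longrightarrow> hom C Tb a = {0}"
  shows "factor_ideal (full_subcat C W) A x y = NN x y"
proof (intro subset_antisym subsetI)
  have xo: "x \<in> ob C" using x(1) by (rule strung_ob)
  fix f assume "f \<in> factor_ideal (full_subcat C W) A x y"
  then obtain a g h where a: "a \<in> ob C" "a \<in> A" "g \<in> hom C x a" "h \<in> hom C a y" "f = cmp C x a y h g"
    by (auto simp: factor_ideal_def full_subcat_def)
  have "g \<in> NN x a" unfolding null_on_def
  proof (intro CollectI conjI ballI a(3))
    fix t assume "t \<in> hom C Tb x"
    then have "cmp C Tb x a g t \<in> hom C Tb a" using a(1,3) xo obs by (simp add: lin_rules)
    then show "cmp C Tb x a g t = 0" using A[OF a(2,1)] by simp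
  qed
  then show "f \<in> NN x y" using a x xo obs by (simp add: null_on_post)
next
  have xo: "x \<in> ob C" using x(1) by (rule strung_ob)
  fix f assume "f \<in> NN x y"
  then have "f \<in> thru C {P, N} x y" by (rule thru_of_null_on[OF x])
  then obtain p g h where p: "p \<in> gen C {P, N}" "g \<in> hom C x p" "h \<in> hom C p y" "f = cmp C x p y h g"
    by (rule thru_factor) (use obs xo x in auto)
  show "f \<in> factor_ideal (full_subcat C W) A x y"
    unfolding factor_ideal_def full_subcat_def
    by (intro CollectI exI[of _ p] exI[of _ g] exI[of _ h]) (use p W gen_ob[OF p(1)] in auto)
qed

section \<open>Transport along autoequivalences\<close>

context linear_category
begin

lemma null_on_transfer:
  assumes F: "autoequiv C F" and o: "t \<in> ob C" "t' \<in> ob C" "x \<in> ob C" "y \<in> ob C"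
    and iso: "\<theta> \<in> hom C (fobj F t) t'" "\<theta>' \<in> hom C t' (fobj F t)"
      "cmp C (fobj F t) t' (fobj F t) \<theta>' \<theta> = ident C (fobj F t)" "cmp C t' (fobj F t) t' \<theta> \<theta>' = ident C t'"
    and f: "f \<in> hom C x y"
  shows "f \<in> null_on (opp C) t y x \<longleftrightarrow> fmap F x y f \<in> null_on (opp C) t' (fobj F y) (fobj F x)"
proof -
  let ?Ft = "fobj F t" and ?Fx = "fobj F x" and ?Fy = "fobj F y"
  note Fr = functor_rules[OF autoequiv_functor[OF F]]
  have ob: "?Ft \<in> ob C" "?Fx \<in> ob C" "?Fy \<in> ob C" using o Fr(1) by simp_all
  have Ff: "fmap F x y f \<in> hom C ?Fx ?Fy" using f o by (simp add: Fr)
  have "cmp C ?Fx ?Fy t' s (fmap F x y f) = 0"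
    if s: "s \<in> hom C ?Fy t'" and null: "\<forall>h \<in> hom C y t. cmp C x y t h f = 0" for s
  proof -
    have "cmp C ?Fy t' ?Ft \<theta>' s \<in> hom C ?Fy ?Ft" using s iso o ob by (simp add: lin_rules)
    then obtain h where h: "h \<in> hom C y t" "fmap F y t h = cmp C ?Fy t' ?Ft \<theta>' s"
      by (rule ff_full[OF autoequiv_ff[OF F] o(4,1)])
    have "s = cmp C ?Fy ?Ft t' \<theta> (fmap F y t h)"
      unfolding h(2) using s iso o ob by (simp add: lin_rules cmp_assoc)
    then have "cmp C ?Fx ?Fy t' s (fmap F x y f)
        = cmp C ?Fx ?Ft t' \<theta> (fmap F x t (cmp C x y t h f))"
      using h(1) f Ff iso o ob by (simp add: Fr cmp_assoc)
    then show ?thesis using null h(1) iso o ob autoequiv_zero[OF F o(3,1)] by (simp add: lin_rules)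
  qed
  moreover have "cmp C x y t h f = 0"
    if h: "h \<in> hom C y t" and null: "\<forall>s \<in> hom C ?Fy t'. cmp C ?Fx ?Fy t' s (fmap F x y f) = 0" for h
  proof -
    have Fh: "fmap F y t h \<in> hom C ?Fy ?Ft" using h o by (simp add: Fr)
    have "fmap F x t (cmp C x y t h f)
        = cmp C ?Fx t' ?Ft \<theta>' (cmp C ?Fx ?Fy t' (cmp C ?Fy ?Ft t' \<theta> (fmap F y t h)) (fmap F x y f))"
      using h Fh f Ff iso o ob by (simp add: Fr cmp_assoc lin_rules)
    also have "\<dots> = 0" using null Fh iso o ob by (simp add: lin_rules)
    finally show ?thesis using autoequiv_eq_0[OF F o(3,1)] h f o by (simp add: lin_rules)
  qed
  ultimately show ?thesis using f Ff unfolding null_on_def by auto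
qed

text \<open>\<open>F t\<close>, \<open>F r\<close> and \<open>F x\<close> are known only up to
  isomorphism, whereas \<open>F y\<close> is kept: it has to be the image of a given object under an
  embedding. So \<open>w\<close> is moved by \<open>F\<close> and precomposed with
  \<open>k'\<close>.\<close>

lemma wequiv_transfer:
  assumes F: "autoequiv C F" and o: "t \<in> ob C" "t' \<in> ob C" "r \<in> ob C" "r' \<in> ob C" "x \<in> ob C" "x' \<in> ob C" "y \<in> ob C"
    and \<theta>: "\<theta> \<in> hom C (fobj F t) t'" "\<theta>' \<in> hom C t' (fobj F t)"
      "cmp C (fobj F t) t' (fobj F t) \<theta>' \<theta> = ident C (fobj F t)" "cmp C t' (fobj F t) t' \<theta> \<theta>' = ident C t'"
    and \<rho>: "\<rho> \<in> hom C (fobj F r) r'" "\<rho>' \<in> hom C r' (fobj F r)"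
      "cmp C (fobj F r) r' (fobj F r) \<rho>' \<rho> = ident C (fobj F r)" "cmp C r' (fobj F r) r' \<rho> \<rho>' = ident C r'"
    and k: "k \<in> hom C (fobj F x) x'" "k' \<in> hom C x' (fobj F x)"
      "cmp C (fobj F x) x' (fobj F x) k' k = ident C (fobj F x)" "cmp C x' (fobj F x) x' k k' = ident C x'"
    and w: "w \<in> wequiv (opp C) t r y x"
  shows "cmp C x' (fobj F x) (fobj F y) (fmap F x y w) k' \<in> wequiv (opp C) t' r' (fobj F y) x'"
proof -
  let ?Ft = "fobj F t" and ?Fr = "fobj F r" and ?Fx = "fobj F x" and ?Fy = "fobj F y"
  note Fr = functor_rules[OF autoequiv_functor[OF F]]
  interpret O: linear_category scale "opp C" by (rule linear_opp)
  have ob: "?Ft \<in> ob C" "?Fr \<in> ob C" "?Fx \<in> ob C" "?Fy \<in> ob C" using o Fr(1) by simp_all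
  have wh: "w \<in> hom C x y" using w by (simp add: wequiv_def)
  have Fw: "fmap F x y w \<in> hom C ?Fx ?Fy" using wh o by (simp add: Fr)
  let ?w = "cmp C x' ?Fx ?Fy (fmap F x y w) k'"
  have w'h: "?w \<in> hom C x' ?Fy" using Fw k o ob by (simp add: lin_rules)
  have wk: "cmp C ?Fx x' ?Fy ?w k = fmap F x y w"
    using Fw k o ob by (simp add: lin_rules flip: cmp_assoc)
  have cancel: "h = 0" if h: "h \<in> hom C ?Fy t'" "cmp C x' ?Fy t' h ?w = 0" for h
  proof -
    have "cmp C ?Fy t' ?Ft \<theta>' h \<in> hom C ?Fy ?Ft" using h \<theta> o ob by (simp add: lin_rules)
    then obtain h0 where h0: "h0 \<in> hom C y t" "fmap F y t h0 = cmp C ?Fy t' ?Ft \<theta>' h"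
      by (rule ff_full[OF autoequiv_ff[OF F] o(7,1)])
    have "fmap F x t (cmp C x y t h0 w)
        = cmp C ?Fx t' ?Ft \<theta>' (cmp C ?Fx x' t' (cmp C x' ?Fy t' h ?w) k)"
      using h(1) h0 wh Fw w'h wk \<theta> k(1) o ob by (simp add: Fr flip: cmp_assoc)
    then have "fmap F x t (cmp C x y t h0 w) = 0" using h(2) \<theta> k o ob by (simp add: lin_rules)
    then have "cmp C x y t h0 w = 0" using autoequiv_eq_0[OF F o(5,1)] h0 wh o by (simp add: lin_rules)
    then have "h0 = 0" using w h0(1) by (simp add: wequiv_def)
    then have "cmp C ?Fy t' ?Ft \<theta>' h = 0" using h0(2) autoequiv_zero[OF F o(7,1)] by simp
    then have "cmp C ?Fy ?Ft t' \<theta> (cmp C ?Fy t' ?Ft \<theta>' h) = 0" using \<theta> o ob by (simp add: lin_rules)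
    then show ?thesis using h \<theta> o ob by (simp add: lin_rules cmp_assoc)
  qed
  have comp: "cmp C x' ?Fy s' (cmp C ?Fy (fobj F s) s' \<sigma> (fmap F y s g)) ?w
      = cmp C x' ?Fx s' (cmp C ?Fx (fobj F s) s' \<sigma> (fmap F x s (cmp C x y s g w))) k'"
    if "s \<in> ob C" "s' \<in> ob C" "\<sigma> \<in> hom C (fobj F s) s'" "g \<in> hom C y s" for s s' \<sigma> g
    using that wh Fw k o ob Fr(1)[OF that(1)] Fr(2)[OF o(7) that(1,4)] by (simp add: Fr(4) cmp_assoc lin_rules)
  have lift: "\<exists>g\<in>hom C ?Fy t'. h = cmp C x' ?Fy t' g ?w" if h: "h \<in> hom C x' t'" for h
  proof -
    let ?h = "cmp C ?Fx t' ?Ft \<theta>' (cmp C ?Fx x' t' h k)"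
    have "?h \<in> hom C ?Fx ?Ft" using h \<theta> k o ob by (simp add: lin_rules)
    then obtain h0 where h0: "h0 \<in> hom C x t" "fmap F x t h0 = ?h"
      by (rule ff_full[OF autoequiv_ff[OF F] o(5,1)])
    obtain g where g: "g \<in> hom C y t" "h0 = cmp C x y t g w" using w h0(1) unfolding wequiv_def by auto
    have "cmp C ?Fx ?Ft t' \<theta> ?h = cmp C ?Fx x' t' h k"
      using h \<theta> k o ob by (simp add: lin_rules cmp_assoc)
    then have "cmp C x' ?Fy t' (cmp C ?Fy ?Ft t' \<theta> (fmap F y t g)) ?w = h"
      using comp[OF o(1,2) \<theta>(1) g(1)] g(2) h0(2) h k o ob by (simp add: lin_rules flip: cmp_assoc)
    moreover have "cmp C ?Fy ?Ft t' \<theta> (fmap F y t g) \<in> hom C ?Fy t'"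
      using g \<theta> o ob by (simp add: lin_rules Fr)
    ultimately show ?thesis by metis
  qed
  have lift_r: "\<exists>g\<in>hom C ?Fy r'. h - cmp C x' ?Fy r' g ?w \<in> null_on (opp C) t' r' x'"
    if h: "h \<in> hom C x' r'" for h
  proof -
    let ?h = "cmp C ?Fx r' ?Fr \<rho>' (cmp C ?Fx x' r' h k)"
    have "?h \<in> hom C ?Fx ?Fr" using h \<rho> k o ob by (simp add: lin_rules)
    then obtain h0 where h0: "h0 \<in> hom C x r" "fmap F x r h0 = ?h"
      by (rule ff_full[OF autoequiv_ff[OF F] o(5,3)])
    obtain g where g: "g \<in> hom C y r" "h0 - cmp C x y r g w \<in> null_on (opp C) t r x"
      using w h0(1) unfolding wequiv_def by auto
    let ?d = "h0 - cmp C x y r g w"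
    let ?g = "cmp C ?Fy ?Fr r' \<rho> (fmap F y r g)"
    have gw: "cmp C x y r g w \<in> hom C x r" using g wh o by (simp add: lin_rules)
    have d: "?d \<in> hom C x r" using gw h0 o by (simp add: lin_rules)
    have Fd: "fmap F x r ?d \<in> hom C ?Fx ?Fr" using d o by (simp add: Fr)
    have Fgw: "fmap F x r (cmp C x y r g w) \<in> hom C ?Fx ?Fr" using gw o by (simp add: Fr)
    have gh: "?g \<in> hom C ?Fy r'" using g \<rho> o ob by (simp add: lin_rules Fr)
    have "cmp C ?Fx ?Fr r' \<rho> ?h = cmp C ?Fx x' r' h k"
      using h \<rho> k o ob by (simp add: lin_rules cmp_assoc)
    then have "cmp C x' ?Fx r' (cmp C ?Fx ?Fr r' \<rho> (fmap F x r h0)) k' = h"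
      using h0(2) h k o ob by (simp add: lin_rules flip: cmp_assoc)
    then have "h - cmp C x' ?Fy r' ?g ?w
        = cmp C x' ?Fx r' (cmp C ?Fx ?Fr r' \<rho> (fmap F x r ?d)) k'"
      using comp[OF o(3,4) \<rho>(1) g(1)] autoequiv_diff[OF F o(5,3) h0(1) gw] \<rho> k o ob Fgw
        Fr(2)[OF o(5,3) h0(1)] by (simp add: lin_rules)
    moreover have "cmp C x' ?Fx r' (cmp C ?Fx ?Fr r' \<rho> (fmap F x r ?d)) k' \<in> null_on (opp C) t' r' x'"
    proof -
      have "fmap F x r ?d \<in> null_on (opp C) t' ?Fr ?Fx"
        using null_on_transfer[OF F o(1,2,5,3) \<theta> d] g(2) by simp
      then have "cmp C ?Fx ?Fr r' \<rho> (fmap F x r ?d) \<in> null_on (opp C) t' r' ?Fx"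
        using O.null_on_pre[of t' "?Fr" "?Fx" r' "fmap F x r ?d" \<rho>] \<rho> o ob by simp
      then show ?thesis
        using O.null_on_post[of t' r' "?Fx" x' _ k'] k o ob by simp
    qed
    ultimately show ?thesis using gh by metis
  qed
  show ?thesis unfolding wequiv_def using w'h cancel lift lift_r by auto
qed

end

section \<open>Extension classes\<close>

context triangulated_category
begin

lemma gen_susp_inv:
  assumes "y \<in> ob C" "x \<in> gen C {fobj \<Sigma> y}"
  shows "fobj \<Sigma>i x \<in> gen C {y}"
proof -
  have sy: "fobj \<Sigma> y \<in> ob C" "fobj \<Sigma>i (fobj \<Sigma> y) \<in> ob C"
    using assms S_rules(1) Si_rules(1) by simp_all
  obtain f g where "f \<in> hom C (fobj \<Sigma>i (fobj \<Sigma> y)) y" "g \<in> hom C y (fobj \<Sigma>i (fobj \<Sigma> y))"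
    "cmp C (fobj \<Sigma>i (fobj \<Sigma> y)) y (fobj \<Sigma>i (fobj \<Sigma> y)) g f = ident C (fobj \<Sigma>i (fobj \<Sigma> y))"
    using susp_inv_iso[OF assms(1)] by metis
  then have "fobj \<Sigma>i (fobj \<Sigma> y) \<in> gen C {y}" by (rule gen_iso[OF sy(2) assms(1)])
  moreover have "fobj \<Sigma>i x \<in> gen C {fobj \<Sigma>i (fobj \<Sigma> y)}"
    using autoequiv_gen[OF susp_inv assms(2)] sy by simp
  ultimately show ?thesis using gen_trans[of _ "{fobj \<Sigma>i (fobj \<Sigma> y)}" "{y}"] assms(1) by simp
qed

lemma gen_susp: "\<lbrakk>y \<in> ob C; x \<in> gen C {y}\<rbrakk> \<Longrightarrow> fobj \<Sigma> x \<in> gen C {fobj \<Sigma> y}"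
  using autoequiv_gen[OF susp, of x "{y}"] by simp

lemma gen_susp_susp_inv:
  assumes "y \<in> ob C"
  shows "fobj \<Sigma> (fobj \<Sigma>i y) \<in> gen C {y}" "y \<in> gen C {fobj \<Sigma> (fobj \<Sigma>i y)}"
proof -
  have o: "fobj \<Sigma> (fobj \<Sigma>i y) \<in> ob C" using assms S_rules(1) Si_rules(1) by simp
  obtain f g where *: "f \<in> hom C (fobj \<Sigma> (fobj \<Sigma>i y)) y" "g \<in> hom C y (fobj \<Sigma> (fobj \<Sigma>i y))"
    "cmp C (fobj \<Sigma> (fobj \<Sigma>i y)) y (fobj \<Sigma> (fobj \<Sigma>i y)) g f = ident C (fobj \<Sigma> (fobj \<Sigma>i y))"
    "cmp C y (fobj \<Sigma> (fobj \<Sigma>i y)) y f g = ident C y"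
    using susp_iso[OF assms] by metis
  show "fobj \<Sigma> (fobj \<Sigma>i y) \<in> gen C {y}" by (rule gen_iso[OF o assms *(1,2,3)])
  show "y \<in> gen C {fobj \<Sigma> (fobj \<Sigma>i y)}" by (rule gen_iso[OF assms o *(2,1,4)])
qed

lemma zero_gen: obtains z where "z \<in> gen C Z" "is_zero_obj C z" "z \<in> ob C" "ident C z = 0"
  using zero_ob thru.zero[of C Z] by (metis (mono_tags, lifting) gen_def mem_Collect_eq)

lemma gen_in_star_left:
  assumes "x \<in> gen C Z"
  shows "x \<in> star C \<Delta> (gen C Z) (gen C Z')"
proof -
  obtain z where z: "z \<in> gen C Z'" "is_zero_obj C z" using zero_gen by metis
  have "(x, x, z, ident C x, 0, 0) \<in> \<Delta>" using tri_ident[OF gen_ob[OF assms] z(2)] .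
  then show ?thesis using assms z(1) gen_ob[OF assms] unfolding star_def by blast
qed

lemma gen_in_star_right:
  assumes "x \<in> gen C Z'"
  shows "x \<in> star C \<Delta> (gen C Z) (gen C Z')"
proof -
  obtain z where z: "z \<in> gen C Z" "is_zero_obj C z" "z \<in> ob C" "ident C z = 0" using zero_gen by metis
  have x: "x \<in> ob C" using assms by (rule gen_ob)
  have sz: "fobj \<Sigma> z \<in> ob C" "is_zero_obj C (fobj \<Sigma> z)"
    using z S_rules(1,3)[OF z(3)] autoequiv_zero[OF susp z(3,3)] by (simp_all add: is_zero_obj_iff)
  have "(x, x, fobj \<Sigma> z, ident C x, 0, - fmap \<Sigma> z x 0) \<in> \<Delta>"
    using tri_ident[OF x sz(2)] autoequiv_zero[OF susp z(3) x] by simp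
  then have "(z, x, x, 0, ident C x, 0) \<in> \<Delta>"
    using tri_rotate[of z x x 0 "ident C x" 0] z x sz by (simp add: lin_rules)
  then show ?thesis using assms z(1) x unfolding star_def by blast
qed

lemma star_subset_ob: "star C \<Delta> A B \<subseteq> ob C"
  by (auto simp: star_def)

lemma starE:
  assumes "x \<in> star C \<Delta> A B"
  obtains a b u v w where "a \<in> A" "b \<in> B" "(a, x, b, u, v, w) \<in> \<Delta>"
  using assms unfolding star_def by blast

lemma wexact_iso_right:
  assumes "wexact C x y z u v" "z' \<in> ob C" "f \<in> hom C z z'" "g \<in> hom C z' z"
    "cmp C z z' z g f = ident C z" "cmp C z' z z' f g = ident C z'"
  shows "wexact C x y z' u (cmp C y z z' f v)"
proof -
  note e = wexactD[OF assms(1)]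
  have *: "cmp C w y z v h = 0" if "w \<in> ob C" "h \<in> hom C w y" "cmp C w y z' (cmp C y z z' f v) h = 0" for w h
  proof -
    have "cmp C w y z v h = cmp C w z' z g (cmp C w y z' (cmp C y z z' f v) h)"
      using that(1,2) e assms(2-5) by (simp add: lin_rules cmp_assoc)
    then show ?thesis using that e assms by (simp add: lin_rules)
  qed
  show ?thesis unfolding wexact_def
  proof (intro conjI ballI impI)
    show "cmp C x y z' (cmp C y z z' f v) u = 0"
      using e assms cmp_assoc[of x y z z' u v f] by (simp add: lin_rules)
  next
    fix w h assume w: "w \<in> ob C" "h \<in> hom C w y" "cmp C w y z' (cmp C y z z' f v) h = 0"
    show "\<exists>g\<in>hom C w x. h = cmp C w x y u g" using wexact_lift[OF assms(1) w(1,2) *[OF w]] by metis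
  next
    fix w h assume w: "w \<in> ob C" "h \<in> hom C y w" "cmp C x y w h u = 0"
    obtain k where k: "k \<in> hom C z w" "h = cmp C y z w k v" by (rule wexact_ext[OF assms(1) w])
    have "h = cmp C y z' w (cmp C z' z w k g) (cmp C y z z' f v)"
      using k w e assms(2-5) by (simp add: lin_rules flip: cmp_assoc) (simp add: assms cmp_assoc lin_rules)
    moreover have "cmp C z' z w k g \<in> hom C z' w" using k w e assms by (simp add: lin_rules)
    ultimately show "\<exists>g\<in>hom C z' w. h = cmp C y z' w g (cmp C y z z' f v)" by blast
  qed (use e assms in \<open>simp_all add: lin_rules\<close>)
qed

end

section \<open>Extension classes as classes of objects with strings\<close>

locale finite_triangulated = triangulated_category scale C \<Sigma> \<Sigma>i \<Delta>
  for scale :: "'k::field \<Rightarrow> 'v::ab_group_add \<Rightarrow> 'v" and C :: "('o, 'v) cat" and \<Sigma> \<Sigma>i \<Delta> +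
  assumes hom_fin: "hom_finite scale C"
begin

sublocale add_category scale C by (rule add_category[OF hom_fin])

text \<open>For a triangle \<open>a \<rightarrow> U \<rightarrow> b\<close> with \<open>b\<close> in
  \<open>add (\<Sigma> Y)\<close> one rotation back gives
  \<open>t1 = \<Sigma>\<^sup>-\<^sup>1 b\<close>; conversely a cone of \<open>d\<close> lies in the
  class because \<open>\<Sigma> t1\<close> is in \<open>add (\<Sigma> Y)\<close>.\<close>

lemma mutation_class_star:
  assumes pair: "mutation_pair scale C Y R (fobj \<Sigma> Y) N M \<kappa> \<nu>"
  shows "mutation_class scale C Y R (fobj \<Sigma> Y) N M \<kappa> \<nu>
    (star C \<Delta> (gen C {Y, R}) (gen C {fobj \<Sigma> Y}))"
proof -
  interpret mutation_pair scale C Y R "fobj \<Sigma> Y" N M \<kappa> \<nu> by (rule pair)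
  show ?thesis
  proof (intro mutation_class.intro pair mutation_class_axioms.intro)
    fix U assume "U \<in> star C \<Delta> (gen C {Y, R}) (gen C {fobj \<Sigma> Y})"
    then obtain a b u v w where t: "a \<in> gen C {Y, R}" "b \<in> gen C {fobj \<Sigma> Y}" "(a, U, b, u, v, w) \<in> \<Delta>"
      by (rule starE)
    obtain d w' where d: "(fobj \<Sigma>i b, a, U, d, u, w') \<in> \<Delta>" by (rule tri_unrotate[OF t(3)])
    show "strung U" unfolding strung_def
      using tri_wexact[OF d] tri_wexact[OF t(3)] t(1,2) gen_susp_inv[OF obs(1) t(2)] by blast
  next
    fix t1 t0 d assume t: "t1 \<in> gen C {Y}" "t0 \<in> gen C {Y, R}" "d \<in> hom C t1 t0"
    obtain U a b where d: "(t1, t0, U, d, a, b) \<in> \<Delta>"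
      using tri_exists[OF gen_ob[OF t(1)] gen_ob[OF t(2)] t(3)] by metis
    have "fobj \<Sigma> t1 \<in> gen C {fobj \<Sigma> Y}" by (rule gen_susp[OF obs(1) t(1)])
    moreover from this have "U \<in> star C \<Delta> (gen C {Y, R}) (gen C {fobj \<Sigma> Y})"
      using tri_rot[OF d] t(2) triD(3)[OF d] unfolding star_def by blast
    ultimately show "\<exists>U\<in>star C \<Delta> (gen C {Y, R}) (gen C {fobj \<Sigma> Y}). \<exists>p\<in>gen C {fobj \<Sigma> Y}.
        \<exists>a b. wexact C t1 t0 U d a \<and> wexact C t0 U p a b"
      using tri_wexact[OF d] tri_wexact'[OF d] by blast
  qed
qed

text \<open>Seen in the opposite category, a triangle
  \<open>a \<rightarrow> U \<rightarrow> b\<close> is the string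
  \<open>\<Sigma> a \<rightarrow> b \<rightarrow> U \<rightarrow> a\<close>. So \<open>P\<close>
  plays the role of \<open>\<Sigma>\<^sup>-\<^sup>1 Y\<close>, and this is asked up to additive
  closure because \<open>\<Sigma>\<close> is only an equivalence.\<close>

lemma mutation_class_star_opp:
  assumes pair: "mutation_pair scale (opp C) Y R P N M \<kappa> \<nu>"
    and YP: "Y \<in> gen C {fobj \<Sigma> P}" "fobj \<Sigma> P \<in> gen C {Y}"
  shows "mutation_class scale (opp C) Y R P N M \<kappa> \<nu> (star C \<Delta> (gen C {P}) (gen C {Y, R}))"
proof -
  interpret O: mutation_pair scale "opp C" Y R P N M \<kappa> \<nu> by (rule pair)
  have Y: "Y \<in> ob C" and P: "P \<in> ob C" using O.obs by simp_all
  have SP: "fobj \<Sigma> P \<in> ob C" using P S_rules(1) by simp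
  show ?thesis
  proof (intro mutation_class.intro pair mutation_class_axioms.intro)
    fix U assume "U \<in> star C \<Delta> (gen C {P}) (gen C {Y, R})"
    then obtain a b u v w where t: "a \<in> gen C {P}" "b \<in> gen C {Y, R}" "(a, U, b, u, v, w) \<in> \<Delta>"
      by (rule starE)
    have "fobj \<Sigma> a \<in> gen C {Y}"
      using gen_trans[OF gen_susp[OF P t(1)], of "{Y}"] YP Y by simp
    moreover have "wexact (opp C) (fobj \<Sigma> a) b U w v" "wexact (opp C) b U a v u"
      using tri_wexact'[OF t(3)] tri_wexact[OF t(3)] by simp_all
    ultimately show "O.strung U" unfolding O.strung_def using t(1,2) gen_opp by metis
  next
    fix t1 t0 d assume t: "t1 \<in> gen (opp C) {Y}" "t0 \<in> gen (opp C) {Y, R}" "d \<in> hom (opp C) t1 t0"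
    then have t': "t1 \<in> gen C {Y}" "t0 \<in> gen C {Y, R}" "d \<in> hom C t0 t1" by simp_all
    have o: "t1 \<in> ob C" "t0 \<in> ob C" using t' by (auto dest: gen_ob)
    \<comment> \<open>\<open>t1\<close> need not be a suspension; the triangle is built on
      \<open>\<Sigma> (\<Sigma>i t1)\<close>, and the exact pair is carried back by the isomorphism
      \<open>f\<close>.\<close>
    let ?z = "fobj \<Sigma> (fobj \<Sigma>i t1)"
    have oz: "?z \<in> ob C" "fobj \<Sigma>i t1 \<in> ob C" using o S_rules(1) Si_rules(1) by simp_all
    obtain f g where fg: "f \<in> hom C ?z t1" "g \<in> hom C t1 ?z"
      "cmp C ?z t1 ?z g f = ident C ?z" "cmp C t1 ?z t1 f g = ident C t1" using susp_iso[OF o(1)] by metis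
    have "cmp C t0 t1 ?z g d \<in> hom C t0 ?z" using t' fg o oz by (simp add: lin_rules)
    then obtain U u v where tri: "(fobj \<Sigma>i t1, U, t0, u, v, cmp C t0 t1 ?z g d) \<in> \<Delta>"
      by (rule tri_from_third[OF o(2) oz(2)])
    have "t1 \<in> gen C {fobj \<Sigma> P}" using gen_trans[OF t'(1)] YP SP by simp
    then have p: "fobj \<Sigma>i t1 \<in> gen C {P}" by (rule gen_susp_inv[OF P])
    have "wexact C U t0 t1 v (cmp C t0 ?z t1 f (cmp C t0 t1 ?z g d))"
      by (rule wexact_iso_right[OF tri_wexact'[OF tri] o(1) fg])
    moreover have "cmp C t0 ?z t1 f (cmp C t0 t1 ?z g d) = d"
      using t'(3) fg o oz by (simp add: lin_rules cmp_assoc)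
    ultimately have "wexact (opp C) t1 t0 U d v" by simp
    moreover have "wexact (opp C) t0 U (fobj \<Sigma>i t1) v u" using tri_wexact[OF tri] by simp
    moreover have "U \<in> star C \<Delta> (gen C {P}) (gen C {Y, R})"
      using p t'(2) tri triD(2)[OF tri] unfolding star_def by blast
    ultimately show "\<exists>U\<in>star C \<Delta> (gen C {P}) (gen C {Y, R}). \<exists>p\<in>gen (opp C) {P}.
        \<exists>a b. wexact (opp C) t1 t0 U d a \<and> wexact (opp C) t0 U p a b"
      using p gen_opp by metis
  qed
qed

text \<open>The inclusion \<open>T \<ast> \<Sigma> Tb \<subseteq> Tb \<ast> \<Sigma> T'\<close> and, in the opposite category, its converse: the cone of a
  right \<open>Tb\<close>-approximation of \<open>U\<close> lies in \<open>add (\<Sigma> T')\<close>. This replaces closure of these classes under direct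
  sums.\<close>

lemma strung_in_star:
  assumes pair: "mutation_pair scale C Y R P N M \<kappa> \<nu>" and YP: "fobj \<Sigma> Y \<in> gen C {P}"
    and U: "mutation_pair.strung C Y R P U"
  shows "U \<in> star C \<Delta> (gen C {Y}) (gen C {P, N})"
proof -
  interpret mutation_pair scale C Y R P N M \<kappa> \<nu> by (rule pair)
  have Uo: "U \<in> ob C" using U by (rule strung_ob)
  obtain c m where c: "c \<in> gen C {Y}" and m: "m \<in> hom C c U"
    and lift: "\<And>f. f \<in> hom C Y U \<Longrightarrow> \<exists>g \<in> hom C Y c. f = cmp C Y c U m g"
    using approx[OF Uo obs(1)] by metis
  obtain E \<pi> \<omega> where t: "(c, U, E, m, \<pi>, \<omega>) \<in> \<Delta>" using tri_exists[OF gen_ob[OF c] Uo m] by metis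
  have "fobj \<Sigma> c \<in> gen C {P}"
    using gen_trans[OF gen_susp[OF obs(1) c], of "{P}"] YP obs by simp
  then have "E \<in> gen C {P, N}"
    using cone_of_approx[OF U c lift tri_wexact[OF t] tri_wexact'[OF t]] by blast
  then show ?thesis using c t Uo unfolding star_def by blast
qed

lemma strung_opp_in_star:
  assumes pair: "mutation_pair scale (opp C) Y R P N M \<kappa> \<nu>" and YP: "Y \<in> gen C {fobj \<Sigma> P}"
    and U: "mutation_pair.strung (opp C) Y R P U"
  shows "U \<in> star C \<Delta> (gen C {P, N}) (gen C {Y})"
proof -
  interpret O: mutation_pair scale "opp C" Y R P N M \<kappa> \<nu> by (rule pair)
  have Y: "Y \<in> ob C" and P: "P \<in> ob C" using O.obs by simp_all
  have SP: "fobj \<Sigma> P \<in> ob C" using P S_rules(1) by simp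
  have Uo: "U \<in> ob C" using O.strung_ob[OF U] by simp
  obtain c m where c: "c \<in> gen C {Y}" and m: "m \<in> hom C U c"
    and lift: "\<And>f. f \<in> hom (opp C) Y U \<Longrightarrow> \<exists>g \<in> hom (opp C) Y c. f = cmp (opp C) Y c U m g"
    using O.approx[of U Y] Uo Y by auto
  \<comment> \<open>Two rotations back produce the cocone of the left approximation \<open>m\<close>
    and the term \<open>\<Sigma>\<^sup>-\<^sup>1 c\<close> before it, which is the cone in the sense
    of the opposite category.\<close>
  obtain z g h where t: "(U, c, z, m, g, h) \<in> \<Delta>" using tri_exists[OF Uo gen_ob[OF c] m] by metis
  obtain \<pi> w where t1: "(fobj \<Sigma>i z, U, c, \<pi>, m, w) \<in> \<Delta>" by (rule tri_unrotate[OF t])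
  obtain \<omega> w' where t2: "(fobj \<Sigma>i c, fobj \<Sigma>i z, U, \<omega>, \<pi>, w') \<in> \<Delta>" by (rule tri_unrotate[OF t1])
  have "c \<in> gen C {fobj \<Sigma> P}" using gen_trans[OF c] YP SP by simp
  then have "fobj \<Sigma>i c \<in> gen (opp C) {P}" using gen_susp_inv[OF P] by simp
  moreover have "wexact (opp C) c U (fobj \<Sigma>i z) m \<pi>" "wexact (opp C) U (fobj \<Sigma>i z) (fobj \<Sigma>i c) \<pi> \<omega>"
    using tri_wexact[OF t1] tri_wexact[OF t2] by simp_all
  moreover have "c \<in> gen (opp C) {Y}" using c by simp
  ultimately have "fobj \<Sigma>i z \<in> gen (opp C) {P, N}" using O.cone_of_approx[OF U _ lift] by blast
  then have "fobj \<Sigma>i z \<in> gen C {P, N}" by simp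
  then show ?thesis using c t1 Uo unfolding star_def by blast
qed

end

section \<open>The equivalences\<close>

locale mutation_setting = finite_triangulated scale C \<Sigma> \<Sigma>i \<Delta>
  for scale :: "'k::field \<Rightarrow> 'v::ab_group_add \<Rightarrow> 'v" and C :: "('o, 'v) cat" and \<Sigma> \<Sigma>i \<Delta> +
  fixes S :: "('o, 'v, 'o, 'v) fctr" and Tb R T Rs M T' :: 'o and i p q :: 'v
  assumes serre_functor: "serre_functor scale C S"
    and T_sum: "is_direct_sum C [Tb, R] T"
    and T_rigid: "rigid C \<Sigma> T"
    and mutation_tri: "(Rs, M, R, i, p, q) \<in> \<Delta>"
    and p_approx: "right_approx C (add_cat C Tb) M R p"
    and T'_sum: "is_direct_sum C [Tb, Rs] T'"
begin

abbreviation "STb \<equiv> fobj S Tb"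
abbreviation "SRs \<equiv> fobj S Rs"
abbreviation "SM \<equiv> fobj S M"
abbreviation "PTb \<equiv> fobj \<Sigma>i STb"
abbreviation "PR \<equiv> fobj \<Sigma>i (fobj S R)"
abbreviation "\<Sigma>Tb \<equiv> fobj \<Sigma> Tb"
abbreviation "\<Sigma>Rs \<equiv> fobj \<Sigma> Rs"
abbreviation "\<Sigma>M \<equiv> fobj \<Sigma> M"

sublocale serre_category scale C S
  by unfold_locales (rule serre_functor)

lemma obs: "Tb \<in> ob C" "R \<in> ob C" "Rs \<in> ob C" "M \<in> ob C" "T \<in> ob C" "T' \<in> ob C"
  using T_sum T'_sum triD[OF mutation_tri] by (auto simp: is_direct_sum_def)

lemma obs_susp: "x \<in> ob C \<Longrightarrow> fobj \<Sigma> x \<in> ob C" "x \<in> ob C \<Longrightarrow> fobj \<Sigma>i x \<in> ob C" "x \<in> ob C \<Longrightarrow> fobj S x \<in> ob C"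
  by (simp_all add: S_rules(1) Si_rules(1) Sr(1))

lemma gen_T:
  assumes "autoequiv C F"
  shows "gen C {fobj F T} = gen C {fobj F Tb, fobj F R}" "gen C {fobj F T'} = gen C {fobj F Tb, fobj F Rs}"
proof -
  from T_sum T'_sum obtain j k r s j' k' r' s' where
    "biprod C Tb R T j k r s" "biprod C Tb Rs T' j' k' r' s'" using direct_sum_pair by metis
  then show "gen C {fobj F T} = gen C {fobj F Tb, fobj F R}" "gen C {fobj F T'} = gen C {fobj F Tb, fobj F Rs}"
    using biprod_gen biprod_autoequiv[OF assms] by metis+
qed

lemmas gen_T_fid = gen_T[OF autoequiv_fid, simplified]

lemma M_gen: "M \<in> gen C {Tb}"
  using p_approx add_cat_gen[OF obs(1)] by (simp add: right_approx_def)

lemma p_lift: "h \<in> hom C Tb R \<Longrightarrow> \<exists>g \<in> hom C Tb M. h = cmp C Tb M R p g"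
  using p_approx add_cat_gen[OF obs(1)] gen_self[of Tb "{Tb}"] obs by (auto simp: right_approx_def)

lemma hom_T_susp:
  assumes "x \<in> gen C {Tb, R}" "y \<in> gen C {Tb, R}"
  shows "hom C x (fobj \<Sigma> y) = {0}"
proof -
  have o: "x \<in> ob C" "fobj \<Sigma> y \<in> ob C" "fobj \<Sigma> T \<in> ob C"
    using assms obs obs_susp by (auto dest: gen_ob)
  have x: "x \<in> gen C {T}" using assms gen_T_fid by simp
  have y: "fobj \<Sigma> y \<in> gen C {fobj \<Sigma> T}" using assms gen_T_fid gen_susp[OF obs(5)] by simp
  have T0: "f = 0" if "f \<in> hom C x (fobj \<Sigma> T)" for f
    by (rule gen_hom_0[OF x _ o(3) _ that]) (use obs T_rigid in \<open>auto simp: rigid_def\<close>)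
  then have "hom C x (fobj \<Sigma> T) = {0}" using hom_zero[OF o(1,3)] by auto
  then have "f = 0" if "f \<in> hom C x (fobj \<Sigma> y)" for f
    by (intro hom_gen_0[OF y _ o(1) _ that]) (use o in auto)
  then show ?thesis using hom_zero[OF o(1,2)] by auto
qed

lemmas Tb_R_gen = gen_self[of Tb "{Tb, R}", OF _ obs(1), simplified] gen_self[of R "{Tb, R}", OF _ obs(2), simplified]

text \<open>A map \<open>Tb \<rightarrow> \<Sigma> Rs\<close> becomes zero in
  \<open>\<Sigma> M\<close> by rigidity, so it comes from a map to \<open>R\<close> along
  \<open>q\<close>; that map factors through the approximation \<open>p\<close>, and
  \<open>q \<circ> p = 0\<close>.\<close>

lemma hom_Tb_susp_Rs: "hom C Tb \<Sigma>Rs = {0}"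
proof -
  note e1 = tri_wexact'[OF mutation_tri] and e2 = tri_wexact''[OF mutation_tri]
  note e = wexactD[OF e1] wexactD[OF e2]
  have "f = 0" if f: "f \<in> hom C Tb \<Sigma>Rs" for f
  proof -
    have "M \<in> gen C {Tb, R}" using M_gen gen_mono[of M C "{Tb}" "{Tb, R}"] by simp
    then have "hom C Tb \<Sigma>M = {0}" using hom_T_susp Tb_R_gen by blast
    moreover have "cmp C Tb \<Sigma>Rs \<Sigma>M (fmap \<Sigma> Rs M i) f \<in> hom C Tb \<Sigma>M"
      using f e obs by (simp add: lin_rules)
    ultimately have "cmp C Tb \<Sigma>Rs \<Sigma>M (fmap \<Sigma> Rs M i) f = 0" by simp
    then obtain h where h: "h \<in> hom C Tb R" "f = cmp C Tb R \<Sigma>Rs q h"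
      by (rule wexact_lift[OF e2 obs(1) f])
    then obtain g where "g \<in> hom C Tb M" "h = cmp C Tb M R p g" using p_lift by blast
    then show "f = 0" using h(2) e obs by (simp add: lin_rules cmp_assoc)
  qed
  then show ?thesis using hom_zero[of Tb "\<Sigma>Rs"] obs obs_susp by auto
qed

text \<open>\<open>i\<close> is a left \<open>add Tb\<close>-approximation: the obstruction to
  extending a map along \<open>i\<close> lies in \<open>Hom(R, \<Sigma> Tb)\<close>, which vanishes
  by rigidity.\<close>

lemma i_ext: "h \<in> hom C Rs Tb \<Longrightarrow> \<exists>g \<in> hom C M Tb. h = cmp C Rs M Tb g i"
proof -
  assume h: "h \<in> hom C Rs Tb"
  note e2 = tri_wexact''[OF mutation_tri]
  note e = wexactD[OF e2] and ei = triD[OF mutation_tri]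
  have Sh: "fmap \<Sigma> Rs Tb h \<in> hom C \<Sigma>Rs \<Sigma>Tb" using h obs by (simp add: S_rules)
  have "cmp C R \<Sigma>Rs \<Sigma>Tb (fmap \<Sigma> Rs Tb h) q \<in> hom C R \<Sigma>Tb"
    using Sh e obs obs_susp by (simp add: lin_rules)
  then have "cmp C R \<Sigma>Rs \<Sigma>Tb (fmap \<Sigma> Rs Tb h) q = 0" using hom_T_susp Tb_R_gen by blast
  then obtain g where g: "g \<in> hom C \<Sigma>M \<Sigma>Tb"
    "fmap \<Sigma> Rs Tb h = cmp C \<Sigma>Rs \<Sigma>M \<Sigma>Tb g (fmap \<Sigma> Rs M i)"
    using wexact_ext[OF e2 obs_susp(1)[OF obs(1)] Sh] by metis
  obtain g' where g': "g' \<in> hom C M Tb" "fmap \<Sigma> M Tb g' = g"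
    by (rule ff_full[OF autoequiv_ff[OF susp] obs(4,1) g(1)])
  have "fmap \<Sigma> Rs Tb h = fmap \<Sigma> Rs Tb (cmp C Rs M Tb g' i)"
    using g g' obs ei by (simp add: S_rules)
  then have "h = cmp C Rs M Tb g' i"
    using ff_inj[OF autoequiv_ff[OF susp] obs(3,1) h] g' ei obs by (simp add: lin_rules)
  then show ?thesis using g' by blast
qed

abbreviation "UU \<equiv> star C \<Delta> (gen C {Tb, R}) (gen C {\<Sigma>Tb})"

lemma upper_pair: "mutation_pair scale C Tb R \<Sigma>Tb \<Sigma>Rs M p q"
  by unfold_locales
    (use obs obs_susp tri_wexact'[OF mutation_tri] M_gen hom_T_susp Tb_R_gen hom_Tb_susp_Rs in auto)

lemma upper_class: "mutation_class scale C Tb R \<Sigma>Tb \<Sigma>Rs M p q UU"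
  by (rule mutation_class_star[OF upper_pair])

text \<open>The exact pair here is the next part
  \<open>R \<rightarrow> \<Sigma> Rs \<rightarrow> \<Sigma> M\<close> of the mutation triangle;
  \<open>T\<close> and \<open>\<Sigma> T'\<close> exchange their roles.\<close>

lemma dual_pair: "mutation_pair scale (opp C) \<Sigma>Tb \<Sigma>Rs Tb R \<Sigma>M (fmap \<Sigma> Rs M i) q"
  by (intro mutation_pair.intro add_category_opp mutation_pair_axioms.intro)
    (use obs obs_susp tri_wexact''[OF mutation_tri] gen_susp[OF obs(1) M_gen] hom_T_susp Tb_R_gen in simp_all)

lemma dual_class:
  "mutation_class scale (opp C) \<Sigma>Tb \<Sigma>Rs Tb R \<Sigma>M (fmap \<Sigma> Rs M i) q
    (star C \<Delta> (gen C {Tb}) (gen C {\<Sigma>Tb, \<Sigma>Rs}))"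
  by (rule mutation_class_star_opp[OF dual_pair]) (use gen_self obs obs_susp in auto)

text \<open>An object of either side has a string for one of the two pairs, and the cone of its
  approximation displays it on the other side. The form on the right is the one that fits the
  opposite category.\<close>

lemma UU_alt: "UU = star C \<Delta> (gen C {Tb}) (gen C {\<Sigma>Tb, \<Sigma>Rs})"
proof
  have self: "\<Sigma>Tb \<in> gen C {\<Sigma>Tb}" using obs obs_susp by (intro gen_self) auto
  show "UU \<subseteq> star C \<Delta> (gen C {Tb}) (gen C {\<Sigma>Tb, \<Sigma>Rs})"
    using strung_in_star[OF upper_pair self] mutation_class.UU_strung[OF upper_class] by blast
  show "star C \<Delta> (gen C {Tb}) (gen C {\<Sigma>Tb, \<Sigma>Rs}) \<subseteq> UU"
    using strung_opp_in_star[OF dual_pair self] mutation_class.UU_strung[OF dual_class] by blast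
qed

end

section \<open>The lower class\<close>

context mutation_setting
begin

text \<open>Two applications of Serre duality: \<open>Hom(x, \<Sigma> y)\<close> is dual to
  \<open>Hom(\<Sigma> y, S x)\<close>, this is \<open>Hom(y, \<Sigma>\<^sup>-\<^sup>1 S x)\<close>,
  and the latter is dual to \<open>Hom(\<Sigma>\<^sup>-\<^sup>1 S x, S y)\<close>.\<close>

lemma hom_lower_0:
  assumes x: "x \<in> ob C" and y: "y \<in> ob C" and xy: "hom C x (fobj \<Sigma> y) = {0}"
  shows "hom C (fobj \<Sigma>i (fobj S x)) (fobj S y) = {0}"
proof -
  let ?s = "fobj \<Sigma>i (fobj S x)"
  note o = x y obs_susp
  have sx: "fobj S x \<in> ob C" using o by simp
  have "hom C (fobj \<Sigma> y) (fobj S x) = {0}" using serre_hom_0[of x "fobj \<Sigma> y"] o xy by simp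
  then have "f = 0" if "f \<in> hom C (fobj \<Sigma> y) (fobj \<Sigma> ?s)" for f
    by (intro hom_gen_0[OF gen_susp_susp_inv(1)[OF sx] _ _ _ that]) (use o in auto)
  then have "hom C (fobj \<Sigma> y) (fobj \<Sigma> ?s) = {0}" using hom_zero[of "fobj \<Sigma> y" "fobj \<Sigma> ?s"] o by auto
  then have "hom C y ?s = {0}" using autoequiv_hom_0[OF susp, of y ?s] o by simp
  then show ?thesis using serre_hom_0[of y ?s] o by simp
qed

abbreviation "LL \<equiv> star C \<Delta> (gen C {PTb}) (gen C {STb, SRs})"

text \<open>The object \<open>x0\<close> plays the role of \<open>\<Sigma>\<^sup>-\<^sup>1 S R\<close>. We do not know that \<open>S\<close> preserves triangles,
  so it is defined as a cocone of \<open>S i\<close>; comparing the weak kernels \<open>x0\<close> and \<open>S \<Sigma>\<^sup>-\<^sup>1 R\<close> of \<open>S i\<close> shows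
  that it lies in \<open>add (\<Sigma>\<^sup>-\<^sup>1 S T)\<close>.\<close>

lemma lower_pair:
  obtains x0 u where
    "mutation_pair scale (opp C) STb SRs PTb x0 SM (fmap S Rs M i) u"
    "gen C {PTb, x0} \<subseteq> gen C {PTb, PR}"
    "gen C {PTb, x0} \<subseteq> LL"
proof -
  let ?T = "STb" and ?Rs = "SRs" and ?M = "SM" and ?i = "fmap S Rs M i"
  let ?P = "fobj \<Sigma>i ?T" and ?N = "PR" and ?PM = "fobj \<Sigma>i ?M" and ?SiR = "fobj S (fobj \<Sigma>i R)"
  note ti = triD[OF mutation_tri]
  have o: "?T \<in> ob C" "?Rs \<in> ob C" "?M \<in> ob C" "?P \<in> ob C" "?N \<in> ob C" "?PM \<in> ob C" "?SiR \<in> ob C"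
    using obs obs_susp by simp_all
  have ih: "?i \<in> hom C ?Rs ?M" using ti Sr by simp
  obtain z g h where t1: "(?Rs, ?M, z, ?i, g, h) \<in> \<Delta>" using tri_exists[OF o(2,3) ih] by metis
  define x0 where "x0 = fobj \<Sigma>i z"
  obtain u w where t2: "(x0, ?Rs, ?M, u, ?i, w) \<in> \<Delta>" unfolding x0_def by (rule tri_unrotate[OF t1])
  obtain d w' where t3: "(?PM, x0, ?Rs, d, u, w') \<in> \<Delta>" by (rule tri_unrotate[OF t2])
  note e2 = tri_wexact[OF t2] and e3 = tri_wexact[OF t3]
  note d2 = wexactD[OF e2] and d3 = wexactD[OF e3]
  have x0: "x0 \<in> ob C" using d2 by simp
  have MT: "?M \<in> gen C {?T}" using autoequiv_gen[OF S M_gen] obs by simp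
  have PM: "?PM \<in> gen C {?P}" using autoequiv_gen[OF susp_inv MT] o by simp
  have x0_gen: "x0 \<in> gen C {?P, ?N}"
  proof -
    obtain m w'' where tm: "(fobj \<Sigma>i R, Rs, M, m, i, w'') \<in> \<Delta>" by (rule tri_unrotate[OF mutation_tri])
    have em: "wexact C ?SiR ?Rs ?M (fmap S (fobj \<Sigma>i R) Rs m) ?i"
      by (rule autoequiv_wexact[OF S tri_wexact[OF tm]])
    note dm = wexactD[OF em]
    obtain \<alpha> where \<alpha>: "\<alpha> \<in> hom C ?SiR x0" "fmap S (fobj \<Sigma>i R) Rs m = cmp C ?SiR x0 ?Rs u \<alpha>"
      by (rule wexact_lift[OF e2 dm(1,4,6)])
    obtain \<beta> where \<beta>: "\<beta> \<in> hom C x0 ?SiR" "u = cmp C x0 ?SiR ?Rs (fmap S (fobj \<Sigma>i R) Rs m) \<beta>"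
      by (rule wexact_lift[OF em d2(1,4,6)])
    \<comment> \<open>\<open>u\<close> does not distinguish the identity from
      \<open>\<alpha> \<circ> \<beta>\<close>; their difference factors through
      \<open>\<Sigma>\<^sup>-\<^sup>1 S M\<close>, which lies in \<open>add PTb\<close>.\<close>
    let ?e = "ident C x0 - cmp C x0 ?SiR x0 \<alpha> \<beta>"
    have eh: "?e \<in> hom C x0 x0" using \<alpha> \<beta> x0 o by (simp add: lin_rules)
    have "cmp C x0 x0 ?Rs u (cmp C x0 ?SiR x0 \<alpha> \<beta>) = u"
      using \<alpha> \<beta> d2(4) x0 o by (metis cmp_assoc)
    then have "cmp C x0 x0 ?Rs u ?e = 0" using \<alpha>(1) \<beta>(1) d2(4) x0 o by (simp add: lin_rules)
    then obtain k where k: "k \<in> hom C x0 ?PM" "?e = cmp C x0 ?PM x0 d k"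
      using wexact_lift[OF e3 x0 eh] by metis
    have "?SiR \<in> gen C {?N}" by (rule serre_susp_gen[OF serre_functor obs(2)])
    then have "?SiR \<in> gen C {?P, ?N}" "?PM \<in> gen C {?P, ?N}" using PM by (auto intro: gen_mono)
    then have "cmp C x0 ?PM x0 d k + cmp C x0 ?SiR x0 \<alpha> \<beta> \<in> thru C {?P, ?N} x0 x0"
      using k \<alpha> \<beta> d3 x0 o by (intro thru_plus thru_via_gen) auto
    then show ?thesis using x0 unfolding k(2)[symmetric] by (simp add: gen_def)
  qed
  have P_T: "hom C ?P ?T = {0}" using hom_lower_0 obs hom_T_susp Tb_R_gen by blast
  have N_T: "hom C ?N ?T = {0}" using hom_lower_0 obs hom_T_susp Tb_R_gen by blast
  have P_Rs: "hom C ?P ?Rs = {0}" using hom_lower_0 obs hom_Tb_susp_Rs by blast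
  have "f = 0" if "f \<in> hom C x0 ?T" for f
    by (rule gen_hom_0[OF x0_gen _ _ _ that]) (use o P_T N_T in auto)
  then have x0_T: "hom C x0 ?T = {0}" using hom_zero[OF x0 o(1)] by auto
  have "mutation_pair scale (opp C) ?T ?Rs ?P x0 ?M ?i u"
    by (intro mutation_pair.intro add_category_opp mutation_pair_axioms.intro)
      (use o x0 e2 MT P_T x0_T in simp_all)
  moreover have "gen C {?P, x0} \<subseteq> gen C {?P, ?N}"
  proof
    fix y assume "y \<in> gen C {?P, x0}"
    then show "y \<in> gen C {?P, ?N}"
      by (rule gen_trans) (use x0_gen gen_self[of ?P "{?P, ?N}"] o in auto)
  qed
  moreover have "gen C {?P, x0} \<subseteq> LL"
  proof
    fix y assume "y \<in> gen C {?P, x0}"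
    then have y: "y \<in> star C \<Delta> (gen C {?P, x0}) (gen C {fobj \<Sigma> ?P})" by (rule gen_in_star_left)
    note iso = gen_susp_susp_inv[OF o(1)]
    have oP: "fobj \<Sigma> ?P \<in> ob C" using o obs_susp by simp
    have "f = 0" if "f \<in> hom C ?P (fobj \<Sigma> ?P)" for f
      by (rule hom_gen_0[OF iso(1) _ _ _ that]) (use o P_T in auto)
    then have P_P: "hom C ?P (fobj \<Sigma> ?P) = {0}" using hom_zero[OF o(4) oP] by auto
    \<comment> \<open>A second pair, now in \<open>C\<close>: since
      \<open>Hom(PTb, \<Sigma> PTb)\<close> and \<open>Hom(PTb, S Rs)\<close> vanish, the argument
      that proves \<open>T \<ast> \<Sigma> Tb \<subseteq> Tb \<ast> \<Sigma> T'\<close> applies to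
      \<open>PTb\<close> and \<open>x0\<close>.\<close>
    have pair: "mutation_pair scale C ?P x0 (fobj \<Sigma> ?P) ?Rs ?PM d u"
      by (intro mutation_pair.intro add_category_axioms mutation_pair_axioms.intro)
        (use o oP x0 e3 PM P_P P_Rs in simp_all)
    have "mutation_pair.strung C ?P x0 (fobj \<Sigma> ?P) y"
      using mutation_class.UU_strung[OF mutation_class_star[OF pair] y] .
    then have "y \<in> star C \<Delta> (gen C {?P}) (gen C {fobj \<Sigma> ?P, ?Rs})"
      by (rule strung_in_star[OF pair gen_self[of _ "{fobj \<Sigma> ?P}"], rotated 2]) (use oP in auto)
    moreover have "gen C {fobj \<Sigma> ?P, ?Rs} \<subseteq> gen C {?T, ?Rs}"
    proof
      fix y assume "y \<in> gen C {fobj \<Sigma> ?P, ?Rs}"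
      then show "y \<in> gen C {?T, ?Rs}"
        by (rule gen_trans) (use iso(1) gen_mono[of _ C "{?T}" "{?T, ?Rs}"] gen_self[of ?Rs "{?T, ?Rs}"] o in auto)
    qed
    ultimately show "y \<in> LL" unfolding star_def by blast
  qed
  ultimately show thesis by (rule that)
qed

text \<open>Strings involve neither \<open>x0\<close> nor the exact pair, so the predicate makes
  sense although \<open>x0\<close> is only known to exist.\<close>

abbreviation "lower_strung \<equiv> mutation_pair.strung (opp C) STb SRs PTb"

lemma lower_class:
  obtains x0 u where
    "mutation_class scale (opp C) STb SRs PTb x0 SM (fmap S Rs M i) u LL"
    "gen C {PTb, x0} \<subseteq> gen C {PTb, PR}"
    "gen C {PTb, x0} \<subseteq> LL"
proof -
  obtain x0 u where p: "mutation_pair scale (opp C) STb SRs PTb x0 SM (fmap S Rs M i) u"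
    "gen C {PTb, x0} \<subseteq> gen C {PTb, PR}"
    "gen C {PTb, x0} \<subseteq> LL" by (rule lower_pair)
  have "mutation_class scale (opp C) STb SRs PTb x0 SM (fmap S Rs M i) u LL"
    by (rule mutation_class_star_opp[OF p(1)]) (use gen_susp_susp_inv[of "STb"] obs obs_susp in auto)
  then show thesis using that p(2,3) by blast
qed

section \<open>Lifting and extending along the class of morphisms\<close>

abbreviation "NN \<equiv> null_on C Tb"

lemma NN_serre: "x \<in> ob C \<Longrightarrow> y \<in> ob C \<Longrightarrow> null_on (opp C) STb y x = NN x y"
  by (rule null_on_serre[OF obs(1)])

lemma wequiv_eq: "x \<in> ob C \<Longrightarrow> y \<in> ob C \<Longrightarrow>
    wequiv (opp C) STb SRs y x = wequiv C Tb R x y"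
  by (rule wequiv_serre[OF tri_wexact[OF mutation_tri] obs(1) M_gen p_lift i_ext])

lemma lower_strung: "V \<in> LL \<Longrightarrow> lower_strung V"
  using lower_class mutation_class.UU_strung by metis

lemma lower_exists:
  assumes "X \<in> ob C"
  shows "\<exists>V \<in> LL. \<exists>w. w \<in> wequiv C Tb R X V"
proof -
  obtain x0 u where "mutation_class scale (opp C) STb SRs PTb x0 SM (fmap S Rs M i) u LL"
    using lower_class by metis
  then interpret L: mutation_class scale "opp C" "STb" "SRs" "PTb" x0 "SM" "fmap S Rs M i" u LL .
  obtain V w where "V \<in> LL" "w \<in> L.WW V X" using L.WW_exists[of X] assms by auto
  then show ?thesis using wequiv_eq[OF assms, of V] star_subset_ob by blast
qed

lemma upper_exists:
  assumes "X \<in> ob C"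
  shows "\<exists>U \<in> UU. \<exists>w. w \<in> wequiv C Tb R U X"
  using mutation_class.WW_exists[OF upper_class assms] by metis

lemma upper_lift:
  assumes "w \<in> wequiv C Tb R x y" "x \<in> ob C" "y \<in> ob C" "u \<in> UU"
  shows "f \<in> hom C u y \<Longrightarrow> \<exists>g \<in> hom C u x. f - cmp C u x y w g \<in> NN u y"
    and "g \<in> hom C u x \<Longrightarrow> cmp C u x y w g \<in> NN u y \<Longrightarrow> g \<in> NN u x"
  using mutation_pair.WW_lift[OF upper_pair assms(1-3) mutation_class.UU_strung[OF upper_class assms(4)]]
    mutation_pair.WW_cancel[OF upper_pair assms(1-3)] assms(4) star_subset_ob by (metis, blast)

lemma lower_ext:
  assumes "w \<in> wequiv C Tb R x y" and o: "x \<in> ob C" "y \<in> ob C" and v: "lower_strung v"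
  shows "f \<in> hom C x v \<Longrightarrow> \<exists>g \<in> hom C y v. f - cmp C x y v g w \<in> NN x v"
    and "g \<in> hom C y v \<Longrightarrow> cmp C x y v g w \<in> NN x v \<Longrightarrow> g \<in> NN y v"
proof -
  obtain x0 u where "mutation_pair scale (opp C) STb SRs PTb x0 SM (fmap S Rs M i) u"
    using lower_pair by metis
  then interpret L: mutation_pair scale "opp C" "STb" "SRs" "PTb" x0 "SM" "fmap S Rs M i" u .
  have w: "w \<in> L.WW y x" using wequiv_eq[OF o] assms(1) by simp
  have vo: "v \<in> ob C" using L.strung_ob[OF v] by simp
  show "\<exists>g \<in> hom C y v. f - cmp C x y v g w \<in> NN x v" if "f \<in> hom C x v"
  proof -
    have "y \<in> ob (opp C)" "x \<in> ob (opp C)" "f \<in> hom (opp C) v x" using o that by simp_all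
    then obtain g where "g \<in> hom (opp C) v y" "f - cmp (opp C) v y x w g \<in> null_on (opp C) STb v x"
      by (rule L.WW_lift[OF w _ _ v])
    then show ?thesis using NN_serre[OF o(1) vo] by auto
  qed
  show "g \<in> NN y v" if "g \<in> hom C y v" "cmp C x y v g w \<in> NN x v"
    using L.WW_cancel[OF w, of v g] that o vo NN_serre[OF o(1) vo] NN_serre[OF o(2) vo] by simp
qed

section \<open>The four ideals as spaces of null morphisms\<close>

lemma gen_hom_eq_0:
  assumes "a \<in> gen C Z" "Z \<subseteq> ob C" "t \<in> ob C" "\<And>z. z \<in> Z \<Longrightarrow> hom C t z = {0}"
  shows "hom C t a = {0}"
  using hom_gen_0[OF assms(1-3)] assms(3,4) hom_zero[of t a] gen_ob[OF assms(1)] by blast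

lemma gen_hom_eq_0':
  assumes "a \<in> gen C Z" "Z \<subseteq> ob C" "t \<in> ob C" "\<And>z. z \<in> Z \<Longrightarrow> hom C z t = {0}"
  shows "hom C a t = {0}"
  using gen_hom_0[OF assms(1-3)] assms(3,4) hom_zero[of a t] gen_ob[OF assms(1)] by blast

lemma upper_ideal:
  assumes "x \<in> UU" "y \<in> UU"
  shows "factor_ideal (full_subcat C UU) (gen C {\<Sigma>Tb, \<Sigma>Rs}) x y = NN x y"
proof (rule mutation_pair.factor_ideal_eq_null_on[OF upper_pair])
  show "mutation_pair.strung C Tb R \<Sigma>Tb x" using mutation_class.UU_strung[OF upper_class assms(1)] .
  show "y \<in> ob C" using assms star_subset_ob by blast
  show "gen C {\<Sigma>Tb, \<Sigma>Rs} \<subseteq> UU" unfolding UU_alt using gen_in_star_right by blast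
  show "hom C Tb a = {0}" if "a \<in> gen C {\<Sigma>Tb, \<Sigma>Rs}" for a
    by (rule gen_hom_eq_0[OF that]) (use obs obs_susp hom_T_susp Tb_R_gen hom_Tb_susp_Rs in auto)
qed simp

text \<open>Dividing by \<open>T\<close> instead of \<open>\<Sigma> T'\<close> gives another ideal
  on the same objects, the maps killed by \<open>Hom(-, \<Sigma> Tb)\<close>; this is the case of
  the dual pair.\<close>

lemma dual_ideal:
  assumes "x \<in> UU" "y \<in> UU"
  shows "factor_ideal (full_subcat C UU) (gen C {Tb, R}) x y = null_on (opp C) \<Sigma>Tb y x"
proof -
  have "factor_ideal (full_subcat (opp C) UU) (gen C {Tb, R}) y x = null_on (opp C) \<Sigma>Tb y x"
  proof (rule mutation_pair.factor_ideal_eq_null_on[OF dual_pair])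
    show "mutation_pair.strung (opp C) \<Sigma>Tb \<Sigma>Rs Tb y"
      using mutation_class.UU_strung[OF dual_class] assms(2) UU_alt by simp
    show "x \<in> ob (opp C)" using assms star_subset_ob by auto
    show "gen (opp C) {Tb, R} \<subseteq> UU" using gen_in_star_left by auto
    show "hom (opp C) \<Sigma>Tb a = {0}" if "a \<in> gen C {Tb, R}" for a
      using hom_T_susp[OF that] Tb_R_gen by simp
  qed simp
  then show ?thesis by (simp add: opp_full_subcat)
qed

text \<open>The ideal is that of \<open>\<Sigma>\<^sup>-\<^sup>1 S T\<close>, while the pair
  provides \<open>x0\<close>. It suffices that \<open>add (PTb \<oplus> x0)\<close> lies in
  \<open>LL\<close> and in \<open>add (PTb \<oplus> PR)\<close>, and that the latter has no maps to
  \<open>S Tb\<close>.\<close>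

lemma lower_ideal:
  assumes "x \<in> LL" "y \<in> LL"
  shows "factor_ideal (full_subcat C LL) (gen C {PTb, PR}) x y = NN x y"
proof -
  let ?A = "gen C {PTb, PR}"
  obtain x0 u where p: "mutation_pair scale (opp C) STb SRs PTb x0 SM (fmap S Rs M i) u"
    "gen C {PTb, x0} \<subseteq> ?A" "gen C {PTb, x0} \<subseteq> LL" by (rule lower_pair)
  have o: "x \<in> ob C" "y \<in> ob C" using assms star_subset_ob by blast+
  have "factor_ideal (full_subcat (opp C) LL) ?A y x = null_on (opp C) STb y x"
  proof (rule mutation_pair.factor_ideal_eq_null_on[OF p(1)])
    show "lower_strung y" using lower_strung[OF assms(2)] .
    show "x \<in> ob (opp C)" using o by simp
    show "gen (opp C) {PTb, x0} \<subseteq> LL" "gen (opp C) {PTb, x0} \<subseteq> ?A" using p by simp_all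
    have z: "hom C z STb = {0}" if "z \<in> {PTb, PR}" for z
      using that hom_lower_0 obs hom_T_susp Tb_R_gen by blast
    have "hom C a STb = {0}" if "a \<in> ?A" for a
      by (rule gen_hom_eq_0'[OF that _ _ z]) (use obs obs_susp in auto)
    then show "hom (opp C) STb a = {0}" if "a \<in> ?A" for a using that by simp
  qed
  then show ?thesis using NN_serre[OF o] by (simp add: opp_full_subcat)
qed

lemma perp_ideal:
  assumes o: "x \<in> ob C" "y \<in> ob C"
  shows "factor_ideal C (perp C Tb) x y = NN x y"
proof (intro subset_antisym subsetI)
  fix f assume "f \<in> factor_ideal C (perp C Tb) x y"
  then obtain a g h where a: "a \<in> ob C" "hom C Tb a = {0}" "g \<in> hom C x a" "h \<in> hom C a y" "f = cmp C x a y h g"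
    by (auto simp: factor_ideal_def perp_def)
  have "g \<in> NN x a" unfolding null_on_def
  proof (intro CollectI conjI ballI a(3))
    fix t assume "t \<in> hom C Tb x"
    then have "cmp C Tb x a g t \<in> hom C Tb a" using a(1,3) o obs by (simp add: lin_rules)
    then show "cmp C Tb x a g t = 0" using a(2) by simp
  qed
  then show "f \<in> NN x y" using a o obs by (simp add: null_on_post)
next
  fix f assume f: "f \<in> NN x y"
  have fh: "f \<in> hom C x y" using f by (rule null_on_hom)
  obtain c m where c: "c \<in> gen C {Tb}" and m: "m \<in> hom C c x"
    and lift: "\<And>h. h \<in> hom C Tb x \<Longrightarrow> \<exists>g \<in> hom C Tb c. h = cmp C Tb c x m g"
    using approx[OF o(1) obs(1)] by metis
  obtain E \<pi> \<omega> where t: "(c, x, E, m, \<pi>, \<omega>) \<in> \<Delta>" using tri_exists[OF gen_ob[OF c] o(1) m] by metis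
  note e1 = tri_wexact[OF t] and e2 = tri_wexact'[OF t]
  note e = wexactD[OF e1] wexactD[OF e2]
  have "cmp C c x y f m = 0" by (rule null_on_gen[OF f c m obs(1) o])
  then obtain g where g: "g \<in> hom C E y" "f = cmp C x E y g \<pi>" using wexact_ext[OF e1 o(2) fh] by metis
  have Sc: "hom C Tb (fobj \<Sigma> c) = {0}"
    using hom_T_susp[OF Tb_R_gen(1)] gen_mono[OF c, of "{Tb, R}"] by simp
  have "k = 0" if k: "k \<in> hom C Tb E" for k
  proof -
    have "cmp C Tb E (fobj \<Sigma> c) \<omega> k \<in> hom C Tb (fobj \<Sigma> c)" using k e obs by (simp add: lin_rules)
    then have "cmp C Tb E (fobj \<Sigma> c) \<omega> k = 0" using Sc by simp
    then obtain k1 where k1: "k1 \<in> hom C Tb x" "k = cmp C Tb x E \<pi> k1"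
      by (rule wexact_lift[OF e2 obs(1) k])
    then obtain k2 where "k2 \<in> hom C Tb c" "k1 = cmp C Tb c x m k2" using lift by blast
    then show "k = 0" using k1(2) e obs by (simp add: lin_rules cmp_assoc)
  qed
  then have "E \<in> perp C Tb" using e hom_zero[of Tb E] obs by (auto simp: perp_def)
  then show "f \<in> factor_ideal C (perp C Tb) x y"
    unfolding factor_ideal_def using g e by blast
qed

section \<open>The quotient categories and the functors between them\<close>

sublocale NN: ideal scale C NN
  by (rule ideal_null_on[OF obs(1)])

definition Quot :: "('o, 'v set) cat" where
  "Quot = C //\<^sub>c perp C Tb"

definition Upper :: "('o, 'v set) cat" where
  "Upper = upper_cat C \<Sigma> \<Delta> T Tb //\<^sub>c add_cat C (fobj \<Sigma> T')"

definition Upper' :: "('o, 'v set) cat" where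
  "Upper' = upper_cat C \<Sigma> \<Delta> T Tb //\<^sub>c add_cat C T"

definition Lower :: "('o, 'v set) cat" where
  "Lower = lower_cat C \<Sigma>i S \<Delta> T' Tb //\<^sub>c add_cat C (fobj \<Sigma>i (fobj S T))"

definition II :: "('o, 'v set, 'o, 'v set) fctr" where
  "II = induced_functor C (perp C Tb)"

lemma presents_Quot: "NN.presents UNIV Quot"
proof -
  have "full_subcat C UNIV = C" by (simp add: full_subcat_def)
  then show ?thesis
    using NN.presents_quotient[of UNIV "factor_ideal C (perp C Tb)"] perp_ideal by (simp add: Quot_def cat_mod_def)
qed

lemma upper_cat_eq: "upper_cat C \<Sigma> \<Delta> T Tb = full_subcat C UU"
  using obs obs_susp gen_T_fid by (simp add: upper_cat_def add_cat_gen)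

lemma presents_Upper: "NN.presents UU Upper"
proof -
  have "add_cat C (fobj \<Sigma> T') = gen C {\<Sigma>Tb, \<Sigma>Rs}"
    using obs obs_susp gen_T[OF susp] by (simp add: add_cat_gen)
  then show ?thesis
    unfolding Upper_def upper_cat_eq cat_mod_def by (intro NN.presents_quotient) (use upper_ideal in simp)
qed

lemma presents_Lower: "NN.presents LL Lower"
proof -
  have "add_cat C (fobj \<Sigma>i (fobj S T)) = gen C {PTb, PR}"
    using obs obs_susp gen_T(1)[OF autoequiv_fcomp[OF S susp_inv]] by (simp add: add_cat_gen)
  moreover have "lower_cat C \<Sigma>i S \<Delta> T' Tb = full_subcat C LL"
    using obs obs_susp gen_T[OF S] by (simp add: lower_cat_def add_cat_gen)
  ultimately show ?thesis
    unfolding Lower_def cat_mod_def by (simp, intro NN.presents_quotient) (use lower_ideal in simp)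
qed

lemma ideal_Upper': "ideal scale C (\<lambda>x y. null_on (opp C) \<Sigma>Tb y x)"
  by (rule ideal_null_on_opp) (use obs obs_susp in simp)

lemma presents_Upper': "ideal.presents C (\<lambda>x y. null_on (opp C) \<Sigma>Tb y x) UU Upper'"
proof -
  have "add_cat C T = gen C {Tb, R}" using obs gen_T_fid by (simp add: add_cat_gen)
  then show ?thesis
    unfolding Upper'_def upper_cat_eq cat_mod_def
    by (intro ideal.presents_quotient[OF ideal_Upper']) (use dual_ideal in simp)
qed

lemma II_fmap:
  assumes "x \<in> ob C" "y \<in> ob C"
  shows "fmap II x y (f +o NN x y) = f +o NN x y"
proof -
  have "f' +o NN x y = f +o NN x y" if "f' \<in> f +o NN x y" for f'
    using that NN.cls_mem[OF assms] NN.cls_eq[OF assms] by simp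
  then have "(\<Union>f' \<in> f +o NN x y. f' +o NN x y) = f +o NN x y"
    using NN.cls_self[OF assms, of f] by blast
  then show ?thesis by (simp add: II_def induced_functor_def perp_ideal[OF assms])
qed

lemma II_ff:
  assumes A: "NN.presents U A"
  shows "fully_faithful A Quot II"
proof (rule NN.presents_ff[OF A NN.ideal_axioms presents_Quot autoequiv_fid])
  show "fmap II x y (f +o NN x y) = fmap fid x y f +o NN (fobj fid x) (fobj fid y)"
    if "x \<in> ob A" "y \<in> ob A" for x y f
    using II_fmap NN.presents_ob[OF A] that by simp
qed (simp_all add: II_def induced_functor_def)

text \<open>The target \<open>B\<close> with its embedding \<open>K\<close> stays general: what
  matters is that the images of \<open>K\<close> have strings in the opposite category. Both
  equivalences of the theorem are instances.\<close>

lemma good_of_wequiv: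
  assumes br: "bridge Upper B Quot II K"
    and K: "\<And>b. b \<in> ob B \<Longrightarrow> lower_strung (fobj K b) \<and> fobj K b \<in> ob C"
    and o: "x \<in> ob C" "y \<in> ob C" and w: "w \<in> wequiv C Tb R x y"
  shows "bridge.good Upper B Quot II K x y (w +o NN x y)"
proof -
  interpret bridge Upper B Quot II K by (rule br)
  have wh: "w \<in> hom C x y" using w by (simp add: wequiv_def)
  have obQ: "ob Quot = ob C" and obU: "ob Upper = UU"
    using presents_Quot presents_Upper star_subset_ob[of "gen C {Tb, R}"] by (auto simp: NN.presents_def)
  have h: "w +o NN x y \<in> hom Quot x y" using NN.presents_hom[OF presents_Quot] obQ o wh by simp
  have IIo: "fobj II u = u" for u by (simp add: II_def induced_functor_def)
  have "linv x y (w +o NN x y)" unfolding linv_def IIo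
  proof (intro conjI ballI h)
    fix u assume u: "u \<in> ob Upper"
    then have "u \<in> UU" "u \<in> ob C" using obU star_subset_ob by blast+
    then show "bij_betw (cmp Quot u x y (w +o NN x y)) (hom Quot u x) (hom Quot u y)"
      using o obQ wh upper_lift[OF w o] by (intro NN.quotient_bij_left[OF presents_Quot]) auto
  qed
  moreover have "rinv x y (w +o NN x y)" unfolding rinv_def
  proof (intro conjI ballI h)
    fix v assume v: "v \<in> ob B"
    show "bij_betw (\<lambda>f. cmp Quot x y (fobj K v) f (w +o NN x y)) (hom Quot y (fobj K v)) (hom Quot x (fobj K v))"
      using o obQ wh lower_ext[OF w o] K[OF v] by (intro NN.quotient_bij_right[OF presents_Quot]) auto
  qed
  ultimately show ?thesis by (simp add: good_def)
qed

lemma quot_cats: "category Quot" "category Upper" "category Lower" "category Upper'"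
  using NN.presents_category presents_Quot presents_Upper presents_Lower
    ideal.presents_category[OF ideal_Upper' presents_Upper'] by blast+

lemma obs_quot: "ob Quot = ob C" "ob Upper = UU" "ob Lower = LL" "ob Upper' = UU"
  using presents_Quot presents_Upper presents_Lower presents_Upper' star_subset_ob
  by (auto simp: NN.presents_def ideal.presents_def[OF ideal_Upper'])

section \<open>The adjoints between the upper and the lower category\<close>

lemma main_bridge: "bridge Upper Lower Quot II II"
  using quot_cats II_ff[OF presents_Upper] II_ff[OF presents_Lower]
  by (simp add: bridge_def bridge_axioms_def)

lemma main_good:
  "x \<in> ob C \<Longrightarrow> y \<in> ob C \<Longrightarrow> w \<in> wequiv C Tb R x y \<Longrightarrow> bridge.good Upper Lower Quot II II x y (w +o NN x y)"
  by (rule good_of_wequiv[OF main_bridge])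
    (use lower_strung star_subset_ob obs_quot in \<open>auto simp: II_def induced_functor_def\<close>)

lemma main_good_left: "x \<in> ob Quot \<Longrightarrow> \<exists>u \<in> ob Upper. \<exists>e. bridge.good Upper Lower Quot II II (fobj II u) x e"
  and main_good_right: "x \<in> ob Quot \<Longrightarrow> \<exists>v \<in> ob Lower. \<exists>e. bridge.good Upper Lower Quot II II x (fobj II v) e"
proof -
  have II: "fobj II u = u" for u by (simp add: II_def induced_functor_def)
  assume "x \<in> ob Quot"
  then have x: "x \<in> ob C" by (simp add: obs_quot)
  show "\<exists>u \<in> ob Upper. \<exists>e. bridge.good Upper Lower Quot II II (fobj II u) x e"
    using upper_exists[OF x] main_good[OF _ x] star_subset_ob obs_quot II by (metis subsetD)
  show "\<exists>v \<in> ob Lower. \<exists>e. bridge.good Upper Lower Quot II II x (fobj II v) e"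
    using lower_exists[OF x] main_good[OF x] star_subset_ob obs_quot II by (metis subsetD)
qed

text \<open>\<open>S \<Sigma>\<^sup>-\<^sup>1\<close> turns maps killed by \<open>Hom(-, \<Sigma> Tb)\<close> into maps killed by \<open>Hom(-, S Tb)\<close>, i.e. by
  \<open>Hom(Tb, -)\<close>; it therefore embeds \<open>Upper'\<close> into \<open>Quot\<close>.\<close>

abbreviation "F \<equiv> S \<circ>\<^sub>F \<Sigma>i"

lemma F: "autoequiv C F"
  by (rule autoequiv_fcomp[OF susp_inv S])

lemma F_ob: "u \<in> star C \<Delta> Z Z' \<Longrightarrow> fobj S (fobj \<Sigma>i u) \<in> ob C"
  using obs_susp by (auto simp: star_def)

lemma F_susp_iso:
  assumes x: "x \<in> ob C"
  obtains \<theta> \<theta>' where "\<theta> \<in> hom C (fobj F (fobj \<Sigma> x)) (fobj S x)" "\<theta>' \<in> hom C (fobj S x) (fobj F (fobj \<Sigma> x))"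
    "cmp C (fobj F (fobj \<Sigma> x)) (fobj S x) (fobj F (fobj \<Sigma> x)) \<theta>' \<theta> = ident C (fobj F (fobj \<Sigma> x))"
    "cmp C (fobj S x) (fobj F (fobj \<Sigma> x)) (fobj S x) \<theta> \<theta>' = ident C (fobj S x)"
proof -
  let ?s = "fobj \<Sigma>i (fobj \<Sigma> x)"
  have s: "?s \<in> ob C" using x obs_susp by simp
  obtain f g where fg: "f \<in> hom C ?s x" "g \<in> hom C x ?s"
    "cmp C ?s x ?s g f = ident C ?s" "cmp C x ?s x f g = ident C x" using susp_inv_iso[OF x] by metis
  show thesis
    by (rule that[of "fmap S ?s x f" "fmap S x ?s g"])
      (use fg s x Sr(4)[OF s x s fg(1,2)] Sr(4)[OF x s x fg(2,1)] in \<open>simp_all add: Sr(1-3)\<close>)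
qed

lemma F_null:
  assumes "x \<in> ob C" "y \<in> ob C" "f \<in> hom C x y"
  shows "f \<in> null_on (opp C) \<Sigma>Tb y x \<longleftrightarrow> fmap F x y f \<in> NN (fobj F x) (fobj F y)"
proof -
  obtain \<theta> \<theta>' where \<theta>: "\<theta> \<in> hom C (fobj F \<Sigma>Tb) STb" "\<theta>' \<in> hom C STb (fobj F \<Sigma>Tb)"
    "cmp C (fobj F \<Sigma>Tb) STb (fobj F \<Sigma>Tb) \<theta>' \<theta> = ident C (fobj F \<Sigma>Tb)"
    "cmp C STb (fobj F \<Sigma>Tb) STb \<theta> \<theta>' = ident C STb"
    by (rule F_susp_iso[OF obs(1)])
  have "f \<in> null_on (opp C) \<Sigma>Tb y x \<longleftrightarrow> fmap F x y f \<in> null_on (opp C) STb (fobj F y) (fobj F x)"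
    by (rule null_on_transfer[OF F _ _ assms(1,2) \<theta> assms(3)]) (use obs obs_susp in auto)
  then show ?thesis using NN_serre[of "fobj F x" "fobj F y"] assms obs_susp by simp
qed

text \<open>Apply \<open>F\<close> to \<open>U\<close> as an object of
  \<open>Tb \<ast> \<Sigma> T'\<close>: up to isomorphism \<open>F (\<Sigma> Tb)\<close> and
  \<open>F (\<Sigma> Rs)\<close> are \<open>S Tb\<close> and \<open>S Rs\<close>, and
  \<open>F Tb\<close> lies in \<open>add PTb\<close>. Only the exact pairs are carried along
  \<open>F\<close>, hence the conclusion is a string and not membership in
  \<open>LL\<close>.\<close>

lemma F_strung:
  assumes "U \<in> UU"
  shows "lower_strung (fobj F U)"
proof -
  obtain x0 u where "mutation_pair scale (opp C) STb SRs PTb x0 SM (fmap S Rs M i) u"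
    using lower_pair by metis
  then interpret L: mutation_pair scale "opp C" "STb" "SRs" "PTb" x0 "SM" "fmap S Rs M i" u .
  from assms obtain a b u v w where t: "a \<in> gen C {Tb}" "b \<in> gen C {\<Sigma>Tb, \<Sigma>Rs}" "(a, U, b, u, v, w) \<in> \<Delta>"
    unfolding UU_alt by (rule starE)
  have F_susp: "fobj F (fobj \<Sigma> x) \<in> gen C {fobj S x}" if x: "x \<in> ob C" for x
  proof -
    obtain \<theta> \<theta>' where "\<theta> \<in> hom C (fobj F (fobj \<Sigma> x)) (fobj S x)" "\<theta>' \<in> hom C (fobj S x) (fobj F (fobj \<Sigma> x))"
      "cmp C (fobj F (fobj \<Sigma> x)) (fobj S x) (fobj F (fobj \<Sigma> x)) \<theta>' \<theta> = ident C (fobj F (fobj \<Sigma> x))"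
      by (rule F_susp_iso[OF x])
    then show ?thesis by (intro gen_iso) (use x obs_susp in auto)
  qed
  have "fobj F (fobj \<Sigma> a) \<in> gen C {fobj F \<Sigma>Tb}"
    using autoequiv_gen[OF F gen_susp[OF obs(1) t(1)]] obs obs_susp by simp
  then have a: "fobj F (fobj \<Sigma> a) \<in> gen C {STb}"
    by (rule gen_trans) (use F_susp[OF obs(1)] obs obs_susp in auto)
  have "fobj F b \<in> gen C {fobj F \<Sigma>Tb, fobj F \<Sigma>Rs}"
    using autoequiv_gen[OF F t(2)] obs obs_susp by simp
  then have b: "fobj F b \<in> gen C {STb, SRs}"
    by (rule gen_trans) (use gen_mono[OF F_susp[OF obs(1)]] gen_mono[OF F_susp[OF obs(3)]] obs obs_susp in auto)
  have "fobj F a \<in> gen C {fobj F Tb}" using autoequiv_gen[OF F t(1)] obs by simp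
  then have p: "fobj F a \<in> gen C {PTb}"
    by (rule gen_trans) (use serre_susp_gen[OF serre_functor obs(1)] obs obs_susp in auto)
  have "wexact (opp C) (fobj F (fobj \<Sigma> a)) (fobj F b) (fobj F U) (fmap F b (fobj \<Sigma> a) w) (fmap F U b v)"
    "wexact (opp C) (fobj F b) (fobj F U) (fobj F a) (fmap F U b v) (fmap F a U u)"
    using autoequiv_wexact[OF F tri_wexact'[OF t(3)]] autoequiv_wexact[OF F tri_wexact[OF t(3)]] by simp_all
  then show ?thesis unfolding L.strung_def using a b p gen_opp by metis
qed

text \<open>The class of \<open>f\<close> goes to the class of \<open>F f\<close>; by
  \<open>F_null\<close> all members of a coset contribute the same set to the union.\<close>

definition KK :: "('o, 'v set, 'o, 'v set) fctr" where
  "KK = \<lparr>fobj = fobj F, fmap = (\<lambda>x y c. \<Union>f \<in> c. fmap F x y f +o NN (fobj F x) (fobj F y))\<rparr>"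

lemma KK_ff: "fully_faithful Upper' Quot KK"
proof (rule NN.presents_ff[OF presents_Upper' ideal_Upper' presents_Quot F])
  interpret N': ideal scale C "\<lambda>x y. null_on (opp C) \<Sigma>Tb y x" by (rule ideal_Upper')
  have oC: "x \<in> ob C" if "x \<in> ob Upper'" for x using N'.presents_ob[OF presents_Upper' that] .
  show "fobj KK x = fobj F x" for x by (simp add: KK_def)
  show "f \<in> null_on (opp C) \<Sigma>Tb y x \<longleftrightarrow> fmap F x y f \<in> NN (fobj F x) (fobj F y)"
    if "x \<in> ob Upper'" "y \<in> ob Upper'" "f \<in> hom C x y" for x y f
    using F_null oC that by blast
  show "fmap KK x y (f +o null_on (opp C) \<Sigma>Tb y x) = fmap F x y f +o NN (fobj F x) (fobj F y)"
    if a: "x \<in> ob Upper'" "y \<in> ob Upper'" "f \<in> hom C x y" for x y f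
  proof -
    note o = oC[OF a(1)] oC[OF a(2)]
    have Fo: "fobj F x \<in> ob C" "fobj F y \<in> ob C" using o obs_susp by simp_all
    have "fmap F x y f' +o NN (fobj F x) (fobj F y) = fmap F x y f +o NN (fobj F x) (fobj F y)"
      if f': "f' \<in> f +o null_on (opp C) \<Sigma>Tb y x" for f'
    proof -
      have h: "f' \<in> hom C x y" by (rule N'.mem_cls_hom[OF o a(3) f'])
      have "f' - f \<in> null_on (opp C) \<Sigma>Tb y x" using N'.cls_mem[OF o] f' by simp
      then have "fmap F x y f' - fmap F x y f \<in> NN (fobj F x) (fobj F y)"
        using F_null[OF o, of "f' - f"] autoequiv_diff[OF F o h a(3)] h a(3) o by (simp add: lin_rules)
      then show ?thesis using NN.cls_eq[OF Fo] by simp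
    qed
    then have "(\<Union>f' \<in> f +o null_on (opp C) \<Sigma>Tb y x. fmap F x y f' +o NN (fobj F x) (fobj F y))
        = fmap F x y f +o NN (fobj F x) (fobj F y)"
      using N'.cls_self[OF o, of f] by blast
    then show ?thesis by (simp add: KK_def)
  qed
qed simp

lemma KK_bridge: "bridge Upper Upper' Quot II KK"
  using quot_cats II_ff[OF presents_Upper] KK_ff by (simp add: bridge_def bridge_axioms_def)

lemma KK_good:
  "x \<in> ob C \<Longrightarrow> y \<in> ob C \<Longrightarrow> w \<in> wequiv C Tb R x y \<Longrightarrow> bridge.good Upper Upper' Quot II KK x y (w +o NN x y)"
  by (rule good_of_wequiv[OF KK_bridge])
    (use F_strung F_ob obs_quot in \<open>auto simp: KK_def\<close>)

text \<open>\<open>u\<close> is isomorphic to some \<open>F x\<close>. The dual class provides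
  \<open>x \<rightarrow> v\<close> inverted by maps into \<open>\<Sigma> Tb\<close> and
  \<open>\<Sigma> Rs\<close>; transport by \<open>F\<close> gives the condition for
  \<open>S Tb\<close> and \<open>S Rs\<close>, which Serre duality rewrites for \<open>Tb\<close>
  and \<open>R\<close>.\<close>

lemma upper'_exists:
  assumes u: "u \<in> ob C"
  shows "\<exists>v \<in> UU. \<exists>w. w \<in> wequiv C Tb R u (fobj F v)"
proof -
  obtain x k k' where k: "x \<in> ob C" "k \<in> hom C (fobj F x) u" "k' \<in> hom C u (fobj F x)"
    "cmp C (fobj F x) u (fobj F x) k' k = ident C (fobj F x)" "cmp C u (fobj F x) u k k' = ident C u"
    using autoequiv_essential[OF F u] by metis
  interpret D: mutation_class scale "opp C" "\<Sigma>Tb" "\<Sigma>Rs" Tb R "\<Sigma>M" "fmap \<Sigma> Rs M i" q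
    "star C \<Delta> (gen C {Tb}) (gen C {\<Sigma>Tb, \<Sigma>Rs})" by (rule dual_class)
  obtain v w where v: "v \<in> UU" and w: "w \<in> D.WW v x" using D.WW_exists[of x] k(1) UU_alt by auto
  have vo: "v \<in> ob C" using v star_subset_ob by blast
  obtain \<theta> \<theta>' where \<theta>: "\<theta> \<in> hom C (fobj F \<Sigma>Tb) STb" "\<theta>' \<in> hom C STb (fobj F \<Sigma>Tb)"
    "cmp C (fobj F \<Sigma>Tb) STb (fobj F \<Sigma>Tb) \<theta>' \<theta> = ident C (fobj F \<Sigma>Tb)"
    "cmp C STb (fobj F \<Sigma>Tb) STb \<theta> \<theta>' = ident C STb"
    by (rule F_susp_iso[OF obs(1)])
  obtain \<rho> \<rho>' where \<rho>: "\<rho> \<in> hom C (fobj F \<Sigma>Rs) SRs" "\<rho>' \<in> hom C SRs (fobj F \<Sigma>Rs)"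
    "cmp C (fobj F \<Sigma>Rs) SRs (fobj F \<Sigma>Rs) \<rho>' \<rho> = ident C (fobj F \<Sigma>Rs)"
    "cmp C SRs (fobj F \<Sigma>Rs) SRs \<rho> \<rho>' = ident C SRs"
    by (rule F_susp_iso[OF obs(3)])
  have "cmp C u (fobj F x) (fobj F v) (fmap F x v w) k' \<in> wequiv (opp C) STb SRs (fobj F v) u"
    by (rule wequiv_transfer[OF F _ _ _ _ k(1) u vo \<theta> \<rho> k(2-5) w]) (use obs obs_susp in auto)
  then show ?thesis using wequiv_eq[OF u, of "fobj F v"] vo obs_susp v by auto
qed

lemma upper_equivalent: "equivalent Upper Upper'"
proof (rule bridge.bridge_equivalent[OF KK_bridge])
  have o: "fobj II u = u" "fobj KK u = fobj F u" for u by (simp_all add: II_def induced_functor_def KK_def)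
  have UU: "u \<in> ob C" "fobj F u \<in> ob C" if "u \<in> UU" for u using that F_ob[OF that] by (auto simp: star_def)
  fix x assume "x \<in> ob Quot"
  then have x: "x \<in> ob C" by (simp add: obs_quot)
  show "\<exists>u\<in>ob Upper. \<exists>e. bridge.good Upper Upper' Quot II KK (fobj II u) x e"
    using upper_exists[OF x] KK_good[OF _ x] UU unfolding o obs_quot by metis
  show "\<exists>v\<in>ob Upper'. \<exists>e. bridge.good Upper Upper' Quot II KK x (fobj KK v) e"
    using upper'_exists[OF x] KK_good[OF x] UU unfolding o obs_quot by metis
qed

end

theorem theorem2p9:
  fixes scale :: "'k::field \<Rightarrow> 'v::ab_group_add \<Rightarrow> 'v"
    and C :: "('o, 'v) cat"
    and \<Sigma> \<Sigma>i S :: "('o, 'v, 'o, 'v) fctr"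
    and \<Delta> :: "('o \<times> 'o \<times> 'o \<times> 'v \<times> 'v \<times> 'v) set"
    and T Tb T' R Rstar B :: 'o
    and i p q :: 'v
    and Upper Lower Quot :: "('o, 'v set) cat"
    and I J :: "('o, 'v set, 'o, 'v set) fctr"
  assumes "triangulated_category scale C \<Sigma> \<Sigma>i \<Delta>"
    and "krull_schmidt C"
    and "hom_finite scale C"
    and "serre_functor scale C S"
    and "is_direct_sum C [Tb, R] T"
    and "basic_obj C T"
    and "rigid C \<Sigma> T"
    and "(Rstar, B, R, i, p, q) \<in> \<Delta>"
    and "minimal_right_approx C (add_cat C Tb) B R p"
    and "is_direct_sum C [Tb, Rstar] T'"
    and "Upper = upper_cat C \<Sigma> \<Delta> T Tb //\<^sub>c add_cat C (fobj \<Sigma> T')"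
    and "Lower = lower_cat C \<Sigma>i S \<Delta> T' Tb //\<^sub>c add_cat C (fobj \<Sigma>i (fobj S T))"
    and "Quot = C //\<^sub>c perp C Tb"
    and "I = induced_functor C (perp C Tb)"
    and "J = induced_functor C (perp C Tb)"
  shows "(\<exists>Rf. adjoint Upper Quot I Rf) \<and>
    (\<exists>Lf. adjoint Quot Lower Lf J) \<and>
    (\<forall>Rf Lf. adjoint Upper Quot I Rf \<longrightarrow> adjoint Quot Lower Lf J \<longrightarrow>
       quasi_inverse Upper Lower (Lf \<circ>\<^sub>F I) (Rf \<circ>\<^sub>F J)) \<and>
    equivalent Upper (upper_cat C \<Sigma> \<Delta> T Tb //\<^sub>c add_cat C T)"
proof -
  interpret m: mutation_setting scale C \<Sigma> \<Sigma>i \<Delta> S Tb R T Rstar B T' i p q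
    by (intro mutation_setting.intro finite_triangulated.intro finite_triangulated_axioms.intro
        mutation_setting_axioms.intro)
      (use assms in \<open>auto simp: minimal_right_approx_def\<close>)
  \<comment> \<open>One functor \<open>II\<close> serves as \<open>I\<close> and as
    \<open>J\<close>: it is the identity on objects, and only the source category differs.\<close>
  have eq: "Upper = m.Upper" "Lower = m.Lower" "Quot = m.Quot" "I = m.II" "J = m.II"
    "upper_cat C \<Sigma> \<Delta> T Tb //\<^sub>c add_cat C T = m.Upper'"
    using assms by (simp_all add: m.Upper_def m.Lower_def m.Quot_def m.II_def m.Upper'_def)
  interpret b: bridge m.Upper m.Lower m.Quot m.II m.II by (rule m.main_bridge)
  have "\<exists>Rf. adjoint m.Upper m.Quot m.II Rf"
    using b.right_adjoint_exists m.main_good_left unfolding b.good_def by meson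
  moreover have "\<exists>Lf. adjoint m.Quot m.Lower Lf m.II"
    using b.left_adjoint_exists m.main_good_right unfolding b.good_def by meson
  moreover have "quasi_inverse m.Upper m.Lower (Lf \<circ>\<^sub>F m.II) (Rf \<circ>\<^sub>F m.II)"
    if "adjoint m.Upper m.Quot m.II Rf" "adjoint m.Quot m.Lower Lf m.II" for Rf Lf
    by (rule b.adjoint_quasi_inverse[OF m.main_good_left m.main_good_right that])
  ultimately show ?thesis
    unfolding eq using m.upper_equivalent by blast
qed

end
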